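(* Let $(M^n,g)$ be a connected smooth Riemannian manifold of dimension $n\ge2$ and let $\Omega\subset M$ be a domain with compact closure and $C^2$-boundary. Let $k\in\mathbb R$, $f\in C^1(\mathbb R)$, and let $u\in C^3(\Omega)\cap C^2(\overline\Omega)$ be a positive solution of $$\Delta u=-f(u)\ \text{ in }\Omega,\qquad u=0\ \text{ on }\partial\Omega .$$ Put $\mathcal E(u)=\int_\Omega(f'(u)-nk)|\nabla u|^2\,d\Omega$. Suppose that $H>0$ on $\partial\Omega$ and set $c=(n-1)/n$. Then $$c\Big(cf(0)^2\int_{\partial\Omega}\frac1H\,d\sigma-f(0)\int_\Omega f(u)\,d\Omega+\mathcal E(u)\Big)$$ $$=\int_\Omega|\mathring{\mathrm{Hess}}\,u|^2\,d\Omega+\int_\Omega\big[\mathrm{Ric}-(n-1)kg\big](\nabla u,\nabla u)\,d\Omega+\int_{\partial\Omega}\frac{(Hu_\eta+cf(0))^2}{H}\,d\sigma .$$ In particular, if $\mathrm{Ric}\ge(n-1)k\,g$ on $\Omega$, then (with no sign assumption on $\mathcal E(u)$) $$\frac{n-1}{n}f(0)^2\int_{\partial\Omega}\frac1H\,d\sigma\ \ge\ f(0)\int_\Omega f(u)\,d\Omega-\mathcal E(u).$$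
   Context: $\mathring{\mathrm{Hess}}\,u=\mathrm{Hess}\,u-\frac{\Delta u}{n}g$ is the trace-free Hessian, and $\Delta u=\mathrm{tr}(\mathrm{Hess}\,u)$. $\eta$ is the outward unit normal along $\partial\Omega$, $u_\eta=\langle\nabla u,\eta\rangle$, and $H$ is the non-normalized mean curvature, $H=\mathrm{tr}_{\partial\Omega}(X\mapsto\nabla_X\eta)$ (so a Euclidean sphere of radius $r$ has $H=(n-1)/r$). $d\Omega$ and $d\sigma$ are the Riemannian volume elements of $\Omega$ and $\partial\Omega$. "$\mathrm{Ric}\ge(n-1)kg$ on $\Omega$" means $\mathrm{Ric}_q(X,X)\ge (n-1)k\,g_q(X,X)$ for all $q\in\Omega$, $X\in T_qM$, with the convention that $\mathbb S^n$ has $\mathrm{Ric}=(n-1)g$. "Positive" means $u>0$ in $\Omega$. *)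

theory Defs
  imports "HOL-Analysis.Analysis"
begin

section \<open>Functions of class C^k on subsets of R^n\<close>

text \<open>All derivatives are taken within the set \<open>S\<close>.  On an open set this is ordinary
  differentiability.  On the closure of a domain with regular boundary the derivative within the
  closure is still unique, and \<open>Ck_on k\<close> says that the derivatives up to order \<open>k\<close> in the interior
  extend continuously to the closure.\<close>

definition partial ::
  "(real^'n) set \<Rightarrow> 'n \<Rightarrow> (real^'n \<Rightarrow> 'b::real_normed_vector) \<Rightarrow> real^'n \<Rightarrow> 'b" where
  "partial S i f x = frechet_derivative f (at x within S) (axis i 1)"

primrec Ck_on :: "nat \<Rightarrow> (real^'n) set \<Rightarrow> (real^'n \<Rightarrow> 'b::real_normed_vector) \<Rightarrow> bool" where
  "Ck_on 0 S f \<longleftrightarrow> continuous_on S f"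
| "Ck_on (Suc k) S f \<longleftrightarrow> f differentiable_on S \<and> (\<forall>i. Ck_on k S (partial S i f))"

definition Cinf_on :: "(real^'n) set \<Rightarrow> (real^'n \<Rightarrow> 'b::real_normed_vector) \<Rightarrow> bool" where
  "Cinf_on S f \<longleftrightarrow> (\<forall>k. Ck_on k S f)"


section \<open>Smooth manifolds and Riemannian metrics\<close>

text \<open>The manifold is the whole type \<open>'a\<close> (Hausdorff and second countable by its type class) with a
  smooth atlas; it has dimension \<open>CARD('n)\<close>.  A chart is a pair of its domain and its coordinate
  map, whose values off the domain are irrelevant.\<close>

type_synonym ('a, 'n) chart = "'a set \<times> ('a \<Rightarrow> (real, 'n) vec)"

definition chart_inv :: "('a, 'n::finite) chart \<Rightarrow> real^'n \<Rightarrow> 'a" where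
  "chart_inv c = inv_into (fst c) (snd c)"

definition chart_img :: "('a, 'n::finite) chart \<Rightarrow> 'a set \<Rightarrow> (real^'n) set" where
  "chart_img c D = snd c ` (fst c \<inter> D)"

definition is_chart :: "('a::topological_space, 'n::finite) chart \<Rightarrow> bool" where
  "is_chart c \<longleftrightarrow> open (fst c) \<and> open (chart_img c UNIV) \<and>
     homeomorphism (fst c) (chart_img c UNIV) (snd c) (chart_inv c)"

definition smooth_atlas :: "('a::topological_space, 'n::finite) chart set \<Rightarrow> bool" where
  "smooth_atlas A \<longleftrightarrow> (\<forall>c\<in>A. is_chart c) \<and> (\<Union>c\<in>A. fst c) = UNIV \<and>
     (\<forall>c\<in>A. \<forall>d\<in>A. Cinf_on (chart_img c (fst d)) (snd d \<circ> chart_inv c))"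

text \<open>A metric is a smooth positive definite symmetric covariant 2-tensor, given by its matrix of
  components \<open>g c x\<close> in each chart \<open>c\<close> of the atlas at the coordinate point \<open>x\<close>, subject to the
  tensor transformation law.\<close>

definition riemannian_metric ::
  "('a::topological_space, 'n::finite) chart set \<Rightarrow> (('a, 'n) chart \<Rightarrow> real^'n \<Rightarrow> real^'n^'n) \<Rightarrow> bool"
  where
  "riemannian_metric A g \<longleftrightarrow>
     (\<forall>c\<in>A. Cinf_on (chart_img c UNIV) (g c) \<and>
        (\<forall>x\<in>chart_img c UNIV.
           transpose (g c x) = g c x \<and> (\<forall>v. v \<noteq> 0 \<longrightarrow> v \<bullet> (g c x *v v) > 0))) \<and>
     (\<forall>c\<in>A. \<forall>d\<in>A. \<forall>x\<in>chart_img c (fst d).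
        let \<tau> = snd d \<circ> chart_inv c; J = matrix (frechet_derivative \<tau> (at x))
        in g c x = transpose J ** g d (\<tau> x) ** J)"

text \<open>The common value at the point \<open>p\<close> of an expression \<open>F\<close> that is evaluated in coordinates and
  does not depend on the chart.\<close>

definition scalar ::
  "('a, 'n::finite) chart set \<Rightarrow> (('a, 'n) chart \<Rightarrow> real^'n \<Rightarrow> real) \<Rightarrow> 'a \<Rightarrow> real" where
  "scalar A F p = (THE v. \<forall>c\<in>A. p \<in> fst c \<longrightarrow> F c (snd c p) = v)"

definition Ck_manifold_on ::
  "('a, 'n::finite) chart set \<Rightarrow> nat \<Rightarrow> 'a set \<Rightarrow> ('a \<Rightarrow> real) \<Rightarrow> bool" where
  "Ck_manifold_on A k D u \<longleftrightarrow> (\<forall>c\<in>A. Ck_on k (chart_img c D) (u \<circ> chart_inv c))"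


section \<open>Tensor calculus in coordinates\<close>

text \<open>\<open>G\<close> is a field of metric matrices; \<open>S\<close> is the coordinate domain of the function \<open>u\<close>.\<close>

definition metric_inner ::
  "(real^'n \<Rightarrow> real^'n^'n) \<Rightarrow> real^'n \<Rightarrow> real^'n \<Rightarrow> real^'n \<Rightarrow> real" where
  "metric_inner G x v w = v \<bullet> (G x *v w)"

definition metric_inv :: "(real^'n \<Rightarrow> real^'n^'n) \<Rightarrow> real^'n \<Rightarrow> 'n \<Rightarrow> 'n \<Rightarrow> real" where
  "metric_inv G x i j = matrix_inv (G x) $ i $ j"

text \<open>\<open>christoffel G k i j\<close> has the upper index \<open>k\<close>.\<close>

definition christoffel ::
  "(real^'n \<Rightarrow> real^'n^'n) \<Rightarrow> 'n \<Rightarrow> 'n \<Rightarrow> 'n \<Rightarrow> real^'n \<Rightarrow> real" where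
  "christoffel G k i j x = (1/2) * (\<Sum>l\<in>UNIV. metric_inv G x k l *
     (partial UNIV i (\<lambda>y. G y $ j $ l) x + partial UNIV j (\<lambda>y. G y $ i $ l) x
      - partial UNIV l (\<lambda>y. G y $ i $ j) x))"

text \<open>\<open>curvature G l i j k\<close> is the \<open>l\<close>-th component of \<open>R(\<partial>\<^sub>i,\<partial>\<^sub>j)\<partial>\<^sub>k\<close>, where
  \<open>R(X,Y) = [\<nabla>\<^sub>X,\<nabla>\<^sub>Y] - \<nabla>\<^bsub>[X,Y]\<^esub>\<close>, and \<open>Ric(Y,Z)\<close> is the trace of \<open>X \<mapsto> R(X,Y)Z\<close>; so the unit
  sphere has \<open>Ric = (n-1)g\<close>.\<close>

definition curvature ::
  "(real^'n \<Rightarrow> real^'n^'n) \<Rightarrow> 'n \<Rightarrow> 'n \<Rightarrow> 'n \<Rightarrow> 'n \<Rightarrow> real^'n \<Rightarrow> real" where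
  "curvature G l i j k x =
     partial UNIV i (christoffel G l j k) x - partial UNIV j (christoffel G l i k) x
     + (\<Sum>m\<in>UNIV. christoffel G l i m x * christoffel G m j k x
                - christoffel G l j m x * christoffel G m i k x)"

definition ricci :: "(real^'n \<Rightarrow> real^'n^'n) \<Rightarrow> real^'n \<Rightarrow> real^'n^'n" where
  "ricci G x = (\<chi> j k. \<Sum>i\<in>UNIV. curvature G i i j k x)"

definition gradient ::
  "(real^'n \<Rightarrow> real^'n^'n) \<Rightarrow> (real^'n) set \<Rightarrow> (real^'n \<Rightarrow> real) \<Rightarrow> real^'n \<Rightarrow> real^'n" where
  "gradient G S u x = matrix_inv (G x) *v (\<chi> i. partial S i u x)"

definition hessian ::
  "(real^'n \<Rightarrow> real^'n^'n) \<Rightarrow> (real^'n) set \<Rightarrow> (real^'n \<Rightarrow> real) \<Rightarrow> real^'n \<Rightarrow> real^'n^'n" where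
  "hessian G S u x = (\<chi> i j. partial S i (partial S j u) x
     - (\<Sum>k\<in>UNIV. christoffel G k i j x * partial S k u x))"

definition metric_trace :: "(real^'n \<Rightarrow> real^'n^'n) \<Rightarrow> real^'n \<Rightarrow> real^'n^'n \<Rightarrow> real" where
  "metric_trace G x T = (\<Sum>i\<in>UNIV. \<Sum>j\<in>UNIV. metric_inv G x i j * T $ i $ j)"

definition metric_norm2 :: "(real^'n \<Rightarrow> real^'n^'n) \<Rightarrow> real^'n \<Rightarrow> real^'n^'n \<Rightarrow> real" where
  "metric_norm2 G x T = (\<Sum>i\<in>UNIV. \<Sum>j\<in>UNIV. \<Sum>k\<in>UNIV. \<Sum>l\<in>UNIV.
     metric_inv G x i k * metric_inv G x j l * T $ i $ j * T $ k $ l)"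

definition laplacian ::
  "(real^'n \<Rightarrow> real^'n^'n) \<Rightarrow> (real^'n) set \<Rightarrow> (real^'n \<Rightarrow> real) \<Rightarrow> real^'n \<Rightarrow> real" where
  "laplacian G S u x = metric_trace G x (hessian G S u x)"

definition tracefree_hessian ::
  "(real^'n \<Rightarrow> real^'n^'n) \<Rightarrow> (real^'n) set \<Rightarrow> (real^'n \<Rightarrow> real) \<Rightarrow> real^'n \<Rightarrow> real^'n^'n" where
  "tracefree_hessian G S u x =
     hessian G S u x - (laplacian G S u x / real CARD('n)) *\<^sub>R G x"


section \<open>Domains with C^2 boundary: normal and mean curvature\<close>

definition defining_function ::
  "(real^'n) set \<Rightarrow> (real^'n) set \<Rightarrow> (real^'n \<Rightarrow> real) \<Rightarrow> real^'n \<Rightarrow> bool" where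
  "defining_function D V \<rho> x \<longleftrightarrow> open V \<and> x \<in> V \<and> Ck_on 2 V \<rho> \<and>
     (\<forall>y\<in>V. \<exists>i. partial V i \<rho> y \<noteq> 0) \<and> D \<inter> V = {y\<in>V. \<rho> y < 0}"

definition C2_boundary :: "('a::topological_space, 'n::finite) chart set \<Rightarrow> 'a set \<Rightarrow> bool" where
  "C2_boundary A \<Omega> \<longleftrightarrow>
     (\<forall>c\<in>A. \<forall>p\<in>fst c \<inter> frontier \<Omega>. \<exists>V \<rho>. defining_function (chart_img c \<Omega>) V \<rho> (snd c p))"

text \<open>In coordinates, the outward unit normal at a boundary point of \<open>D\<close> is \<open>\<nabla>\<rho>/|\<nabla>\<rho>|\<close> for any local
  defining function \<open>\<rho>\<close> of \<open>D\<close> (negative inside).\<close>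

definition outward_normal ::
  "(real^'n \<Rightarrow> real^'n^'n) \<Rightarrow> (real^'n) set \<Rightarrow> real^'n \<Rightarrow> real^'n" where
  "outward_normal G D x = (THE \<nu>. \<exists>V \<rho>. defining_function D V \<rho> x \<and>
     \<nu> = (let X = gradient G V \<rho> x in (1 / sqrt (metric_inner G x X X)) *\<^sub>R X))"

text \<open>Covariant derivative in a direction \<open>X\<close> tangent to the hypersurface \<open>B\<close> of a vector field \<open>N\<close>
  defined along \<open>B\<close> only.  The derivative within \<open>B\<close> is determined on tangent vectors \<open>X\<close>.\<close>

definition covariant_along ::
  "(real^'n \<Rightarrow> real^'n^'n) \<Rightarrow> (real^'n) set \<Rightarrow> (real^'n \<Rightarrow> real^'n) \<Rightarrow> real^'n \<Rightarrow> real^'n \<Rightarrow> real^'n"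
  where
  "covariant_along G B N x X = frechet_derivative N (at x within B) X
     + (\<chi> k. \<Sum>i\<in>UNIV. \<Sum>j\<in>UNIV. christoffel G k i j x * X $ i * N x $ j)"

text \<open>For a unit normal field \<open>N\<close> along \<open>B\<close>, the trace over the tangent space of \<open>B\<close> of
  \<open>X \<mapsto> \<nabla>\<^sub>X N\<close>: that endomorphism is extended to all vectors by first projecting tangentially (so by
  0 on the normal line), which leaves the trace unchanged.\<close>

definition trace_shape ::
  "(real^'n \<Rightarrow> real^'n^'n) \<Rightarrow> (real^'n) set \<Rightarrow> (real^'n \<Rightarrow> real^'n) \<Rightarrow> real^'n \<Rightarrow> real" where
  "trace_shape G B N x =
     trace (matrix (\<lambda>X. covariant_along G B N x (X - metric_inner G x X (N x) *\<^sub>R N x)))"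


section \<open>The scalar quantities on the manifold\<close>

definition Lap ::
  "('a, 'n::finite) chart set \<Rightarrow> (('a, 'n) chart \<Rightarrow> real^'n \<Rightarrow> real^'n^'n) \<Rightarrow> 'a set
     \<Rightarrow> ('a \<Rightarrow> real) \<Rightarrow> 'a \<Rightarrow> real" where
  "Lap A g D u = scalar A (\<lambda>c. laplacian (g c) (chart_img c D) (u \<circ> chart_inv c))"

definition grad_norm2 ::
  "('a, 'n::finite) chart set \<Rightarrow> (('a, 'n) chart \<Rightarrow> real^'n \<Rightarrow> real^'n^'n) \<Rightarrow> 'a set
     \<Rightarrow> ('a \<Rightarrow> real) \<Rightarrow> 'a \<Rightarrow> real" where
  "grad_norm2 A g D u = scalar A (\<lambda>c x.
     let X = gradient (g c) (chart_img c D) (u \<circ> chart_inv c) x in metric_inner (g c) x X X)"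

definition tracefree_hessian_norm2 ::
  "('a, 'n::finite) chart set \<Rightarrow> (('a, 'n) chart \<Rightarrow> real^'n \<Rightarrow> real^'n^'n) \<Rightarrow> 'a set
     \<Rightarrow> ('a \<Rightarrow> real) \<Rightarrow> 'a \<Rightarrow> real" where
  "tracefree_hessian_norm2 A g D u = scalar A (\<lambda>c x.
     metric_norm2 (g c) x (tracefree_hessian (g c) (chart_img c D) (u \<circ> chart_inv c) x))"

text \<open>The value of \<open>Ric - \<kappa>g\<close> on \<open>(\<nabla>u,\<nabla>u)\<close>.\<close>

definition ricci_minus_grad ::
  "('a, 'n::finite) chart set \<Rightarrow> (('a, 'n) chart \<Rightarrow> real^'n \<Rightarrow> real^'n^'n) \<Rightarrow> real \<Rightarrow> 'a set
     \<Rightarrow> ('a \<Rightarrow> real) \<Rightarrow> 'a \<Rightarrow> real" where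
  "ricci_minus_grad A g \<kappa> D u = scalar A (\<lambda>c x.
     let X = gradient (g c) (chart_img c D) (u \<circ> chart_inv c) x
     in X \<bullet> ((ricci (g c) x - \<kappa> *\<^sub>R g c x) *v X))"

definition ricci_ge ::
  "('a, 'n::finite) chart set \<Rightarrow> (('a, 'n) chart \<Rightarrow> real^'n \<Rightarrow> real^'n^'n) \<Rightarrow> real \<Rightarrow> 'a set \<Rightarrow> bool"
  where
  "ricci_ge A g \<kappa> D \<longleftrightarrow> (\<forall>c\<in>A. \<forall>x\<in>chart_img c D. \<forall>X.
     X \<bullet> (ricci (g c) x *v X) \<ge> \<kappa> * metric_inner (g c) x X X)"

text \<open>On the boundary the gradient of a function given on \<open>closure \<Omega>\<close> is the one-sided one.\<close>

definition normal_derivative ::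
  "('a::topological_space, 'n::finite) chart set \<Rightarrow> (('a, 'n) chart \<Rightarrow> real^'n \<Rightarrow> real^'n^'n) \<Rightarrow> 'a set
     \<Rightarrow> ('a \<Rightarrow> real) \<Rightarrow> 'a \<Rightarrow> real" where
  "normal_derivative A g \<Omega> u = scalar A (\<lambda>c x.
     metric_inner (g c) x
       (gradient (g c) (chart_img c (closure \<Omega>)) (u \<circ> chart_inv c) x)
       (outward_normal (g c) (chart_img c \<Omega>) x))"

definition mean_curvature ::
  "('a::topological_space, 'n::finite) chart set \<Rightarrow> (('a, 'n) chart \<Rightarrow> real^'n \<Rightarrow> real^'n^'n) \<Rightarrow> 'a set
     \<Rightarrow> 'a \<Rightarrow> real" where
  "mean_curvature A g \<Omega> = scalar A (\<lambda>c.
     trace_shape (g c) (chart_img c (frontier \<Omega>)) (outward_normal (g c) (chart_img c \<Omega>)))"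


section \<open>Riemannian volume elements\<close>

definition volume_measure ::
  "('a::topological_space, 'n::finite) chart set \<Rightarrow> (('a, 'n) chart \<Rightarrow> real^'n \<Rightarrow> real^'n^'n)
     \<Rightarrow> 'a measure" where
  "volume_measure A g = (THE \<mu>. sets \<mu> = sets borel \<and>
     (\<forall>c\<in>A. \<forall>E\<in>sets borel. E \<subseteq> fst c \<longrightarrow>
        emeasure \<mu> E = (\<integral>\<^sup>+x\<in>chart_img c E. ennreal (sqrt (det (g c x))) \<partial>lborel)))"

text \<open>The volume element of the metric induced on a \<open>CARD('m)\<close>-dimensional C^2 submanifold \<open>B\<close>.  A
  local parametrization of \<open>B\<close>, written in a chart \<open>c\<close>, is an injective C^2 immersion \<open>\<psi>\<close> of an open
  \<open>W\<close> in \<open>R^m\<close>, in which the induced metric has the Gram matrix \<open>g(\<partial>\<^sub>a\<psi>, \<partial>\<^sub>b\<psi>)\<close>.\<close>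

definition local_parametrization ::
  "('a, 'n::finite) chart \<Rightarrow> 'a set \<Rightarrow> (real^'m) set \<Rightarrow> (real^'m \<Rightarrow> real^'n) \<Rightarrow> bool" where
  "local_parametrization c B W \<psi> \<longleftrightarrow> open W \<and> Ck_on 2 W \<psi> \<and> inj_on \<psi> W \<and>
     (\<forall>y\<in>W. inj (frechet_derivative \<psi> (at y))) \<and> \<psi> ` W \<subseteq> chart_img c B"

definition submanifold_measure ::
  "'m::finite itself \<Rightarrow> ('a::topological_space, 'n::finite) chart set
     \<Rightarrow> (('a, 'n) chart \<Rightarrow> real^'n \<Rightarrow> real^'n^'n) \<Rightarrow> 'a set \<Rightarrow> 'a measure" where
  "submanifold_measure _ A g B = (THE \<mu>. sets \<mu> = sets borel \<and> emeasure \<mu> (- B) = 0 \<and>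
     (\<forall>c\<in>A. \<forall>(W :: (real^'m) set) \<psi>. local_parametrization c B W \<psi> \<longrightarrow>
        (\<forall>E\<in>sets borel. E \<subseteq> (chart_inv c \<circ> \<psi>) ` W \<longrightarrow>
           emeasure \<mu> E = (\<integral>\<^sup>+y\<in>{y\<in>W. chart_inv c (\<psi> y) \<in> E}.
             ennreal (sqrt (det (\<chi> a b.
               metric_inner (g c) (\<psi> y) (partial W a \<psi> y) (partial W b \<psi> y)))) \<partial>lborel))))"

end

theory Submission imports Defs
begin

text \<open>Apply the divergence theorem to the three vector fields
  \<open>\<nabla>\<^bsub>\<nabla>u\<^esub>\<nabla>u - \<Delta>u \<nabla>u\<close>, \<open>\<nabla>u\<close> and \<open>f(u)\<nabla>u\<close>.  By the Bochner formula the first one has divergence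
  \<open>|Hess u|\<^sup>2 - (\<Delta>u)\<^sup>2 + Ric(\<nabla>u,\<nabla>u)\<close>, and since \<open>u\<close> vanishes on the boundary, \<open>\<nabla>u = u\<eta> \<eta>\<close> there
  and its flux is \<open>- H u\<eta>\<^sup>2\<close>.  The other two fields give \<open>\<integral>u\<eta> = - \<integral>f(u)\<close> and
  \<open>\<integral>f'(u)|\<nabla>u|\<^sup>2 - \<integral>f(u)\<^sup>2 = f(0) \<integral>u\<eta>\<close>.  Expanding \<open>(H u\<eta> + c f(0))\<^sup>2/H\<close> and eliminating \<open>\<integral>f(u)\<^sup>2\<close>
  and \<open>\<integral>u\<eta>\<close> gives the identity, whose right hand side is nonnegative under the curvature bound.

  The first field has no derivatives on the boundary, only continuous boundary values.  A \<open>C\<^sup>1\<close> partition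
  of unity reduces the divergence theorem to coordinate patches in which \<open>\<Omega>\<close> is the region below
  the graph of a \<open>C\<^sup>2\<close> function \<open>h\<close>; there the field is multiplied by a cutoff function of the height
  below the graph, whose width tends to 0.\<close>

section \<open>Functions of class \<open>C\<^sup>k\<close>\<close>

text \<open>The notions of the statement are definite descriptions: \<open>scalar\<close> over all
  charts, \<open>outward_normal\<close> over all defining functions, and the two measures. Much of
  the proof shows that they denote: independence of the chart, existence and uniqueness of the
  measures. Tensors are compared through matrices intertwined by the Jacobian; no transformation law
  of the full curvature tensor is derived.

  Regularity is tight at the boundary. A \<open>C\<^sup>2\<close> boundary has a
  \<open>C\<^sup>1\<close> normal and a merely continuous mean curvature, and \<open>u\<close> has
  only two derivatives there. The divergence of the first field looks like a third order expression
  in \<open>u\<close>, but by the Bochner formula it involves at most second derivatives and so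
  stays bounded up to the boundary; this bound lets the cutoff width tend to 0 in the volume
  integral.

  The constant \<open>c = 1 - 1/n\<close> is what remains when
  \<open>|Hess u|\<^sup>2 - (\<Delta>u)\<^sup>2\<close> is written as the squared norm of the
  trace-free Hessian minus \<open>c (\<Delta>u)\<^sup>2\<close>. The shift \<open>n k\<close> in
  \<open>E\<close> is matched to the curvature term by \<open>(n - 1) k = c n k\<close>.\<close>

lemma partial_open: "open S \<Longrightarrow> x \<in> S \<Longrightarrow> partial S i f x = partial UNIV i f x"
  unfolding partial_def using at_within_open[of x S] by metis

lemma partial_eqI: "(f has_derivative f') (at x) \<Longrightarrow> partial UNIV i f x = f' (axis i 1)"
  unfolding partial_def using frechet_derivative_at by fastforce

lemma vec_eq_sum_axis: "(h::real^'n) = (\<Sum>i\<in>UNIV. h $ i *\<^sub>R axis i 1)"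
  by (simp add: vec_eq_iff axis_def if_distrib[of "\<lambda>x. _ * x"] cong: if_cong)

lemma linear_eq_sum_axis:
  assumes "linear f" shows "f (h::real^'n) = (\<Sum>i\<in>UNIV. h $ i *\<^sub>R f (axis i 1))"
proof -
  have "f h = f (\<Sum>i\<in>UNIV. h $ i *\<^sub>R axis i 1)" using vec_eq_sum_axis[of h] by simp
  then show ?thesis by (simp add: linear_sum[OF assms] linear_cmul[OF assms])
qed

lemma has_derivative_partial:
  assumes "f differentiable at x within S"
  shows "(f has_derivative (\<lambda>h. \<Sum>i\<in>UNIV. h $ i *\<^sub>R partial S i f x)) (at x within S)"
proof -
  have d: "(f has_derivative frechet_derivative f (at x within S)) (at x within S)"
    using assms frechet_derivative_works by blast
  then have l: "linear (frechet_derivative f (at x within S))"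
    by (rule has_derivative_linear)
  have "frechet_derivative f (at x within S) = (\<lambda>h. \<Sum>i\<in>UNIV. h $ i *\<^sub>R partial S i f x)"
    using linear_eq_sum_axis[OF l] unfolding partial_def by (rule ext)
  then show ?thesis using d by simp
qed

lemma has_derivative_partial_at:
  assumes "f differentiable at x"
  shows "(f has_derivative (\<lambda>h. \<Sum>i\<in>UNIV. h $ i *\<^sub>R partial UNIV i f x)) (at x)"
  using has_derivative_partial[OF assms] .

lemma partial_cong_open:
  assumes "open S" "x \<in> S" "\<And>y. y \<in> S \<Longrightarrow> f y = g y"
  shows "partial UNIV i f x = partial UNIV i g x"
proof -
  have "(f has_derivative f') (at x) \<longleftrightarrow> (g has_derivative f') (at x)" for f'
    using assms has_derivative_transform_within_open[of f f' x UNIV S g]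
      has_derivative_transform_within_open[of g f' x UNIV S f] by auto
  then show ?thesis unfolding partial_def frechet_derivative_def by simp
qed

lemma differentiable_on_open_cong:
  assumes "open S" "\<And>y. y \<in> S \<Longrightarrow> f y = g y"
  shows "f differentiable_on S \<longleftrightarrow> g differentiable_on S"
  using assms by (metis differentiable_on_def differentiable_transform_within
      openE mem_ball dist_commute zero_less_one)

text \<open>Derivative formulas are available only at the points of \<open>S\<close>, so regularity
  has to pass between functions that agree only there. On an open set the derivatives see no other
  values.\<close>

lemma Ck_on_cong:
  assumes "open S" "\<And>y. y \<in> S \<Longrightarrow> f y = g y"
  shows "Ck_on k S f \<longleftrightarrow> Ck_on k S g"
  using assms(2)
proof (induction k arbitrary: f g)
  case 0 then show ?case by (simp cong: continuous_on_cong)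
next
  case (Suc k)
  have "partial S i f y = partial S i g y" if "y \<in> S" for i y
    using partial_cong_open[OF assms(1) that, of f g] Suc.prems
    by (simp add: partial_open[OF assms(1) that])
  then have "Ck_on k S (partial S i f) \<longleftrightarrow> Ck_on k S (partial S i g)" for i
    by (intro Suc.IH) auto
  then show ?case
    using differentiable_on_open_cong[OF assms(1) Suc.prems] by simp
qed

lemma Ck_on_Suc_D: "Ck_on (Suc k) S f \<Longrightarrow> Ck_on k S f"
proof (induction k arbitrary: f)
  case 0 then show ?case by (simp add: differentiable_imp_continuous_on)
next
  case (Suc k) then show ?case by (metis Ck_on.simps(2))
qed

lemma Ck_on_mono: "Ck_on k S f \<Longrightarrow> l \<le> k \<Longrightarrow> Ck_on l S f"
  by (induction k) (auto simp: le_Suc_eq dest: Ck_on_Suc_D simp del: Ck_on.simps)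

lemma Ck_on_continuous: "Ck_on k S f \<Longrightarrow> continuous_on S f"
  using Ck_on_mono[of k S f 0] by simp

lemma Ck_on_subset:
  assumes "open S" "open T" "T \<subseteq> S" "Ck_on k S f" shows "Ck_on k T f"
  using assms(4)
proof (induction k arbitrary: f)
  case 0 then show ?case using assms continuous_on_subset by auto
next
  case (Suc k)
  have "Ck_on k T (partial T i f) \<longleftrightarrow> Ck_on k T (partial S i f)" for i
    by (rule Ck_on_cong[OF assms(2)]) (metis assms partial_open subsetD)
  then show ?case using Suc assms(3) by (auto intro: differentiable_on_subset)
qed

text \<open>For functions that are regular for different reasons in different places, such as
  extensions by zero and bump functions seen in a foreign chart.\<close>

lemma Ck_on_local:
  assumes "open S" "\<And>x. x \<in> S \<Longrightarrow> \<exists>T. open T \<and> x \<in> T \<and> Ck_on k (S \<inter> T) f"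
  shows "Ck_on k S f"
  using assms(2)
proof (induction k arbitrary: f)
  case 0
  then have "\<exists>T. open T \<and> x \<in> T \<and> continuous_on (S \<inter> T) f" if "x \<in> S" for x using that by simp
  then show ?case
    by (metis Ck_on.simps(1) IntI assms(1) at_within_open continuous_at_imp_continuous_on
        continuous_on_eq_continuous_within open_Int)
next
  case (Suc k)
  have 1: "f differentiable_on S"
    unfolding differentiable_on_def
  proof
    fix x assume x: "x \<in> S"
    then obtain T where T: "open T" "x \<in> T" "Ck_on (Suc k) (S \<inter> T) f" using Suc.prems by blast
    then have "f differentiable at x within (S \<inter> T)" using x by (auto simp: differentiable_on_def)
    then show "f differentiable at x within S"
      using T x assms(1) by (metis IntI at_within_open open_Int)
  qed
  have "Ck_on k S (partial S i f)" for i
  proof (rule Suc.IH)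
    fix x assume x: "x \<in> S"
    then obtain T where T: "open T" "x \<in> T" "Ck_on (Suc k) (S \<inter> T) f" using Suc.prems by blast
    have "Ck_on k (S \<inter> T) (partial S i f) \<longleftrightarrow> Ck_on k (S \<inter> T) (partial (S \<inter> T) i f)"
      by (rule Ck_on_cong) (use T assms in \<open>auto simp: partial_open[of S] partial_open[of "S \<inter> T"] open_Int\<close>)
    then show "\<exists>T. open T \<and> x \<in> T \<and> Ck_on k (S \<inter> T) (partial S i f)" using T by auto
  qed
  then show ?case using 1 by simp
qed

lemma Ck_on_SucD1: "open S \<Longrightarrow> Ck_on (Suc k) S f \<Longrightarrow> x \<in> S \<Longrightarrow> f differentiable at x"
  using at_within_open[of x S] by (metis Ck_on.simps(2) differentiable_on_def)

lemma Ck_on_SucD2: "open S \<Longrightarrow> Ck_on (Suc k) S f \<Longrightarrow> Ck_on k S (partial UNIV i f)"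
  using Ck_on_cong[of S "partial S i f" "partial UNIV i f" k] by (simp add: partial_open[of S])

lemma Ck_on_SucI:
  assumes "open S" "\<And>x. x \<in> S \<Longrightarrow> f differentiable at x" "\<And>i. Ck_on k S (partial UNIV i f)"
  shows "Ck_on (Suc k) S f"
  using Ck_on_cong[of S "partial S _ f" "partial UNIV _ f" k] assms
  by (auto simp: partial_open[of S] differentiable_on_def intro: differentiable_at_withinI)

lemma Ck_on_Suc_iff:
  assumes "open S"
  shows "Ck_on (Suc k) S f \<longleftrightarrow> (\<forall>x\<in>S. f differentiable at x) \<and> (\<forall>i. Ck_on k S (partial UNIV i f))"
  using Ck_on_SucD1 Ck_on_SucD2 Ck_on_SucI assms by metis

section \<open>Rules for partial derivatives\<close>

lemma partial_const [simp]: "partial UNIV i (\<lambda>x. c) x = 0"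
  by (rule partial_eqI[of _ "\<lambda>_. 0", simplified]) simp

lemma partial_nth [simp]: "partial UNIV i (\<lambda>x. x $ k) x = (if i = k then 1 else 0)"
proof -
  have "((\<lambda>x. x $ k) has_derivative (\<lambda>h. h $ k)) (at x)"
    by (rule bounded_linear_imp_has_derivative) (rule bounded_linear_vec_nth)
  then show ?thesis using partial_eqI[of "\<lambda>x. x $ k" "\<lambda>h. h $ k" x i] by (simp add: axis_def)
qed

lemma sum_axis_scaleR [simp]: "(\<Sum>i\<in>UNIV. axis j (1::real) $ i *\<^sub>R F i) = (F j :: 'b::real_vector)"
proof -
  have "axis j (1::real) $ i *\<^sub>R F i = (if i = j then F i else 0)" for i by (simp add: axis_def)
  then show ?thesis by simp
qed

lemma sum_axis_mult [simp]: "(\<Sum>i\<in>UNIV. axis j (1::real) $ i * F i) = F j"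
  using sum_axis_scaleR[of j F] by simp

lemma partial_const_fun [simp]: "partial UNIV i (\<lambda>x. c) = (\<lambda>x. 0)"
  by (rule ext) simp

lemma partial_nth_fun [simp]: "partial UNIV i (\<lambda>x. x $ k) = (\<lambda>x. if i = k then 1 else 0)"
  by (rule ext) simp

lemma partial_add: "f differentiable at x \<Longrightarrow> g differentiable at x \<Longrightarrow>
   partial UNIV i (\<lambda>y. f y + g y) x = partial UNIV i f x + partial UNIV i g x"
  by (rule partial_eqI[THEN trans], rule has_derivative_add; (erule has_derivative_partial_at)?)
    simp

lemma partial_diff: "f differentiable at x \<Longrightarrow> g differentiable at x \<Longrightarrow>
   partial UNIV i (\<lambda>y. f y - g y) x = partial UNIV i f x - partial UNIV i g x"
  by (rule partial_eqI[THEN trans], rule has_derivative_diff; (erule has_derivative_partial_at)?)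
    simp

lemma partial_mult:
  fixes f g :: "real^'n \<Rightarrow> real"
  shows "f differentiable at x \<Longrightarrow> g differentiable at x \<Longrightarrow>
   partial UNIV i (\<lambda>y. f y * g y) x = f x * partial UNIV i g x + partial UNIV i f x * g x"
  by (rule partial_eqI[THEN trans], rule has_derivative_mult; (erule has_derivative_partial_at)?)
    simp

lemma partial_sum:
  assumes "finite A" "\<And>a. a \<in> A \<Longrightarrow> f a differentiable at x"
  shows "partial UNIV i (\<lambda>y. \<Sum>a\<in>A. f a y) x = (\<Sum>a\<in>A. partial UNIV i (f a) x)"
proof -
  have "((\<lambda>y. \<Sum>a\<in>A. f a y) has_derivative (\<lambda>h. \<Sum>a\<in>A. \<Sum>i\<in>UNIV. h $ i *\<^sub>R partial UNIV i (f a) x)) (at x)"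
    by (intro has_derivative_sum has_derivative_partial_at assms(2))
  from partial_eqI[OF this] show ?thesis by simp
qed

lemma partial_inverse:
  fixes f :: "real^'n \<Rightarrow> real"
  assumes "f differentiable at x" "f x \<noteq> 0"
  shows "partial UNIV i (\<lambda>y. inverse (f y)) x = - (inverse (f x) * inverse (f x)) * partial UNIV i f x"
  by (rule partial_eqI[THEN trans],
      rule Deriv.has_derivative_inverse[OF assms(2) has_derivative_partial_at[OF assms(1)]]) simp

lemma partial_real_compose:
  fixes f :: "real^'n \<Rightarrow> real"
  assumes "f differentiable at x" "(\<beta> has_real_derivative d) (at (f x))"
  shows "partial UNIV i (\<lambda>y. \<beta> (f y)) x = d * partial UNIV i f x"
  using partial_eqI[OF has_derivative_compose[OF has_derivative_partial_at[OF assms(1)]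
     assms(2)[unfolded has_field_derivative_def]], of i] by simp

lemma vec_differentiableI:
  assumes "\<And>a. (\<lambda>x. \<tau> x $ a) differentiable at x within S"
  shows "(\<tau> :: _ \<Rightarrow> real^'m) differentiable at x within S"
proof -
  obtain D where "\<And>a. ((\<lambda>x. \<tau> x $ a) has_derivative D a) (at x within S)"
    using assms unfolding differentiable_def by metis
  then have "(\<tau> has_derivative (\<lambda>h. \<chi> a. D a h)) (at x within S)"
    by (auto simp: has_derivative_componentwise_within[of \<tau>] Basis_vec_def inner_axis)
  then show ?thesis unfolding differentiable_def by blast
qed

lemma vec_differentiableD:
  "(\<tau> :: _ \<Rightarrow> 'b::real_normed_vector^'m) differentiable at x within S \<Longrightarrow> (\<lambda>x. \<tau> x $ a) differentiable at x within S"
  unfolding differentiable_def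
  using bounded_linear.has_derivative[OF bounded_linear_vec_nth] by blast

lemma partial_component:
  assumes "(\<tau> :: _ \<Rightarrow> 'b::real_normed_vector^'m) differentiable at x"
  shows "partial UNIV i (\<lambda>x. \<tau> x $ a) x = partial UNIV i \<tau> x $ a"
  by (subst partial_eqI[OF bounded_linear.has_derivative[OF bounded_linear_vec_nth has_derivative_partial_at[OF assms]]]) simp

lemma partial_compose:
  fixes \<tau> :: "real^'n \<Rightarrow> real^'m"
  assumes "\<tau> differentiable at x" "f differentiable at (\<tau> x)"
  shows "partial UNIV i (\<lambda>x. f (\<tau> x)) x
       = (\<Sum>a\<in>UNIV. partial UNIV i (\<lambda>x. \<tau> x $ a) x *\<^sub>R partial UNIV a f (\<tau> x))"
  by (subst partial_eqI[OF has_derivative_compose[OF has_derivative_partial_at[OF assms(1)]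
     has_derivative_partial_at[OF assms(2)]]]) (simp add: partial_component[OF assms(1)])

section \<open>Closure of the classes \<open>Ck_on\<close> under algebra and composition\<close>

lemma Ck_on_const [simp]: "open S \<Longrightarrow> Ck_on k S (\<lambda>x. c)"
  by (induction k arbitrary: c) (simp_all add: Ck_on_Suc_iff del: Ck_on.simps(2))

lemma Ck_on_nth [simp]: "open S \<Longrightarrow> Ck_on k S (\<lambda>x. x $ i)"
  by (cases k) (auto simp: Ck_on_Suc_iff vec_differentiableD[OF differentiable_ident] intro!: continuous_intros simp del: Ck_on.simps(2))

lemma Ck_on_add:
  assumes "open S" "Ck_on k S f" "Ck_on k S g" shows "Ck_on k S (\<lambda>x. f x + g x)"
  using assms(2,3)
proof (induction k arbitrary: f g)
  case 0 then show ?case by (auto intro: continuous_intros)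
next
  case (Suc k)
  have "Ck_on k S (partial UNIV i (\<lambda>x. f x + g x)) \<longleftrightarrow> Ck_on k S (\<lambda>x. partial UNIV i f x + partial UNIV i g x)" for i
    by (rule Ck_on_cong) (use Suc.prems assms(1) in \<open>auto intro!: partial_add Ck_on_SucD1 simp del: Ck_on.simps\<close>)
  then show ?case using Suc by (simp add: Ck_on_Suc_iff[OF assms(1)] del: Ck_on.simps)
qed

lemma Ck_on_mult:
  fixes f g :: "real^'n \<Rightarrow> real"
  assumes "open S" "Ck_on k S f" "Ck_on k S g" shows "Ck_on k S (\<lambda>x. f x * g x)"
  using assms(2,3)
proof (induction k arbitrary: f g)
  case 0 then show ?case by (auto intro: continuous_intros)
next
  case (Suc k)
  have "Ck_on k S (partial UNIV i (\<lambda>x. f x * g x)) \<longleftrightarrow> Ck_on k S (\<lambda>x. f x * partial UNIV i g x + partial UNIV i f x * g x)" for i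
    by (rule Ck_on_cong) (use Suc.prems assms(1) in \<open>auto intro!: partial_mult Ck_on_SucD1 simp del: Ck_on.simps\<close>)
  moreover have "Ck_on k S f" "Ck_on k S g" using Suc.prems Ck_on_Suc_D by auto
  ultimately show ?case using Suc
    by (auto simp: Ck_on_Suc_iff[OF assms(1)] intro!: Ck_on_add[OF assms(1)] simp del: Ck_on.simps)
qed

lemma Ck_on_sum:
  assumes "open S" "\<And>a. a \<in> A \<Longrightarrow> Ck_on k S (f a)" shows "Ck_on k S (\<lambda>x. \<Sum>a\<in>A. f a x)"
  using assms(2) by (induction A rule: infinite_finite_induct) (auto intro: Ck_on_add simp: assms(1))

lemma Ck_on_prod:
  fixes f :: "_ \<Rightarrow> real^'n \<Rightarrow> real"
  assumes "open S" "\<And>a. a \<in> A \<Longrightarrow> Ck_on k S (f a)" shows "Ck_on k S (\<lambda>x. \<Prod>a\<in>A. f a x)"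
  using assms(2) by (induction A rule: infinite_finite_induct) (auto intro: Ck_on_mult simp: assms(1))

lemma Ck_on_minus:
  fixes f :: "real^'n \<Rightarrow> real"
  assumes "open S" "Ck_on k S f" shows "Ck_on k S (\<lambda>x. - f x)"
  using Ck_on_mult[OF assms(1) Ck_on_const[OF assms(1), of k "-1"] assms(2)] by simp

lemma Ck_on_diff:
  fixes f g :: "real^'n \<Rightarrow> real"
  assumes "open S" "Ck_on k S f" "Ck_on k S g" shows "Ck_on k S (\<lambda>x. f x - g x)"
  using Ck_on_add[OF assms(1,2) Ck_on_minus[OF assms(1,3)]] by simp

lemma Ck_on_inverse:
  fixes f :: "real^'n \<Rightarrow> real"
  assumes "open S" "Ck_on k S f" "\<And>x. x \<in> S \<Longrightarrow> f x \<noteq> 0" shows "Ck_on k S (\<lambda>x. inverse (f x))"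
  using assms(2)
proof (induction k)
  case 0 then show ?case using assms by (auto intro: continuous_intros)
next
  case (Suc k)
  have "Ck_on k S (partial UNIV i (\<lambda>x. inverse (f x))) \<longleftrightarrow>
      Ck_on k S (\<lambda>x. - (inverse (f x) * inverse (f x)) * partial UNIV i f x)" for i
    by (rule Ck_on_cong) (use Suc.prems assms(1,3) in \<open>simp_all add: partial_inverse Ck_on_SucD1[OF assms(1) Suc.prems] del: Ck_on.simps\<close>)
  moreover have "Ck_on k S (\<lambda>x. inverse (f x))" using Suc Ck_on_Suc_D by auto
  ultimately show ?case using Suc.prems assms
    by (auto simp: Ck_on_Suc_iff[OF assms(1)] intro!: Ck_on_mult Ck_on_minus simp del: Ck_on.simps)
qed

lemma Ck_on_divide:
  fixes f g :: "real^'n \<Rightarrow> real"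
  assumes "open S" "Ck_on k S f" "Ck_on k S g" "\<And>x. x \<in> S \<Longrightarrow> g x \<noteq> 0"
  shows "Ck_on k S (\<lambda>x. f x / g x)"
  using Ck_on_mult[OF assms(1,2) Ck_on_inverse[OF assms(1,3,4)]] by (simp add: field_class.field_divide_inverse)

lemma Ck_on_component:
  assumes "open S" "Ck_on k S (\<tau> :: _ \<Rightarrow> 'b::real_normed_vector^'m)" shows "Ck_on k S (\<lambda>x. \<tau> x $ a)"
  using assms(2)
proof (induction k arbitrary: \<tau>)
  case 0 then show ?case by (auto intro: continuous_intros)
next
  case (Suc k)
  have "Ck_on k S (partial UNIV i (\<lambda>x. \<tau> x $ a)) \<longleftrightarrow> Ck_on k S (\<lambda>x. partial UNIV i \<tau> x $ a)" for i
    by (rule Ck_on_cong) (use Suc.prems assms(1) in \<open>auto intro!: partial_component Ck_on_SucD1 simp del: Ck_on.simps\<close>)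
  then show ?case using Suc by (simp add: Ck_on_Suc_iff[OF assms(1)] vec_differentiableD del: Ck_on.simps)
qed

lemma Ck_on_vecI:
  assumes "open S" "\<And>a. Ck_on k S (\<lambda>x. (\<tau> :: _ \<Rightarrow> real^'m) x $ a)" shows "Ck_on k S \<tau>"
  using assms(2)
proof (induction k arbitrary: \<tau>)
  case 0 then show ?case using continuous_on_vec_lambda[of S "\<lambda>a x. \<tau> x $ a"] by simp
next
  case (Suc k)
  have d: "\<tau> differentiable at x" if "x \<in> S" for x
    by (rule vec_differentiableI) (use Suc.prems Ck_on_SucD1[OF assms(1)] that in blast)
  have "Ck_on k S (partial UNIV i (\<lambda>x. \<tau> x $ a)) \<longleftrightarrow> Ck_on k S (\<lambda>x. partial UNIV i \<tau> x $ a)" for i a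
    by (rule Ck_on_cong) (simp_all add: assms(1) d partial_component)
  then show ?case using Suc d by (simp add: Ck_on_Suc_iff[OF assms(1)] del: Ck_on.simps)
qed

text \<open>Induction over all outer functions with \<tau> fixed: the chain rule turns a partial
  derivative of the composition into products of partials of \<tau> with compositions of partials of
  \<open>f\<close>, and both factors are one order less regular.\<close>

lemma Ck_on_compose:
  fixes \<tau> :: "real^'n \<Rightarrow> real^'m" and f :: "real^'m \<Rightarrow> real"
  assumes "open S" "open T" "Ck_on k S \<tau>" "\<tau> ` S \<subseteq> T" "Ck_on k T f"
  shows "Ck_on k S (\<lambda>x. f (\<tau> x))"
  using assms(3,5)
proof (induction k arbitrary: f)
  case 0 then show ?case using assms(4) continuous_on_compose2 by auto
next
  case (Suc k)
  have d: "\<tau> differentiable at x" "f differentiable at (\<tau> x)" if "x \<in> S" for x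
    using Suc.prems that assms Ck_on_SucD1 by blast+
  have "Ck_on k S (partial UNIV i (\<lambda>x. f (\<tau> x))) \<longleftrightarrow>
      Ck_on k S (\<lambda>x. \<Sum>a\<in>UNIV. partial UNIV i (\<lambda>x. \<tau> x $ a) x * partial UNIV a f (\<tau> x))" for i
    by (rule Ck_on_cong) (use assms(1) d in \<open>auto simp: partial_compose\<close>)
  moreover have "Ck_on k S (\<lambda>x. \<Sum>a\<in>UNIV. partial UNIV i (\<lambda>x. \<tau> x $ a) x * partial UNIV a f (\<tau> x))" for i
    using Suc.prems Suc.IH[OF Ck_on_Suc_D[OF Suc.prems(1)]] Ck_on_component[OF assms(1) Suc.prems(1)] assms
    by (intro Ck_on_sum Ck_on_mult) (auto intro: Ck_on_SucD2 simp del: Ck_on.simps)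
  ultimately show ?case using d unfolding Ck_on_Suc_iff[OF assms(1)]
    by (auto intro: differentiable_compose)
qed

text \<open>\<open>Ck_on\<close> speaks of functions on \<open>real^'n\<close>, so an outer function
  of one real variable is treated separately. Order 1 is enough for its uses: the square root, the
  cutoffs and \<open>f\<close> applied to \<open>u\<close>.\<close>

lemma Ck_on_1_real_compose:
  fixes f :: "real^'n \<Rightarrow> real"
  assumes "open S" "Ck_on 1 S f" "\<And>x. x \<in> S \<Longrightarrow> (\<beta> has_real_derivative \<beta>' (f x)) (at (f x))"
    "continuous_on (f ` S) \<beta>'"
  shows "Ck_on 1 S (\<lambda>x. \<beta> (f x))"
proof -
  have d: "f differentiable at x" if "x \<in> S" for x
    using that assms Ck_on_SucD1[of S 0] by auto
  have "Ck_on 0 S (partial UNIV i (\<lambda>x. \<beta> (f x))) \<longleftrightarrow> Ck_on 0 S (\<lambda>x. \<beta>' (f x) * partial UNIV i f x)" for i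
    by (rule Ck_on_cong) (simp_all add: assms(1) partial_real_compose[OF d assms(3)])
  moreover have "continuous_on S (\<lambda>x. \<beta>' (f x) * partial UNIV i f x)" for i
    using assms Ck_on_SucD2[of S 0 f] continuous_on_compose2[OF assms(4), of S f] Ck_on_continuous[OF assms(2)]
    by (auto intro!: continuous_intros)
  moreover have "(\<lambda>x. \<beta> (f x)) differentiable at x" if "x \<in> S" for x
    using d[OF that] assms(3)[OF that] has_derivative_compose unfolding has_field_derivative_def differentiable_def by blast
  ultimately show ?thesis
    unfolding One_nat_def by (intro Ck_on_SucI[OF assms(1)]) simp_all
qed

lemma Ck_on_sqrt_1:
  fixes f :: "real^'n \<Rightarrow> real"
  assumes "open S" "Ck_on 1 S f" "\<And>x. x \<in> S \<Longrightarrow> f x > 0"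
  shows "Ck_on 1 S (\<lambda>x. sqrt (f x))"
  by (rule Ck_on_1_real_compose[where \<beta>'="\<lambda>y. inverse (sqrt y) / 2"])
     (use assms in \<open>fastforce intro!: DERIV_real_sqrt continuous_intros\<close>)+

text \<open>Both mixed partials are limits of the same second difference quotient.\<close>

lemma second_difference:
  fixes f :: "real^'n \<Rightarrow> real"
  assumes S: "open S" and f: "Ck_on 2 S f" and h: "h > 0"
    and sub: "\<And>s t. 0 \<le> s \<Longrightarrow> s \<le> h \<Longrightarrow> 0 \<le> t \<Longrightarrow> t \<le> h \<Longrightarrow> x + s *\<^sub>R axis i 1 + t *\<^sub>R axis j 1 \<in> S"
  shows "\<exists>s t. 0 \<le> s \<and> s \<le> h \<and> 0 \<le> t \<and> t \<le> h \<and>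
    f (x + h *\<^sub>R axis i 1 + h *\<^sub>R axis j 1) - f (x + h *\<^sub>R axis i 1) - f (x + h *\<^sub>R axis j 1) + f x
     = h * h * partial UNIV j (partial UNIV i f) (x + s *\<^sub>R axis i 1 + t *\<^sub>R axis j 1)"
proof -
  have deriv_line: "((\<lambda>t. g (y + t *\<^sub>R axis l 1)) has_real_derivative partial UNIV l g (y + t *\<^sub>R axis l 1)) (at t)"
    if "g differentiable at (y + t *\<^sub>R axis l 1)" for g :: "real^'n \<Rightarrow> real" and y t l
  proof -
    have 1: "((\<lambda>t. y + t *\<^sub>R axis l 1) has_derivative (\<lambda>t. t *\<^sub>R axis l 1)) (at t)"
      by (auto intro!: derivative_eq_intros)
    show ?thesis
      using has_derivative_compose[OF 1 has_derivative_partial_at[OF that]]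
      by (simp add: has_field_derivative_def mult.commute[of _ "partial _ _ _ _"] axis_def
          if_distrib[of "\<lambda>x. _ * x"] if_distrib[of "\<lambda>x. x * _"] cong: if_cong)
  qed
  have f2: "Ck_on (Suc (Suc 0)) S f" using f by (simp add: numeral_2_eq_2)
  have df: "f differentiable at z" if "z \<in> S" for z using Ck_on_SucD1[OF S f2 that] .
  have dpf: "partial UNIV i f differentiable at z" if "z \<in> S" for z
    using Ck_on_SucD1[OF S Ck_on_SucD2[OF S f2] that] .
  \<comment> \<open>The mean value theorem is used twice: in direction \<open>i\<close> on the
    increment in direction \<open>j\<close>, then in direction \<open>j\<close> on the resulting
    partial derivative.\<close>
  let ?p = "\<lambda>s. f (x + h *\<^sub>R axis j 1 + s *\<^sub>R axis i 1) - f (x + s *\<^sub>R axis i 1)"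
  let ?p' = "\<lambda>s. partial UNIV i f (x + h *\<^sub>R axis j 1 + s *\<^sub>R axis i 1) - partial UNIV i f (x + s *\<^sub>R axis i 1)"
  have "(?p has_real_derivative ?p' s) (at s)" if "0 \<le> s" "s \<le> h" for s
    using sub[of s h] sub[of s 0] that h
    by (intro DERIV_diff deriv_line df) (auto simp: algebra_simps)
  then obtain s where s: "0 < s" "s < h" "?p h - ?p 0 = (h - 0) * ?p' s"
    using MVT2[OF h, of ?p ?p'] by auto
  let ?q = "\<lambda>t. partial UNIV i f (x + s *\<^sub>R axis i 1 + t *\<^sub>R axis j 1)"
  have "(?q has_real_derivative partial UNIV j (partial UNIV i f) (x + s *\<^sub>R axis i 1 + t *\<^sub>R axis j 1)) (at t)"
     if "0 \<le> t" "t \<le> h" for t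
    using sub[of s t] that s by (intro deriv_line dpf) auto
  then obtain t where t: "0 < t" "t < h"
     "?q h - ?q 0 = (h - 0) * partial UNIV j (partial UNIV i f) (x + s *\<^sub>R axis i 1 + t *\<^sub>R axis j 1)"
    using MVT2[OF h, of ?q "\<lambda>t. partial UNIV j (partial UNIV i f) (x + s *\<^sub>R axis i 1 + t *\<^sub>R axis j 1)"] by auto
  have "?p' s = ?q h - ?q 0" by (simp add: add.assoc add.commute[of "h *\<^sub>R axis j 1"])
  then have "?p h - ?p 0 = h * h * partial UNIV j (partial UNIV i f) (x + s *\<^sub>R axis i 1 + t *\<^sub>R axis j 1)"
    using s t by simp
  moreover have "?p h - ?p 0 = f (x + h *\<^sub>R axis i 1 + h *\<^sub>R axis j 1) - f (x + h *\<^sub>R axis i 1) - f (x + h *\<^sub>R axis j 1) + f x"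
    by (simp add: algebra_simps)
  ultimately show ?thesis using s t by (intro exI[of _ s] exI[of _ t]) auto
qed

lemma partial_commute:
  fixes f :: "real^'n \<Rightarrow> real"
  assumes S: "open S" "x \<in> S" and f: "Ck_on 2 S f"
  shows "partial UNIV i (partial UNIV j f) x = partial UNIV j (partial UNIV i f) x"
proof -
  have f2: "Ck_on (Suc (Suc 0)) S f" using f by (simp add: numeral_2_eq_2)
  have "\<bar>partial UNIV i (partial UNIV j f) x - partial UNIV j (partial UNIV i f) x\<bar> \<le> e" if "e > 0" for e
  proof -
    have cont: "isCont (partial UNIV k (partial UNIV l f)) x" for k l
      using Ck_on_SucD2[OF S(1) Ck_on_SucD2[OF S(1) f2], of k l] S
        continuous_on_eq_continuous_at[OF S(1), of "partial UNIV k (partial UNIV l f)"] by (simp del: Ck_on.simps(2))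
    obtain d where d: "d > 0" "ball x d \<subseteq> S" using S open_contains_ball by blast
    obtain d1 where d1: "d1 > 0" "\<And>z. dist z x < d1 \<Longrightarrow> dist (partial UNIV i (partial UNIV j f) z) (partial UNIV i (partial UNIV j f) x) < e/2"
      using cont[of i j] \<open>e > 0\<close> unfolding continuous_at_eps_delta by (metis half_gt_zero)
    obtain d2 where d2: "d2 > 0" "\<And>z. dist z x < d2 \<Longrightarrow> dist (partial UNIV j (partial UNIV i f) z) (partial UNIV j (partial UNIV i f) x) < e/2"
      using cont[of j i] \<open>e > 0\<close> unfolding continuous_at_eps_delta by (metis half_gt_zero)
    \<comment> \<open>The points of the square with side \<open>h\<close> are at distance at most
      \<open>2 * h\<close> from \<open>x\<close>, which is two thirds of the allowed radius.\<close>
    define h where "h = min d (min d1 d2) / 3"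
    have h: "h > 0" using d d1 d2 by (simp add: h_def)
    have near: "dist (x + s *\<^sub>R axis k 1 + t *\<^sub>R axis l 1) x < min d (min d1 d2)"
      if "0 \<le> s" "s \<le> h" "0 \<le> t" "t \<le> h" for s t and k l :: 'n
    proof -
      have "norm (s *\<^sub>R axis k 1 + t *\<^sub>R axis l 1 :: real^'n) \<le> s + t"
        using that norm_triangle_ineq[of "s *\<^sub>R axis k 1" "t *\<^sub>R axis l 1 :: real^'n"] by simp
      also have "\<dots> < min d (min d1 d2)" using that h unfolding h_def by linarith
      finally show ?thesis by (simp add: dist_norm add.assoc)
    qed
    have inS: "x + s *\<^sub>R axis k 1 + t *\<^sub>R axis l 1 \<in> S"
      if "0 \<le> s" "s \<le> h" "0 \<le> t" "t \<le> h" for s t and k l :: 'n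
      using near[OF that, of k l] d(2) by (auto simp: dist_commute subset_iff)
    obtain s t where st: "0 \<le> s" "s \<le> h" "0 \<le> t" "t \<le> h"
      "f (x + h *\<^sub>R axis i 1 + h *\<^sub>R axis j 1) - f (x + h *\<^sub>R axis i 1) - f (x + h *\<^sub>R axis j 1) + f x
       = h * h * partial UNIV j (partial UNIV i f) (x + s *\<^sub>R axis i 1 + t *\<^sub>R axis j 1)"
      using second_difference[OF S(1) f h inS, of i j] by blast
    obtain s' t' where st': "0 \<le> s'" "s' \<le> h" "0 \<le> t'" "t' \<le> h"
      "f (x + h *\<^sub>R axis j 1 + h *\<^sub>R axis i 1) - f (x + h *\<^sub>R axis j 1) - f (x + h *\<^sub>R axis i 1) + f x
       = h * h * partial UNIV i (partial UNIV j f) (x + s' *\<^sub>R axis j 1 + t' *\<^sub>R axis i 1)"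
      using second_difference[OF S(1) f h inS, of j i] by blast
    have "h * h * partial UNIV j (partial UNIV i f) (x + s *\<^sub>R axis i 1 + t *\<^sub>R axis j 1)
        = h * h * partial UNIV i (partial UNIV j f) (x + s' *\<^sub>R axis j 1 + t' *\<^sub>R axis i 1)"
      unfolding st(5)[symmetric] st'(5)[symmetric] by (simp add: algebra_simps)
    then have eq: "partial UNIV j (partial UNIV i f) (x + s *\<^sub>R axis i 1 + t *\<^sub>R axis j 1)
        = partial UNIV i (partial UNIV j f) (x + s' *\<^sub>R axis j 1 + t' *\<^sub>R axis i 1)" using h by simp
    show ?thesis
      using d1(2)[of "x + s' *\<^sub>R axis j 1 + t' *\<^sub>R axis i 1"] near[OF st'(1-4), of j i]
        d2(2)[of "x + s *\<^sub>R axis i 1 + t *\<^sub>R axis j 1"] near[OF st(1-4), of i j] eq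
      unfolding dist_real_def by linarith
  qed
  then show ?thesis using field_le_epsilon[of "\<bar>_ - _\<bar>" 0] by (metis abs_le_zero_iff eq_iff_diff_eq_0 add_0)
qed

section \<open>The Levi-Civita connection in coordinates\<close>

lemma has_derivative_vecI:
  assumes "\<And>a. ((\<lambda>x. f x $ a) has_derivative (\<lambda>h. f' h $ a)) (at x within S)"
  shows "((f :: _ \<Rightarrow> real^'m) has_derivative f') (at x within S)"
  using assms by (auto simp: has_derivative_componentwise_within[of f] Basis_vec_def inner_axis)

lemma has_derivative_nth:
  "(f has_derivative f') F \<Longrightarrow> ((\<lambda>x. f x $ a) has_derivative (\<lambda>h. f' h $ a)) F"
  using bounded_linear.has_derivative[OF bounded_linear_vec_nth] by blast

lemma has_derivative_matvec:
  fixes A :: "_ \<Rightarrow> real^'n^'m"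
  assumes "(A has_derivative A') (at x within S)" "(b has_derivative b') (at x within S)"
  shows "((\<lambda>y. A y *v b y) has_derivative (\<lambda>v. A' v *v b x + A x *v b' v)) (at x within S)"
proof (rule has_derivative_vecI)
  fix a
  have "((\<lambda>y. A y $ a $ i * b y $ i) has_derivative (\<lambda>v. A x $ a $ i * b' v $ i + A' v $ a $ i * b x $ i)) (at x within S)" for i
    using has_derivative_mult[OF has_derivative_nth[OF has_derivative_nth[OF assms(1)]] has_derivative_nth[OF assms(2)]] .
  from has_derivative_sum[of UNIV, OF this]
  show "((\<lambda>y. (A y *v b y) $ a) has_derivative (\<lambda>v. (A' v *v b x + A x *v b' v) $ a)) (at x within S)"
    by (simp add: matrix_vector_mult_def sum.distrib add.commute)
qed

lemma has_derivative_matI: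
  assumes "\<And>i j. ((\<lambda>x. A x $ i $ j) has_derivative (\<lambda>h. A' h $ i $ j)) (at x within S)"
  shows "((A :: _ \<Rightarrow> real^'n^'m) has_derivative A') (at x within S)"
proof -
  have "(A has_derivative A') (at x within S) \<longleftrightarrow>
     (\<forall>i. ((\<lambda>x. A x $ i) has_derivative (\<lambda>h. A' h $ i)) (at x within S))"
  proof
    assume "\<forall>i. ((\<lambda>x. A x $ i) has_derivative (\<lambda>h. A' h $ i)) (at x within S)"
    then have 1: "((\<lambda>x. A x \<bullet> b) has_derivative (\<lambda>h. A' h \<bullet> b)) (at x within S)" if "b \<in> Basis" for b
    proof -
      obtain i c where b: "b = axis i c" using \<open>b \<in> Basis\<close> by (auto simp: Basis_vec_def)
      show ?thesis
        using has_derivative_inner_left[OF \<open>\<forall>i. _\<close>[rule_format, of i], of c]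
        by (simp add: b inner_axis)
    qed
    then show "(A has_derivative A') (at x within S)" by (subst has_derivative_componentwise_within) blast
  qed (auto intro: has_derivative_nth)
  then show ?thesis using has_derivative_vecI[OF assms] by simp
qed

definition mat_deriv :: "(real^'n \<Rightarrow> real^'k^'m) \<Rightarrow> real^'n \<Rightarrow> real^'n \<Rightarrow> real^'k^'m" where
  "mat_deriv A x z = (\<chi> i j. \<Sum>l\<in>UNIV. z $ l * partial UNIV l (\<lambda>y. A y $ i $ j) x)"

lemma has_derivative_mat_deriv:
  assumes "\<And>i j. (\<lambda>y. A y $ i $ j) differentiable at x"
  shows "(A has_derivative mat_deriv A x) (at x)"
  by (rule has_derivative_matI) (use has_derivative_partial_at[OF assms] in \<open>simp add: mat_deriv_def\<close>)

lemma inner_transpose_left: "(transpose A *v x) \<bullet> y = x \<bullet> (A *v (y::real^'n))"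
  by (simp add: dot_lmul_matrix)

lemma vec_eq_if_inner: "(\<And>z::real^'n. a \<bullet> z = b \<bullet> z) \<Longrightarrow> a = b"
  using vector_eq_rdot[of a b] by blast

lemma matrix_inv_left: "invertible A \<Longrightarrow> matrix_inv A ** A = mat 1"
  and matrix_inv_right: "invertible A \<Longrightarrow> A ** matrix_inv A = mat 1"
  unfolding matrix_inv_def invertible_def by (metis (mono_tags, lifting) someI_ex)+

lemma matrix_inv_unique_left: "(B::real^'n^'n) ** A = mat 1 \<Longrightarrow> matrix_inv A = B"
  by (metis invertible_left_inverse matrix_inv_right matrix_mul_assoc matrix_mul_lid matrix_mul_rid)

lemma posdef_invertible:
  assumes "\<And>v. v \<noteq> 0 \<Longrightarrow> v \<bullet> (A *v v) > (0::real)" shows "invertible (A::real^'n^'n)"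
proof -
  have "\<forall>v. A *v v = 0 \<longrightarrow> v = 0" using assms by (metis inner_zero_right less_irrefl)
  then show ?thesis using matrix_left_invertible_ker invertible_left_inverse by blast
qed

lemma Ck_on_det:
  assumes "open S" "\<And>i j. Ck_on k S (\<lambda>x. A x $ i $ j)"
  shows "Ck_on k S (\<lambda>x. det (A x :: real^'m^'m))"
  unfolding det_def by (intro Ck_on_sum Ck_on_mult Ck_on_prod assms Ck_on_const)

lemma continuous_on_det [continuous_intros]:
  assumes "\<And>i j. continuous_on S (\<lambda>x. A x $ i $ j)"
  shows "continuous_on S (\<lambda>x. det (A x :: real^'m^'m))"
  unfolding det_def by (intro continuous_intros assms)

text \<open>All matrices on the segment from the identity to \<open>A\<close> are positive definite,
  hence invertible, so by the intermediate value theorem the determinant cannot leave the sign it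
  has at the identity.\<close>

lemma posdef_det_pos:
  assumes "\<And>v. v \<noteq> 0 \<Longrightarrow> v \<bullet> (A *v v) > (0::real)" shows "det (A::real^'n^'n) > 0"
proof (rule ccontr)
  assume neg: "\<not> det A > 0"
  let ?B = "\<lambda>t::real. (1 - t) *\<^sub>R mat 1 + t *\<^sub>R A"
  have c: "continuous_on {0..1} (\<lambda>t. det (?B t))"
    by (intro continuous_intros)
  have "\<exists>t\<ge>0. t \<le> 1 \<and> det (?B t) = 0"
    by (rule IVT2'[of "\<lambda>t. det (?B t)" 1 0 0]) (use neg c in auto)
  then obtain t where t: "0 \<le> t" "t \<le> 1" "det (?B t) = 0" by blast
  have "v \<bullet> (?B t *v v) > 0" if "v \<noteq> 0" for v
  proof -
    have "v \<bullet> (?B t *v v) = (1 - t) * (v \<bullet> v) + t * (v \<bullet> (A *v v))"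
      by (simp add: matrix_vector_mult_add_rdistrib scaleR_matrix_vector_assoc[symmetric] inner_add_right)
    moreover have "v \<bullet> v > 0" "v \<bullet> (A *v v) > 0" using assms that by auto
    ultimately show ?thesis using t(1,2)
      by (cases "t = 0") (auto intro!: add_nonneg_pos mult_pos_pos)
  qed
  then show False using posdef_invertible[of "?B t"] t(3) by (simp add: invertible_det_nz)
qed

text \<open>Cramer's rule shows the entries of the inverse as quotients of polynomials in the
  entries of \<open>A\<close>; in this form smoothness of the metric passes to the inverse
  metric.\<close>

lemma matrix_inv_cramer:
  assumes "invertible (A::real^'n^'n)"
  shows "matrix_inv A $ k $ j = det (\<chi> i l. if l = k then axis j 1 $ i else A $ i $ l) / det A"
proof -
  have "A *v (matrix_inv A *v axis j 1) = axis j 1"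
    by (simp add: matrix_vector_mul_assoc matrix_inv_right[OF assms])
  then have "matrix_inv A *v axis j 1 = (\<chi> k. det (\<chi> i l. if l = k then axis j 1 $ i else A $ i $ l) / det A)"
    using cramer[of A "matrix_inv A *v axis j 1" "axis j 1"] assms by (simp add: invertible_det_nz)
  then have "(matrix_inv A *v axis j 1) $ k = det (\<chi> i l. if l = k then axis j 1 $ i else A $ i $ l) / det A"
    by simp
  then show ?thesis by (simp add: matrix_vector_mult_basis column_def)
qed

text \<open>Jacobi's formula. The product rule gives a sum of determinants in which row
  \<open>k\<close> is replaced by row \<open>k\<close> of \<open>A' v\<close>. Writing
  \<open>A' v\<close> as \<open>?C ** A x\<close>, that row is a combination of the rows of
  \<open>A x\<close>, and only the coefficient \<open>?C $ k $ k\<close> survives.\<close>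

lemma has_derivative_det:
  fixes A :: "_ \<Rightarrow> real^'n^'n"
  assumes A: "(A has_derivative A') (at x within S)" and inv: "invertible (A x)"
  shows "((\<lambda>y. det (A y)) has_derivative (\<lambda>v. det (A x) * trace (A' v ** matrix_inv (A x)))) (at x within S)"
proof -
  have 1: "((\<lambda>y. det (A y)) has_derivative (\<lambda>v. \<Sum>p | p permutes (UNIV::'n set). of_int (sign p) *
      (\<Sum>k\<in>UNIV. A' v $ k $ p k * (\<Prod>j\<in>UNIV - {k}. A x $ j $ p j)))) (at x within S)"
    unfolding det_def
    by (intro has_derivative_sum has_derivative_mult_right has_derivative_prod has_derivative_nth[OF has_derivative_nth[OF A]])
  have "(\<Sum>p | p permutes (UNIV::'n set). of_int (sign p) *
      (\<Sum>k\<in>UNIV. A' v $ k $ p k * (\<Prod>j\<in>UNIV - {k}. A x $ j $ p j))) = det (A x) * trace (A' v ** matrix_inv (A x))" for v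
  proof -
    let ?C = "A' v ** matrix_inv (A x)"
    have C: "?C ** A x = A' v" by (simp add: matrix_mul_assoc[symmetric] matrix_inv_left[OF inv])
    have rowA: "row i (A x) = A x $ i" for i by (simp add: row_def)
    have row: "(\<Sum>i\<in>UNIV. (?C $ k) $ i *s row i (A x)) = A' v $ k" for k
    proof -
      have "(\<Sum>i\<in>UNIV. (?C $ k) $ i *s row i (A x)) = (?C ** A x) $ k"
        by (simp add: vec_eq_iff matrix_matrix_mult_def row_def)
      then show ?thesis using C by simp
    qed
    have d: "det (\<chi> i. if i = k then A' v $ k else A x $ i) = ?C $ k $ k * det (A x)" for k
      using cramer_lemma_transpose[of k "?C $ k" "A x"] unfolding row unfolding rowA by simp
    have prod: "(\<Prod>i\<in>UNIV. (\<chi> i. if i = k then A' v $ k else A x $ i) $ i $ p i)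
        = A' v $ k $ p k * (\<Prod>j\<in>UNIV - {k}. A x $ j $ p j)" for k :: 'n and p
      by (subst prod.remove[of UNIV k]) (auto intro!: prod.cong)
    have "(\<Sum>p | p permutes (UNIV::'n set). of_int (sign p) *
      (\<Sum>k\<in>UNIV. A' v $ k $ p k * (\<Prod>j\<in>UNIV - {k}. A x $ j $ p j)))
      = (\<Sum>k\<in>UNIV. det (\<chi> i. if i = k then A' v $ k else A x $ i))"
      unfolding det_def prod sum_distrib_left by (rule sum.swap)
    also have "\<dots> = det (A x) * trace ?C" unfolding d trace_def by (simp add: sum_distrib_left mult.commute)
    finally show ?thesis .
  qed
  then show ?thesis using 1 by simp
qed


text \<open>\<open>Gam\<close> is the bilinear map with components the Christoffel symbols, and the columns of
  \<open>nab G X x\<close> are the covariant derivatives of the vector field \<open>X\<close> in the coordinate directions.\<close>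

definition Gam :: "(real^'n \<Rightarrow> real^'n^'n) \<Rightarrow> real^'n \<Rightarrow> real^'n \<Rightarrow> real^'n \<Rightarrow> real^'n" where
  "Gam G x v w = (\<chi> k. \<Sum>i\<in>UNIV. \<Sum>j\<in>UNIV. christoffel G k i j x * v $ i * w $ j)"

definition nab :: "(real^'n \<Rightarrow> real^'n^'n) \<Rightarrow> (real^'n \<Rightarrow> real^'n) \<Rightarrow> real^'n \<Rightarrow> real^'n^'n" where
  "nab G X x = (\<chi> k j. partial UNIV j (\<lambda>y. X y $ k) x + (\<Sum>m\<in>UNIV. christoffel G k j m x * X x $ m))"

text \<open>The bridge to chain rule arguments, which produce Frechet derivatives rather than
  partial derivatives.\<close>

lemma nab_mult:
  assumes "X differentiable at x"
  shows "nab G X x *v v = frechet_derivative X (at x) v + Gam G x v (X x)"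
proof -
  have "frechet_derivative X (at x) = (\<lambda>h. \<Sum>i\<in>UNIV. h $ i *\<^sub>R partial UNIV i X x)"
    using frechet_derivative_at[OF has_derivative_partial_at[OF assms]] by simp
  then show ?thesis
    by (simp add: vec_eq_iff nab_def Gam_def matrix_vector_mult_def partial_component[OF assms]
        algebra_simps sum.distrib sum_distrib_left)
qed

section \<open>The metric and its Christoffel symbols in a single chart\<close>

locale coord_metric =
  fixes G :: "real^'n \<Rightarrow> real^'n^'n" and S :: "(real^'n) set"
  assumes open_S: "open S" and smooth: "Cinf_on S G"
    and sym: "\<And>x. x \<in> S \<Longrightarrow> transpose (G x) = G x"
    and pos: "\<And>x v. x \<in> S \<Longrightarrow> v \<noteq> 0 \<Longrightarrow> v \<bullet> (G x *v v) > 0"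
begin

lemma inv: "x \<in> S \<Longrightarrow> invertible (G x)"
  using pos posdef_invertible by blast

lemma det_pos: "x \<in> S \<Longrightarrow> det (G x) > 0"
  using pos posdef_det_pos by blast

lemma symD: "x \<in> S \<Longrightarrow> G x $ i $ j = G x $ j $ i"
  using arg_cong[OF sym[of x], of "\<lambda>A. A $ i $ j"] by (simp add: transpose_def)

lemma inner_sym: "x \<in> S \<Longrightarrow> (G x *v v) \<bullet> w = v \<bullet> (G x *v w)"
  using inner_transpose_left[of "G x" v w] sym by metis

lemma inner_commute': "x \<in> S \<Longrightarrow> v \<bullet> (G x *v w) = w \<bullet> (G x *v v)"
  by (metis inner_sym inner_commute)

lemma inv_sym: "x \<in> S \<Longrightarrow> transpose (matrix_inv (G x)) = matrix_inv (G x)"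
  by (rule matrix_inv_unique_left[symmetric])
     (metis inv matrix_inv_right matrix_transpose_mul sym transpose_mat)

lemma metric_inv_sym: "x \<in> S \<Longrightarrow> metric_inv G x i j = metric_inv G x j i"
  unfolding metric_inv_def using arg_cong[OF inv_sym[of x], of "\<lambda>A. A $ i $ j"] by (simp add: transpose_def)

lemma Ck_G: "Ck_on k S (\<lambda>x. G x $ i $ j)"
  using smooth unfolding Cinf_on_def by (intro Ck_on_component open_S) auto

lemma Ck_det: "Ck_on k S (\<lambda>x. det (G x))"
  by (intro Ck_on_det open_S Ck_G)

lemma Ck_metric_inv: "Ck_on k S (\<lambda>x. metric_inv G x i j)"
proof -
  have e: "Ck_on k S (\<lambda>x. (\<chi> i' l. if l = i then axis j 1 $ i' else G x $ i' $ l) $ a $ b)" for a b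
    using open_S Ck_G by (cases "b = i") simp_all
  have "Ck_on k S (\<lambda>x. det (\<chi> i' l. if l = i then axis j 1 $ i' else G x $ i' $ l) / det (G x))"
    using det_pos by (intro Ck_on_divide Ck_on_det Ck_det open_S e) fastforce
  moreover have "Ck_on k S (\<lambda>x. metric_inv G x i j) \<longleftrightarrow>
     Ck_on k S (\<lambda>x. det (\<chi> i' l. if l = i then axis j 1 $ i' else G x $ i' $ l) / det (G x))"
    by (rule Ck_on_cong[OF open_S]) (simp add: metric_inv_def matrix_inv_cramer inv)
  ultimately show ?thesis by simp
qed

lemma Ck_partial_G: "Ck_on k S (partial UNIV l (\<lambda>x. G x $ i $ j))"
  using Ck_on_SucD2[OF open_S Ck_G] .

lemma Ck_christoffel: "Ck_on k S (christoffel G l i j)"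
proof -
  have "christoffel G l i j = (\<lambda>x. (1/2) * (\<Sum>m\<in>UNIV. metric_inv G x l m *
     (partial UNIV i (\<lambda>y. G y $ j $ m) x + partial UNIV j (\<lambda>y. G y $ i $ m) x
      - partial UNIV m (\<lambda>y. G y $ i $ j) x)))"
    by (rule ext) (simp add: christoffel_def)
  then show ?thesis
    by (simp only:) (intro Ck_on_mult Ck_on_sum Ck_on_diff Ck_on_add open_S Ck_partial_G Ck_metric_inv Ck_on_const)
qed

lemma diff_G: "x \<in> S \<Longrightarrow> (\<lambda>y. G y $ i $ j) differentiable at x"
  using Ck_on_SucD1[OF open_S Ck_G] .

lemma deriv_G: "x \<in> S \<Longrightarrow> (G has_derivative mat_deriv G x) (at x)"
  by (intro has_derivative_mat_deriv diff_G)

lemma partial_G_sym: "x \<in> S \<Longrightarrow> partial UNIV l (\<lambda>y. G y $ i $ j) x = partial UNIV l (\<lambda>y. G y $ j $ i) x"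
  by (rule partial_cong_open[OF open_S]) (simp_all add: symD)

lemma christoffel_sym: "x \<in> S \<Longrightarrow> christoffel G k i j x = christoffel G k j i x"
  unfolding christoffel_def using partial_G_sym[of x _ i j] by (simp add: add.commute)

lemma mat_deriv_sym: "x \<in> S \<Longrightarrow> transpose (mat_deriv G x z) = mat_deriv G x z"
  unfolding mat_deriv_def transpose_def using partial_G_sym by (simp add: vec_eq_iff)

text \<open>Lowering the upper index cancels the inverse metric in the definition of the Christoffel
  symbols.\<close>

lemma koszul_index:
  assumes "x \<in> S"
  shows "(\<Sum>k\<in>UNIV. G x $ l $ k * christoffel G k i j x) =
    (partial UNIV i (\<lambda>y. G y $ j $ l) x + partial UNIV j (\<lambda>y. G y $ i $ l) x
      - partial UNIV l (\<lambda>y. G y $ i $ j) x) / 2"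
proof -
  define F :: "real^'n" where "F = (\<chi> m. (partial UNIV i (\<lambda>y. G y $ j $ m) x + partial UNIV j (\<lambda>y. G y $ i $ m) x
      - partial UNIV m (\<lambda>y. G y $ i $ j) x) / 2)"
  have "(\<chi> k. christoffel G k i j x) = matrix_inv (G x) *v F"
    by (simp add: vec_eq_iff matrix_vector_mult_def christoffel_def metric_inv_def F_def sum_divide_distrib)
  then have "G x *v (\<chi> k. christoffel G k i j x) = F"
    by (simp add: matrix_vector_mul_assoc matrix_inv_right[OF inv[OF assms]])
  then have "(G x *v (\<chi> k. christoffel G k i j x)) $ l = F $ l" by simp
  then show ?thesis by (simp add: matrix_vector_mult_def F_def)
qed

text \<open>The Koszul formula for fields with constant coefficients. Without indices it reduces
  metric compatibility and the change of coordinates to matrix algebra.\<close>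

lemma koszul:
  assumes "x \<in> S"
  shows "z \<bullet> (G x *v Gam G x v w) = (w \<bullet> (mat_deriv G x v *v z) + v \<bullet> (mat_deriv G x w *v z) - v \<bullet> (mat_deriv G x z *v w)) / 2"
proof -
  let ?p = "\<lambda>a b c. partial UNIV a (\<lambda>y. G y $ b $ c) x"
  have "(G x *v Gam G x v w) $ l = (\<Sum>i\<in>UNIV. \<Sum>j\<in>UNIV. (?p i j l + ?p j i l - ?p l i j) / 2 * (v $ i * w $ j))" for l
  proof -
    have "(G x *v Gam G x v w) $ l = (\<Sum>k\<in>UNIV. \<Sum>i\<in>UNIV. \<Sum>j\<in>UNIV. G x $ l $ k * christoffel G k i j x * (v $ i * w $ j))"
      by (simp add: matrix_vector_mult_def Gam_def sum_distrib_left mult.assoc)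
    also have "\<dots> = (\<Sum>i\<in>UNIV. \<Sum>j\<in>UNIV. \<Sum>k\<in>UNIV. G x $ l $ k * christoffel G k i j x * (v $ i * w $ j))"
      by (subst sum.swap, rule sum.cong[OF refl], rule sum.swap)
    also have "\<dots> = (\<Sum>i\<in>UNIV. \<Sum>j\<in>UNIV. (?p i j l + ?p j i l - ?p l i j) / 2 * (v $ i * w $ j))"
      by (simp only: sum_distrib_right[symmetric] koszul_index[OF assms])
    finally show ?thesis .
  qed
  then have "z \<bullet> (G x *v Gam G x v w) = (\<Sum>l\<in>UNIV. \<Sum>i\<in>UNIV. \<Sum>j\<in>UNIV. (?p i j l + ?p j i l - ?p l i j) / 2 * (v $ i * w $ j) * z $ l)"
    by (simp add: inner_vec_def sum_distrib_left mult.commute)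
  also have "\<dots> = ((\<Sum>l\<in>UNIV. \<Sum>i\<in>UNIV. \<Sum>j\<in>UNIV. ?p i j l * v $ i * w $ j * z $ l)
     + (\<Sum>l\<in>UNIV. \<Sum>i\<in>UNIV. \<Sum>j\<in>UNIV. ?p j i l * v $ i * w $ j * z $ l)
     - (\<Sum>l\<in>UNIV. \<Sum>i\<in>UNIV. \<Sum>j\<in>UNIV. ?p l i j * v $ i * w $ j * z $ l)) / 2"
    by (simp add: sum.distrib[symmetric] sum_subtractf[symmetric] sum_divide_distrib field_simps)
  also have "(\<Sum>l\<in>UNIV. \<Sum>i\<in>UNIV. \<Sum>j\<in>UNIV. ?p i j l * v $ i * w $ j * z $ l) = w \<bullet> (mat_deriv G x v *v z)"
  proof -
    have "w \<bullet> (mat_deriv G x v *v z) = (\<Sum>j\<in>UNIV. \<Sum>l\<in>UNIV. \<Sum>i\<in>UNIV. ?p i j l * v $ i * w $ j * z $ l)"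
      by (simp add: inner_vec_def matrix_vector_mult_def mat_deriv_def sum_distrib_left sum_distrib_right mult_ac)
    also have "\<dots> = (\<Sum>l\<in>UNIV. \<Sum>j\<in>UNIV. \<Sum>i\<in>UNIV. ?p i j l * v $ i * w $ j * z $ l)"
      by (rule sum.swap)
    also have "\<dots> = (\<Sum>l\<in>UNIV. \<Sum>i\<in>UNIV. \<Sum>j\<in>UNIV. ?p i j l * v $ i * w $ j * z $ l)"
      by (rule sum.cong[OF refl], rule sum.swap)
    finally show ?thesis by simp
  qed
  also have "(\<Sum>l\<in>UNIV. \<Sum>i\<in>UNIV. \<Sum>j\<in>UNIV. ?p j i l * v $ i * w $ j * z $ l) = v \<bullet> (mat_deriv G x w *v z)"
  proof -
    have "v \<bullet> (mat_deriv G x w *v z) = (\<Sum>i\<in>UNIV. \<Sum>l\<in>UNIV. \<Sum>j\<in>UNIV. ?p j i l * v $ i * w $ j * z $ l)"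
      by (simp add: inner_vec_def matrix_vector_mult_def mat_deriv_def sum_distrib_left sum_distrib_right mult_ac)
    also have "\<dots> = (\<Sum>l\<in>UNIV. \<Sum>i\<in>UNIV. \<Sum>j\<in>UNIV. ?p j i l * v $ i * w $ j * z $ l)"
      by (rule sum.swap)
    finally show ?thesis by simp
  qed
  also have "(\<Sum>l\<in>UNIV. \<Sum>i\<in>UNIV. \<Sum>j\<in>UNIV. ?p l i j * v $ i * w $ j * z $ l) = v \<bullet> (mat_deriv G x z *v w)"
  proof -
    have "v \<bullet> (mat_deriv G x z *v w) = (\<Sum>i\<in>UNIV. \<Sum>j\<in>UNIV. \<Sum>l\<in>UNIV. ?p l i j * v $ i * w $ j * z $ l)"
      by (simp add: inner_vec_def matrix_vector_mult_def mat_deriv_def sum_distrib_left sum_distrib_right mult_ac)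
    also have "\<dots> = (\<Sum>i\<in>UNIV. \<Sum>l\<in>UNIV. \<Sum>j\<in>UNIV. ?p l i j * v $ i * w $ j * z $ l)"
      by (rule sum.cong[OF refl], rule sum.swap)
    also have "\<dots> = (\<Sum>l\<in>UNIV. \<Sum>i\<in>UNIV. \<Sum>j\<in>UNIV. ?p l i j * v $ i * w $ j * z $ l)"
      by (rule sum.swap)
    finally show ?thesis by simp
  qed
  finally show ?thesis .
qed

text \<open>After contraction two of the three derivatives of the metric cancel by symmetry. By
  Jacobi's formula the remaining one is the logarithmic derivative of the volume density.\<close>

lemma contracted_christoffel:
  assumes "x \<in> S"
  shows "(\<Sum>m\<in>UNIV. christoffel G m m k x) = trace (mat_deriv G x (axis k 1) ** matrix_inv (G x)) / 2"
proof -
  let ?g = "\<lambda>a b. metric_inv G x a b" and ?p = "\<lambda>a b c. partial UNIV a (\<lambda>y. G y $ b $ c) x"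
  have "(\<Sum>m\<in>UNIV. \<Sum>l\<in>UNIV. ?g m l * ?p m k l) = (\<Sum>m\<in>UNIV. \<Sum>l\<in>UNIV. ?g m l * ?p l m k)"
    by (subst sum.swap) (use metric_inv_sym[OF assms] partial_G_sym[OF assms] in simp)
  then have "(\<Sum>m\<in>UNIV. christoffel G m m k x) = (\<Sum>m\<in>UNIV. \<Sum>l\<in>UNIV. ?g m l * ?p k m l) / 2"
    by (simp add: christoffel_def sum_divide_distrib[symmetric] algebra_simps sum.distrib sum_subtractf)
  also have "(\<Sum>m\<in>UNIV. \<Sum>l\<in>UNIV. ?g m l * ?p k m l) = trace (mat_deriv G x (axis k 1) ** matrix_inv (G x))"
    by (simp add: trace_def matrix_matrix_mult_def mat_deriv_def metric_inv_def[symmetric] metric_inv_sym[OF assms, of _ _] mult.commute)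
  finally show ?thesis .
qed

lemma Ck_sqrt_det: "Ck_on 1 S (\<lambda>x. sqrt (det (G x)))"
  by (rule Ck_on_sqrt_1[OF open_S Ck_det det_pos])

lemma partial_sqrt_det:
  assumes "x \<in> S"
  shows "partial UNIV k (\<lambda>x. sqrt (det (G x))) x = sqrt (det (G x)) * (\<Sum>m\<in>UNIV. christoffel G m m k x)"
proof -
  have d: "((\<lambda>y. det (G y)) has_derivative (\<lambda>v. det (G x) * trace (mat_deriv G x v ** matrix_inv (G x)))) (at x)"
    by (rule has_derivative_det[OF deriv_G inv]) (use assms in auto)
  have "partial UNIV k (\<lambda>x. sqrt (det (G x))) x = inverse (sqrt (det (G x))) / 2 * partial UNIV k (\<lambda>x. det (G x)) x"
    using DERIV_real_sqrt[OF det_pos[OF assms]] d by (intro partial_real_compose) (auto simp: differentiable_def)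
  also have "partial UNIV k (\<lambda>x. det (G x)) x = det (G x) * (2 * (\<Sum>m\<in>UNIV. christoffel G m m k x))"
    using partial_eqI[OF d, of k] contracted_christoffel[OF assms, of k] by simp
  also have "inverse (sqrt (det (G x))) / 2 * (det (G x) * (2 * (\<Sum>m\<in>UNIV. christoffel G m m k x)))
     = (inverse (sqrt (det (G x))) * det (G x)) * (\<Sum>m\<in>UNIV. christoffel G m m k x)" by simp
  also have "inverse (sqrt (det (G x))) * det (G x) = sqrt (det (G x))"
    using det_pos[OF assms] by (metis divide_inverse mult.commute real_div_sqrt less_imp_le)
  finally show ?thesis .
qed

text \<open>Weighting by the volume density turns the covariant divergence into a Euclidean one, so
  the divergence theorem has to be proved for Lebesgue measure only.\<close>

lemma weighted_divergence:
  assumes x: "x \<in> S" and Y: "\<And>k. (\<lambda>y. Y y $ k) differentiable at x"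
  shows "(\<Sum>k\<in>UNIV. partial UNIV k (\<lambda>y. sqrt (det (G y)) * Y y $ k) x) = sqrt (det (G x)) * trace (nab G Y x)"
proof -
  have s: "(\<lambda>y. sqrt (det (G y))) differentiable at x"
    using Ck_on_SucD1[OF open_S _ x, of 0] Ck_sqrt_det by simp
  have "(\<Sum>k\<in>UNIV. partial UNIV k (\<lambda>y. sqrt (det (G y)) * Y y $ k) x)
    = sqrt (det (G x)) * ((\<Sum>k\<in>UNIV. partial UNIV k (\<lambda>y. Y y $ k) x) + (\<Sum>k\<in>UNIV. \<Sum>m\<in>UNIV. christoffel G m m k x * Y x $ k))"
    unfolding partial_mult[OF s Y] partial_sqrt_det[OF x] by (simp add: sum.distrib algebra_simps sum_distrib_left)
  also have "(\<Sum>k\<in>UNIV. \<Sum>m\<in>UNIV. christoffel G m m k x * Y x $ k) = (\<Sum>k\<in>UNIV. \<Sum>m\<in>UNIV. christoffel G k k m x * Y x $ m)"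
    by (rule sum.swap)
  finally show ?thesis by (simp add: trace_def nab_def sum.distrib)
qed

end

section \<open>The Bochner formula and changes of coordinates\<close>

text \<open>The source of chart independence: Laplacian, squared Hessian, divergence and mean
  curvature are all traces of endomorphisms that the Jacobian intertwines.\<close>

lemma trace_similar:
  assumes "(A::real^'n^'n) ** J = J ** B" "invertible J" shows "trace A = trace B"
proof -
  have "A = (A ** J) ** matrix_inv J"
    by (simp add: matrix_mul_assoc[symmetric] matrix_inv_right[OF assms(2)])
  also have "\<dots> = J ** (B ** matrix_inv J)"
    by (simp only: assms(1) matrix_mul_assoc)
  finally have "trace A = trace ((B ** matrix_inv J) ** J)" by (metis trace_mul_sym)
  then show ?thesis by (simp add: matrix_mul_assoc[symmetric] matrix_inv_left[OF assms(2)])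
qed

lemma matvec_cancel:
  assumes "invertible (A::real^'n^'n)" "A *v x = A *v y" shows "x = y"
proof -
  have "matrix_inv A *v (A *v z) = z" for z
    by (simp add: matrix_vector_mul_assoc matrix_inv_left[OF assms(1)])
  then show ?thesis using assms(2) by metis
qed

lemma matrix_mult_scaleR:
  "A ** (c *\<^sub>R B) = c *\<^sub>R (A ** B)" "(c *\<^sub>R A) ** B = c *\<^sub>R (A ** B)" for A B :: "real^'n^'n"
  by (simp_all add: vec_eq_iff matrix_matrix_mult_def sum_distrib_left mult_ac)

lemma intertwine_mult:
  assumes "(A::real^'n^'n) ** J = J ** B" "A' ** J = J ** B'"
  shows "(A ** A') ** J = J ** (B ** B')"
  by (metis assms matrix_mul_assoc)

context coord_metric begin

text \<open>Differentiating the inverse metric produces Christoffel terms, which metric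
  compatibility combines into a covariant derivative. The derivative is taken within
  \<open>S0\<close> because the flux computation needs it at boundary points, with \<open>S0\<close>
  the image of the closure. The transpose is kept since symmetry of the Hessian is proved on open
  sets.\<close>

lemma gradient_has_derivative:
  assumes S0: "S0 \<subseteq> S" and u: "Ck_on 2 S0 u" and x: "x \<in> S0"
  shows "(gradient G S0 u has_derivative
     (\<lambda>v. (matrix_inv (G x) ** transpose (hessian G S0 u x)) *v v - Gam G x v (gradient G S0 u x))) (at x within S0)"
proof -
  have xS: "x \<in> S" using S0 x by blast
  define p where "p y = (\<chi> i. partial S0 i u y)" for y
  define p' where "p' v = (\<chi> j. \<Sum>i\<in>UNIV. v $ i * partial S0 i (partial S0 j u) x)" for v
  have u2: "Ck_on (Suc (Suc 0)) S0 u" using u by (simp add: numeral_2_eq_2)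
  have dp: "(p has_derivative p') (at x within S0)"
  proof (rule has_derivative_vecI)
    fix j
    have "partial S0 j u differentiable at x within S0"
      using u2 x by (simp add: differentiable_on_def)
    from has_derivative_partial[OF this]
    show "((\<lambda>y. p y $ j) has_derivative (\<lambda>v. p' v $ j)) (at x within S0)"
      by (simp add: p_def p'_def)
  qed
  let ?I = "\<lambda>y. matrix_inv (G y)"
  have dI: "(?I has_derivative mat_deriv ?I x) (at x)"
    using Ck_on_SucD1[OF open_S Ck_metric_inv xS]
    by (intro has_derivative_mat_deriv) (simp add: metric_inv_def)
  \<comment> \<open>Obtained by differentiating the constant vector
    \<open>G y *v (?I y *v q) = q\<close>.\<close>
  have inv_der: "G x *v (mat_deriv ?I x v *v q) = - (mat_deriv G x v *v (?I x *v q))" for v q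
  proof -
    have 1: "((\<lambda>y. G y *v (?I y *v q)) has_derivative
       (\<lambda>v. mat_deriv G x v *v (?I x *v q) + G x *v (mat_deriv ?I x v *v q + ?I x *v 0))) (at x)"
      by (intro has_derivative_matvec deriv_G[OF xS] dI has_derivative_const)
    have 2: "((\<lambda>y. G y *v (?I y *v q)) has_derivative (\<lambda>v. 0)) (at x)"
      by (rule has_derivative_transform_within_open[OF _ open_S xS, of "\<lambda>_. q"])
         (auto simp: matrix_vector_mul_assoc matrix_inv_right inv)
    have "mat_deriv G x v *v (?I x *v q) + G x *v (mat_deriv ?I x v *v q) = 0"
      using fun_cong[OF has_derivative_unique[OF 1 2], of v] by simp
    then show ?thesis by (simp add: eq_neg_iff_add_eq_0 add.commute)
  qed
  have grad: "gradient G S0 u = (\<lambda>y. ?I y *v p y)" by (rule ext) (simp add: gradient_def p_def)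
  let ?X = "gradient G S0 u x"
  have "(gradient G S0 u has_derivative (\<lambda>v. mat_deriv ?I x v *v p x + ?I x *v p' v)) (at x within S0)"
    unfolding grad using has_derivative_matvec[OF has_derivative_at_withinI[OF dI] dp] .
  moreover have "mat_deriv ?I x v *v p x + ?I x *v p' v
     = (?I x ** transpose (hessian G S0 u x)) *v v - Gam G x v ?X" for v
  proof -
    have pX: "p x = G x *v ?X"
      by (simp add: grad matrix_vector_mul_assoc matrix_inv_right[OF inv[OF xS]])
    have hess: "(transpose (hessian G S0 u x) *v v) \<bullet> z
       = p' v \<bullet> z - (\<Sum>j\<in>UNIV. \<Sum>i\<in>UNIV. \<Sum>k\<in>UNIV. christoffel G k i j x * p x $ k * v $ i * z $ j)" for z
      by (simp add: inner_vec_def matrix_vector_mult_def transpose_def hessian_def p'_def p_def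
          sum_distrib_left sum_distrib_right algebra_simps sum_subtractf)
    have gam: "(\<Sum>j\<in>UNIV. \<Sum>i\<in>UNIV. \<Sum>k\<in>UNIV. christoffel G k i j x * p x $ k * v $ i * z $ j)
       = ?X \<bullet> (G x *v Gam G x v z)" for z
    proof -
      have "?X \<bullet> (G x *v Gam G x v z) = Gam G x v z \<bullet> p x"
        using inner_commute'[OF xS] pX by metis
      also have "\<dots> = (\<Sum>k\<in>UNIV. \<Sum>i\<in>UNIV. \<Sum>j\<in>UNIV. christoffel G k i j x * p x $ k * v $ i * z $ j)"
        by (simp add: inner_vec_def Gam_def sum_distrib_left sum_distrib_right mult_ac)
      also have "\<dots> = (\<Sum>i\<in>UNIV. \<Sum>j\<in>UNIV. \<Sum>k\<in>UNIV. christoffel G k i j x * p x $ k * v $ i * z $ j)"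
        by (subst sum.swap, rule sum.cong[OF refl], rule sum.swap)
      also have "\<dots> = (\<Sum>j\<in>UNIV. \<Sum>i\<in>UNIV. \<Sum>k\<in>UNIV. christoffel G k i j x * p x $ k * v $ i * z $ j)"
        by (rule sum.swap)
      finally show ?thesis by simp
    qed
    have "G x *v (mat_deriv ?I x v *v p x + ?I x *v p' v)
      = G x *v ((?I x ** transpose (hessian G S0 u x)) *v v - Gam G x v ?X)"
    proof (rule vec_eq_if_inner)
      fix z
      have "(G x *v (mat_deriv ?I x v *v p x + ?I x *v p' v)) \<bullet> z
         = p' v \<bullet> z - (mat_deriv G x v *v ?X) \<bullet> z"
        by (simp add: matrix_vector_right_distrib inv_der inner_add_left)
           (simp add: grad inner_diff_left matrix_vector_mul_assoc matrix_inv_right[OF inv[OF xS]])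
      moreover have "(G x *v ((?I x ** transpose (hessian G S0 u x)) *v v - Gam G x v ?X)) \<bullet> z
         = (transpose (hessian G S0 u x) *v v) \<bullet> z - (G x *v Gam G x v ?X) \<bullet> z"
        by (simp add: matrix_vector_right_distrib matrix_vector_mult_diff_distrib inner_diff_left
            matrix_vector_mul_assoc matrix_mul_assoc matrix_inv_right[OF inv[OF xS]] del: transpose_matrix_vector)
      \<comment> \<open>Metric compatibility: in the sum of two Koszul formulas with exchanged
        arguments all but one derivative of the metric cancel.\<close>
      moreover have "(G x *v Gam G x v ?X) \<bullet> z + ?X \<bullet> (G x *v Gam G x v z) = (mat_deriv G x v *v ?X) \<bullet> z"
      proof -
        have s: "a \<bullet> (mat_deriv G x c *v b) = b \<bullet> (mat_deriv G x c *v a)" for a b c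
          using inner_transpose_left[of "mat_deriv G x c" a b] mat_deriv_sym[OF xS, of c] by (metis inner_commute)
        have "(G x *v Gam G x v ?X) \<bullet> z = z \<bullet> (G x *v Gam G x v ?X)" by (rule inner_commute)
        then show ?thesis
          using koszul[OF xS, of z v ?X] koszul[OF xS, of ?X v z] s[of ?X v z] s[of v ?X z] s[of v z ?X]
          by (simp add: inner_commute[of _ z])
      qed
      ultimately show "(G x *v (mat_deriv ?I x v *v p x + ?I x *v p' v)) \<bullet> z =
        (G x *v ((?I x ** transpose (hessian G S0 u x)) *v v - Gam G x v ?X)) \<bullet> z"
        unfolding hess gam by simp
    qed
    then show ?thesis by (rule matvec_cancel[OF inv[OF xS]])
  qed
  ultimately show ?thesis by simp
qed

lemma nab_gradient:
  assumes "open S0" "S0 \<subseteq> S" "Ck_on 2 S0 u" "x \<in> S0"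
  shows "nab G (gradient G S0 u) x = matrix_inv (G x) ** transpose (hessian G S0 u x)"
proof -
  let ?T = "matrix_inv (G x) ** transpose (hessian G S0 u x)"
  have d: "(gradient G S0 u has_derivative (\<lambda>v. ?T *v v - Gam G x v (gradient G S0 u x))) (at x)"
    using gradient_has_derivative[OF assms(2-4)] unfolding at_within_open[OF assms(4,1)] .
  then have "gradient G S0 u differentiable at x" unfolding differentiable_def by blast
  from nab_mult[OF this, of G] have "nab G (gradient G S0 u) x *v v = ?T *v v" for v
    unfolding frechet_derivative_at[OF d, symmetric] by simp
  then show ?thesis by (simp add: matrix_eq)
qed

lemma hessian_sym:
  assumes "open S0" "S0 \<subseteq> S" "Ck_on 2 S0 u" "x \<in> S0"
  shows "transpose (hessian G S0 u x) = hessian G S0 u x"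
proof -
  have c: "partial S0 i (partial S0 j u) x = partial UNIV i (partial UNIV j u) x" for i j
    unfolding partial_open[OF assms(1,4)]
    by (rule partial_cong_open[OF assms(1,4) partial_open[OF assms(1)]])
  show ?thesis
    using partial_commute[OF assms(1,4,3)] christoffel_sym[of x] assms
    by (auto simp: vec_eq_iff transpose_def hessian_def c)
qed

lemma laplacian_eq_trace:
  "laplacian G S0 u x = trace (matrix_inv (G x) ** transpose (hessian G S0 u x))"
  by (simp add: laplacian_def metric_trace_def trace_def matrix_matrix_mult_def transpose_def metric_inv_def)

text \<open>As the trace of a square the norm fits both the Bochner formula and the comparison of
  charts.\<close>

lemma metric_norm2_sym:
  assumes "x \<in> S" "transpose K = K"
  shows "metric_norm2 G x K = trace ((matrix_inv (G x) ** K) ** (matrix_inv (G x) ** K))"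
proof -
  have K: "K $ l $ k = K $ k $ l" for k l
    using arg_cong[OF assms(2), of "\<lambda>A. A $ k $ l"] by (simp add: transpose_def)
  have "trace ((matrix_inv (G x) ** K) ** (matrix_inv (G x) ** K))
     = (\<Sum>k\<in>UNIV. \<Sum>j\<in>UNIV. \<Sum>l\<in>UNIV. \<Sum>i\<in>UNIV. metric_inv G x k i * K $ i $ j * (metric_inv G x j l * K $ l $ k))"
    by (simp add: trace_def matrix_matrix_mult_def metric_inv_def sum_product)
       (intro sum.cong refl sum.swap)
  also have "\<dots> = (\<Sum>k\<in>UNIV. \<Sum>j\<in>UNIV. \<Sum>l\<in>UNIV. \<Sum>i\<in>UNIV. metric_inv G x i k * metric_inv G x j l * K $ i $ j * K $ k $ l)"
    by (simp add: metric_inv_sym[OF assms(1), of _ _] K mult_ac)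
  also have "\<dots> = metric_norm2 G x K"
  proof -
    let ?F = "\<lambda>i j k l. metric_inv G x i k * metric_inv G x j l * K $ i $ j * K $ k $ l"
    have "(\<Sum>k\<in>UNIV. \<Sum>j\<in>UNIV. \<Sum>l\<in>UNIV. \<Sum>i\<in>UNIV. ?F i j k l) = (\<Sum>k\<in>UNIV. \<Sum>j\<in>UNIV. \<Sum>i\<in>UNIV. \<Sum>l\<in>UNIV. ?F i j k l)"
      by (intro sum.cong refl sum.swap)
    also have "\<dots> = (\<Sum>k\<in>UNIV. \<Sum>i\<in>UNIV. \<Sum>j\<in>UNIV. \<Sum>l\<in>UNIV. ?F i j k l)"
      by (intro sum.cong refl sum.swap)
    also have "\<dots> = (\<Sum>i\<in>UNIV. \<Sum>k\<in>UNIV. \<Sum>j\<in>UNIV. \<Sum>l\<in>UNIV. ?F i j k l)"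
      by (rule sum.swap)
    also have "\<dots> = (\<Sum>i\<in>UNIV. \<Sum>j\<in>UNIV. \<Sum>k\<in>UNIV. \<Sum>l\<in>UNIV. ?F i j k l)"
      by (intro sum.cong refl sum.swap)
    finally show ?thesis by (simp add: metric_norm2_def)
  qed
  finally show ?thesis by simp
qed

text \<open>Expand the square of \<open>T\<close> minus \<open>trace T / n\<close> times the
  identity: the cross term contributes \<open>-2 / n\<close> and the scalar part
  \<open>1 / n\<close> times the squared trace.\<close>

lemma tracefree_norm2:
  assumes "open S0" "S0 \<subseteq> S" "Ck_on 2 S0 u" "x \<in> S0"
  defines "T \<equiv> matrix_inv (G x) ** transpose (hessian G S0 u x)"
  shows "metric_norm2 G x (tracefree_hessian G S0 u x) = trace (T ** T) - (trace T)\<^sup>2 / real CARD('n)"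
proof -
  have xS: "x \<in> S" using assms by blast
  let ?a = "trace T / real CARD('n)"
  have tf: "tracefree_hessian G S0 u x = hessian G S0 u x - ?a *\<^sub>R G x"
    by (simp add: tracefree_hessian_def laplacian_eq_trace T_def)
  have sc: "matrix_inv (G x) ** (?a *\<^sub>R G x) = ?a *\<^sub>R mat 1"
    by (simp add: matrix_mult_scaleR matrix_inv_left[OF inv[OF xS]])
  have dist: "A ** (B - C) = A ** B - A ** C" "(B - C) ** A = B ** A - C ** A" for A B C :: "real^'n^'n"
    by (simp_all add: vec_eq_iff matrix_matrix_mult_def sum_subtractf algebra_simps)
  have sI: "A ** (c *\<^sub>R mat 1) = c *\<^sub>R A" "(c *\<^sub>R mat 1) ** A = c *\<^sub>R A" for A :: "real^'n^'n" and c
    by (simp_all add: matrix_mult_scaleR)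
  have tr: "trace (c *\<^sub>R A) = c * trace A" for A :: "real^'n^'n" and c
    by (simp add: trace_def sum_distrib_left)
  have "transpose (tracefree_hessian G S0 u x) = tracefree_hessian G S0 u x"
    using hessian_sym[OF assms(1-4)] sym[OF xS] unfolding tf
    by (simp add: vec_eq_iff transpose_def)
  moreover have giK: "matrix_inv (G x) ** tracefree_hessian G S0 u x = T - ?a *\<^sub>R mat 1"
    unfolding tf dist(1) sc by (simp add: T_def hessian_sym[OF assms(1-4)])
  ultimately have "metric_norm2 G x (tracefree_hessian G S0 u x) = trace ((T - ?a *\<^sub>R mat 1) ** (T - ?a *\<^sub>R mat 1))"
    using metric_norm2_sym[OF xS] giK by simp
  also have "\<dots> = trace (T ** T) - (trace T)\<^sup>2 / real CARD('n)"
    by (simp add: dist sI trace_sub tr trace_I power2_eq_square)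
  finally show ?thesis .
qed

text \<open>For an arbitrary vector field \<open>X\<close> and a torsion-free connection, the divergence of
  \<open>\<nabla>\<^bsub>X\<^esub>X - (div X) X\<close>: the second derivatives of \<open>X\<close> cancel up to the curvature.\<close>

lemma bochner:
  assumes U: "open U" "U \<subseteq> S" "x \<in> U" and X: "\<And>k. Ck_on 2 U (\<lambda>y. X y $ k)"
  defines "Y \<equiv> \<lambda>y. nab G X y *v X y - trace (nab G X y) *\<^sub>R X y"
  shows "trace (nab G Y x) = trace (nab G X x ** nab G X x) - (trace (nab G X x))\<^sup>2 + X x \<bullet> (ricci G x *v X x)"
    and "Ck_on 1 U (\<lambda>y. Y y $ k)"
proof -
  have xS: "x \<in> S" using U by blast
  have X2: "Ck_on (Suc (Suc 0)) U (\<lambda>y. X y $ k)" for k using X by (simp add: numeral_2_eq_2)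
  have X1: "Ck_on 1 U (\<lambda>y. X y $ k)" for k by (rule Ck_on_mono[OF X]) simp
  have P1: "Ck_on 1 U (partial UNIV j (\<lambda>y. X y $ k))" for j k
    using Ck_on_SucD2[OF U(1) X2] by simp
  have G1: "Ck_on 1 U (christoffel G k i j)" for k i j
    using Ck_on_subset[OF open_S U(1,2) Ck_christoffel] .
  have T1: "Ck_on 1 U (\<lambda>y. nab G X y $ k $ j)" for k j
    unfolding nab_def vec_lambda_beta by (intro Ck_on_add Ck_on_sum Ck_on_mult U(1) P1 G1 X1)
  have Yk: "Y y $ k = (\<Sum>j\<in>UNIV. nab G X y $ k $ j * X y $ j) - (\<Sum>m\<in>UNIV. nab G X y $ m $ m) * X y $ k" for y k
    by (simp add: Y_def matrix_vector_mult_def trace_def)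
  show "Ck_on 1 U (\<lambda>y. Y y $ k)" for k
    unfolding Yk by (intro Ck_on_diff Ck_on_sum Ck_on_mult U(1) T1 X1)
  have D: "f differentiable at x" if "Ck_on 1 U f" for f :: "_ \<Rightarrow> real"
    using Ck_on_SucD1[OF U(1) _ U(3), of 0 f] that by simp
  define P where "P k j = partial UNIV j (\<lambda>y. X y $ k) x" for k j
  define h where "h i j k = partial UNIV i (partial UNIV j (\<lambda>y. X y $ k)) x" for i j k
  define c where "c k i j = christoffel G k i j x" for k i j
  define dc where "dc l k i j = partial UNIV l (christoffel G k i j) x" for l k i j
  define v where "v k = X x $ k" for k
  define T where "T k j = nab G X x $ k $ j" for k j
  have T: "T k j = P k j + (\<Sum>m\<in>UNIV. c k j m * v m)" for k j
    by (simp add: T_def nab_def P_def c_def v_def)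
  have hs: "h i j k = h j i k" for i j k
    unfolding h_def by (rule partial_commute[OF U(1,3) X])
  have cs: "c k i j = c k j i" for k i j unfolding c_def by (rule christoffel_sym[OF xS])
  have dT: "partial UNIV l (\<lambda>y. nab G X y $ k $ j) x = h l j k + (\<Sum>m\<in>UNIV. dc l k j m * v m + c k j m * P m l)" for l k j
  proof -
    have "partial UNIV l (\<lambda>y. nab G X y $ k $ j) x
       = partial UNIV l (\<lambda>y. partial UNIV j (\<lambda>y. X y $ k) y + (\<Sum>m\<in>UNIV. christoffel G k j m y * X y $ m)) x"
      by (simp add: nab_def)
    also have "\<dots> = h l j k + (\<Sum>m\<in>UNIV. partial UNIV l (\<lambda>y. christoffel G k j m y * X y $ m) x)"
      unfolding h_def using D[OF P1] D[OF Ck_on_mult[OF U(1) G1 X1]]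
      by (subst partial_add) (auto simp: partial_sum intro!: differentiable_sum)
    finally show ?thesis
      unfolding partial_mult[OF D[OF G1] D[OF X1]] dc_def v_def c_def P_def by (simp add: add.commute)
  qed
  have dY: "partial UNIV l (\<lambda>y. Y y $ k) x = (\<Sum>j\<in>UNIV. (h l j k + (\<Sum>m\<in>UNIV. dc l k j m * v m + c k j m * P m l)) * v j + T k j * P j l)
     - ((\<Sum>n\<in>UNIV. h l n n + (\<Sum>m\<in>UNIV. dc l n n m * v m + c n n m * P m l)) * v k + (\<Sum>m\<in>UNIV. T m m) * P k l)" for l k
    unfolding Yk
    apply (subst partial_diff)
      apply (intro D Ck_on_sum Ck_on_mult U(1) T1 X1)+
    apply (subst partial_mult)
      apply (intro D Ck_on_sum Ck_on_mult U(1) T1 X1)+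
    apply (subst (1 2) partial_sum)
      apply simp
      apply (intro D Ck_on_sum Ck_on_mult U(1) T1 X1)+
    unfolding partial_mult[OF D[OF T1] D[OF X1]] dT T_def[symmetric] v_def[symmetric] P_def[symmetric]
    by (simp add: add.commute)
  define C where "C k j = (\<Sum>m\<in>UNIV. c k j m * v m)" for k j
  define t where "t = (\<Sum>m\<in>UNIV. T m m)"
  have TC: "T k j = P k j + C k j" for k j by (simp add: T C_def)
  have Yx: "Y x $ m = (\<Sum>j\<in>UNIV. T m j * v j) - t * v m" for m
    by (simp add: Yk T_def v_def t_def)
  have lhs: "trace (nab G Y x) = (\<Sum>k\<in>UNIV. partial UNIV k (\<lambda>y. Y y $ k) x) + (\<Sum>k\<in>UNIV. \<Sum>m\<in>UNIV. c k k m * Y x $ m)"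
    by (simp add: trace_def nab_def sum.distrib c_def)
  \<comment> \<open>Here the second derivatives of \<open>X\<close> cancel, by symmetry of the mixed
    partials after renaming indices.\<close>
  have a1: "(\<Sum>k\<in>UNIV. \<Sum>j\<in>UNIV. h k j k * v j) = (\<Sum>k\<in>UNIV. \<Sum>n\<in>UNIV. h k n n * v k)"
    by (subst sum.swap) (simp add: hs[of _ _ _])
  have a3: "(\<Sum>k\<in>UNIV. \<Sum>j\<in>UNIV. \<Sum>m\<in>UNIV. c k j m * P m k * v j) = (\<Sum>k\<in>UNIV. \<Sum>m\<in>UNIV. C k m * P m k)"
  proof -
    have "(\<Sum>k\<in>UNIV. \<Sum>j\<in>UNIV. \<Sum>m\<in>UNIV. c k j m * P m k * v j) = (\<Sum>k\<in>UNIV. \<Sum>m\<in>UNIV. \<Sum>j\<in>UNIV. c k j m * P m k * v j)"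
      by (intro sum.cong refl sum.swap)
    also have "\<dots> = (\<Sum>k\<in>UNIV. \<Sum>m\<in>UNIV. \<Sum>j\<in>UNIV. c k m j * P m k * v j)"
      by (intro sum.cong refl) (simp add: cs)
    finally show ?thesis by (simp add: C_def sum_distrib_left sum_distrib_right mult_ac)
  qed
  have a5: "(\<Sum>k\<in>UNIV. \<Sum>n\<in>UNIV. \<Sum>m\<in>UNIV. c n n m * P m k * v k) = (\<Sum>k\<in>UNIV. \<Sum>m\<in>UNIV. c k k m * (\<Sum>j\<in>UNIV. P m j * v j))"
  proof -
    have "(\<Sum>k\<in>UNIV. \<Sum>n\<in>UNIV. \<Sum>m\<in>UNIV. c n n m * P m k * v k) = (\<Sum>n\<in>UNIV. \<Sum>k\<in>UNIV. \<Sum>m\<in>UNIV. c n n m * P m k * v k)"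
      by (rule sum.swap)
    also have "\<dots> = (\<Sum>n\<in>UNIV. \<Sum>m\<in>UNIV. \<Sum>k\<in>UNIV. c n n m * P m k * v k)"
      by (intro sum.cong refl sum.swap)
    finally show ?thesis by (simp add: sum_distrib_left mult_ac)
  qed
  have a6: "(\<Sum>k\<in>UNIV. \<Sum>m\<in>UNIV. c k k m * (t * v m)) = t * (\<Sum>k\<in>UNIV. C k k)"
    by (simp add: C_def sum_distrib_left mult_ac)
  have tr: "t = (\<Sum>k\<in>UNIV. P k k) + (\<Sum>k\<in>UNIV. C k k)"
    by (simp add: t_def TC sum.distrib)
  have divY: "(\<Sum>k\<in>UNIV. partial UNIV k (\<lambda>y. Y y $ k) x) =
     (\<Sum>k\<in>UNIV. \<Sum>j\<in>UNIV. \<Sum>m\<in>UNIV. dc k k j m * v m * v j) - (\<Sum>k\<in>UNIV. \<Sum>n\<in>UNIV. \<Sum>m\<in>UNIV. dc k n n m * v m * v k)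
     + (\<Sum>k\<in>UNIV. \<Sum>m\<in>UNIV. C k m * P m k) + (\<Sum>k\<in>UNIV. \<Sum>j\<in>UNIV. T k j * P j k)
     - (\<Sum>k\<in>UNIV. \<Sum>m\<in>UNIV. c k k m * (\<Sum>j\<in>UNIV. P m j * v j)) - t * (\<Sum>k\<in>UNIV. P k k)"
    unfolding dY a3[symmetric] a5[symmetric] t_def[symmetric]
    using a1 by (simp add: sum.distrib sum_subtractf distrib_right sum_distrib_right sum_distrib_left[symmetric])
  have gY: "(\<Sum>k\<in>UNIV. \<Sum>m\<in>UNIV. c k k m * Y x $ m) = (\<Sum>k\<in>UNIV. \<Sum>m\<in>UNIV. c k k m * (\<Sum>j\<in>UNIV. P m j * v j))
     + (\<Sum>k\<in>UNIV. \<Sum>m\<in>UNIV. c k k m * (\<Sum>j\<in>UNIV. C m j * v j)) - t * (\<Sum>k\<in>UNIV. C k k)"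
    unfolding Yx a6[symmetric] by (simp add: TC sum.distrib sum_subtractf distrib_right distrib_left right_diff_distrib)
  \<comment> \<open>What is left of \<open>divY\<close> and \<open>gY\<close> after splitting off
    \<open>TT\<close> and the square of \<open>t\<close>. The products \<open>C i m * C m i\<close>
    are subtracted here and reappear with the opposite sign in \<open>TT\<close>.\<close>
  have ric: "X x \<bullet> (ricci G x *v X x) = (\<Sum>k\<in>UNIV. \<Sum>j\<in>UNIV. \<Sum>m\<in>UNIV. dc k k j m * v m * v j)
     - (\<Sum>k\<in>UNIV. \<Sum>n\<in>UNIV. \<Sum>m\<in>UNIV. dc k n n m * v m * v k)
     + (\<Sum>k\<in>UNIV. \<Sum>m\<in>UNIV. c k k m * (\<Sum>j\<in>UNIV. C m j * v j)) - (\<Sum>i\<in>UNIV. \<Sum>m\<in>UNIV. C i m * C m i)"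
  proof -
    have "X x \<bullet> (ricci G x *v X x) = (\<Sum>j\<in>UNIV. \<Sum>k\<in>UNIV. \<Sum>i\<in>UNIV.
       (dc i i j k - dc j i i k + (\<Sum>m\<in>UNIV. c i i m * c m j k - c i j m * c m i k)) * v k * v j)"
      by (simp add: inner_vec_def matrix_vector_mult_def ricci_def curvature_def dc_def[symmetric] c_def[symmetric]
          v_def[symmetric] sum_distrib_left sum_distrib_right mult_ac)
    also have "\<dots> = (\<Sum>j\<in>UNIV. \<Sum>i\<in>UNIV. \<Sum>k\<in>UNIV.
       (dc i i j k - dc j i i k + (\<Sum>m\<in>UNIV. c i i m * c m j k - c i j m * c m i k)) * v k * v j)"
      by (intro sum.cong refl sum.swap)
    also have "\<dots> = (\<Sum>j\<in>UNIV. \<Sum>i\<in>UNIV. \<Sum>k\<in>UNIV. dc i i j k * v k * v j) - (\<Sum>j\<in>UNIV. \<Sum>i\<in>UNIV. \<Sum>k\<in>UNIV. dc j i i k * v k * v j)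
       + (\<Sum>j\<in>UNIV. \<Sum>i\<in>UNIV. \<Sum>k\<in>UNIV. \<Sum>m\<in>UNIV. c i i m * c m j k * v k * v j)
       - (\<Sum>j\<in>UNIV. \<Sum>i\<in>UNIV. \<Sum>k\<in>UNIV. \<Sum>m\<in>UNIV. c i j m * c m i k * v k * v j)"
      by (simp add: sum.distrib sum_subtractf left_diff_distrib distrib_right sum_distrib_right)
    also have "(\<Sum>j\<in>UNIV. \<Sum>i\<in>UNIV. \<Sum>k\<in>UNIV. dc i i j k * v k * v j) = (\<Sum>i\<in>UNIV. \<Sum>j\<in>UNIV. \<Sum>k\<in>UNIV. dc i i j k * v k * v j)"
      by (rule sum.swap)
    also have "(\<Sum>j\<in>UNIV. \<Sum>i\<in>UNIV. \<Sum>k\<in>UNIV. \<Sum>m\<in>UNIV. c i i m * c m j k * v k * v j)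
       = (\<Sum>i\<in>UNIV. \<Sum>m\<in>UNIV. c i i m * (\<Sum>j\<in>UNIV. C m j * v j))"
    proof -
      have "(\<Sum>j\<in>UNIV. \<Sum>i\<in>UNIV. \<Sum>k\<in>UNIV. \<Sum>m\<in>UNIV. c i i m * c m j k * v k * v j)
        = (\<Sum>j\<in>UNIV. \<Sum>i\<in>UNIV. \<Sum>m\<in>UNIV. \<Sum>k\<in>UNIV. c i i m * c m j k * v k * v j)"
        by (intro sum.cong refl sum.swap)
      also have "\<dots> = (\<Sum>i\<in>UNIV. \<Sum>j\<in>UNIV. \<Sum>m\<in>UNIV. \<Sum>k\<in>UNIV. c i i m * c m j k * v k * v j)"
        by (rule sum.swap)
      also have "\<dots> = (\<Sum>i\<in>UNIV. \<Sum>m\<in>UNIV. \<Sum>j\<in>UNIV. \<Sum>k\<in>UNIV. c i i m * c m j k * v k * v j)"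
        by (intro sum.cong refl sum.swap)
      finally show ?thesis by (simp add: C_def sum_distrib_left sum_distrib_right mult_ac)
    qed
    also have "(\<Sum>j\<in>UNIV. \<Sum>i\<in>UNIV. \<Sum>k\<in>UNIV. \<Sum>m\<in>UNIV. c i j m * c m i k * v k * v j)
       = (\<Sum>i\<in>UNIV. \<Sum>m\<in>UNIV. C i m * C m i)"
    proof -
      have "(\<Sum>j\<in>UNIV. \<Sum>i\<in>UNIV. \<Sum>k\<in>UNIV. \<Sum>m\<in>UNIV. c i j m * c m i k * v k * v j)
        = (\<Sum>i\<in>UNIV. \<Sum>j\<in>UNIV. \<Sum>k\<in>UNIV. \<Sum>m\<in>UNIV. c i j m * c m i k * v k * v j)"
        by (rule sum.swap)
      also have "\<dots> = (\<Sum>i\<in>UNIV. \<Sum>j\<in>UNIV. \<Sum>m\<in>UNIV. \<Sum>k\<in>UNIV. c i j m * c m i k * v k * v j)"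
        by (intro sum.cong refl sum.swap)
      also have "\<dots> = (\<Sum>i\<in>UNIV. \<Sum>m\<in>UNIV. \<Sum>j\<in>UNIV. \<Sum>k\<in>UNIV. c i j m * c m i k * v k * v j)"
        by (intro sum.cong refl sum.swap)
      also have "\<dots> = (\<Sum>i\<in>UNIV. \<Sum>m\<in>UNIV. (\<Sum>j\<in>UNIV. c i m j * v j) * (\<Sum>k\<in>UNIV. c m i k * v k))"
        by (simp add: sum_product cs[of _ _ _] mult_ac)
      finally show ?thesis by (simp add: C_def)
    qed
    finally show ?thesis by simp
  qed
  have TT: "trace (nab G X x ** nab G X x) = (\<Sum>k\<in>UNIV. \<Sum>j\<in>UNIV. T k j * P j k) + (\<Sum>k\<in>UNIV. \<Sum>m\<in>UNIV. C k m * P m k)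
     + (\<Sum>i\<in>UNIV. \<Sum>m\<in>UNIV. C i m * C m i)"
  proof -
    have "trace (nab G X x ** nab G X x) = (\<Sum>k\<in>UNIV. \<Sum>j\<in>UNIV. T k j * T j k)"
      by (simp add: trace_def matrix_matrix_mult_def T_def)
    also have "\<dots> = (\<Sum>k\<in>UNIV. \<Sum>j\<in>UNIV. T k j * P j k) + (\<Sum>k\<in>UNIV. \<Sum>j\<in>UNIV. P k j * C j k) + (\<Sum>i\<in>UNIV. \<Sum>m\<in>UNIV. C i m * C m i)"
      by (simp add: TC[of _ _] distrib_left distrib_right sum.distrib)
    also have "(\<Sum>k\<in>UNIV. \<Sum>j\<in>UNIV. P k j * C j k) = (\<Sum>k\<in>UNIV. \<Sum>m\<in>UNIV. C k m * P m k)"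
      by (subst sum.swap) (simp add: mult.commute)
    finally show ?thesis by simp
  qed
  have tt: "trace (nab G X x) = t" by (simp add: trace_def t_def T_def)
  show "trace (nab G Y x) = trace (nab G X x ** nab G X x) - (trace (nab G X x))\<^sup>2 + X x \<bullet> (ricci G x *v X x)"
    unfolding lhs divY gY ric TT tt power2_eq_square
    using arg_cong[OF tr, of "\<lambda>s. t * s"] by (simp add: distrib_left)
qed

end

section \<open>Two metrics related by a change of coordinates\<close>

locale coord_change = c: coord_metric Gc Sc + d: coord_metric Gd Sd
  for Gc :: "real^'n \<Rightarrow> real^'n^'n" and Sc and Gd :: "real^'n \<Rightarrow> real^'n^'n" and Sd +
  fixes Z :: "(real^'n) set" and \<tau> :: "real^'n \<Rightarrow> real^'n" and J :: "real^'n \<Rightarrow> real^'n^'n"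
  defines "J \<equiv> \<lambda>x. matrix (frechet_derivative \<tau> (at x))"
  assumes Z: "open Z" "Z \<subseteq> Sc" "\<tau> ` Z \<subseteq> Sd"
    and \<tau>: "Ck_on 2 Z \<tau>"
    and trans: "\<And>x. x \<in> Z \<Longrightarrow> Gc x = transpose (J x) ** Gd (\<tau> x) ** J x"
begin

lemma \<tau>_diff: "x \<in> Z \<Longrightarrow> \<tau> differentiable at x"
  using Ck_on_SucD1[OF Z(1), of 1] \<tau> by (simp add: numeral_2_eq_2)

lemma \<tau>_deriv: "x \<in> Z \<Longrightarrow> (\<tau> has_derivative (*v) (J x)) (at x)"
  using \<tau>_diff frechet_derivative_works matrix_works[of "frechet_derivative \<tau> (at x)"]
  unfolding J_def by (metis (no_types, lifting) ext has_derivative_linear linear_matrix_vector_mul_eq matrix_vector_mul)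

lemma J_nth: "x \<in> Z \<Longrightarrow> J x $ a $ i = partial UNIV i (\<lambda>y. \<tau> y $ a) x"
  using partial_component[OF \<tau>_diff, of x i a] by (simp add: J_def matrix_def partial_def)

lemma Ck_J: "Ck_on 1 Z (\<lambda>y. J y $ a $ i)"
proof -
  have "Ck_on (Suc 1) Z (\<lambda>y. \<tau> y $ a)" using Ck_on_component[OF Z(1) \<tau>] by (simp add: numeral_2_eq_2)
  then have "Ck_on 1 Z (partial UNIV i (\<lambda>y. \<tau> y $ a))" by (rule Ck_on_SucD2[OF Z(1)])
  then show ?thesis using Ck_on_cong[OF Z(1), of "\<lambda>y. J y $ a $ i"] J_nth by blast
qed

lemma deriv_J: "x \<in> Z \<Longrightarrow> (J has_derivative mat_deriv J x) (at x)"
  using Ck_on_SucD1[OF Z(1) Ck_J[unfolded One_nat_def]] by (intro has_derivative_mat_deriv)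

text \<open>Symmetry of the second derivative of \<tau>, read off its Jacobian.\<close>

lemma mat_deriv_J_sym: "x \<in> Z \<Longrightarrow> mat_deriv J x z *v v = mat_deriv J x v *v z"
proof -
  assume x: "x \<in> Z"
  have p: "partial UNIV l (\<lambda>y. J y $ a $ i) x = partial UNIV i (\<lambda>y. J y $ a $ l) x" for a l i
  proof -
    have "partial UNIV l (\<lambda>y. J y $ a $ i) x = partial UNIV l (partial UNIV i (\<lambda>y. \<tau> y $ a)) x" for i l
      by (rule partial_cong_open[OF Z(1) x]) (rule J_nth)
    then show ?thesis using partial_commute[OF Z(1) x Ck_on_component[OF Z(1) \<tau>]] by metis
  qed
  have "(\<Sum>i\<in>UNIV. (\<Sum>l\<in>UNIV. z $ l * partial UNIV l (\<lambda>y. J y $ a $ i) x) * v $ i)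
     = (\<Sum>i\<in>UNIV. (\<Sum>l\<in>UNIV. v $ l * partial UNIV l (\<lambda>y. J y $ a $ i) x) * z $ i)" for a
    unfolding sum_distrib_right by (subst sum.swap) (simp add: p[of _ a] mult_ac)
  then show ?thesis by (simp add: vec_eq_iff matrix_vector_mult_def mat_deriv_def)
qed

lemma inner_trans: "x \<in> Z \<Longrightarrow> v \<bullet> (Gc x *v w) = (J x *v v) \<bullet> (Gd (\<tau> x) *v (J x *v w))"
  unfolding trans using inner_transpose_left[of "J x" "Gd (\<tau> x) *v (J x *v w)" v]
  by (simp add: matrix_vector_mul_assoc[symmetric] inner_commute)

text \<open>A vector killed by the Jacobian has length 0 for \<open>Gc\<close> by the transformation
  law, which positive definiteness excludes.\<close>

lemma J_inv: "x \<in> Z \<Longrightarrow> invertible (J x)"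
proof -
  assume x: "x \<in> Z"
  have "v = 0" if "J x *v v = 0" for v
    using c.pos[of x v] inner_trans[OF x, of v v] that x Z by auto
  then show ?thesis using matrix_left_invertible_ker invertible_left_inverse by blast
qed

text \<open>The inhomogeneous law of the Christoffel symbols. Differentiating the transformation law
  of the metric and inserting it into the Koszul formula leaves the second derivative of \<tau> as
  the extra term.\<close>

lemma gam_transform:
  assumes x: "x \<in> Z"
  shows "J x *v Gam Gc x v w = Gam Gd (\<tau> x) (J x *v v) (J x *v w) + mat_deriv J x v *v w"
proof -
  let ?J = "J x" and ?H = "\<lambda>z v. mat_deriv J x z *v v" and ?g = "Gd (\<tau> x)"
  have xc: "x \<in> Sc" and xd: "\<tau> x \<in> Sd" using x Z by auto
  have der: "v \<bullet> (mat_deriv Gc x z *v w) = ?H z v \<bullet> (?g *v (?J *v w))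
      + (?J *v v) \<bullet> (mat_deriv Gd (\<tau> x) (?J *v z) *v (?J *v w)) + (?J *v v) \<bullet> (?g *v ?H z w)" for v w z
  proof -
    have 1: "((\<lambda>y. v \<bullet> (Gc y *v w)) has_derivative (\<lambda>z. v \<bullet> (mat_deriv Gc x z *v w + Gc x *v 0))) (at x)"
      by (intro has_derivative_inner_right has_derivative_matvec c.deriv_G xc has_derivative_const)
    have 2: "((\<lambda>y. (J y *v v) \<bullet> (Gd (\<tau> y) *v (J y *v w))) has_derivative
       (\<lambda>z. (J x *v v) \<bullet> (mat_deriv Gd (\<tau> x) (J x *v z) *v (J x *v w) + Gd (\<tau> x) *v (mat_deriv J x z *v w + J x *v 0))
           + (mat_deriv J x z *v v + J x *v 0) \<bullet> (Gd (\<tau> x) *v (J x *v w)))) (at x)"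
      by (intro has_derivative_inner has_derivative_matvec deriv_J x has_derivative_const
          has_derivative_compose[OF \<tau>_deriv[OF x] d.deriv_G[OF xd]])
    have 3: "((\<lambda>y. v \<bullet> (Gc y *v w)) has_derivative
       (\<lambda>z. (J x *v v) \<bullet> (mat_deriv Gd (\<tau> x) (J x *v z) *v (J x *v w) + Gd (\<tau> x) *v (mat_deriv J x z *v w + J x *v 0))
           + (mat_deriv J x z *v v + J x *v 0) \<bullet> (Gd (\<tau> x) *v (J x *v w)))) (at x)"
      by (rule has_derivative_transform_within_open[OF 2 Z(1) x]) (simp add: inner_trans)
    from fun_cong[OF has_derivative_unique[OF 1 3], of z] show ?thesis
      by (simp add: inner_add_right)
  qed
  have "(?J *v Gam Gc x v w) = Gam Gd (\<tau> x) (?J *v v) (?J *v w) + ?H v w"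
  proof -
    have g: "(?g *v (?J *v Gam Gc x v w)) \<bullet> z' = (?g *v (Gam Gd (\<tau> x) (?J *v v) (?J *v w) + ?H v w)) \<bullet> z'" for z'
    proof -
      obtain z where z: "z' = ?J *v z"
        using J_inv[OF x] by (metis matrix_inv_right matrix_vector_mul_assoc matrix_vector_mul_lid)
      have "(?J *v z) \<bullet> (?g *v (?J *v Gam Gc x v w)) = z \<bullet> (Gc x *v Gam Gc x v w)"
        using inner_trans[OF x] by simp
      also have "\<dots> = (?J *v z) \<bullet> (?g *v Gam Gd (\<tau> x) (?J *v v) (?J *v w)) + (?J *v z) \<bullet> (?g *v ?H v w)"
        unfolding c.koszul[OF xc] der d.koszul[OF xd]
        using mat_deriv_J_sym[OF x, of v z] mat_deriv_J_sym[OF x, of w z] mat_deriv_J_sym[OF x, of v w]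
          d.inner_commute'[OF xd, of "?J *v w" "?H z v"] d.inner_commute'[OF xd, of "?J *v v" "?H w z"]
          d.inner_commute'[OF xd, of "?H w v" "?J *v z"]
        by (simp add: field_simps)
      finally show ?thesis using z by (simp add: matrix_vector_right_distrib inner_add_right inner_commute)
    qed
    then have "?g *v (?J *v Gam Gc x v w) = ?g *v (Gam Gd (\<tau> x) (?J *v v) (?J *v w) + ?H v w)"
      by (rule vec_eq_if_inner)
    then show ?thesis by (rule matvec_cancel[OF d.inv[OF xd]])
  qed
  then show ?thesis .
qed

text \<open>Differentiating \<open>J y *v Yc y\<close> creates a second derivative of \<tau> that is
  exactly the extra term in the law of the Christoffel symbols; hence the covariant derivative is a
  tensor.\<close>

lemma nab_transform:
  assumes U: "open U" "x \<in> U" "U \<subseteq> Z" and Y: "\<And>y. y \<in> U \<Longrightarrow> Yd (\<tau> y) = J y *v Yc y"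
    and d: "Yc differentiable at x" "Yd differentiable at (\<tau> x)"
  shows "nab Gd Yd (\<tau> x) ** J x = J x ** nab Gc Yc x"
proof -
  have x: "x \<in> Z" using U by blast
  have dd: "(Yd has_derivative frechet_derivative Yd (at (\<tau> x))) (at (\<tau> x))"
    "(Yc has_derivative frechet_derivative Yc (at x)) (at x)"
    using d frechet_derivative_works by blast+
  have 1: "((\<lambda>y. Yd (\<tau> y)) has_derivative (\<lambda>v. frechet_derivative Yd (at (\<tau> x)) (J x *v v))) (at x)"
    by (rule has_derivative_compose[OF \<tau>_deriv[OF x] dd(1)])
  have 2: "((\<lambda>y. J y *v Yc y) has_derivative (\<lambda>v. mat_deriv J x v *v Yc x + J x *v frechet_derivative Yc (at x) v)) (at x)"
    by (intro has_derivative_matvec deriv_J x dd)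
  have 3: "((\<lambda>y. Yd (\<tau> y)) has_derivative (\<lambda>v. mat_deriv J x v *v Yc x + J x *v frechet_derivative Yc (at x) v)) (at x)"
    by (rule has_derivative_transform_within_open[OF 2 U(1,2)]) (simp add: Y)
  have "(nab Gd Yd (\<tau> x) ** J x) *v v = (J x ** nab Gc Yc x) *v v" for v
  proof -
    have "(nab Gd Yd (\<tau> x) ** J x) *v v = frechet_derivative Yd (at (\<tau> x)) (J x *v v) + Gam Gd (\<tau> x) (J x *v v) (J x *v Yc x)"
      using nab_mult[OF d(2)] Y[OF U(2)] by (simp add: matrix_vector_mul_assoc[symmetric])
    also have "\<dots> = J x *v frechet_derivative Yc (at x) v + J x *v Gam Gc x v (Yc x)"
      using fun_cong[OF has_derivative_unique[OF 1 3], of v] gam_transform[OF x, of v "Yc x"] by simp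
    also have "\<dots> = (J x ** nab Gc Yc x) *v v"
      using nab_mult[OF d(1)] by (simp add: matrix_vector_mul_assoc[symmetric] matrix_vector_right_distrib)
    finally show ?thesis .
  qed
  then show ?thesis by (simp add: matrix_eq)
qed

text \<open>Raising an index commutes with the change of coordinates. Hence gradients of functions,
  and with them normals, transform as vectors.\<close>

lemma inverse_transform:
  assumes "x \<in> Z"
  shows "J x *v (matrix_inv (Gc x) *v (transpose (J x) *v q)) = matrix_inv (Gd (\<tau> x)) *v q"
proof -
  have xd: "\<tau> x \<in> Sd" and xc: "x \<in> Sc" using assms Z by auto
  have "transpose (J x) *v (Gd (\<tau> x) *v (J x *v w)) = Gc x *v w" for w
    by (simp add: trans[OF assms] matrix_vector_mul_assoc matrix_mul_assoc del: transpose_matrix_vector)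
  then have "transpose (J x) *v (Gd (\<tau> x) *v (J x *v (matrix_inv (Gc x) *v (transpose (J x) *v q)))) = transpose (J x) *v q"
    by (simp only:) (simp add: matrix_vector_mul_assoc matrix_inv_right[OF c.inv[OF xc]] matrix_mul_assoc del: transpose_matrix_vector)
  moreover have "invertible (transpose (J x))" using J_inv[OF assms] transpose_invertible by blast
  ultimately have "Gd (\<tau> x) *v (J x *v (matrix_inv (Gc x) *v (transpose (J x) *v q))) = q"
    by (blast intro: matvec_cancel)
  also have "q = Gd (\<tau> x) *v (matrix_inv (Gd (\<tau> x)) *v q)"
    by (simp add: matrix_vector_mul_assoc matrix_inv_right[OF d.inv[OF xd]])
  finally show ?thesis by (rule matvec_cancel[OF d.inv[OF xd]])
qed

end

section \<open>The divergence theorem below a graph\<close>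

text \<open>A permutation that moves some index outside \<open>range \<iota>\<close> picks a zero
  entry from that row; the remaining ones are the permutations of \<open>'m\<close> carried over by
  \<iota>. Used with one index left out, and with \<iota> a bijection as relabelling.\<close>

lemma det_diagonal_block:
  fixes A :: "'a::comm_ring_1^'n^'n" and \<iota> :: "'m::finite \<Rightarrow> 'n"
  assumes inj: "inj \<iota>" and diag: "\<And>i k. i \<notin> range \<iota> \<Longrightarrow> k \<noteq> i \<Longrightarrow> A $ i $ k = 0"
  shows "det A = (\<Prod>i\<in>- range \<iota>. A $ i $ i) * det (\<chi> a b. A $ \<iota> a $ \<iota> b)"
proof -
  let ?t = "\<lambda>p. of_int (sign p) * (\<Prod>i\<in>UNIV. A $ i $ p i)"
  have sub: "{p. p permutes range \<iota>} \<subseteq> {p. p permutes UNIV}"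
    using permutes_subset by blast
  have "det A = sum ?t {p. p permutes UNIV}" by (simp add: det_def)
  also have "\<dots> = sum ?t {p. p permutes range \<iota>}"
  proof (rule sum.mono_neutral_right[OF _ sub])
    show "\<forall>p\<in>{p. p permutes UNIV} - {p. p permutes range \<iota>}. ?t p = 0"
    proof
      fix p assume p: "p \<in> {p. p permutes UNIV} - {p. p permutes range \<iota>}"
      have "\<exists>i. i \<notin> range \<iota> \<and> p i \<noteq> i"
      proof (rule ccontr)
        assume n: "\<nexists>i. i \<notin> range \<iota> \<and> p i \<noteq> i"
        have "p permutes range \<iota>"
          by (rule permutes_superset[of p UNIV]) (use p n in auto)
        then show False using p by simp
      qed
      then obtain i where "i \<notin> range \<iota>" "p i \<noteq> i" by blast
      then have "(\<Prod>i\<in>UNIV. A $ i $ p i) = 0" using diag by (intro prod_zero) auto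
      then show "?t p = 0" by simp
    qed
  qed simp
  also have "\<dots> = (\<Sum>q | q permutes (UNIV::'m set). (\<Prod>i\<in>- range \<iota>. A $ i $ i) *
       (of_int (sign q) * (\<Prod>a\<in>UNIV. A $ \<iota> a $ \<iota> (q a))))"
  proof (rule sum.reindex_bij_witness[of _ "map_permutation UNIV \<iota>" "map_permutation (range \<iota>) (inv \<iota>)"])
    have b1: "bij_betw \<iota> UNIV (range \<iota>)" using inj by (rule inj_on_imp_bij_betw)
    have b2: "bij_betw (inv \<iota>) (range \<iota>) UNIV" using bij_betw_inv_into[OF b1] .
    show "map_permutation UNIV \<iota> (map_permutation (range \<iota>) (inv \<iota>) p) = p" if "p \<in> {p. p permutes range \<iota>}" for p
      by (rule map_permutation_compose_inv[OF b2]) (use that inj in auto)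
    show "map_permutation (range \<iota>) (inv \<iota>) p \<in> {q. q permutes UNIV}" if "p \<in> {p. p permutes range \<iota>}" for p
      using map_permutation_permutes[OF b2] that by auto
    show "map_permutation (range \<iota>) (inv \<iota>) (map_permutation UNIV \<iota> q) = q" if "q \<in> {q. q permutes UNIV}" for q
      by (rule map_permutation_compose_inv[OF b1]) (use that inj in auto)
    show "map_permutation UNIV \<iota> q \<in> {p. p permutes range \<iota>}" if "q \<in> {q. q permutes UNIV}" for q
      using map_permutation_permutes[OF b1] that by auto
    show "(\<Prod>i\<in>- range \<iota>. A $ i $ i) * (of_int (sign (map_permutation (range \<iota>) (inv \<iota>) p)) *
       (\<Prod>a\<in>UNIV. A $ \<iota> a $ \<iota> (map_permutation (range \<iota>) (inv \<iota>) p a))) = ?t p"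
      if "p \<in> {p. p permutes range \<iota>}" for p
    proof -
      have p: "p permutes range \<iota>" using that by simp
      have sg: "sign (map_permutation (range \<iota>) (inv \<iota>) p) = sign p"
        by (rule sign_map_permutation) (use p b2 in \<open>auto simp: bij_betw_def\<close>)
      have ap: "\<iota> (map_permutation (range \<iota>) (inv \<iota>) p a) = p (\<iota> a)" for a
      proof -
        have "map_permutation (range \<iota>) (inv \<iota>) p (inv \<iota> (\<iota> a)) = inv \<iota> (p (\<iota> a))"
          by (rule map_permutation_apply) (use b2 in \<open>auto simp: bij_betw_def\<close>)
        moreover have "p (\<iota> a) \<in> range \<iota>" using permutes_in_image[OF p, of "\<iota> a"] by simp
        ultimately show ?thesis using inj by (simp add: f_inv_into_f)
      qed
      have "(\<Prod>i\<in>UNIV. A $ i $ p i) = (\<Prod>i\<in>- range \<iota>. A $ i $ p i) * (\<Prod>i\<in>range \<iota>. A $ i $ p i)"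
        by (subst prod.union_disjoint[symmetric]) auto
      also have "(\<Prod>i\<in>- range \<iota>. A $ i $ p i) = (\<Prod>i\<in>- range \<iota>. A $ i $ i)"
        using p by (intro prod.cong refl) (simp add: permutes_not_in)
      also have "(\<Prod>i\<in>range \<iota>. A $ i $ p i) = (\<Prod>a\<in>UNIV. A $ \<iota> a $ p (\<iota> a))"
        using inj by (subst prod.reindex) auto
      finally show ?thesis unfolding sg ap by (simp add: mult_ac)
    qed
  qed
  also have "\<dots> = (\<Prod>i\<in>- range \<iota>. A $ i $ i) * det (\<chi> a b. A $ \<iota> a $ \<iota> b)"
    by (simp add: det_def sum_distrib_left)
  finally show ?thesis .
qed


text \<open>\<open>\<real>\<^sup>n\<close> as a product of the \<open>j\<close>-th coordinate line and \<open>\<real>\<^sup>m\<close>.\<close>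

definition prj :: "('m::finite \<Rightarrow> 'n::finite) \<Rightarrow> real^'n \<Rightarrow> real^'m" where
  "prj \<iota> x = (\<chi> a. x $ \<iota> a)"

definition ins :: "'n::finite \<Rightarrow> ('m::finite \<Rightarrow> 'n) \<Rightarrow> real \<Rightarrow> real^'m \<Rightarrow> real^'n" where
  "ins j \<iota> t y = (\<chi> i. if i = j then t else y $ (inv \<iota> i))"

definition hyper :: "'n \<Rightarrow> ('m \<Rightarrow> 'n) \<Rightarrow> bool" where
  "hyper j \<iota> \<longleftrightarrow> inj \<iota> \<and> range \<iota> = - {j}"

lemma hyper_exists:
  assumes "CARD('n::finite) = CARD('m::finite) + 1"
  shows "\<exists>\<iota> :: 'm \<Rightarrow> 'n. hyper j \<iota>"
proof -
  have "card (- {j}) = CARD('m)" using assms by (simp add: Compl_eq_Diff_UNIV)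
  then obtain \<iota> where "bij_betw \<iota> (UNIV :: 'm set) (- {j})"
    using finite_same_card_bij[of "UNIV :: 'm set" "- {j}"] by auto
  then show ?thesis by (auto simp: hyper_def bij_betw_def)
qed

context
  fixes j :: "'n::finite" and \<iota> :: "'m::finite \<Rightarrow> 'n"
  assumes hyp: "hyper j \<iota>"
begin

lemma hyper_neq [simp]: "\<iota> a \<noteq> j"
  using hyp by (auto simp: hyper_def)

lemma hyper_inv [simp]: "inv \<iota> (\<iota> a) = a"
  using hyp by (auto simp: hyper_def)

lemma hyper_inv' [simp]: "i \<noteq> j \<Longrightarrow> \<iota> (inv \<iota> i) = i"
  using hyp by (auto simp: hyper_def f_inv_into_f)

lemma hyper_inj [simp]: "\<iota> a = \<iota> b \<longleftrightarrow> a = b"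
  using hyp by (auto simp: hyper_def inj_def)

lemma hyper_all: "(\<forall>i. P i) \<longleftrightarrow> P j \<and> (\<forall>a. P (\<iota> a))"
  using hyper_inv' by metis

lemma ins_j [simp]: "ins j \<iota> t y $ j = t" by (simp add: ins_def)
lemma ins_\<iota> [simp]: "ins j \<iota> t y $ \<iota> a = y $ a" by (simp add: ins_def)
lemma prj_nth: "prj \<iota> x $ a = x $ \<iota> a" by (simp add: prj_def)
lemma prj_ins [simp]: "prj \<iota> (ins j \<iota> t y) = y" by (simp add: vec_eq_iff prj_nth)
lemma ins_prj [simp]: "ins j \<iota> (x $ j) (prj \<iota> x) = x"
  unfolding vec_eq_iff hyper_all by (simp add: prj_nth)

lemma hyper_sum: "(\<Sum>i\<in>UNIV. F i) = F j + (\<Sum>a\<in>UNIV. F (\<iota> a))"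
proof -
  have "UNIV = insert j (range \<iota>)" "j \<notin> range \<iota>" "inj \<iota>" using hyp by (auto simp: hyper_def)
  then show ?thesis by (metis (no_types, lifting) finite sum.insert sum.reindex_cong)
qed

lemma hyper_prod: "(\<Prod>i\<in>UNIV. F i) = F j * (\<Prod>a\<in>UNIV. F (\<iota> a))"
proof -
  have "UNIV = insert j (range \<iota>)" "j \<notin> range \<iota>" "inj \<iota>" using hyp by (auto simp: hyper_def)
  then show ?thesis by (metis (no_types, lifting) finite prod.insert prod.reindex_cong)
qed

lemma det_hyper_block:
  fixes A :: "real^'n^'n"
  assumes "\<And>k. k \<noteq> j \<Longrightarrow> A $ j $ k = 0"
  shows "det A = A $ j $ j * det (\<chi> a b. A $ \<iota> a $ \<iota> b)"
proof -
  have "inj \<iota>" and r: "range \<iota> = - {j}" using hyp by (auto simp: hyper_def)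
  have "det A = (\<Prod>i\<in>- range \<iota>. A $ i $ i) * det (\<chi> a b. A $ \<iota> a $ \<iota> b)"
    by (rule det_diagonal_block) (use assms r \<open>inj \<iota>\<close> in auto)
  then show ?thesis by (simp add: r)
qed

lemma continuous_on_ins [continuous_intros]:
  "continuous_on S f \<Longrightarrow> continuous_on S g \<Longrightarrow> continuous_on S (\<lambda>x. ins j \<iota> (f x) (g x))"
  unfolding ins_def
proof (intro continuous_on_vec_lambda)
  fix i assume "continuous_on S f" "continuous_on S g"
  then show "continuous_on S (\<lambda>x. if i = j then f x else g x $ inv \<iota> i)"
    by (cases "i = j") (auto intro!: continuous_intros)
qed

lemma continuous_on_prj [continuous_intros]:
  "continuous_on S f \<Longrightarrow> continuous_on S (\<lambda>x. prj \<iota> (f x))"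
  unfolding prj_def by (intro continuous_intros)

text \<open>Subtracting from the row \<open>N\<close> its components along the other rows reduces it
  to a multiple of \<open>axis j 1\<close>; the complementary block is then the identity.\<close>

lemma tangent_frame_det:
  fixes w :: "real^'m" and N :: "real^'n"
  shows "det (\<chi> i. if i = j then N else axis i 1 + w $ inv \<iota> i *\<^sub>R axis j 1)
     = N $ j - (\<Sum>a\<in>UNIV. w $ a * N $ \<iota> a)"
proof -
  let ?r = "\<lambda>i. axis i 1 + w $ inv \<iota> i *\<^sub>R axis j 1 :: real^'n"
  let ?\<kappa> = "N $ j - (\<Sum>a\<in>UNIV. w $ a * N $ \<iota> a)"
  let ?A = "\<chi> i. if i = j then N else ?r i"
  let ?x = "- (\<Sum>a\<in>UNIV. N $ \<iota> a *\<^sub>R ?r (\<iota> a))"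
  have rowA: "row i ?A = (if i = j then N else ?r i)" for i by (simp add: row_def vec_eq_iff)
  have sp: "?x \<in> vec.span {row i ?A |i. i \<noteq> j}"
  proof -
    have "row (\<iota> a) ?A \<in> {row i ?A |i. i \<noteq> j}" for a using hyper_neq by blast
    then have "(\<Sum>a\<in>UNIV. N $ \<iota> a *s row (\<iota> a) ?A) \<in> vec.span {row i ?A |i. i \<noteq> j}"
      by (intro vec.span_sum vec.span_scale vec.span_base)
    from vec.span_neg[OF this] show ?thesis unfolding rowA by (simp only: scalar_mult_eq_scaleR hyper_neq if_False hyper_inv)
  qed
  have "det ?A = det (\<chi> k. if k = j then row j ?A + ?x else row k ?A)"
    using det_row_span[OF sp] by simp
  also have "row j ?A + ?x = ?\<kappa> *\<^sub>R axis j 1"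
    unfolding rowA vec_eq_iff hyper_all
    by (simp add: sum_component axis_def hyper_neq[symmetric] if_distrib[of "\<lambda>x. _ * x"] mult.commute cong: if_cong)
  also have "det (\<chi> k. if k = j then ?\<kappa> *\<^sub>R axis j 1 else row k ?A) = ?\<kappa>"
  proof -
    let ?B = "(\<chi> k. if k = j then ?\<kappa> *\<^sub>R axis j 1 else row k ?A) :: real^'n^'n"
    have "det ?B = ?B $ j $ j * det (\<chi> a b. ?B $ \<iota> a $ \<iota> b)"
      by (rule det_hyper_block) (simp add: axis_def)
    moreover have "(\<chi> a b. ?B $ \<iota> a $ \<iota> b) = (mat 1 :: real^'m^'m)"
      unfolding rowA by (auto simp: vec_eq_iff axis_def mat_def)
    ultimately show ?thesis by (simp add: axis_def)
  qed
  finally show ?thesis .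
qed

text \<open>The Gram determinant of the tangent frame \<open>e\<^bsub>\<iota> a\<^esub> + w\<^sub>a e\<^sub>j\<close> is read off from the Gram matrix of
  that frame completed by the unit normal.\<close>

lemma gram_det:
  fixes G :: "real^'n^'n" and w :: "real^'m" and \<nu> :: "real^'n"
  assumes sym: "transpose G = G" and pos: "\<And>v. v \<noteq> 0 \<Longrightarrow> v \<bullet> (G *v v) > 0"
    and s: "s * s = (1::real)" and \<nu>: "\<nu> $ j = s" "\<And>a. \<nu> $ \<iota> a = - s * w $ a"
  defines "q2 \<equiv> \<nu> \<bullet> (matrix_inv G *v \<nu>)"
  defines "p \<equiv> \<lambda>a. axis (\<iota> a) 1 + w $ a *\<^sub>R axis j 1"
  shows "q2 > 0" and "det (\<chi> a b. p a \<bullet> (G *v p b)) = det G * q2"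
proof -
  have inv: "invertible G" using pos posdef_invertible by blast
  let ?M = "matrix_inv G *v \<nu>"
  have GM: "G *v ?M = \<nu>" by (simp add: matrix_vector_mul_assoc matrix_inv_right[OF inv])
  have "\<nu> \<noteq> 0" using \<nu>(1) s by auto
  then have M0: "?M \<noteq> 0" using GM by auto
  have q2': "q2 = ?M \<bullet> (G *v ?M)" unfolding GM q2_def by (simp add: inner_commute)
  then show q: "q2 > 0" using pos[OF M0] by simp
  let ?N = "(1 / sqrt q2) *\<^sub>R ?M"
  have NN: "?N \<bullet> (G *v ?N) = 1"
    using q q2' by (simp add: matrix_vector_mult_scaleR)
  have GN: "G *v ?N = (1 / sqrt q2) *\<^sub>R \<nu>" by (simp add: matrix_vector_mult_scaleR GM)
  have p\<nu>: "p a \<bullet> \<nu> = 0" for a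
    by (simp add: p_def inner_add_left inner_axis' \<nu>)
  have s1: "(G *v x) \<bullet> y = x \<bullet> (G *v y)" for x y
    using inner_transpose_left[of G x y] sym by metis
  define R :: "real^'n^'n" where "R = (\<chi> i. if i = j then ?N else axis i 1 + w $ inv \<iota> i *\<^sub>R axis j 1)"
  have Rj: "R $ j = ?N" and Ra: "R $ \<iota> a = p a" for a by (simp_all add: R_def p_def)
  have RGR: "(R ** G ** transpose R) $ i $ k = R $ i \<bullet> (G *v R $ k)" for i k
  proof -
    have "(R ** G ** transpose R) $ i $ k = (\<Sum>l\<in>UNIV. \<Sum>m\<in>UNIV. R $ i $ m * G $ m $ l * R $ k $ l)"
      by (simp add: matrix_matrix_mult_def transpose_def sum_distrib_right)
    also have "\<dots> = (\<Sum>m\<in>UNIV. \<Sum>l\<in>UNIV. R $ i $ m * G $ m $ l * R $ k $ l)"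
      by (rule sum.swap)
    finally show ?thesis
      by (simp add: inner_vec_def matrix_vector_mult_def sum_distrib_left mult.assoc)
  qed
  \<comment> \<open>The frame vectors are annihilated by the covector \<nu>, hence
    \<open>G\<close>-orthogonal to \<open>?N\<close>: row \<open>j\<close> of the completed Gram
    matrix is 0 off the diagonal and has diagonal entry 1.\<close>
  have "det (R ** G ** transpose R) = (R ** G ** transpose R) $ j $ j * det (\<chi> a b. (R ** G ** transpose R) $ \<iota> a $ \<iota> b)"
  proof (rule det_hyper_block)
    fix k assume "k \<noteq> j"
    then obtain a where k: "k = \<iota> a" using hyper_inv' by metis
    have "R $ j \<bullet> (G *v R $ k) = (G *v ?N) \<bullet> p a" unfolding k Rj Ra s1 ..
    then show "(R ** G ** transpose R) $ j $ k = 0"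
      unfolding RGR GN using p\<nu>[of a] by (simp add: inner_commute)
  qed
  then have 1: "det (\<chi> a b. p a \<bullet> (G *v p b)) = (det R)\<^sup>2 * det G"
    unfolding RGR Rj Ra NN by (simp add: det_mul power2_eq_square mult_ac)
  have "det R = ?N $ j - (\<Sum>a\<in>UNIV. w $ a * ?N $ \<iota> a)"
    unfolding R_def by (rule tangent_frame_det)
  also have "\<dots> = s * (\<nu> \<bullet> ?N)"
  proof -
    have "s * (\<nu> \<bullet> v) = (s * s) * v $ j - (s * s) * (\<Sum>a\<in>UNIV. w $ a * v $ \<iota> a)" for v
      unfolding inner_vec_def hyper_sum by (simp add: \<nu> algebra_simps sum_distrib_left sum_negf)
    from this[of ?N, symmetric] show ?thesis unfolding s mult_1_left .
  qed
  also have "\<nu> \<bullet> ?N = q2 / sqrt q2" by (simp add: q2_def)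
  finally have "det R = s * sqrt q2" using q by (simp add: real_div_sqrt)
  then have "(det R)\<^sup>2 = (s * s) * (sqrt q2)\<^sup>2" by (simp add: power2_eq_square mult_ac)
  then have "(det R)\<^sup>2 = q2" using q s by simp
  then show "det (\<chi> a b. p a \<bullet> (G *v p b)) = det G * q2" using 1 by simp
qed

lemma prod_Basis_vec: "(\<Prod>b\<in>Basis. F b) = (\<Prod>i\<in>UNIV. F (axis i (1::real) :: real^'k::finite))"
proof -
  have B: "Basis = range (\<lambda>i. axis i (1::real) :: real^'k)" by (auto simp: Basis_vec_def)
  have "inj (\<lambda>i. axis i (1::real) :: real^'k)" by (auto simp: inj_def axis_eq_axis)
  then show ?thesis unfolding B by (subst prod.reindex) auto
qed

lemma emeasure_lborel_box_vec:
  assumes "\<And>i. l $ i \<le> u $ i"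
  shows "emeasure lborel (box l (u :: real^'k::finite)) = ennreal (\<Prod>i\<in>UNIV. u $ i - l $ i)"
proof -
  have "emeasure lborel (box l u) = ennreal (\<Prod>b\<in>Basis. (u - l) \<bullet> b)"
    by (rule emeasure_lborel_box) (use assms in \<open>auto simp: Basis_vec_def inner_axis\<close>)
  then show ?thesis by (simp add: prod_Basis_vec inner_axis)
qed

lemma measurable_ins [measurable]: "(\<lambda>(y, t). ins j \<iota> t y) \<in> borel_measurable (lborel \<Otimes>\<^sub>M lborel)"
proof -
  have "(\<lambda>p. ins j \<iota> (snd p) (fst p)) \<in> borel_measurable borel"
    by (intro borel_measurable_continuous_onI continuous_intros)
  then show ?thesis by (simp add: lborel_prod case_prod_beta')
qed

text \<open>Lebesgue measure is determined by boxes, and a box is an interval in direction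
  \<open>j\<close> times a box of one dimension less. This gives Fubini's theorem over the
  hyperplane complementary to \<open>j\<close>.\<close>

lemma lborel_eq_distr_ins:
  "(lborel :: (real^'n) measure) = distr (lborel \<Otimes>\<^sub>M lborel) borel (\<lambda>(y, t). ins j \<iota> t y)"
proof (rule lborel_eqI)
  fix l u :: "real^'n" assume "\<And>b. b \<in> Basis \<Longrightarrow> l \<bullet> b \<le> u \<bullet> b"
  moreover have "axis i 1 \<in> (Basis :: (real^'n) set)" for i by simp
  ultimately have lu: "l $ i \<le> u $ i" for i by (metis cart_eq_inner_axis)
  have "(\<lambda>(y, t). ins j \<iota> t y) -` box l u \<inter> space (lborel \<Otimes>\<^sub>M lborel) = box (prj \<iota> l) (prj \<iota> u) \<times> box (l $ j) (u $ j)"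
    by (auto simp: space_pair_measure mem_box_cart hyper_all prj_nth box_real)
  then have "emeasure (distr (lborel \<Otimes>\<^sub>M lborel) borel (\<lambda>(y, t). ins j \<iota> t y)) (box l u)
     = emeasure lborel (box (prj \<iota> l) (prj \<iota> u)) * emeasure lborel (box (l $ j) (u $ j))"
    by (simp add: emeasure_distr lborel.emeasure_pair_measure_Times)
  also have "\<dots> = ennreal (\<Prod>a\<in>UNIV. u $ \<iota> a - l $ \<iota> a) * ennreal (u $ j - l $ j)"
    by (simp add: emeasure_lborel_box_vec lu prj_nth box_real)
  also have "\<dots> = ennreal (\<Prod>i\<in>UNIV. u $ i - l $ i)"
    unfolding hyper_prod by (simp add: ennreal_mult[symmetric] prod_nonneg lu mult.commute)
  finally show "emeasure (distr (lborel \<Otimes>\<^sub>M lborel) borel (\<lambda>(y, t). ins j \<iota> t y)) (box l u)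
     = ennreal (\<Prod>b\<in>Basis. (u - l) \<bullet> b)"
    by (simp add: prod_Basis_vec inner_axis)
qed simp

end

section \<open>Integrals of derivatives with compact support, and a cutoff function\<close>

lemma Ck_on_1_differentiable: "open S \<Longrightarrow> Ck_on 1 S f \<Longrightarrow> x \<in> S \<Longrightarrow> f differentiable at x"
  using Ck_on_SucD1[of S 0 f x] by simp

lemma Ck_on_1_partial: "open S \<Longrightarrow> Ck_on 1 S f \<Longrightarrow> continuous_on S (partial UNIV i f)"
  using Ck_on_SucD2[of S 0 f i] by simp

lemma partial_zero_open:
  assumes "open U" "x \<in> U" "\<And>y. y \<in> U \<Longrightarrow> f y = 0" shows "partial UNIV i f x = 0"
  using partial_cong_open[OF assms(1,2), of f "\<lambda>_. 0"] assms(3) by simp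

text \<open>Every point lies in \<open>S\<close> or in the complement of \<open>K\<close>, which is
  open and on which the function is 0; regularity is local.\<close>

lemma Ck_on_UNIV_compact_support:
  assumes "open S" "compact K" "K \<subseteq> S" "Ck_on k S f" "\<And>x. x \<notin> K \<Longrightarrow> f x = (0::real)"
  shows "Ck_on k UNIV f"
proof (rule Ck_on_local)
  fix x
  have oK: "open (- K)" using assms(2) by (simp add: compact_imp_closed open_Compl)
  show "\<exists>T. open T \<and> x \<in> T \<and> Ck_on k (UNIV \<inter> T) f"
  proof (cases "x \<in> S")
    case False
    have "Ck_on k (- K) f \<longleftrightarrow> Ck_on k (- K) (\<lambda>x. 0 :: real)" by (rule Ck_on_cong[OF oK]) (simp add: assms)
    then show ?thesis using oK False assms(3) by (intro exI[of _ "- K"]) auto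
  qed (use assms in auto)
qed simp

text \<open>The integral of \<open>F\<close> is invariant under translations in the direction \<open>i\<close>; differentiate.\<close>

lemma integral_partial_compact_support:
  fixes F :: "real^'n \<Rightarrow> real"
  assumes C1: "Ck_on 1 UNIV F" and K: "compact K" "\<And>x. x \<notin> K \<Longrightarrow> F x = 0"
  shows "integrable lborel (partial UNIV i F)" "(LINT x|lborel. partial UNIV i F x) = 0"
proof -
  let ?D = "partial UNIV i F" and ?e = "axis i 1 :: real^'n"
  have oK: "open (- K)" using K(1) by (simp add: compact_imp_closed open_Compl)
  have D0: "?D x = 0" if "x \<notin> K" for x
    by (rule partial_zero_open[OF oK]) (use that K in auto)
  have cD: "continuous_on UNIV ?D" by (rule Ck_on_1_partial[OF open_UNIV C1])
  have cF: "continuous_on UNIV F" by (rule Ck_on_continuous[OF C1])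
  have int: "integrable lborel f" if "continuous_on UNIV f" "\<And>x. x \<notin> K \<Longrightarrow> f x = 0" for f :: "real^'n \<Rightarrow> real"
  proof -
    have "integrable lborel (\<lambda>x. indicator K x *\<^sub>R f x)"
      by (rule borel_integrable_compact[OF K(1)]) (use that continuous_on_subset in blast)
    moreover have "(\<lambda>x. indicator K x *\<^sub>R f x) = f"
      using that(2) by (intro ext) (metis indicator_simps mult_zero_left mult_1 real_scaleR_def)
    ultimately show ?thesis by simp
  qed
  show "integrable lborel ?D" by (rule int[OF cD D0])
  have iF: "integrable lborel F" by (rule int[OF cF K(2)])
  obtain M where M: "\<And>x. x \<in> K \<Longrightarrow> \<bar>?D x\<bar> \<le> M"
    using compact_imp_bounded[OF compact_continuous_image[OF continuous_on_subset[OF cD] K(1)]]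
    by (auto simp: bounded_iff)
  define M' where "M' = max M 0"
  have M': "\<bar>?D x\<bar> \<le> M'" for x using M[of x] D0[of x] by (cases "x \<in> K") (auto simp: M'_def)
  have deriv_line: "((\<lambda>t. F (y + t *\<^sub>R ?e)) has_real_derivative ?D (y + t *\<^sub>R ?e)) (at t)" for y t
  proof -
    have 1: "((\<lambda>t. y + t *\<^sub>R ?e) has_derivative (\<lambda>t. t *\<^sub>R ?e)) (at t)"
      by (auto intro!: derivative_eq_intros)
    have 2: "F differentiable at (y + t *\<^sub>R ?e)" by (rule Ck_on_1_differentiable[OF open_UNIV C1 UNIV_I])
    show ?thesis
      using has_derivative_compose[OF 1 has_derivative_partial_at[OF 2]]
      by (simp add: has_field_derivative_def mult.commute[of _ "partial _ _ _ _"] axis_def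
          if_distrib[of "\<lambda>x. _ * x"] if_distrib[of "\<lambda>x. x * _"] cong: if_cong)
  qed
  have lip: "\<bar>F (x + t *\<^sub>R ?e) - F x\<bar> \<le> M' * t" if t: "t > 0" for x t
  proof -
    obtain z where "F (x + t *\<^sub>R ?e) - F (x + 0 *\<^sub>R ?e) = (t - 0) * ?D (x + z *\<^sub>R ?e)"
      using MVT2[OF t, of "\<lambda>t. F (x + t *\<^sub>R ?e)" "\<lambda>t. ?D (x + t *\<^sub>R ?e)"] deriv_line by blast
    then show ?thesis using M'[of "x + z *\<^sub>R ?e"] that by (simp add: abs_mult mult.commute)
  qed
  obtain R where R: "\<And>x. x \<in> K \<Longrightarrow> norm x \<le> R"
    using compact_imp_bounded[OF K(1)] by (auto simp: bounded_iff)
  define s where "s n = 1 / real (Suc n)" for n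
  have s: "s n > 0" "s n \<le> 1" for n by (auto simp: s_def)
  have s0: "s \<longlonglongrightarrow> 0" unfolding s_def using LIMSEQ_inverse_real_of_nat by (simp add: inverse_eq_divide)
  let ?q = "\<lambda>n x. (F (x + s n *\<^sub>R ?e) - F x) / s n"
  have cFt: "continuous_on UNIV (\<lambda>x. F (x + c))" for c
    by (rule continuous_on_compose2[OF cF]) (auto intro!: continuous_intros)
  \<comment> \<open>Since \<open>s n\<close> is at most 1, all difference quotients vanish off the
    ball of radius \<open>R + 1\<close>; together with the Lipschitz bound this gives one dominating
    function.\<close>
  have conv: "(\<lambda>n. LINT x|lborel. ?q n x) \<longlonglongrightarrow> (LINT x|lborel. ?D x)"
  proof (rule integral_dominated_convergence[where w="\<lambda>x. M' * indicator (cball 0 (R + 1)) x"])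
    show "?D \<in> borel_measurable lborel" using cD borel_measurable_continuous_onI by auto
    show "?q n \<in> borel_measurable lborel" for n
    proof -
      have "continuous_on UNIV (?q n)" using s(1)[of n] by (intro continuous_intros cF cFt) auto
      then show ?thesis by (simp add: borel_measurable_continuous_onI)
    qed
    show "integrable lborel (\<lambda>x. M' * indicator (cball 0 (R + 1)) x)"
      using emeasure_bounded_finite[OF bounded_cball, of 0 "R + 1"]
      by (intro integrable_mult_right integrable_real_indicator) auto
    show "AE x in lborel. (\<lambda>n. ?q n x) \<longlonglongrightarrow> ?D x"
    proof (rule AE_I2)
      fix x
      have "((\<lambda>h. (F (x + h *\<^sub>R ?e) - F x) / h) \<longlongrightarrow> ?D x) (at 0)"
        using deriv_line[of x 0] by (simp add: DERIV_def)
      then have "((\<lambda>h. (F (x + h *\<^sub>R ?e) - F x) / h) \<circ> s) \<longlonglongrightarrow> ?D x"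
        unfolding tendsto_at_iff_sequentially using s0 s(1) by (auto simp: less_le dest!: spec[of _ s])
      then show "(\<lambda>n. ?q n x) \<longlonglongrightarrow> ?D x" by (simp add: o_def)
    qed
    show "AE x in lborel. norm (?q n x) \<le> M' * indicator (cball 0 (R + 1)) x" for n
    proof (rule AE_I2)
      fix x
      show "norm (?q n x) \<le> M' * indicator (cball 0 (R + 1)) x"
      proof (cases "x \<in> cball 0 (R + 1)")
        case True
        then show ?thesis using lip[OF s(1), of x n] s(1)[of n] by (simp add: pos_divide_le_eq)
      next
        case False
        then have nx: "norm x > R + 1" by simp
        moreover have "norm (x + s n *\<^sub>R ?e) \<ge> norm x - s n"
          using norm_diff_ineq[of x "s n *\<^sub>R ?e"] s(1)[of n] by simp
        ultimately have "x \<notin> K" "x + s n *\<^sub>R ?e \<notin> K" using R s(2)[of n] by (smt (verit))+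
        then show ?thesis using K(2) False by simp
      qed
    qed
  qed
  have "(LINT x|lborel. ?q n x) = 0" for n
  proof -
    let ?c = "s n *\<^sub>R ?e"
    have m: "F \<in> borel_measurable borel" using cF borel_measurable_continuous_onI by auto
    have "(LINT x|lborel. F x) = (LINT x|distr lborel borel ((+) ?c). F x)" by (simp add: lborel_distr_plus)
    also have "\<dots> = (LINT x|lborel. F (?c + x))" by (rule integral_distr) (use m in auto)
    finally have e: "(LINT x|lborel. F (x + ?c)) = (LINT x|lborel. F x)" by (simp add: add.commute)
    have "integrable (distr lborel borel ((+) ?c)) F" using iF by (simp add: lborel_distr_plus)
    then have "integrable lborel (\<lambda>x. F (x + ?c))"
      by (subst (asm) integrable_distr_eq) (use m in \<open>auto simp: add.commute\<close>)
    then show ?thesis using e iF by simp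
  qed
  then show "(LINT x|lborel. ?D x) = 0" using conv by (simp only: LIMSEQ_const_iff)
qed

text \<open>The elementary \<open>C\<^sup>1\<close> function vanishing on a half-line, from which
  both the cutoff and the bump functions of the partition of unity are built.\<close>

lemma DERIV_max_square: "((\<lambda>t. (max 0 t)\<^sup>2) has_real_derivative 2 * max 0 t) (at (t::real))"
proof -
  consider "t > 0" | "t < 0" | "t = 0" by linarith
  then show ?thesis
  proof cases
    case 1
    have "((\<lambda>t. t\<^sup>2) has_real_derivative 2 * t) (at t)" by (auto intro!: derivative_eq_intros)
    then have "((\<lambda>t. (max 0 t)\<^sup>2) has_real_derivative 2 * t) (at t)"
      by (rule has_field_derivative_transform_within_open[of _ _ _ "{0<..}"]) (use 1 in auto)
    then show ?thesis using 1 by simp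
  next
    case 2
    have "((\<lambda>t. 0) has_real_derivative 0) (at t)" by simp
    then have "((\<lambda>t. (max 0 t)\<^sup>2) has_real_derivative 0) (at t)"
      by (rule has_field_derivative_transform_within_open[of _ _ _ "{..<0}"]) (use 2 in auto)
    then show ?thesis using 2 by simp
  next
    case 3
    have "((\<lambda>h::real. (max 0 h)\<^sup>2 / h) \<longlongrightarrow> 0) (at 0)"
    proof (rule Lim_null_comparison[of _ "\<lambda>h. \<bar>h\<bar>"])
      have "norm ((max 0 h)\<^sup>2 / h) \<le> \<bar>h\<bar>" for h :: real
        by (cases "h > 0") (auto simp: power2_eq_square max_def)
      then show "\<forall>\<^sub>F h in at 0. norm ((max 0 h)\<^sup>2 / h) \<le> \<bar>h\<bar>" for h :: real by simp
      show "((\<lambda>h::real. \<bar>h\<bar>) \<longlongrightarrow> 0) (at 0)" by (rule tendsto_rabs_zero) (rule tendsto_ident_at)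
    qed
    then show ?thesis using 3 by (simp add: DERIV_def)
  qed
qed

text \<open>The quotient \<open>p / (p + q)\<close>, where \<open>p\<close> vanishes below 1 and
  \<open>q\<close> above 2, so that the denominator is never 0. The transition lies away from 0, so
  a field cut off at small height vanishes near the graph. The integral of \<beta>' is its total
  increment; this makes the limit of the flux exact.\<close>

lemma C1_cutoff_exists:
  obtains \<beta> \<beta>' :: "real \<Rightarrow> real"
  where "\<And>t. (\<beta> has_real_derivative \<beta>' t) (at t)" "continuous_on UNIV \<beta>'"
    "\<And>t. t \<le> 1 \<Longrightarrow> \<beta> t = 0" "\<And>t. t \<ge> 2 \<Longrightarrow> \<beta> t = 1" "\<And>t. 0 \<le> \<beta> t" "\<And>t. \<beta> t \<le> 1"
    "\<And>t. t \<notin> {1..2} \<Longrightarrow> \<beta>' t = 0" "integrable lborel \<beta>'" "(LINT t|lborel. \<beta>' t) = 1"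
proof -
  define p q where "p t = (max 0 (t - 1))\<^sup>2" and "q t = (max 0 (2 - t))\<^sup>2" for t :: real
  define p' q' where "p' t = 2 * max 0 (t - 1)" and "q' t = - 2 * max 0 (2 - t)" for t :: real
  have p: "(p has_real_derivative p' t) (at t)" for t
  proof -
    have "((\<lambda>t. t - 1) has_real_derivative 1) (at t)" by (auto intro!: derivative_eq_intros)
    from DERIV_chain2[OF DERIV_max_square this] show ?thesis by (simp add: p_def[abs_def] p'_def)
  qed
  have q: "(q has_real_derivative q' t) (at t)" for t
  proof -
    have "((\<lambda>t. 2 - t) has_real_derivative - 1) (at t)" by (auto intro!: derivative_eq_intros)
    from DERIV_chain2[OF DERIV_max_square this] show ?thesis by (simp add: q_def[abs_def] q'_def)
  qed
  have pos: "p t + q t > 0" for t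
  proof (cases "t > 1")
    case True then have "p t > 0" "q t \<ge> 0" by (auto simp: p_def q_def)
    then show ?thesis by simp
  next
    case False then have "p t \<ge> 0" "q t > 0" by (auto simp: p_def q_def)
    then show ?thesis by simp
  qed
  define \<beta> \<beta>' where "\<beta> t = p t / (p t + q t)" and "\<beta>' t = (p' t * (p t + q t) - p t * (p' t + q' t)) / ((p t + q t) * (p t + q t))" for t
  have d: "(\<beta> has_real_derivative \<beta>' t) (at t)" for t
    unfolding \<beta>_def[abs_def] \<beta>'_def using pos[of t]
    by (intro DERIV_divide DERIV_add p q) auto
  have c: "continuous_on UNIV \<beta>'"
  proof -
    have "continuous_on UNIV p" "continuous_on UNIV q" "continuous_on UNIV p'" "continuous_on UNIV q'"
      unfolding p_def[abs_def] q_def[abs_def] p'_def[abs_def] q'_def[abs_def] by (intro continuous_intros)+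
    then show ?thesis unfolding \<beta>'_def[abs_def] using pos
      by (intro continuous_intros) (auto simp: less_le)
  qed
  have 0: "\<beta> t = 0" if "t \<le> 1" for t using that by (simp add: \<beta>_def p_def)
  have 1: "\<beta> t = 1" if "t \<ge> 2" for t using that pos[of t] by (simp add: \<beta>_def q_def)
  have out: "\<beta>' t = 0" if "t \<notin> {1..2}" for t
    using that by (cases "t < 1") (auto simp: \<beta>'_def p_def q_def p'_def q'_def)
  have "has_bochner_integral lborel (\<lambda>t. \<beta>' t * indicator {1..2} t) (\<beta> 2 - \<beta> 1)"
    by (rule has_bochner_integral_FTC_Icc_real) (use d c continuous_on_eq_continuous_at[OF open_UNIV, of \<beta>'] in auto)
  moreover have "(\<lambda>t. \<beta>' t * indicator {1..2} t) = \<beta>'"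
  proof
    fix t show "\<beta>' t * indicator {1..2} t = \<beta>' t" using out[of t] by (cases "t \<in> {1..2}") simp_all
  qed
  ultimately have "has_bochner_integral lborel \<beta>' 1" by (simp add: 0 1)
  then have "integrable lborel \<beta>'" "(LINT t|lborel. \<beta>' t) = 1"
    by (simp_all add: has_bochner_integral_iff)
  moreover have "0 \<le> \<beta> t" "\<beta> t \<le> 1" for t
    using pos[of t] by (auto simp: \<beta>_def p_def q_def divide_le_eq intro!: divide_nonneg_nonneg)
  ultimately show ?thesis using that[OF d c 0 1 _ _ out] by blast
qed

text \<open>In \<open>Q\<close>, the domain \<open>D\<close> lies on one side of the graph of \<open>h\<close> over the coordinate hyperplane
  complementary to \<open>j\<close>; the side is given by the sign \<open>s\<close>.\<close>

definition graph_fun :: "'n::finite \<Rightarrow> ('m::finite \<Rightarrow> 'n) \<Rightarrow> (real^'m \<Rightarrow> real) \<Rightarrow> real \<Rightarrow> real^'n \<Rightarrow> real" where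
  "graph_fun j \<iota> h s z = s * (z $ j - h (prj \<iota> z))"

text \<open>The Euclidean gradient of \<open>graph_fun\<close>, a conormal of the graph; it depends
  only on the projection to the hyperplane.\<close>

definition graph_normal :: "'n::finite \<Rightarrow> ('m::finite \<Rightarrow> 'n) \<Rightarrow> (real^'m \<Rightarrow> real) \<Rightarrow> real \<Rightarrow> real^'m \<Rightarrow> real^'n" where
  "graph_normal j \<iota> h s y = (\<chi> i. if i = j then s else - s * partial UNIV (inv \<iota> i) h y)"

definition graph_patch :: "(real^'n::finite) set \<Rightarrow> (real^'n) set \<Rightarrow> 'n \<Rightarrow> ('m::finite \<Rightarrow> 'n)
    \<Rightarrow> (real^'m) set \<Rightarrow> (real^'m \<Rightarrow> real) \<Rightarrow> real \<Rightarrow> bool" where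
  "graph_patch D Q j \<iota> W h s \<longleftrightarrow> hyper j \<iota> \<and> open Q \<and> open W \<and> Ck_on 2 W h \<and> s * s = 1 \<and>
     (\<forall>z\<in>Q. prj \<iota> z \<in> W \<and> (z \<in> D \<longleftrightarrow> graph_fun j \<iota> h s z < 0)) \<and> (\<forall>y\<in>W. ins j \<iota> (h y) y \<in> Q)"

locale graph_patch_loc =
  fixes D Q :: "(real^'n::finite) set" and j :: 'n and \<iota> :: "'m::finite \<Rightarrow> 'n"
    and W :: "(real^'m) set" and h :: "real^'m \<Rightarrow> real" and s :: real
  assumes gp: "graph_patch D Q j \<iota> W h s"
begin

lemma hyp: "hyper j \<iota>" and open_Q: "open Q" and open_W: "open W" and h2: "Ck_on 2 W h"
  and ss: "s * s = 1" and prjW: "z \<in> Q \<Longrightarrow> prj \<iota> z \<in> W"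
  and D_iff: "z \<in> Q \<Longrightarrow> z \<in> D \<longleftrightarrow> graph_fun j \<iota> h s z < 0"
  and insQ: "y \<in> W \<Longrightarrow> ins j \<iota> (h y) y \<in> Q"
  using gp by (auto simp: graph_patch_def)

abbreviation "g \<equiv> graph_fun j \<iota> h s"
abbreviation "nu \<equiv> graph_normal j \<iota> h s"
abbreviation "par y \<equiv> ins j \<iota> (h y) y"

lemmas [simp] = hyper_neq[OF hyp] hyper_inv[OF hyp] hyper_inj[OF hyp] ins_j[OF hyp] ins_\<iota>[OF hyp] prj_ins[OF hyp] ins_prj[OF hyp]

lemma nu_j [simp]: "nu y $ j = s" and nu_\<iota> [simp]: "nu y $ \<iota> a = - s * partial UNIV a h y"
  by (simp_all add: graph_normal_def)

lemma Ck_prj: "open S \<Longrightarrow> Ck_on k S (prj \<iota>)"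
  by (rule Ck_on_vecI) (simp_all add: prj_def)

lemma Ck_g: "Ck_on 2 Q g"
proof -
  have "Ck_on 2 Q (\<lambda>z. s * (z $ j - h (prj \<iota> z)))"
    by (intro Ck_on_mult Ck_on_diff Ck_on_compose[OF open_Q open_W Ck_prj] open_Q Ck_on_const Ck_on_nth h2)
       (use prjW in auto)
  then show ?thesis by (simp add: graph_fun_def[abs_def])
qed

lemma h1: "Ck_on 1 W h" by (rule Ck_on_mono[OF h2]) simp
lemma g1: "Ck_on 1 Q g" by (rule Ck_on_mono[OF Ck_g]) simp
lemma cont_g: "continuous_on Q g" by (rule Ck_on_continuous[OF Ck_g])
lemma cont_h: "continuous_on W h" by (rule Ck_on_continuous[OF h2])
lemma diff_h: "y \<in> W \<Longrightarrow> h differentiable at y" by (rule Ck_on_1_differentiable[OF open_W h1])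

lemma partial_g: "z \<in> Q \<Longrightarrow> partial UNIV i g z = nu (prj \<iota> z) $ i"
proof -
  assume z: "z \<in> Q"
  have dp: "prj \<iota> differentiable at z" using Ck_on_1_differentiable[OF open_UNIV Ck_prj[OF open_UNIV] UNIV_I] .
  have dh: "h differentiable at (prj \<iota> z)" by (rule diff_h[OF prjW[OF z]])
  have dhp: "(\<lambda>x. h (prj \<iota> x)) differentiable at z" using differentiable_compose[OF dh dp] .
  have dj: "(\<lambda>z. z $ j) differentiable at z" by (rule vec_differentiableD) simp
  have "partial UNIV i g z = s * partial UNIV i (\<lambda>z. z $ j - h (prj \<iota> z)) z"
    unfolding graph_fun_def[abs_def] by (subst partial_mult) (use dj dhp in auto)
  also have "partial UNIV i (\<lambda>z. z $ j - h (prj \<iota> z)) z = (if i = j then 1 else 0) -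
      (\<Sum>a\<in>UNIV. (if i = \<iota> a then 1 else 0) * partial UNIV a h (prj \<iota> z))"
    unfolding partial_diff[OF dj dhp] partial_compose[OF dp dh] by (simp add: prj_def)
  finally have e: "partial UNIV i g z = s * ((if i = j then 1 else 0) -
      (\<Sum>a\<in>UNIV. (if i = \<iota> a then 1 else 0) * partial UNIV a h (prj \<iota> z)))" .
  show ?thesis
  proof (cases "i = j")
    case True then show ?thesis unfolding e by (simp add: hyper_neq[OF hyp, symmetric])
  next
    case False
    then obtain b where b: "i = \<iota> b" using hyper_inv'[OF hyp] by metis
    have "(\<Sum>a\<in>UNIV. (if i = \<iota> a then 1 else 0) * partial UNIV a h (prj \<iota> z)) = partial UNIV b h (prj \<iota> z)"
      by (simp add: b if_distrib[of "\<lambda>x. x * _"] cong: if_cong)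
    then show ?thesis unfolding e by (simp add: b)
  qed
qed

lemma cont_nu: "continuous_on W nu"
proof -
  have "continuous_on W (\<lambda>y. if i = j then s else - s * partial UNIV (inv \<iota> i) h y)" for i
    using Ck_on_1_partial[OF open_W h1] by (cases "i = j") (auto intro!: continuous_intros)
  then show ?thesis unfolding graph_normal_def[abs_def] by (rule continuous_on_vec_lambda)
qed

lemma g_par [simp]: "g (par y) = 0" by (simp add: graph_fun_def)

lemma par_Q: "y \<in> W \<Longrightarrow> par y \<in> Q" by (rule insQ)

lemma cont_par: "continuous_on W par"
  by (intro continuous_on_ins[OF hyp] cont_h continuous_on_id)

text \<open>For the cut-off field the total divergence integrates to 0, so a volume term equals a
  flux term for every width. The volume term converges by dominated convergence, using the bound
  \<open>B\<close> and the compact \<open>K\<close>. In the flux term the height is rescaled by the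
  width, which turns a concentrating integrand into one that converges pointwise under a fixed
  bound.\<close>

lemma divergence_patch:
  assumes oD: "open D" and K: "compact K" "K \<subseteq> Q"
    and cZ: "continuous_on {z \<in> Q. g z \<le> 0} Z"
    and C1: "\<And>i. Ck_on 1 (D \<inter> Q) (\<lambda>z. Z z $ i)"
    and supp: "\<And>z. z \<in> Q \<Longrightarrow> g z \<le> 0 \<Longrightarrow> z \<notin> K \<Longrightarrow> Z z = 0"
    and bdd: "\<And>z. z \<in> D \<inter> Q \<Longrightarrow> \<bar>\<Sum>i\<in>UNIV. partial UNIV i (\<lambda>z. Z z $ i) z\<bar> \<le> B"
  shows "(LINT z:D \<inter> Q|lborel. \<Sum>i\<in>UNIV. partial UNIV i (\<lambda>z. Z z $ i) z) = (LINT y:W|lborel. Z (par y) \<bullet> nu y)"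
proof -
  obtain \<beta> \<beta>' :: "real \<Rightarrow> real"
    where \<beta>: "\<And>t. (\<beta> has_real_derivative \<beta>' t) (at t)" "continuous_on UNIV \<beta>'"
    "\<And>t. t \<le> 1 \<Longrightarrow> \<beta> t = 0" "\<And>t. t \<ge> 2 \<Longrightarrow> \<beta> t = 1" "\<And>t. 0 \<le> \<beta> t" "\<And>t. \<beta> t \<le> 1"
    "\<And>t. t \<notin> {1..2} \<Longrightarrow> \<beta>' t = 0" "integrable lborel \<beta>'" "(LINT t|lborel. \<beta>' t) = 1"
    by (rule C1_cutoff_exists) blast
  let ?O = "D \<inter> Q"
  have oO: "open ?O" using oD open_Q by auto
  let ?C = "{z \<in> Q. g z \<le> 0}"
  have OC: "?O \<subseteq> ?C" using D_iff by auto
  define dv where "dv z = (\<Sum>i\<in>UNIV. partial UNIV i (\<lambda>z. Z z $ i) z)" for z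
  have cdv: "continuous_on ?O dv"
    unfolding dv_def[abs_def] by (intro continuous_on_sum Ck_on_1_partial oO C1)
  have diffZ: "(\<lambda>z. Z z $ i) differentiable at z" if "z \<in> ?O" for z i
    by (rule Ck_on_1_differentiable[OF oO C1 that])
  have dv0: "dv z = 0" if "z \<in> ?O" "z \<notin> K" for z
  proof -
    have "open (?O \<inter> - K)" using oO K(1) by (simp add: compact_imp_closed open_Int open_Compl)
    then have "partial UNIV i (\<lambda>z. Z z $ i) z = 0" for i
      by (rule partial_zero_open) (use that supp OC in auto)
    then show ?thesis by (simp add: dv_def)
  qed
  define \<epsilon> where "\<epsilon> n = 1 / real (Suc n)" for n
  have \<epsilon>: "\<epsilon> n > 0" for n by (auto simp: \<epsilon>_def)
  have \<epsilon>0: "\<epsilon> \<longlonglongrightarrow> 0" unfolding \<epsilon>_def using LIMSEQ_inverse_real_of_nat by (simp add: inverse_eq_divide)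
  \<comment> \<open>Inside \<open>D\<close> the value \<open>- g z\<close> is the height below the
    graph. The cutoff is 0 up to height \<open>\<epsilon> n\<close> and 1 from height
    \<open>2 * \<epsilon> n\<close> on.\<close>
  define \<phi> where "\<phi> n z = \<beta> (- g z / \<epsilon> n)" for n z
  define flux where "flux n z = indicator ?O z * ((1 / \<epsilon> n) * \<beta>' (- g z / \<epsilon> n) * (Z z \<bullet> nu (prj \<iota> z)))" for n z
  define vol where "vol n z = indicator ?O z * (\<phi> n z * dv z)" for n z
  have cK: "closed K" using K(1) by (rule compact_imp_closed)
  have cl: "closed (K \<inter> g -` T)" if "closed T" for T
    by (rule continuous_closed_preimage[OF continuous_on_subset[OF cont_g K(2)] cK that])
  have KC: "compact (K \<inter> ?C)"
  proof -
    have "K \<inter> ?C = K \<inter> (K \<inter> g -` {..0})" using K(2) by auto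
    then show ?thesis using compact_Int_closed[OF K(1) cl[OF closed_atMost]] by simp
  qed
  \<comment> \<open>A compact subset of the open set \<open>?O\<close> outside of which the cut-off
    field vanishes, so that its extension by zero is \<open>C\<^sup>1\<close> on the whole
    space.\<close>
  define L where "L n = K \<inter> g -` {..- \<epsilon> n}" for n
  have L: "compact (L n)" "L n \<subseteq> ?O" for n
  proof -
    have "L n = K \<inter> (K \<inter> g -` {..- \<epsilon> n})" by (auto simp: L_def)
    then show "compact (L n)" using compact_Int_closed[OF K(1) cl[OF closed_atMost]] by simp
    show "L n \<subseteq> ?O" using K(2) D_iff \<epsilon>[of n] by (fastforce simp: L_def)
  qed
  have off: "\<phi> n z *\<^sub>R Z z = 0" if "z \<in> ?O" "z \<notin> L n" for n z
  proof (cases "z \<in> K")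
    case True
    then have "- \<epsilon> n < g z" using that(2) by (simp add: L_def)
    then have "- g z / \<epsilon> n < 1" using \<epsilon>[of n] by (simp add: pos_less_divide_eq)
    then show ?thesis using \<beta>(3) by (simp add: \<phi>_def)
  qed (use that supp OC in auto)
  have g1O: "Ck_on 1 ?O (\<lambda>z. - g z / \<epsilon> n)" for n
  proof -
    have "Ck_on 1 ?O (\<lambda>z. (- 1 / \<epsilon> n) * g z)"
      by (intro Ck_on_mult Ck_on_const oO Ck_on_subset[OF open_Q oO _ g1]) auto
    then show ?thesis by simp
  qed
  have \<phi>1: "Ck_on 1 ?O (\<phi> n)" for n
    unfolding \<phi>_def[abs_def]
    by (rule Ck_on_1_real_compose[OF oO g1O \<beta>(1)]) (use \<beta>(2) continuous_on_subset in blast)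
  have d\<phi>: "partial UNIV i (\<phi> n) z = \<beta>' (- g z / \<epsilon> n) * (- 1 / \<epsilon> n) * nu (prj \<iota> z) $ i" if "z \<in> ?O" for n z i
  proof -
    have gd: "g differentiable at z" using that by (intro Ck_on_1_differentiable[OF open_Q g1]) auto
    have "partial UNIV i (\<lambda>z. (- 1 / \<epsilon> n) * g z) z = (- 1 / \<epsilon> n) * nu (prj \<iota> z) $ i"
      by (subst partial_mult[OF _ gd]) (use that partial_g in auto)
    then show ?thesis
      unfolding \<phi>_def[abs_def]
      using partial_real_compose[OF Ck_on_1_differentiable[OF oO g1O[of n] that] \<beta>(1), of i] by simp
  qed
  define F where "F n i z = (if z \<in> ?O then \<phi> n z * Z z $ i else 0)" for n i z
  have F1: "Ck_on 1 UNIV (F n i)" and F0: "z \<notin> L n \<Longrightarrow> F n i z = 0" for n i z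
  proof -
    show F0: "F n i z = 0" if "z \<notin> L n" for z
      using off[of z n] that by (auto simp: F_def vec_eq_iff)
    have "Ck_on 1 ?O (\<lambda>z. \<phi> n z * Z z $ i)" by (intro Ck_on_mult oO \<phi>1 C1)
    moreover have "Ck_on 1 ?O (F n i) \<longleftrightarrow> Ck_on 1 ?O (\<lambda>z. \<phi> n z * Z z $ i)"
      by (rule Ck_on_cong[OF oO]) (simp add: F_def)
    ultimately show "Ck_on 1 UNIV (F n i)"
      using Ck_on_UNIV_compact_support[OF oO L] F0 by blast
  qed
  have divF: "(\<Sum>i\<in>UNIV. partial UNIV i (F n i) z) = vol n z - flux n z" for n z
  proof (cases "z \<in> ?O")
    case True
    have "partial UNIV i (F n i) z = partial UNIV i (\<lambda>z. \<phi> n z * Z z $ i) z" for i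
      by (rule partial_cong_open[OF oO True]) (simp add: F_def)
    moreover have "partial UNIV i (\<lambda>z. \<phi> n z * Z z $ i) z = \<phi> n z * partial UNIV i (\<lambda>z. Z z $ i) z
       + \<beta>' (- g z / \<epsilon> n) * (- 1 / \<epsilon> n) * nu (prj \<iota> z) $ i * Z z $ i" for i
      using partial_mult[OF Ck_on_1_differentiable[OF oO \<phi>1 True] diffZ[OF True]] d\<phi>[OF True] by simp
    ultimately show ?thesis using True
      by (simp add: vol_def flux_def dv_def inner_vec_def sum.distrib sum_distrib_left sum_subtractf mult_ac)
  next
    case False
    have "open (- L n)" using L(1) by (simp add: compact_imp_closed open_Compl)
    then have "partial UNIV i (F n i) z = 0" for i
      by (rule partial_zero_open) (use False L(2) F0 in auto)
    then show ?thesis using False by (simp add: vol_def flux_def)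
  qed
  have int_diff: "integrable lborel (\<lambda>z. vol n z - flux n z)" "(LINT z|lborel. vol n z - flux n z) = 0" for n
    using integral_partial_compact_support[OF F1 L(1) F0] unfolding divF[symmetric] by auto
  have ms: "(\<lambda>z. indicator ?O z * f z) \<in> borel_measurable borel" if "continuous_on ?O f" for f :: "_ \<Rightarrow> real"
    using borel_measurable_continuous_on_indicator[OF _ that] oO by simp
  have c\<phi>: "continuous_on ?O (\<phi> n)" for n by (rule Ck_on_continuous[OF \<phi>1])
  have vol_m: "vol n \<in> borel_measurable borel" for n
    unfolding vol_def[abs_def] by (intro ms continuous_intros c\<phi> cdv)
  have dv_m: "(\<lambda>z. indicator ?O z * dv z) \<in> borel_measurable borel" by (intro ms cdv)
  define B' where "B' = max B 0"
  have w_int: "integrable lborel (\<lambda>z. B' * indicator K z)"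
    using K(1) by (intro integrable_mult_right integrable_real_indicator)
      (auto simp: cK compact_imp_bounded emeasure_bounded_finite[unfolded infinity_ennreal_def])
  have vol_bd: "norm (vol n z) \<le> B' * indicator K z" for n z
  proof (cases "z \<in> ?O \<and> z \<in> K")
    case True
    then have "\<bar>dv z\<bar> \<le> B'" using bdd[of z] by (auto simp: dv_def B'_def)
    moreover have "\<bar>\<phi> n z\<bar> \<le> 1" using \<beta>(5,6) by (simp add: \<phi>_def)
    ultimately have "\<bar>\<phi> n z\<bar> * \<bar>dv z\<bar> \<le> 1 * B'" by (intro mult_mono) auto
    then show ?thesis using True by (simp add: vol_def abs_mult)
  next
    case False
    then show ?thesis using dv0[of z] by (auto simp: vol_def B'_def indicator_def)
  qed
  have vol_int: "integrable lborel (vol n)" for n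
    by (rule Bochner_Integration.integrable_bound[OF w_int]) (use vol_m vol_bd in \<open>auto simp: B'_def\<close>)
  have vol_lim: "(\<lambda>n. LINT z|lborel. vol n z) \<longlonglongrightarrow> (LINT z|lborel. indicator ?O z * dv z)"
  proof (rule integral_dominated_convergence[OF _ _ w_int])
    show "AE z in lborel. (\<lambda>n. vol n z) \<longlonglongrightarrow> indicator ?O z * dv z"
    proof (rule AE_I2)
      fix z
      show "(\<lambda>n. vol n z) \<longlonglongrightarrow> indicator ?O z * dv z"
      proof (cases "z \<in> ?O")
        case True
        then have gz: "- g z > 0" using D_iff by auto
        have "\<forall>\<^sub>F n in sequentially. \<epsilon> n < - g z / 2"
          using order_tendstoD(2)[OF \<epsilon>0] gz by simp
        then have "\<forall>\<^sub>F n in sequentially. vol n z = indicator ?O z * dv z"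
        proof eventually_elim
          case (elim n)
          then have "2 * \<epsilon> n \<le> - g z" by simp
          then have "- g z / \<epsilon> n \<ge> 2" using \<epsilon>[of n] by (simp only: pos_le_divide_eq)
          then show ?case using \<beta>(4) by (simp add: vol_def \<phi>_def)
        qed
        then show ?thesis by (rule tendsto_eventually)
      qed (simp add: vol_def)
    qed
  qed (use vol_m dv_m vol_bd in auto)
  have flux_int: "integrable lborel (flux n)" for n
    using Bochner_Integration.integrable_diff[OF vol_int[of n] int_diff(1)[of n]] by simp
  have vol_flux: "(LINT z|lborel. vol n z) = (LINT z|lborel. flux n z)" for n
    using int_diff(2)[of n] Bochner_Integration.integral_diff[OF vol_int flux_int, of n] by simp

  \<comment> \<open>Extended by 0 only to be measurable on the whole space; points over the
    complement of \<open>W\<close> are outside \<open>Q\<close>, where \<open>flux\<close> is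
    0.\<close>
  define h0 where "h0 y = (if y \<in> W then h y else 0)" for y
  have h0_m[measurable]: "h0 \<in> borel_measurable borel"
  proof -
    have "(\<lambda>y. indicator W y *\<^sub>R h y) \<in> borel_measurable borel"
      by (rule borel_measurable_continuous_on_indicator[OF _ cont_h]) (use open_W in auto)
    moreover have "(\<lambda>y. indicator W y *\<^sub>R h y) = h0" by (auto simp: h0_def indicator_def)
    ultimately show ?thesis by simp
  qed
  \<comment> \<open>Here \<open>snd p\<close> is the height below the graph in units of
    \<open>\<epsilon> n\<close>. The factor \<open>\<epsilon> n\<close> is the Jacobian of this
    rescaling and cancels the \<open>1 / \<epsilon> n\<close> from the derivative of the
    cutoff.\<close>
  define k where "k n p = \<epsilon> n * flux n (ins j \<iota> (h0 (fst p) - s * \<epsilon> n * snd p) (fst p))" for n and p :: "(real^'m) \<times> real"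
  have flux_m[measurable]: "flux n \<in> borel_measurable borel" for n
    using borel_measurable_integrable[OF flux_int] by simp
  have ins_m: "(\<lambda>p. ins j \<iota> (b p) (a p)) \<in> borel_measurable borel"
    if [measurable]: "a \<in> borel_measurable borel" "b \<in> borel_measurable borel" for a :: "(real^'m) \<times> real \<Rightarrow> real^'m" and b
  proof -
    have "(\<lambda>q. ins j \<iota> (snd q) (fst q)) \<in> borel_measurable (borel :: ((real^'m) \<times> real) measure)"
      by (intro borel_measurable_continuous_onI continuous_on_ins[OF hyp] continuous_intros)
    moreover have "(\<lambda>p. (a p, b p)) \<in> borel_measurable borel" by measurable
    ultimately have "(\<lambda>p. ins j \<iota> (snd (a p, b p)) (fst (a p, b p))) \<in> borel_measurable borel"
      by (rule measurable_compose[rotated])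
    then show ?thesis by simp
  qed
  have k_m: "k n \<in> borel_measurable borel" for n
  proof -
    have "(\<lambda>p::(real^'m) \<times> real. ins j \<iota> (h0 (fst p) - s * \<epsilon> n * snd p) (fst p)) \<in> borel_measurable borel"
      by (rule ins_m) (simp_all add: borel_prod[symmetric])
    then show ?thesis unfolding k_def[abs_def] by measurable
  qed
  have k_val: "k n (y, t) = (if y \<in> W \<and> ins j \<iota> (h y - s * \<epsilon> n * t) y \<in> ?O
     then \<beta>' t * (Z (ins j \<iota> (h y - s * \<epsilon> n * t) y) \<bullet> nu y) else 0)" for n y t
  proof -
    let ?z = "ins j \<iota> (h0 y - s * \<epsilon> n * t) y"
    have "y \<in> W" if "?z \<in> ?O" using prjW[of ?z] that by simp
    moreover have "- g ?z / \<epsilon> n = t" if "y \<in> W"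
    proof -
      have "g ?z = - ((s * s) * (\<epsilon> n * t))" using that by (simp add: graph_fun_def h0_def)
      then show ?thesis using \<epsilon>[of n] by (simp add: ss)
    qed
    ultimately show ?thesis using \<epsilon>[of n] by (auto simp: k_def flux_def h0_def indicator_def)
  qed
  have cZn: "continuous_on (K \<inter> ?C) (\<lambda>z. Z z \<bullet> nu (prj \<iota> z))"
    by (intro continuous_on_inner continuous_on_subset[OF cZ] continuous_on_compose2[OF cont_nu]
        continuous_on_prj[OF hyp] continuous_on_id) (use prjW in auto)
  obtain M1 where M1: "\<And>z. z \<in> K \<inter> ?C \<Longrightarrow> \<bar>Z z \<bullet> nu (prj \<iota> z)\<bar> \<le> M1"
    using compact_imp_bounded[OF compact_continuous_image[OF cZn KC]] by (auto simp: bounded_iff)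
  obtain M2 where M2: "\<And>t. t \<in> {1..2} \<Longrightarrow> \<bar>\<beta>' t\<bar> \<le> M2"
    using compact_imp_bounded[OF compact_continuous_image[OF continuous_on_subset[OF \<beta>(2) subset_UNIV] compact_Icc[of 1 2]]]
    unfolding bounded_iff by (auto simp del: atLeastAtMost_iff)
  define M where "M = \<bar>M2\<bar> * \<bar>M1\<bar>"
  let ?S = "prj \<iota> ` K \<times> {1..2::real}"
  have cS: "compact ?S"
    by (intro compact_Times compact_continuous_image[OF continuous_on_prj[OF hyp continuous_on_id] K(1)] compact_Icc)
  have wk_int: "integrable lborel (\<lambda>p. M * indicator ?S p)"
    using cS by (intro integrable_mult_right integrable_real_indicator)
      (use compact_imp_closed[OF cS] compact_imp_bounded[OF cS] emeasure_bounded_finite[of ?S] in auto)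
  have k_bd: "norm (k n p) \<le> M * indicator ?S p" for n p
  proof (cases p)
    case (Pair y t)
    let ?z = "ins j \<iota> (h y - s * \<epsilon> n * t) y"
    show ?thesis
    proof (cases "y \<in> W \<and> ?z \<in> ?O \<and> t \<in> {1..2} \<and> ?z \<in> K")
      case True
      then have "prj \<iota> ?z \<in> prj \<iota> ` K" by blast
      then have "p \<in> ?S" using True Pair by simp
      moreover have "\<bar>\<beta>' t\<bar> * \<bar>Z ?z \<bullet> nu y\<bar> \<le> \<bar>M2\<bar> * \<bar>M1\<bar>"
        using M2[of t] M1[of ?z] True OC by (intro mult_mono) auto
      ultimately show ?thesis using True by (simp add: Pair k_val M_def abs_mult)
    next
      case False
      then have "k n p = 0" using supp OC \<beta>(7)[of t] by (auto simp: Pair k_val)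
      then show ?thesis by (simp add: M_def)
    qed
  qed
  have k_int: "integrable lborel (k n)" for n
    by (rule Bochner_Integration.integrable_bound[OF wk_int]) (use k_m k_bd in \<open>auto simp: M_def\<close>)
  have flux_k: "(LINT z|lborel. flux n z) = (LINT p|lborel. k n p)" for n
  proof -
    have e: "(\<lambda>p. flux n (case p of (y, t) \<Rightarrow> ins j \<iota> t y)) = (\<lambda>(y, t). flux n (ins j \<iota> t y))" by auto
    have "integrable (distr (lborel \<Otimes>\<^sub>M lborel) borel (\<lambda>(y, t). ins j \<iota> t y)) (flux n)"
      using flux_int by (simp only: lborel_eq_distr_ins[OF hyp, symmetric])
    then have i2: "integrable (lborel \<Otimes>\<^sub>M lborel) (\<lambda>(y, t). flux n (ins j \<iota> t y))"
      by (subst (asm) integrable_distr_eq[OF measurable_ins[OF hyp]]) (auto simp: e)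
    have "(LINT z|lborel. flux n z) = integral\<^sup>L (distr (lborel \<Otimes>\<^sub>M lborel) borel (\<lambda>(y, t). ins j \<iota> t y)) (flux n)"
      by (simp only: lborel_eq_distr_ins[OF hyp, symmetric])
    also have "\<dots> = integral\<^sup>L (lborel \<Otimes>\<^sub>M lborel) (\<lambda>(y, t). flux n (ins j \<iota> t y))"
      by (subst integral_distr[OF measurable_ins[OF hyp]]) (auto simp: e)
    also have "\<dots> = (LINT y|lborel. LINT t|lborel. flux n (ins j \<iota> t y))"
      using lborel_pair.integral_fst[OF i2] by simp
    also have "\<dots> = (LINT y|lborel. LINT t|lborel. k n (y, t))"
    proof (rule Bochner_Integration.integral_cong[OF refl])
      fix y :: "real^'m"
      have s\<epsilon>: "- s * \<epsilon> n \<noteq> 0" "\<bar>- s * \<epsilon> n\<bar> = \<epsilon> n"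
        using ss \<epsilon>[of n] by (auto simp: abs_mult) (metis abs_mult_self_eq abs_1 abs_mult mult_cancel_right1 square_eq_1_iff abs_minus_cancel)
      have "(LINT t|lborel. flux n (ins j \<iota> t y)) = \<epsilon> n * (LINT t|lborel. flux n (ins j \<iota> (h0 y + - s * \<epsilon> n * t) y))"
        by (subst lborel_integral_real_affine[OF s\<epsilon>(1), of _ "h0 y"]) (simp only: s\<epsilon> real_scaleR_def)
      then show "(LINT t|lborel. flux n (ins j \<iota> t y)) = (LINT t|lborel. k n (y, t))"
        by (simp add: k_def)
    qed
    also have "\<dots> = integral\<^sup>L (lborel \<Otimes>\<^sub>M lborel) (k n)"
      by (rule lborel_pair.integral_fst') (use k_int in \<open>simp add: lborel_prod\<close>)
    finally show ?thesis by (simp add: lborel_prod)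
  qed
  let ?k = "\<lambda>p::(real^'m) \<times> real. indicator W (fst p) * (Z (par (fst p)) \<bullet> nu (fst p)) * \<beta>' (snd p)"
  have par_C: "par y \<in> ?C" if "y \<in> W" for y using par_Q[OF that] by simp
  have Zpar: "continuous_on W (\<lambda>y. Z (par y) \<bullet> nu y)"
    by (intro continuous_on_inner cont_nu continuous_on_compose2[OF cZ cont_par]) (use par_C in auto)
  \<comment> \<open>For a fixed rescaled height \<open>t > 0\<close> the points approach the graph
    from inside \<open>D\<close>, where continuity of \<open>Z\<close> up to the graph
    applies.\<close>
  have k_lim: "(\<lambda>n. k n p) \<longlonglongrightarrow> ?k p" for p
  proof (cases p)
    case (Pair y t)
    show ?thesis
    proof (cases "y \<in> W \<and> t \<in> {1..2}")
      case True
      then have y: "y \<in> W" and t: "t > 0" by auto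
      let ?z = "\<lambda>n. ins j \<iota> (h y - s * \<epsilon> n * t) y"
      have c: "continuous_on UNIV (\<lambda>e. ins j \<iota> (h y - s * e * t) y)"
        by (intro continuous_on_ins[OF hyp] continuous_intros)
      have zl: "?z \<longlonglongrightarrow> par y"
        using continuous_on_tendsto_compose[OF c \<epsilon>0] by simp
      have "\<forall>\<^sub>F n in sequentially. ?z n \<in> Q"
        using topological_tendstoD[OF zl open_Q par_Q[OF y]] .
      then have ev: "\<forall>\<^sub>F n in sequentially. ?z n \<in> ?O \<and> ?z n \<in> ?C"
      proof eventually_elim
        case (elim n)
        have "g (?z n) = - ((s * s) * (\<epsilon> n * t))" by (simp add: graph_fun_def)
        then have "g (?z n) < 0" using \<epsilon>[of n] t by (simp add: ss)
        then show ?case using elim D_iff by auto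
      qed
      have "(\<lambda>n. Z (?z n)) \<longlonglongrightarrow> Z (par y)"
        using continuous_on_tendsto_compose[OF cZ zl par_C[OF y]] ev by (simp add: eventually_conj_iff)
      then have "(\<lambda>n. \<beta>' t * (Z (?z n) \<bullet> nu y)) \<longlonglongrightarrow> \<beta>' t * (Z (par y) \<bullet> nu y)"
        by (intro tendsto_intros)
      moreover have "\<forall>\<^sub>F n in sequentially. \<beta>' t * (Z (?z n) \<bullet> nu y) = k n p"
        using ev by eventually_elim (use y in \<open>simp add: Pair k_val\<close>)
      ultimately show ?thesis using y by (simp add: Pair mult.commute tendsto_cong)
    next
      case False
      then have "k n p = 0" for n using \<beta>(7)[of t] by (auto simp: Pair k_val)
      moreover have "?k p = 0" using False \<beta>(7)[of t] by (auto simp: Pair indicator_def)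
      ultimately show ?thesis by (simp only: tendsto_const)
    qed
  qed
  have k0_m: "?k \<in> borel_measurable borel"
    by (rule borel_measurable_LIMSEQ_metric[OF k_m k_lim])
  have k_conv: "(\<lambda>n. LINT p|lborel. k n p) \<longlonglongrightarrow> (LINT p|lborel. ?k p)"
    by (rule integral_dominated_convergence[OF _ _ wk_int]) (use k0_m k_m k_lim k_bd in auto)
  have k0_int: "integrable lborel ?k"
    by (rule integrable_dominated_convergence[OF _ _ wk_int, of _ k]) (use k0_m k_m k_lim k_bd in auto)
  have "(LINT p|lborel. ?k p) = (LINT y|lborel. LINT t|lborel. ?k (y, t))"
    by (subst lborel_pair.integral_fst') (use k0_int in \<open>simp_all add: lborel_prod\<close>)
  also have "\<dots> = (LINT y|lborel. indicator W y * (Z (par y) \<bullet> nu y))"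
    using \<beta>(9) by simp
  finally have "(LINT z|lborel. indicator ?O z * dv z) = (LINT y|lborel. indicator W y * (Z (par y) \<bullet> nu y))"
    using LIMSEQ_unique[OF vol_lim[unfolded vol_flux flux_k] k_conv] by simp
  then show ?thesis by (simp add: set_lebesgue_integral_def dv_def)
qed

end

section \<open>Measures on images of parametrizations\<close>

text \<open>The library proves the change of variables formula for well-ordered index types only; every
  finite type is in bijection with an initial segment of the natural numbers.\<close>

typedef (overloaded) 'm::finite idx = "{..<CARD('m)} :: nat set"
  by (rule exI[of _ 0]) simp

instantiation idx :: (finite) wellorder
begin
definition "a \<le> b \<longleftrightarrow> Rep_idx a \<le> Rep_idx b"
definition "a < b \<longleftrightarrow> Rep_idx a < Rep_idx b"
instance
proof
  fix P :: "'a idx \<Rightarrow> bool" and a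
  assume *: "\<And>x. (\<And>y. y < x \<Longrightarrow> P y) \<Longrightarrow> P x"
  show "P a" by (induction "Rep_idx a" arbitrary: a rule: less_induct) (use * less_idx_def in blast)
qed (auto simp: less_eq_idx_def less_idx_def Rep_idx_inject)
end

instance idx :: (finite) finite
proof
  have "(UNIV :: 'a idx set) = Abs_idx ` {..<CARD('a)}"
    by (metis Abs_idx_cases UNIV_eq_I image_eqI)
  then show "finite (UNIV :: 'a idx set)" by (metis finite_imageI finite_lessThan)
qed

lemma idx_bij: "\<exists>e :: 'm::finite idx \<Rightarrow> 'm. bij e"
proof -
  have "bij_betw (Rep_idx :: 'm idx \<Rightarrow> nat) UNIV {..<CARD('m)}"
    by (rule bij_betwI[of _ _ _ Abs_idx]) (use Rep_idx in \<open>auto simp: Abs_idx_inverse Rep_idx_inverse\<close>)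
  moreover obtain e where "bij_betw e {..<CARD('m)} (UNIV :: 'm set)"
    using ex_bij_betw_nat_finite[of "UNIV :: 'm set"] by (auto simp: atLeast0LessThan)
  ultimately show ?thesis using bij_betw_trans by blast
qed

definition reidx :: "('k::finite \<Rightarrow> 'm::finite) \<Rightarrow> real^'m \<Rightarrow> real^'k" where
  "reidx e x = (\<chi> a. x $ e a)"

lemma linear_reidx: "linear (reidx e)"
  by (intro linearI) (simp_all add: reidx_def vec_eq_iff)

lemma reidx_inverse: "bij e \<Longrightarrow> reidx (inv e) (reidx e x) = x" "bij e \<Longrightarrow> reidx e (reidx (inv e) y) = y"
  by (simp_all add: reidx_def vec_eq_iff bij_is_surj bij_is_inj surj_f_inv_f)

lemma borel_measurable_reidx [measurable]: "reidx e \<in> borel_measurable borel"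
  by (intro borel_measurable_continuous_onI linear_continuous_on linear_conv_bounded_linear[THEN iffD1] linear_reidx)

lemma lborel_distr_reidx:
  assumes e: "bij (e :: 'k::finite \<Rightarrow> 'm::finite)"
  shows "(lborel :: (real^'k) measure) = distr lborel borel (reidx e)"
proof (rule lborel_eqI)
  fix l u :: "real^'k" assume lu0: "\<And>b. b \<in> Basis \<Longrightarrow> l \<bullet> b \<le> u \<bullet> b"
  moreover have "axis i 1 \<in> (Basis :: (real^'k) set)" for i by simp
  ultimately have lu: "l $ i \<le> u $ i" for i by (metis cart_eq_inner_axis)
  have B: "(\<Prod>b\<in>Basis. F b) = (\<Prod>i\<in>UNIV. F (axis i (1::real) :: real^'j::finite))" for F :: "real^'j \<Rightarrow> real"
  proof -
    have B: "Basis = range (\<lambda>i. axis i (1::real) :: real^'j)" by (auto simp: Basis_vec_def)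
    have "inj (\<lambda>i. axis i (1::real) :: real^'j)" by (auto simp: inj_def axis_eq_axis)
    then show ?thesis unfolding B by (subst prod.reindex) auto
  qed
  have "reidx e -` box l u = box (reidx (inv e) l) (reidx (inv e) u)"
  proof -
    have "(\<forall>a. l $ a < x $ e a \<and> x $ e a < u $ a) \<longleftrightarrow> (\<forall>i. l $ inv e i < x $ i \<and> x $ i < u $ inv e i)" for x
      using e by (metis bij_inv_eq_iff)
    then show ?thesis by (auto simp: mem_box_cart reidx_def)
  qed
  then have "emeasure (distr lborel borel (reidx e)) (box l u) = emeasure lborel (box (reidx (inv e) l) (reidx (inv e) u))"
    by (simp add: emeasure_distr)
  also have "\<dots> = ennreal (\<Prod>b\<in>Basis. (reidx (inv e) u - reidx (inv e) l) \<bullet> b)"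
    by (rule emeasure_lborel_box) (use lu in \<open>auto simp: Basis_vec_def inner_axis reidx_def\<close>)
  also have "(\<Prod>b\<in>Basis. (reidx (inv e) u - reidx (inv e) l) \<bullet> b) = (\<Prod>i\<in>UNIV. u $ inv e i - l $ inv e i)"
    by (simp add: B inner_axis reidx_def)
  also have "\<dots> = (\<Prod>a\<in>UNIV. u $ a - l $ a)"
    using bij_imp_bij_inv[OF e] by (rule prod.reindex_bij_betw)
  also have "\<dots> = (\<Prod>b\<in>Basis. (u - l) \<bullet> b)" by (simp add: B inner_axis)
  finally show "emeasure (distr lborel borel (reidx e)) (box l u) = ennreal (\<Prod>b\<in>Basis. (u - l) \<bullet> b)" .
qed simp

text \<open>The substitution rule concerns absolutely integrable functions, whereas measures are
  given by nonnegative integrals with values in \<open>ennreal\<close>. An infinite value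
  corresponds to failure of absolute integrability.\<close>

lemma nn_integral_absolutely_integrable:
  fixes h :: "'a::euclidean_space \<Rightarrow> real"
  assumes S: "S \<in> sets borel" and m: "(\<lambda>x. indicator S x * h x) \<in> borel_measurable borel"
    and nn: "\<And>x. x \<in> S \<Longrightarrow> 0 \<le> h x"
  shows "h absolutely_integrable_on S \<longleftrightarrow> (\<integral>\<^sup>+x. ennreal (indicator S x * h x) \<partial>lborel) < \<infinity>"
    and "h absolutely_integrable_on S \<Longrightarrow> (\<integral>\<^sup>+x. ennreal (indicator S x * h x) \<partial>lborel) = ennreal (integral S h)"
proof -
  have nn': "0 \<le> indicator S x * h x" for x using nn by (simp add: indicator_def)
  have e: "h absolutely_integrable_on S \<longleftrightarrow> integrable lborel (\<lambda>x. indicator S x * h x)"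
    unfolding set_integrable_def by (simp add: integrable_completion m)
  then show "h absolutely_integrable_on S \<longleftrightarrow> (\<integral>\<^sup>+x. ennreal (indicator S x * h x) \<partial>lborel) < \<infinity>"
    using m nn' by (simp add: integrable_iff_bounded)
  assume "h absolutely_integrable_on S"
  then have i: "integrable lborel (\<lambda>x. indicator S x * h x)" using e by simp
  have "(\<integral>\<^sup>+x. ennreal (indicator S x * h x) \<partial>lborel) = ennreal (LINT x|lborel. indicator S x * h x)"
    by (rule nn_integral_eq_integral[OF i]) (use nn' in auto)
  also have "(LINT x|lborel. indicator S x * h x) = integral S h"
    using set_borel_integral_eq_integral(2)[of S h] i by (simp add: set_integrable_def set_lebesgue_integral_def)
  finally show "(\<integral>\<^sup>+x. ennreal (indicator S x * h x) \<partial>lborel) = ennreal (integral S h)" .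
qed

text \<open>By the substitution rule, applied to functions with values in \<open>real^1\<close>, the
  two integrands are absolutely integrable together. If they are, the integrals agree; otherwise
  both sides are infinite.\<close>

lemma nn_integral_change_of_variables_wellorder:
  fixes f :: "real^'m::{finite,wellorder} \<Rightarrow> real^'m::_" and w :: "real^'m::_ \<Rightarrow> real"
  assumes S: "S \<in> sets borel" and fS: "f ` S \<in> sets borel"
    and der: "\<And>x. x \<in> S \<Longrightarrow> (f has_derivative f' x) (at x within S)" and inj: "inj_on f S"
    and m1: "(\<lambda>y. indicator (f ` S) y * w y) \<in> borel_measurable borel"
    and m2: "(\<lambda>x. indicator S x * (\<bar>det (matrix (f' x))\<bar> * w (f x))) \<in> borel_measurable borel"
    and nn: "\<And>y. y \<in> f ` S \<Longrightarrow> 0 \<le> w y"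
  shows "(\<integral>\<^sup>+y. ennreal (indicator (f ` S) y * w y) \<partial>lborel)
    = (\<integral>\<^sup>+x. ennreal (indicator S x * (\<bar>det (matrix (f' x))\<bar> * w (f x))) \<partial>lborel)"
proof -
  let ?w' = "\<lambda>x. \<bar>det (matrix (f' x))\<bar> * w (f x)"
  have Sl: "S \<in> sets lebesgue" using S by auto
  have cov: "?w' absolutely_integrable_on S \<and> integral S ?w' = b \<longleftrightarrow> w absolutely_integrable_on f ` S \<and> integral (f ` S) w = b" for b
    using has_absolute_integral_change_of_variables[OF Sl der inj, of "\<lambda>x. vec (w x) :: real^1" "vec b"]
    by (simp add: absolutely_integrable_on_1_iff integral_on_1_eq vec_eq_iff)
  have iff: "?w' absolutely_integrable_on S \<longleftrightarrow> w absolutely_integrable_on f ` S" using cov by blast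
  note L = nn_integral_absolutely_integrable[OF fS m1 nn]
  have R: "?w' absolutely_integrable_on S \<longleftrightarrow> (\<integral>\<^sup>+x. ennreal (indicator S x * ?w' x) \<partial>lborel) < \<infinity>"
    "?w' absolutely_integrable_on S \<Longrightarrow> (\<integral>\<^sup>+x. ennreal (indicator S x * ?w' x) \<partial>lborel) = ennreal (integral S ?w')"
    using nn_integral_absolutely_integrable[OF S m2] nn by auto
  show ?thesis
  proof (cases "w absolutely_integrable_on f ` S")
    case True
    then have "integral S ?w' = integral (f ` S) w" using cov[of "integral (f ` S) w"] by blast
    then show ?thesis using L(2)[OF _ True] R(2) iff True by simp
  next
    case False
    then have "(\<integral>\<^sup>+y. ennreal (indicator (f ` S) y * w y) \<partial>lborel) = top"
      "(\<integral>\<^sup>+x. ennreal (indicator S x * ?w' x) \<partial>lborel) = top"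
      using L(1) R(1) iff by (simp_all add: not_less top_unique)
    then show ?thesis by simp
  qed
qed

text \<open>Conjugation with the relabelling \<open>reidx e\<close>, which preserves both Lebesgue
  measure and the Jacobian determinant.\<close>

lemma nn_integral_change_of_variables:
  fixes f :: "real^'m::finite \<Rightarrow> real^'m::_" and w :: "real^'m::_ \<Rightarrow> real"
  assumes S: "S \<in> sets borel" and fS: "f ` S \<in> sets borel"
    and der: "\<And>x. x \<in> S \<Longrightarrow> (f has_derivative f' x) (at x within S)" and inj: "inj_on f S"
    and m1: "(\<lambda>y. indicator (f ` S) y * w y) \<in> borel_measurable borel"
    and m2: "(\<lambda>x. indicator S x * (\<bar>det (matrix (f' x))\<bar> * w (f x))) \<in> borel_measurable borel"
    and nn: "\<And>y. y \<in> f ` S \<Longrightarrow> 0 \<le> w y"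
  shows "(\<integral>\<^sup>+y. ennreal (indicator (f ` S) y * w y) \<partial>lborel)
    = (\<integral>\<^sup>+x. ennreal (indicator S x * (\<bar>det (matrix (f' x))\<bar> * w (f x))) \<partial>lborel)"
proof -
  obtain e :: "'m idx \<Rightarrow> 'm" where e: "bij e" using idx_bij by blast
  let ?A = "reidx e" and ?B = "reidx (inv e)"
  note AB [simp] = reidx_inverse[OF e]
  have blA: "bounded_linear ?A" "bounded_linear ?B" using linear_reidx linear_conv_bounded_linear by blast+
  let ?S = "?B -` S" and ?f = "\<lambda>x. ?A (f (?B x))" and ?f' = "\<lambda>x v. ?A (f' (?B x) (?B v))" and ?w = "\<lambda>y. w (?B y)"
  have imS: "?f ` ?S = ?B -` (f ` S)"
  proof
    show "?B -` (f ` S) \<subseteq> ?f ` ?S"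
    proof
      fix y assume "y \<in> ?B -` (f ` S)"
      then obtain x where x: "x \<in> S" "?B y = f x" by auto
      then have "y = ?f (?A x)" by (metis AB)
      then show "y \<in> ?f ` ?S" using x by (intro image_eqI[of _ _ "?A x"]) auto
    qed
  qed auto
  have vimage: "?B -` X \<in> sets borel" if "X \<in> sets borel" for X
    using measurable_sets[OF borel_measurable_reidx[of "inv e"] that] by simp
  have ind: "indicator (?B -` X) x = (indicator X (?B x) :: real)" for X x by (simp add: indicator_def)
  have det: "det (matrix (?f' x)) = det (matrix (f' (?B x)))" if "x \<in> ?S" for x
  proof -
    have "det (matrix (f' (?B x))) = (\<Prod>i\<in>- range e. matrix (f' (?B x)) $ i $ i) * det (\<chi> a b. matrix (f' (?B x)) $ e a $ e b)"
      by (rule det_diagonal_block) (use e in \<open>auto simp: bij_def\<close>)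
    moreover have "(\<chi> a b. matrix (f' (?B x)) $ e a $ e b) = matrix (?f' x)"
    proof -
      have "?B (axis b 1) = axis (e b) 1" for b
        using e by (auto simp: reidx_def vec_eq_iff axis_def) (metis bij_inv_eq_iff)+
      then show ?thesis by (simp add: vec_eq_iff matrix_def reidx_def)
    qed
    ultimately show ?thesis using e by (simp add: bij_is_surj)
  qed
  have "(\<integral>\<^sup>+y. ennreal (indicator (f ` S) y * w y) \<partial>lborel) = (\<integral>\<^sup>+y. ennreal (indicator (f ` S) y * w y) \<partial>distr lborel borel ?B)"
    using lborel_distr_reidx[OF bij_imp_bij_inv[OF e]] by simp
  also have "\<dots> = (\<integral>\<^sup>+y. ennreal (indicator (f ` S) (?B y) * w (?B y)) \<partial>lborel)"
    by (rule nn_integral_distr) (use m1 in auto)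
  also have "\<dots> = (\<integral>\<^sup>+y. ennreal (indicator (?f ` ?S) y * ?w y) \<partial>lborel)"
    unfolding imS ind ..
  also have "\<dots> = (\<integral>\<^sup>+x. ennreal (indicator ?S x * (\<bar>det (matrix (?f' x))\<bar> * ?w (?f x))) \<partial>lborel)"
  proof (rule nn_integral_change_of_variables_wellorder)
    show "?S \<in> sets borel" using S vimage by blast
    show "?f ` ?S \<in> sets borel" unfolding imS using fS vimage by blast
    show "(?f has_derivative ?f' x) (at x within ?S)" if "x \<in> ?S" for x
    proof -
      have "(f has_derivative f' (?B x)) (at (?B x) within ?B ` ?S)"
        using has_derivative_subset[OF der] that by (metis image_vimage_subset vimage_eq)
      from has_derivative_in_compose[OF bounded_linear_imp_has_derivative[OF blA(2)] this]
      show ?thesis by (rule bounded_linear.has_derivative[OF blA(1)])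
    qed
    show "inj_on ?f ?S" using inj AB by (intro inj_onI) (metis inj_onD vimage_eq)
    show "(\<lambda>y. indicator (?f ` ?S) y * ?w y) \<in> borel_measurable borel"
      unfolding imS ind by (rule measurable_compose[OF borel_measurable_reidx m1])
    have "(\<lambda>x. indicator ?S x * (\<bar>det (matrix (?f' x))\<bar> * ?w (?f x)))
      = (\<lambda>x. indicator S (?B x) * (\<bar>det (matrix (f' (?B x)))\<bar> * w (f (?B x))))"
      by (rule ext) (auto simp: det indicator_def)
    then show "(\<lambda>x. indicator ?S x * (\<bar>det (matrix (?f' x))\<bar> * ?w (?f x))) \<in> borel_measurable borel"
      using measurable_compose[OF borel_measurable_reidx m2] by simp
  qed (use nn imS in auto)
  also have "\<dots> = (\<integral>\<^sup>+x. ennreal (indicator S (?B x) * (\<bar>det (matrix (f' (?B x)))\<bar> * w (f (?B x)))) \<partial>lborel)"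
    by (intro nn_integral_cong) (auto simp: det indicator_def)
  also have "\<dots> = (\<integral>\<^sup>+x. ennreal (indicator S x * (\<bar>det (matrix (f' x))\<bar> * w (f x))) \<partial>distr lborel borel ?B)"
    by (rule nn_integral_distr[symmetric]) (use m2 in auto)
  also have "\<dots> = (\<integral>\<^sup>+x. ennreal (indicator S x * (\<bar>det (matrix (f' x))\<bar> * w (f x))) \<partial>lborel)"
    using lborel_distr_reidx[OF bij_imp_bij_inv[OF e]] by simp
  finally show ?thesis .
qed


text \<open>The common local form of both Riemannian volume elements: Lebesgue measure weighted by a
  density and pushed forward along a chart inverse or a parametrization.\<close>

definition param_measure :: "'b::euclidean_space set \<Rightarrow> ('b \<Rightarrow> 'a::topological_space) \<Rightarrow> ('b \<Rightarrow> real) \<Rightarrow> 'a measure" where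
  "param_measure W \<phi> w = distr (density (restrict_space lborel W) (\<lambda>x. ennreal (w x))) borel \<phi>"

lemma sets_param_measure [simp, measurable_cong]: "sets (param_measure W \<phi> w) = sets borel"
  by (simp add: param_measure_def)

context
  fixes W :: "'b::euclidean_space set" and \<phi> :: "'b \<Rightarrow> 'a::topological_space" and w :: "'b \<Rightarrow> real"
  assumes W: "W \<in> sets borel" and \<phi>: "continuous_on W \<phi>" and w: "continuous_on W w" and w0: "\<And>x. x \<in> W \<Longrightarrow> 0 \<le> w x"
begin

lemma param_meas_\<phi>: "\<phi> \<in> measurable (restrict_space lborel W) borel"
  using borel_measurable_continuous_on_restrict[OF \<phi>]
  by (metis measurable_cong_sets sets_lborel sets_restrict_space_cong)

lemma param_meas_w: "w \<in> borel_measurable (restrict_space lborel W)"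
  using borel_measurable_continuous_on_restrict[OF w]
  by (metis measurable_cong_sets sets_lborel sets_restrict_space_cong)

lemma param_preimage: "E \<in> sets borel \<Longrightarrow> {x \<in> W. \<phi> x \<in> E} \<in> sets borel"
proof -
  assume "E \<in> sets borel"
  then have "\<phi> -` E \<inter> space (restrict_space borel W) \<in> sets (restrict_space borel W)"
    using borel_measurable_continuous_on_restrict[OF \<phi>] measurable_sets by blast
  moreover have "\<phi> -` E \<inter> space (restrict_space borel W) = {x \<in> W. \<phi> x \<in> E}" by (auto simp: space_restrict_space)
  ultimately show ?thesis using W by (simp add: sets_restrict_space_iff)
qed

lemma emeasure_param_measure:
  assumes E: "E \<in> sets borel"
  shows "emeasure (param_measure W \<phi> w) E = (\<integral>\<^sup>+x\<in>{x\<in>W. \<phi> x \<in> E}. ennreal (w x) \<partial>lborel)"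
proof -
  let ?N = "restrict_space lborel W"
  have "emeasure (param_measure W \<phi> w) E = emeasure (density ?N (\<lambda>x. ennreal (w x))) (\<phi> -` E \<inter> space ?N)"
    unfolding param_measure_def using param_meas_\<phi> E by (subst emeasure_distr) auto
  also have "\<dots> = (\<integral>\<^sup>+x\<in>\<phi> -` E \<inter> space ?N. ennreal (w x) \<partial>?N)"
    using param_meas_w measurable_sets[OF param_meas_\<phi> E] by (intro emeasure_density) auto
  also have "\<dots> = (\<integral>\<^sup>+x. ennreal (w x) * indicator (\<phi> -` E \<inter> space ?N) x * indicator W x \<partial>lborel)"
    using W by (subst nn_integral_restrict_space) (auto intro!: nn_integral_cong)
  also have "\<dots> = (\<integral>\<^sup>+x\<in>{x\<in>W. \<phi> x \<in> E}. ennreal (w x) \<partial>lborel)"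
    by (intro nn_integral_cong) (auto simp: indicator_def space_restrict_space)
  finally show ?thesis .
qed

lemma integral_param_measure:
  fixes F :: "'a \<Rightarrow> real"
  assumes F: "F \<in> borel_measurable borel"
  shows "integral\<^sup>L (param_measure W \<phi> w) F = (LINT x:W|lborel. w x * F (\<phi> x))"
proof -
  have m: "(\<lambda>x. F (\<phi> x)) \<in> borel_measurable (restrict_space lborel W)"
    using measurable_compose[OF param_meas_\<phi> F] .
  have "integral\<^sup>L (param_measure W \<phi> w) F = integral\<^sup>L (density (restrict_space lborel W) (\<lambda>x. ennreal (w x))) (\<lambda>x. F (\<phi> x))"
    unfolding param_measure_def by (rule integral_distr) (use param_meas_\<phi> F in auto)
  also have "\<dots> = integral\<^sup>L (restrict_space lborel W) (\<lambda>x. w x *\<^sub>R F (\<phi> x))"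
    by (rule integral_density[OF m param_meas_w]) (use w0 in \<open>auto intro!: AE_I2 simp: space_restrict_space\<close>)
  also have "\<dots> = (LINT x:W|lborel. w x * F (\<phi> x))"
    using W by (subst integral_restrict_space) (auto simp: set_lebesgue_integral_def)
  finally show ?thesis .
qed

end

text \<open>Measures that agree on the subsets of \<open>U\<close> have the same restriction to
  \<open>U\<close>. In this way an integral against a glued measure is computed in one
  parametrization.\<close>

lemma integral_eq_of_local_eq:
  fixes F :: "'a::topological_space \<Rightarrow> real"
  assumes s: "sets \<mu> = sets borel" "sets \<nu> = sets borel" and U: "U \<in> sets borel"
    and eq: "\<And>E. E \<in> sets borel \<Longrightarrow> E \<subseteq> U \<Longrightarrow> emeasure \<mu> E = emeasure \<nu> E"
    and F: "\<And>x. x \<notin> U \<Longrightarrow> F x = 0"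
  shows "integral\<^sup>L \<mu> F = integral\<^sup>L \<nu> F"
proof -
  have sp: "space \<mu> = UNIV" "space \<nu> = UNIV" using s sets_eq_imp_space_eq by (metis space_borel)+
  have r: "restrict_space \<mu> U = restrict_space \<nu> U"
  proof (rule measure_eqI)
    show "sets (restrict_space \<mu> U) = sets (restrict_space \<nu> U)" using s by (simp add: sets_restrict_space)
    fix E assume "E \<in> sets (restrict_space \<mu> U)"
    then have E: "E \<in> sets borel" "E \<subseteq> U" using s U by (auto simp: sets_restrict_space_iff)
    then show "emeasure (restrict_space \<mu> U) E = emeasure (restrict_space \<nu> U) E"
      using s U sp eq by (simp add: emeasure_restrict_space)
  qed
  have "indicator U x *\<^sub>R F x = F x" for x using F[of x] by (cases "x \<in> U") simp_all
  then have i: "(\<lambda>x. indicator U x *\<^sub>R F x) = F" by (rule ext)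
  have "integral\<^sup>L \<mu> F = integral\<^sup>L (restrict_space \<mu> U) F"
    using s U sp by (subst integral_restrict_space) (simp_all add: i del: real_scaleR_def)
  also have "\<dots> = integral\<^sup>L \<nu> F"
    unfolding r using s U sp by (subst integral_restrict_space) (simp_all add: i del: real_scaleR_def)
  finally show ?thesis .
qed

lemma emeasure_disjointed_sum:
  assumes s: "sets \<mu> = sets borel" and U: "\<And>i::nat. U i \<in> sets borel" and E: "E \<in> sets borel" "E \<subseteq> (\<Union>i. U i)"
  shows "emeasure \<mu> E = (\<Sum>i. emeasure \<mu> (E \<inter> disjointed U i))"
proof -
  have D: "disjointed U i \<in> sets borel" for i
    using sets.range_disjointed_sets[of U borel] U by auto
  have "(\<Sum>i. emeasure \<mu> (E \<inter> disjointed U i)) = emeasure \<mu> (\<Union>i. E \<inter> disjointed U i)"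
  proof (rule suminf_emeasure)
    show "disjoint_family (\<lambda>i. E \<inter> disjointed U i)"
      using disjoint_family_disjointed[of U] unfolding disjoint_family_on_def by blast
  qed (use s D E in auto)
  also have "(\<Union>i. E \<inter> disjointed U i) = E" using UN_disjointed_eq[of U] E by auto
  finally show ?thesis by simp
qed

text \<open>Make the cover disjoint, measure each part by its own \<nu> and add up. Compatibility on
  overlaps makes it irrelevant to which part a set has been assigned.\<close>

lemma glue_measures:
  fixes U :: "nat \<Rightarrow> 'a::topological_space set" and \<nu> :: "nat \<Rightarrow> 'a measure"
  assumes U: "\<And>i. U i \<in> sets borel" and s: "\<And>i. sets (\<nu> i) = sets borel"
    and compat: "\<And>i j E. E \<in> sets borel \<Longrightarrow> E \<subseteq> U i \<Longrightarrow> E \<subseteq> U j \<Longrightarrow> emeasure (\<nu> i) E = emeasure (\<nu> j) E"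
  shows "\<exists>\<mu>. sets \<mu> = sets borel \<and> emeasure \<mu> (- (\<Union>i. U i)) = 0 \<and>
     (\<forall>i. \<forall>E\<in>sets borel. E \<subseteq> U i \<longrightarrow> emeasure \<mu> E = emeasure (\<nu> i) E)"
proof -
  have D: "disjointed U i \<in> sets borel" for i
    using sets.range_disjointed_sets[of U borel] U by auto
  define m where "m E = (\<Sum>i. emeasure (\<nu> i) (E \<inter> disjointed U i))" for E
  define \<mu> where "\<mu> = measure_of UNIV (sets borel) m"
  have sig: "sigma_algebra (UNIV :: 'a set) (sets borel)"
    using sets.sigma_algebra_axioms[of "borel :: 'a measure"] by simp
  have s\<mu>: "sets \<mu> = sets borel" unfolding \<mu>_def using sigma_algebra.sets_measure_of_eq[OF sig] .
  have em: "emeasure \<mu> E = m E" if "E \<in> sets borel" for E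
  proof -
    have "countably_additive (sets borel) m"
    proof (rule countably_additiveI)
      fix A :: "nat \<Rightarrow> 'a set" assume A: "range A \<subseteq> sets borel" "disjoint_family A"
      have "m (\<Union>k. A k) = (\<Sum>i. \<Sum>k. emeasure (\<nu> i) (A k \<inter> disjointed U i))"
        unfolding m_def
      proof (intro suminf_cong)
        fix i
        have "(\<Sum>k. emeasure (\<nu> i) (A k \<inter> disjointed U i)) = emeasure (\<nu> i) (\<Union>k. A k \<inter> disjointed U i)"
          by (rule suminf_emeasure) (use A D s in \<open>auto simp: disjoint_family_on_def\<close>)
        then show "emeasure (\<nu> i) ((\<Union>k. A k) \<inter> disjointed U i) = (\<Sum>k. emeasure (\<nu> i) (A k \<inter> disjointed U i))"
          by (simp add: Int_UN_distrib2)
      qed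
      \<comment> \<open>The two series are exchanged by viewing the outer one as an integral over
        the counting measure.\<close>
      also have "\<dots> = (\<integral>\<^sup>+i. (\<Sum>k. emeasure (\<nu> i) (A k \<inter> disjointed U i)) \<partial>count_space UNIV)"
        by (simp add: nn_integral_count_space_nat)
      also have "\<dots> = (\<Sum>k. \<integral>\<^sup>+i. emeasure (\<nu> i) (A k \<inter> disjointed U i) \<partial>count_space UNIV)"
        by (rule nn_integral_suminf) simp
      also have "\<dots> = (\<Sum>k. m (A k))" by (simp add: nn_integral_count_space_nat m_def)
      finally show "(\<Sum>k. m (A k)) = m (\<Union>k. A k)" by simp
    qed
    then show ?thesis unfolding \<mu>_def
      by (intro emeasure_measure_of_sigma[OF sig _ _ that]) (simp_all add: positive_def m_def)
  qed
  have "emeasure \<mu> (- (\<Union>i. U i)) = 0"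
  proof -
    have "- (\<Union>i. U i) \<inter> disjointed U i = {}" for i using disjointed_subset[of U i] by auto
    moreover have "- (\<Union>i. U i) \<in> sets borel" using U by (intro borel_comp sets.countable_UN) auto
    ultimately show ?thesis by (simp add: em m_def)
  qed
  moreover have "emeasure \<mu> E = emeasure (\<nu> i) E" if E: "E \<in> sets borel" "E \<subseteq> U i" for i E
  proof -
    have "emeasure (\<nu> k) (E \<inter> disjointed U k) = emeasure (\<nu> i) (E \<inter> disjointed U k)" for k
      by (rule compat) (use E D disjointed_subset[of U k] in auto)
    then have "m E = (\<Sum>k. emeasure (\<nu> i) (E \<inter> disjointed U k))" by (simp add: m_def)
    also have "\<dots> = emeasure (\<nu> i) E"
      by (rule emeasure_disjointed_sum[symmetric]) (use s U E in auto)
    finally show ?thesis using em[OF E(1)] by simp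
  qed
  ultimately show ?thesis using s\<mu> by blast
qed

section \<open>Charts and the volume measure\<close>

text \<open>Stated relative to \<open>B\<close> to serve two purposes: finite volume of compact
  sets, with \<open>B = UNIV\<close>, and finite area of the boundary.\<close>

lemma emeasure_compact_finite_local:
  assumes s: "sets \<mu> = sets borel" and K: "compact K" and B: "B \<in> sets borel" "K \<inter> B \<in> sets borel"
    and loc: "\<And>p. p \<in> K \<Longrightarrow> \<exists>U. open U \<and> p \<in> U \<and> emeasure \<mu> (U \<inter> B) < \<infinity>"
  shows "emeasure \<mu> (K \<inter> B) < \<infinity>"
proof -
  obtain U where U: "\<And>p. p \<in> K \<Longrightarrow> open (U p) \<and> p \<in> U p \<and> emeasure \<mu> (U p \<inter> B) < \<infinity>"
    using loc by metis
  obtain T where T: "T \<subseteq> K" "finite T" "K \<subseteq> (\<Union>p\<in>T. U p)"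
    using compactE_image[OF K, of K U] U by blast
  have m: "U p \<inter> B \<in> sets \<mu>" if "p \<in> T" for p
    using U T(1) that B s by (metis borel_open sets.Int subsetD)
  have "emeasure \<mu> (K \<inter> B) \<le> emeasure \<mu> (\<Union>p\<in>T. U p \<inter> B)"
  proof (rule emeasure_mono)
    show "(\<Union>p\<in>T. U p \<inter> B) \<in> sets \<mu>" using T m by (intro sets.finite_UN) auto
  qed (use T in auto)
  also have "\<dots> \<le> (\<Sum>p\<in>T. emeasure \<mu> (U p \<inter> B))"
    by (rule emeasure_subadditive_finite) (use T m in auto)
  also have "\<dots> < \<infinity>" using U T by (auto simp: subset_iff less_top)
  finally show ?thesis .
qed

locale chart_loc =
  fixes c :: "('a::topological_space, 'n::finite) chart"
  assumes is_chart: "is_chart c"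
begin

abbreviation "img \<equiv> chart_img c UNIV"
abbreviation "ci \<equiv> chart_inv c"

lemma open_dom: "open (fst c)" and open_img: "open img"
  and cont_ci: "continuous_on img ci" and cont_snd: "continuous_on (fst c) (snd c)"
  and ci_snd: "p \<in> fst c \<Longrightarrow> ci (snd c p) = p" and snd_ci: "x \<in> img \<Longrightarrow> snd c (ci x) = x"
  and ci_dom: "x \<in> img \<Longrightarrow> ci x \<in> fst c" and snd_img: "p \<in> fst c \<Longrightarrow> snd c p \<in> img"
  using is_chart unfolding is_chart_def homeomorphism_def by auto

lemma mem_img: "x \<in> chart_img c D \<longleftrightarrow> x \<in> img \<and> ci x \<in> D"
  unfolding chart_img_def using ci_snd by (auto simp: image_iff)

lemma snd_mem_img: "p \<in> fst c \<Longrightarrow> snd c p \<in> chart_img c D \<longleftrightarrow> p \<in> D"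
  using mem_img[of "snd c p" D] ci_snd[of p] snd_img[of p] by simp

lemma img_subset: "chart_img c D \<subseteq> img" using mem_img by blast

lemma img_mono: "D \<subseteq> D' \<Longrightarrow> chart_img c D \<subseteq> chart_img c D'" using mem_img by blast

lemma open_chart_img: "open D \<Longrightarrow> open (chart_img c D)"
proof -
  assume "open D"
  then have "open (img \<inter> ci -` D)"
    using continuous_openin_preimage_gen[OF cont_ci] open_img by (metis openin_open_trans)
  moreover have "img \<inter> ci -` D = chart_img c D" using mem_img by blast
  ultimately show ?thesis by simp
qed

lemma open_chart_preimage: "open Q \<Longrightarrow> open {p \<in> fst c. snd c p \<in> Q}"
proof -
  assume "open Q"
  then have "open (fst c \<inter> snd c -` Q)"
    using continuous_openin_preimage_gen[OF cont_snd] open_dom by (metis openin_open_trans)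
  then show ?thesis by (simp add: vimage_def Int_def)
qed

lemma borel_chart_img: "E \<in> sets borel \<Longrightarrow> chart_img c E \<in> sets borel"
proof -
  assume "E \<in> sets borel"
  then have "ci -` E \<inter> space (restrict_space borel img) \<in> sets (restrict_space borel img)"
    using borel_measurable_continuous_on_restrict[OF cont_ci] measurable_sets by blast
  moreover have "ci -` E \<inter> space (restrict_space borel img) = chart_img c E"
    using mem_img by (auto simp: space_restrict_space)
  moreover have "img \<in> sets borel" using open_img by simp
  ultimately show ?thesis by (simp add: sets_restrict_space_iff)
qed

end

locale riem =
  fixes A :: "('a::{t2_space, second_countable_topology}, 'n::finite) chart set"
    and g :: "('a, 'n) chart \<Rightarrow> real^'n \<Rightarrow> real^'n^'n"
  assumes atlas: "smooth_atlas A" and metric: "riemannian_metric A g"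
begin

abbreviation "img c \<equiv> chart_img c UNIV"
abbreviation "ci \<equiv> chart_inv"
abbreviation "tr c d \<equiv> snd d \<circ> chart_inv c"

lemma chart_at: "c \<in> A \<Longrightarrow> chart_loc c"
  using atlas by (auto simp: smooth_atlas_def chart_loc_def)

lemma cover: "\<exists>c\<in>A. p \<in> fst c"
  using atlas unfolding smooth_atlas_def by blast

lemma coord_metric_at: "c \<in> A \<Longrightarrow> coord_metric (g c) (img c)"
  using metric chart_loc.open_img[OF chart_at] by (auto simp: riemannian_metric_def coord_metric_def)

lemma mem_imgD:
  assumes "c \<in> A" "x \<in> chart_img c D"
  shows "x \<in> img c" "ci c x \<in> D" "ci c x \<in> fst c" "snd c (ci c x) = x"
proof -
  note L = chart_at[OF assms(1)]
  show x: "x \<in> img c" "ci c x \<in> D" using chart_loc.mem_img[OF L, of x D] assms(2) by blast+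
  show "ci c x \<in> fst c" "snd c (ci c x) = x" using chart_loc.ci_dom[OF L] chart_loc.snd_ci[OF L] x by blast+
qed

lemma tr_mem: "c \<in> A \<Longrightarrow> d \<in> A \<Longrightarrow> x \<in> chart_img c (fst d) \<Longrightarrow> tr c d x \<in> chart_img d (fst c)"
  using mem_imgD(2,3)[of c x "fst d"] chart_loc.snd_mem_img[OF chart_at, of d "ci c x" "fst c"] by simp

lemma ci_tr: "c \<in> A \<Longrightarrow> d \<in> A \<Longrightarrow> x \<in> chart_img c (fst d) \<Longrightarrow> ci d (tr c d x) = ci c x"
  using mem_imgD(2)[of c x "fst d"] chart_loc.ci_snd[OF chart_at, of d "ci c x"] by simp

lemma tr_tr: "c \<in> A \<Longrightarrow> d \<in> A \<Longrightarrow> x \<in> chart_img c (fst d) \<Longrightarrow> tr d c (tr c d x) = x"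
  using ci_tr[of c d x] mem_imgD(4)[of c x "fst d"] by simp

lemma tr_snd: "c \<in> A \<Longrightarrow> p \<in> fst c \<Longrightarrow> tr c d (snd c p) = snd d p"
  using chart_loc.ci_snd[OF chart_at] by simp

lemma open_overlap: "c \<in> A \<Longrightarrow> d \<in> A \<Longrightarrow> open (chart_img c (fst d))"
  using chart_loc.open_chart_img[OF chart_at] chart_loc.open_dom[OF chart_at] by blast

lemma tr_smooth: "c \<in> A \<Longrightarrow> d \<in> A \<Longrightarrow> Ck_on k (chart_img c (fst d)) (tr c d)"
  using atlas by (auto simp: smooth_atlas_def Cinf_on_def)

lemma coord_change_at:
  assumes "c \<in> A" "d \<in> A"
  shows "coord_change (g c) (img c) (g d) (img d) (chart_img c (fst d)) (tr c d)"
proof -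
  have "g c x = transpose (matrix (frechet_derivative (tr c d) (at x))) ** g d (tr c d x) ** matrix (frechet_derivative (tr c d) (at x))"
    if "x \<in> chart_img c (fst d)" for x
    using metric assms that unfolding riemannian_metric_def Let_def by blast
  moreover have "tr c d ` chart_img c (fst d) \<subseteq> img d"
    using tr_mem[OF assms] chart_loc.img_subset[OF chart_at[OF assms(2)]] by blast
  ultimately show ?thesis
    using coord_metric_at assms open_overlap[OF assms] chart_loc.img_subset[OF chart_at[OF assms(1)]] tr_smooth[OF assms]
    by (intro coord_change.intro coord_change_axioms.intro) auto
qed

definition "jac c d x = matrix (frechet_derivative (tr c d) (at x))"

lemma jac_eq: "jac c d \<equiv> \<lambda>x. matrix (frechet_derivative (tr c d) (at x))"
  by (rule eq_reflection, rule ext) (simp add: jac_def)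

lemma jac_mult:
  assumes "c \<in> A" "d \<in> A" "x \<in> chart_img c (fst d)"
  shows "jac d c (tr c d x) ** jac c d x = mat 1"
proof -
  have 1: "(tr c d has_derivative (*v) (jac c d x)) (at x)"
    using coord_change.\<tau>_deriv[OF coord_change_at[OF assms(1,2)] assms(3)] by (simp add: jac_def)
  have 2: "(tr d c has_derivative (*v) (jac d c (tr c d x))) (at (tr c d x))"
    using coord_change.\<tau>_deriv[OF coord_change_at[OF assms(2,1)] tr_mem[OF assms]] by (simp add: jac_def)
  have 3: "((\<lambda>x. tr d c (tr c d x)) has_derivative (\<lambda>v. jac d c (tr c d x) *v (jac c d x *v v))) (at x)"
    by (rule has_derivative_compose[OF 1 2])
  have 4: "((\<lambda>x. tr d c (tr c d x)) has_derivative (\<lambda>v. v)) (at x)"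
    by (rule has_derivative_transform_within_open[OF has_derivative_ident open_overlap[OF assms(1,2)] assms(3)])
       (use tr_tr assms in simp)
  have "(jac d c (tr c d x) ** jac c d x) *v v = v" for v
    using fun_cong[OF has_derivative_unique[OF 3 4], of v] by (simp add: matrix_vector_mul_assoc)
  then show ?thesis by (simp add: matrix_eq)
qed

text \<open>Lindelof's theorem. Measures can be glued only along countable covers.\<close>

lemma countable_charts: "\<exists>C :: nat \<Rightarrow> ('a, 'n) chart. (\<forall>i. C i \<in> A) \<and> (\<Union>i. fst (C i)) = UNIV"
proof -
  have op: "open S" if "S \<in> fst ` A" for S using that chart_loc.open_dom[OF chart_at] by auto
  obtain F where F: "F \<subseteq> fst ` A" "countable F" "\<Union> F = \<Union> (fst ` A)"
    using Lindelof[of "fst ` A"] op by metis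
  have "\<Union> F = UNIV" using F cover by auto
  then have "F \<noteq> {}" by auto
  define C where "C i = (SOME c. c \<in> A \<and> fst c = from_nat_into F i)" for i
  have C: "C i \<in> A \<and> fst (C i) = from_nat_into F i" for i
  proof -
    have "from_nat_into F i \<in> fst ` A" using from_nat_into[OF \<open>F \<noteq> {}\<close>, of i] F(1) by blast
    then have "\<exists>c. c \<in> A \<and> fst c = from_nat_into F i" by (metis imageE)
    then show ?thesis unfolding C_def by (rule someI_ex)
  qed
  have "(\<Union>i. fst (C i)) = \<Union> F" using C range_from_nat_into[OF \<open>F \<noteq> {}\<close> F(2)] by auto
  then show ?thesis using C \<open>\<Union> F = UNIV\<close> by (intro exI[of _ C]) auto
qed

abbreviation "dens c x \<equiv> sqrt (det (g c x))"

lemma dens_cont: "c \<in> A \<Longrightarrow> continuous_on (img c) (dens c)"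
  using Ck_on_continuous[OF coord_metric.Ck_sqrt_det[OF coord_metric_at]] .

lemma dens_pos: "c \<in> A \<Longrightarrow> x \<in> img c \<Longrightarrow> dens c x > 0"
  using coord_metric.det_pos[OF coord_metric_at] by simp

definition "chart_measure c = param_measure (img c) (ci c) (dens c)"

lemma param_ok: "c \<in> A \<Longrightarrow> img c \<in> sets borel \<and> continuous_on (img c) (ci c) \<and> continuous_on (img c) (dens c)
   \<and> (\<forall>x\<in>img c. 0 \<le> dens c x)"
  using chart_loc.open_img[OF chart_at] chart_loc.cont_ci[OF chart_at] dens_cont less_imp_le[OF dens_pos] by (intro conjI ballI borel_open) blast+

lemma emeasure_chart_measure:
  assumes "c \<in> A" "E \<in> sets borel"
  shows "emeasure (chart_measure c) E = (\<integral>\<^sup>+x\<in>chart_img c E. ennreal (dens c x) \<partial>lborel)"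
proof -
  have "{x \<in> img c. ci c x \<in> E} = chart_img c E" using chart_loc.mem_img[OF chart_at[OF assms(1)], of _ E] by blast
  then show ?thesis
    unfolding chart_measure_def using param_ok[OF assms(1)] assms(2) by (subst emeasure_param_measure) auto
qed

text \<open>By the tensor law of the metric, the two densities differ by exactly the factor
  \<open>\<bar>det (jac c d x)\<bar>\<close> of the substitution rule.\<close>

lemma chart_measure_compat:
  assumes c: "c \<in> A" and d: "d \<in> A" and E: "E \<in> sets borel" "E \<subseteq> fst c" "E \<subseteq> fst d"
  shows "emeasure (chart_measure c) E = emeasure (chart_measure d) E"
proof -
  interpret coord_change "g c" "img c" "g d" "img d" "chart_img c (fst d)" "tr c d" "jac c d"
    by (rule coord_change_at[OF c d]) (rule jac_eq)
  let ?S = "chart_img c E"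
  have SZ: "?S \<subseteq> chart_img c (fst d)" using chart_loc.img_mono[OF chart_at[OF c] E(3)] .
  have im: "tr c d ` ?S = chart_img d E"
    unfolding chart_img_def using E chart_loc.ci_snd[OF chart_at[OF c]] by (force simp: image_iff)
  have dens: "\<bar>det (jac c d x)\<bar> * dens d (tr c d x) = dens c x" if "x \<in> ?S" for x
  proof -
    have "det (g c x) = (det (jac c d x))\<^sup>2 * det (g d (tr c d x))"
      using trans[of x] that SZ by (auto simp: det_mul power2_eq_square)
    then show ?thesis by (simp add: real_sqrt_mult)
  qed
  have ind: "indicator X x * y = (if x \<in> X then y else 0 :: real)" for X x y by simp
  have meas: "(\<lambda>x. indicator (chart_img c' E) x * dens c' x) \<in> borel_measurable borel" if "c' \<in> A" for c'
    using borel_measurable_continuous_on_indicator[OF chart_loc.borel_chart_img[OF chart_at[OF that] E(1)]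
       continuous_on_subset[OF dens_cont[OF that] chart_loc.img_subset[OF chart_at[OF that]]]] by simp
  have e: "indicator ?S x * (\<bar>det (matrix ((*v) (jac c d x)))\<bar> * dens d (tr c d x)) = indicator ?S x * dens c x" for x
    using dens[of x] by (cases "x \<in> ?S") simp_all
  have nn: "(\<integral>\<^sup>+y. ennreal (indicator (tr c d ` ?S) y * dens d y) \<partial>lborel)
    = (\<integral>\<^sup>+x. ennreal (indicator ?S x * (\<bar>det (matrix ((*v) (jac c d x)))\<bar> * dens d (tr c d x))) \<partial>lborel)"
  proof (rule nn_integral_change_of_variables)
    show "?S \<in> sets borel" by (rule chart_loc.borel_chart_img[OF chart_at[OF c] E(1)])
    show "tr c d ` ?S \<in> sets borel" unfolding im by (rule chart_loc.borel_chart_img[OF chart_at[OF d] E(1)])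
    show "(tr c d has_derivative (*v) (jac c d x)) (at x within ?S)" if "x \<in> ?S" for x
      by (rule has_derivative_at_withinI[OF \<tau>_deriv]) (use that SZ in auto)
    show "inj_on (tr c d) ?S" by (rule inj_on_inverseI[of _ "tr d c"]) (use tr_tr[OF c d] SZ in auto)
    show "(\<lambda>y. indicator (tr c d ` ?S) y * dens d y) \<in> borel_measurable borel" unfolding im by (rule meas[OF d])
    show "(\<lambda>x. indicator ?S x * (\<bar>det (matrix ((*v) (jac c d x)))\<bar> * dens d (tr c d x))) \<in> borel_measurable borel"
      unfolding e by (rule meas[OF c])
    show "0 \<le> dens d y" if "y \<in> tr c d ` ?S" for y
      using that dens_pos[OF d, of y] chart_loc.img_subset[OF chart_at[OF d]] unfolding im by (auto intro: less_imp_le)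
  qed
  have conv: "(\<integral>\<^sup>+x\<in>X. ennreal (f x) \<partial>lborel) = (\<integral>\<^sup>+x. ennreal (indicator X x * f x) \<partial>lborel)" for X and f :: "real^'n \<Rightarrow> real"
    by (intro nn_integral_cong) (simp add: indicator_def)
  show ?thesis
    unfolding emeasure_chart_measure[OF c E(1)] emeasure_chart_measure[OF d E(1)] conv
    using nn unfolding im e by simp
qed

text \<open>This justifies the definite description in \<open>volume_measure\<close>. Existence is
  gluing; for uniqueness, every Borel set is cut into countably many pieces, each inside one chart
  domain, where the value is prescribed.\<close>

lemma volume_measure_unique:
  "\<exists>!\<mu>. sets \<mu> = sets borel \<and> (\<forall>c\<in>A. \<forall>E\<in>sets borel. E \<subseteq> fst c \<longrightarrow>
        emeasure \<mu> E = (\<integral>\<^sup>+x\<in>chart_img c E. ennreal (sqrt (det (g c x))) \<partial>lborel))"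
proof -
  obtain C :: "nat \<Rightarrow> ('a, 'n) chart" where C: "\<And>i. C i \<in> A" "(\<Union>i. fst (C i)) = UNIV"
    using countable_charts by blast
  have U: "fst (C i) \<in> sets borel" for i using chart_loc.open_dom[OF chart_at[OF C(1)]] by simp
  have sm: "sets (chart_measure c) = sets borel" for c by (simp add: chart_measure_def)
  obtain \<mu> where \<mu>: "sets \<mu> = sets borel"
    "\<And>i E. E \<in> sets borel \<Longrightarrow> E \<subseteq> fst (C i) \<Longrightarrow> emeasure \<mu> E = emeasure (chart_measure (C i)) E"
    using glue_measures[of "\<lambda>i. fst (C i)" "\<lambda>i. chart_measure (C i)", OF U sm chart_measure_compat[OF C(1) C(1)]] by metis
  have D: "disjointed (\<lambda>i. fst (C i)) i \<in> sets borel" for i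
    using sets.range_disjointed_sets[of "\<lambda>i. fst (C i)" borel] U by auto
  have agree: "emeasure \<mu> E = emeasure (chart_measure c) E" if "c \<in> A" "E \<in> sets borel" "E \<subseteq> fst c" for c E
  proof -
    have "emeasure \<mu> (E \<inter> disjointed (\<lambda>i. fst (C i)) i) = emeasure (chart_measure c) (E \<inter> disjointed (\<lambda>i. fst (C i)) i)" for i
    proof -
      have 1: "E \<inter> disjointed (\<lambda>i. fst (C i)) i \<in> sets borel" using D that(2) by auto
      have 2: "E \<inter> disjointed (\<lambda>i. fst (C i)) i \<subseteq> fst (C i)" "E \<inter> disjointed (\<lambda>i. fst (C i)) i \<subseteq> fst c"
        using disjointed_subset[of "\<lambda>i. fst (C i)" i] that(3) by auto
      show ?thesis using \<mu>(2)[OF 1 2(1)] chart_measure_compat[OF C(1) that(1) 1 2] by simp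
    qed
    then show ?thesis
      using emeasure_disjointed_sum[where U="\<lambda>i. fst (C i)", OF \<mu>(1) U that(2)]
        emeasure_disjointed_sum[where U="\<lambda>i. fst (C i)" and \<mu>="chart_measure c", OF sm U that(2)] C(2) by simp
  qed
  show ?thesis
  proof (rule ex1I[of _ \<mu>])
    show "sets \<mu> = sets borel \<and> (\<forall>c\<in>A. \<forall>E\<in>sets borel. E \<subseteq> fst c \<longrightarrow>
        emeasure \<mu> E = (\<integral>\<^sup>+x\<in>chart_img c E. ennreal (sqrt (det (g c x))) \<partial>lborel))"
      using \<mu>(1) agree emeasure_chart_measure by auto
    fix \<mu>' assume \<mu>': "sets \<mu>' = sets borel \<and> (\<forall>c\<in>A. \<forall>E\<in>sets borel. E \<subseteq> fst c \<longrightarrow>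
        emeasure \<mu>' E = (\<integral>\<^sup>+x\<in>chart_img c E. ennreal (sqrt (det (g c x))) \<partial>lborel))"
    show "\<mu>' = \<mu>"
    proof (rule measure_eqI)
      fix E assume "E \<in> sets \<mu>'"
      then have E: "E \<in> sets borel" using \<mu>' by simp
      have "emeasure \<mu>' (E \<inter> disjointed (\<lambda>i. fst (C i)) i) = emeasure \<mu> (E \<inter> disjointed (\<lambda>i. fst (C i)) i)" for i
      proof -
        have 1: "E \<inter> disjointed (\<lambda>i. fst (C i)) i \<in> sets borel" using D E by auto
        have 2: "E \<inter> disjointed (\<lambda>i. fst (C i)) i \<subseteq> fst (C i)"
          using disjointed_subset[of "\<lambda>i. fst (C i)" i] by auto
        show ?thesis using \<mu>(2)[OF 1 2] \<mu>' 1 2 C(1) emeasure_chart_measure[OF C(1) 1] by simp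
      qed
      then show "emeasure \<mu>' E = emeasure \<mu> E"
        using emeasure_disjointed_sum[where U="\<lambda>i. fst (C i)", OF \<mu>(1) U E]
          emeasure_disjointed_sum[where U="\<lambda>i. fst (C i)", OF conjunct1[OF \<mu>'] U E] C(2) by simp
    qed (use \<mu>' \<mu> in simp)
  qed
qed

abbreviation "vol \<equiv> volume_measure A g"

lemma sets_vol [simp]: "sets vol = sets borel"
  and emeasure_vol: "c \<in> A \<Longrightarrow> E \<in> sets borel \<Longrightarrow> E \<subseteq> fst c \<Longrightarrow> emeasure vol E = emeasure (chart_measure c) E"
  using theI'[OF volume_measure_unique] emeasure_chart_measure unfolding volume_measure_def[symmetric] by auto

lemma integral_vol_chart:
  fixes F :: "'a \<Rightarrow> real"
  assumes c: "c \<in> A" and F: "F \<in> borel_measurable borel" "\<And>p. p \<notin> fst c \<Longrightarrow> F p = 0"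
  shows "integral\<^sup>L vol F = (LINT x:img c|lborel. dens c x * F (ci c x))"
proof -
  have "integral\<^sup>L vol F = integral\<^sup>L (chart_measure c) F"
    by (rule integral_eq_of_local_eq[where U="fst c"])
       (use chart_loc.open_dom[OF chart_at[OF c]] emeasure_vol[OF c] F(2) in \<open>auto simp: chart_measure_def\<close>)
  then show ?thesis
    unfolding chart_measure_def using param_ok[OF c] F(1) by (subst (asm) integral_param_measure) auto
qed

lemma vol_locally_finite: "\<exists>U. open U \<and> p \<in> U \<and> emeasure vol U < \<infinity>"
proof -
  obtain c where c: "c \<in> A" "p \<in> fst c" using cover by blast
  interpret L: chart_loc c by (rule chart_at[OF c(1)])
  obtain r where r: "r > 0" "cball (snd c p) r \<subseteq> img c"
    using L.open_img L.snd_img[OF c(2)] open_contains_cball by blast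
  let ?U = "{q \<in> fst c. snd c q \<in> ball (snd c p) r}"
  have oU: "open ?U" by (rule L.open_chart_preimage) simp
  obtain M where M: "\<And>x. x \<in> cball (snd c p) r \<Longrightarrow> dens c x \<le> M"
    using compact_imp_bounded[OF compact_continuous_image[OF continuous_on_subset[OF dens_cont[OF c(1)] r(2)] compact_cball]]
    unfolding bounded_iff by (metis abs_le_D1 image_eqI real_norm_def)
  have "emeasure vol ?U = (\<integral>\<^sup>+x\<in>chart_img c ?U. ennreal (dens c x) \<partial>lborel)"
    using emeasure_vol[OF c(1)] emeasure_chart_measure[OF c(1)] oU by auto
  also have "\<dots> \<le> (\<integral>\<^sup>+x. ennreal M * indicator (cball (snd c p) r) x \<partial>lborel)"
  proof (rule nn_integral_mono)
    fix x show "ennreal (dens c x) * indicator (chart_img c ?U) x \<le> ennreal M * indicator (cball (snd c p) r) x"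
    proof (cases "x \<in> chart_img c ?U")
      case True
      then have "x \<in> cball (snd c p) r" using mem_imgD(2,4)[OF c(1) True] by simp
      then show ?thesis using M True by (simp add: ennreal_leI)
    qed simp
  qed
  also have "\<dots> = ennreal M * emeasure lborel (cball (snd c p) r)"
    by (simp add: nn_integral_cmult_indicator)
  also have "\<dots> < \<infinity>"
    using emeasure_bounded_finite[OF bounded_cball, of "snd c p" r] by (simp add: ennreal_mult_less_top)
  finally show ?thesis using oU c r by (intro exI[of _ ?U]) auto
qed

lemma vol_finite_compact: "compact K \<Longrightarrow> emeasure vol K < \<infinity>"
  using emeasure_compact_finite_local[of vol K UNIV] vol_locally_finite borel_closed[OF compact_imp_closed, of K] by auto

end

section \<open>Local geometry of the boundary\<close>

text \<open>Let \<open>r\<close> be the part of \<open>b\<close> orthogonal to \<open>a\<close>.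
  Testing on \<open>r - e *\<^sub>R a\<close> and letting \<open>e\<close> tend to 0 forces
  \<open>r = 0\<close>. This is why all defining functions of a domain give the same normal.\<close>

lemma halfspace_normals:
  fixes a b :: "real^'n"
  assumes "a \<noteq> 0" "b \<noteq> 0" and ab: "\<And>v. a \<bullet> v < 0 \<Longrightarrow> b \<bullet> v \<le> 0"
  shows "\<exists>l>0. b = l *\<^sub>R a"
proof -
  define l where "l = (b \<bullet> a) / (a \<bullet> a)"
  define r where "r = b - l *\<^sub>R a"
  have aa: "a \<bullet> a > 0" using assms(1) by simp
  have ra: "a \<bullet> r = 0" using aa by (simp add: r_def l_def inner_diff_right inner_commute)
  have br: "b \<bullet> r = r \<bullet> r" using ra by (simp add: r_def inner_diff_left inner_diff_right inner_commute)
  have "r \<bullet> r \<le> e * (l * (a \<bullet> a))" if "e > 0" for e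
  proof -
    have "b \<bullet> (r - e *\<^sub>R a) \<le> 0" by (rule ab) (use ra aa that in \<open>simp add: inner_diff_right\<close>)
    then show ?thesis using aa by (simp add: inner_diff_right br l_def)
  qed
  then have "((\<lambda>e. e * (l * (a \<bullet> a)) - r \<bullet> r) \<longlongrightarrow> 0 * (l * (a \<bullet> a)) - r \<bullet> r) (at_right 0)"
    by (intro tendsto_intros) 
  moreover have "\<forall>\<^sub>F e in at_right 0. 0 \<le> e * (l * (a \<bullet> a)) - r \<bullet> r"
    using \<open>\<And>e. e > 0 \<Longrightarrow> r \<bullet> r \<le> e * (l * (a \<bullet> a))\<close> by (auto simp: eventually_at_right_field intro: exI[of _ 1])
  ultimately have "0 * (l * (a \<bullet> a)) - r \<bullet> r \<ge> 0"
    by (rule tendsto_lowerbound) simp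
  then have "r \<bullet> r = 0" using inner_ge_zero[of r] by simp
  then have bl: "b = l *\<^sub>R a" by (simp add: r_def)
  have "b \<bullet> (- a) \<le> 0" by (rule ab) (use aa in simp)
  then have "l \<ge> 0" using aa bl by (simp add: zero_le_mult_iff)
  then show ?thesis using bl assms(2) by (cases "l = 0") auto
qed

lemma has_derivative_insI:
  assumes "hyper j \<iota>" "(f has_derivative f') F" "(k has_derivative k') F" "F = at x within S"
  shows "((\<lambda>y. ins j \<iota> (f y) (k y)) has_derivative (\<lambda>v. ins j \<iota> (f' v) (k' v))) F"
  unfolding assms(4)
proof (rule has_derivative_vecI)
  fix i
  show "((\<lambda>y. ins j \<iota> (f y) (k y) $ i) has_derivative (\<lambda>v. ins j \<iota> (f' v) (k' v) $ i)) (at x within S)"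
    using assms has_derivative_nth by (cases "i = j") (auto simp: ins_def)
qed

lemma has_derivative_prjI:
  "(f has_derivative f') (at x within S) \<Longrightarrow> ((\<lambda>y. prj \<iota> (f y)) has_derivative (\<lambda>v. prj \<iota> (f' v))) (at x within S)"
  by (rule has_derivative_vecI) (simp add: prj_def has_derivative_nth)

text \<open>The implicit function theorem, by inverting \<open>z \<mapsto> (\<rho> z, prj z)\<close>.\<close>

lemma graph_patch_exists:
  fixes D V :: "(real^'n::finite) set"
  assumes card: "CARD('n::finite) = CARD('m::finite) + 1"
    and def: "defining_function D V \<rho> x" and \<rho>0: "\<rho> x = 0" and oX: "open X" "x \<in> X"
  obtains Q j and \<iota> :: "'m::finite \<Rightarrow> 'n::finite" and W h s where "graph_patch D Q j \<iota> W h s" "x \<in> Q" "Q \<subseteq> X"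
proof -
  have V: "open V" "x \<in> V" and C2: "Ck_on 2 V \<rho>" and DV: "D \<inter> V = {y \<in> V. \<rho> y < 0}"
    using def by (auto simp: defining_function_def)
  obtain j where "partial V j \<rho> x \<noteq> 0" using def by (auto simp: defining_function_def)
  then have j: "partial UNIV j \<rho> x \<noteq> 0" unfolding partial_open[OF V] .
  obtain \<iota> :: "'m \<Rightarrow> 'n" where hyp: "hyper j \<iota>" using hyper_exists[OF card] by blast
  note [simp] = hyper_neq[OF hyp] hyper_inv[OF hyp] hyper_inj[OF hyp] ins_j[OF hyp] ins_\<iota>[OF hyp] prj_ins[OF hyp] ins_prj[OF hyp]
  define s where "s = sgn (partial UNIV j \<rho> x)"
  have ss: "s * s = 1" using j by (simp add: s_def sgn_if)
  have C2': "Ck_on (Suc 1) V \<rho>" using C2 by (simp add: numeral_2_eq_2)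
  have p1: "Ck_on 1 V (partial UNIV i \<rho>)" for i by (rule Ck_on_SucD2[OF V(1) C2'])
  have cp: "continuous_on V (partial UNIV i \<rho>)" for i by (rule Ck_on_continuous[OF p1])
  have dr: "\<rho> differentiable at z" if "z \<in> V" for z by (rule Ck_on_SucD1[OF V(1) C2' that])
  define V' where "V' = {z \<in> V. s * partial UNIV j \<rho> z > 0}"
  have oV': "open V'"
  proof -
    have "open (V \<inter> (\<lambda>z. s * partial UNIV j \<rho> z) -` {0<..})"
      using continuous_openin_preimage_gen[of V "\<lambda>z. s * partial UNIV j \<rho> z" "{0<..}"] cp V(1)
      by (metis continuous_on_mult_left open_greaterThan openin_open_trans)
    moreover have "V \<inter> (\<lambda>z. s * partial UNIV j \<rho> z) -` {0<..} = V'" by (auto simp: V'_def)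
    ultimately show ?thesis by simp
  qed
  have xV': "x \<in> V'" using V j by (auto simp: V'_def s_def sgn_if)
  have "open (V' \<inter> X)" "x \<in> V' \<inter> X" using oV' xV' oX by auto
  then obtain r where r: "r > 0" "ball x r \<subseteq> V' \<inter> X" unfolding open_contains_ball by blast
  let ?B = "ball x r"
  have BV: "?B \<subseteq> V" using r by (auto simp: V'_def)
  have pj: "s * partial UNIV j \<rho> z > 0" if "z \<in> ?B" for z using r that by (auto simp: V'_def)
  \<comment> \<open>Balls are convex, so \<rho> is strictly monotone along every segment in
    direction \<open>j\<close>. This makes \<open>?F\<close> injective on the entire ball and later
    decides on which side of the graph a point lies.\<close>
  have mono: "\<exists>t. t > 0 \<and> s * (\<rho> (ins j \<iota> b y) - \<rho> (ins j \<iota> a y)) = t * (b - a)"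
    if "ins j \<iota> a y \<in> ?B" "ins j \<iota> b y \<in> ?B" "a < b" for a b y
  proof -
    have seg: "ins j \<iota> t y \<in> ?B" if t: "a \<le> t" "t \<le> b" for t
    proof -
      have "ins j \<iota> t y \<in> closed_segment (ins j \<iota> a y) (ins j \<iota> b y)"
      proof -
        define w where "w = (t - a) / (b - a)"
        have lin: "(1 - u) * a + u * b = a + u * (b - a)" for u by (simp add: algebra_simps)
        have "(1 - w) * a + w * b = t" unfolding lin w_def using \<open>a < b\<close> by simp
        moreover have "(1 - u) * c + u * c = c" for u c :: real by (simp add: algebra_simps)
        ultimately have "ins j \<iota> t y = (1 - w) *\<^sub>R ins j \<iota> a y + w *\<^sub>R ins j \<iota> b y"
          unfolding vec_eq_iff hyper_all[OF hyp] by simp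
        moreover have "0 \<le> w" "w \<le> 1" using t \<open>a < b\<close> by (auto simp: w_def)
        ultimately show ?thesis unfolding in_segment by blast
      qed
      then show ?thesis using closed_segment_subset[OF _ _ convex_ball] \<open>ins j \<iota> a y \<in> ?B\<close> \<open>ins j \<iota> b y \<in> ?B\<close> by blast
    qed
    have "((\<lambda>t. \<rho> (ins j \<iota> t y)) has_real_derivative partial UNIV j \<rho> (ins j \<iota> t y)) (at t)" if "a \<le> t" "t \<le> b" for t
    proof -
      have 1: "((\<lambda>t. ins j \<iota> t y) has_derivative (\<lambda>v. ins j \<iota> v 0)) (at t)"
        by (rule has_derivative_insI[OF hyp has_derivative_ident has_derivative_const refl])
      have "\<rho> differentiable at (ins j \<iota> t y)" using dr BV seg[OF that] by blast
      from has_derivative_compose[OF 1 has_derivative_partial_at[OF this]] show ?thesis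
        by (simp add: has_field_derivative_def hyper_sum[OF hyp] mult.commute[of _ "partial _ _ _ _"])
    qed
    then obtain \<xi> where "a < \<xi>" "\<xi> < b" "\<rho> (ins j \<iota> b y) - \<rho> (ins j \<iota> a y) = (b - a) * partial UNIV j \<rho> (ins j \<iota> \<xi> y)"
      using MVT2[OF \<open>a < b\<close>, of "\<lambda>t. \<rho> (ins j \<iota> t y)" "\<lambda>t. partial UNIV j \<rho> (ins j \<iota> t y)"] by blast
    then show ?thesis using pj[OF seg[of \<xi>]] by (intro exI[of _ "s * partial UNIV j \<rho> (ins j \<iota> \<xi> y)"]) (simp add: mult_ac)
  qed
  have sgn_mono: "s * (\<rho> z - \<rho> z') < 0 \<longleftrightarrow> z $ j < z' $ j" if z: "z \<in> ?B" "z' \<in> ?B" "prj \<iota> z = prj \<iota> z'" for z z'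
  proof -
    have e: "ins j \<iota> (z $ j) (prj \<iota> z') = z" "ins j \<iota> (z' $ j) (prj \<iota> z') = z'" using z(3) by (metis ins_prj[OF hyp])+
    consider "z $ j < z' $ j" | "z' $ j < z $ j" | "z $ j = z' $ j" by linarith
    then show ?thesis
    proof cases
      case 1
      obtain t where t: "t > 0" "s * (\<rho> z' - \<rho> z) = t * (z' $ j - z $ j)"
        using mono[of "z $ j" "prj \<iota> z'" "z' $ j"] 1 z unfolding e by blast
      have "t * (z' $ j - z $ j) > 0" using t(1) 1 by (intro mult_pos_pos) auto
      then show ?thesis using t(2) 1 by (simp add: algebra_simps)
    next
      case 2
      obtain t where t: "t > 0" "s * (\<rho> z - \<rho> z') = t * (z $ j - z' $ j)"
        using mono[of "z' $ j" "prj \<iota> z'" "z $ j"] 2 z unfolding e by blast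
      have "t * (z $ j - z' $ j) > 0" using t(1) 2 by (intro mult_pos_pos) auto
      then show ?thesis using t(2) 2 by simp
    next
      case 3
      then have "z = z'" using e by metis
      then show ?thesis by simp
    qed
  qed
  let ?F = "\<lambda>z. ins j \<iota> (\<rho> z) (prj \<iota> z)"
  have injF: "inj_on ?F ?B"
  proof (rule inj_onI)
    fix z z' assume z: "z \<in> ?B" "z' \<in> ?B" "?F z = ?F z'"
    then have e: "\<rho> z = \<rho> z'" "prj \<iota> z = prj \<iota> z'" by (metis ins_j[OF hyp], metis prj_ins[OF hyp])
    have "z $ j = z' $ j" using sgn_mono[of z z'] sgn_mono[of z' z] z e by (simp add: not_less)
    then show "z = z'" using e by (metis ins_prj[OF hyp])
  qed
  have cF: "continuous_on ?B ?F"
    by (intro continuous_on_ins[OF hyp] continuous_on_prj[OF hyp] continuous_on_id continuous_on_subset[OF Ck_on_continuous[OF C2] BV])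
  \<comment> \<open>Invariance of domain: the image is open, hence so is the set \<open>W\<close> on
    which the implicit function is defined.\<close>
  have oF: "open (?F ` ?B)" by (rule invariance_of_domain[OF cF open_ball injF])
  define G where "G = inv_into ?B ?F"
  have GF: "G (?F z) = z" if "z \<in> ?B" for z unfolding G_def by (rule inv_into_f_f[OF injF that])
  define W where "W = {y. ins j \<iota> 0 y \<in> ?F ` ?B}"
  have oW: "open W"
  proof -
    have "continuous_on UNIV (\<lambda>y. ins j \<iota> 0 y)" by (intro continuous_on_ins[OF hyp] continuous_intros)
    then have "open ((\<lambda>y. ins j \<iota> 0 y) -` (?F ` ?B))" by (rule open_vimage[OF oF])
    then show ?thesis by (simp add: W_def vimage_def)
  qed
  define h where "h y = G (ins j \<iota> 0 y) $ j" for y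
  have G0: "G (ins j \<iota> 0 y) \<in> ?B \<and> ?F (G (ins j \<iota> 0 y)) = ins j \<iota> 0 y" if "y \<in> W" for y
    using that GF by (auto simp: W_def)
  have par: "ins j \<iota> (h y) y = G (ins j \<iota> 0 y)" if "y \<in> W" for y
  proof -
    have "prj \<iota> (G (ins j \<iota> 0 y)) = y" using arg_cong[OF conjunct2[OF G0[OF that]], of "prj \<iota>"] by simp
    then show ?thesis unfolding h_def by (metis ins_prj[OF hyp])
  qed
  have parB: "ins j \<iota> (h y) y \<in> ?B" and par0: "\<rho> (ins j \<iota> (h y) y) = 0" if "y \<in> W" for y
  proof -
    show "ins j \<iota> (h y) y \<in> ?B" using par[OF that] G0[OF that] by metis
    show "\<rho> (ins j \<iota> (h y) y) = 0"
      using par[OF that] arg_cong[OF conjunct2[OF G0[OF that]], of "\<lambda>v. v $ j"] by simp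
  qed
  have dh: "(h has_derivative (\<lambda>v. - (\<Sum>a\<in>UNIV. v $ a * partial UNIV (\<iota> a) \<rho> (ins j \<iota> (h y) y)) / partial UNIV j \<rho> (ins j \<iota> (h y) y))) (at y)"
    if y: "y \<in> W" for y
  proof -
    let ?z = "ins j \<iota> (h y) y"
    have z: "?z \<in> ?B" by (rule parB[OF y])
    have pz: "partial UNIV j \<rho> ?z \<noteq> 0" using pj[OF z] by auto
    let ?F' = "\<lambda>v. ins j \<iota> (\<Sum>i\<in>UNIV. v $ i *\<^sub>R partial UNIV i \<rho> ?z) (prj \<iota> v)"
    let ?G' = "\<lambda>u. ins j \<iota> ((u $ j - (\<Sum>a\<in>UNIV. u $ \<iota> a * partial UNIV (\<iota> a) \<rho> ?z)) / partial UNIV j \<rho> ?z) (prj \<iota> u)"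
    have derF: "(?F has_derivative ?F') (at ?z)"
      by (rule has_derivative_insI[OF hyp has_derivative_partial_at[OF dr] has_derivative_prjI[OF has_derivative_ident] refl])
         (use z BV in blast)
    have "(G has_derivative ?G') (at (?F ?z))"
    proof (rule has_derivative_inverse_strong[OF open_ball z cF GF derF])
      show "?F' \<circ> ?G' = id"
      proof
        fix u
        have "?F' (?G' u) = ins j \<iota> (u $ j) (prj \<iota> u)"
          using pz by (simp add: hyper_sum[OF hyp] prj_nth[OF hyp])
        then show "(?F' \<circ> ?G') u = id u" by simp
      qed
    qed
    moreover have "?F ?z = ins j \<iota> 0 y" using par0[OF y] by simp
    ultimately have dG: "(G has_derivative ?G') (at (ins j \<iota> 0 y))" by simp
    have di: "((\<lambda>y. ins j \<iota> 0 y) has_derivative (\<lambda>v. ins j \<iota> 0 v)) (at y)"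
      by (rule has_derivative_insI[OF hyp has_derivative_const has_derivative_ident refl])
    have "(h has_derivative (\<lambda>v. ?G' (ins j \<iota> 0 v) $ j)) (at y)"
      using has_derivative_nth[OF has_derivative_compose[OF di dG], of j] by (simp only: h_def[abs_def])
    then show ?thesis by simp
  qed
  let ?par = "\<lambda>y. ins j \<iota> (h y) y"
  have Ck_par: "Ck_on k W ?par" if "Ck_on k W h" for k
  proof (rule Ck_on_vecI[OF oW])
    fix i show "Ck_on k W (\<lambda>y. ?par y $ i)"
      using that oW by (cases "i = j") (simp_all add: ins_def)
  qed
  have ph: "partial UNIV a h y = (- partial UNIV (\<iota> a) \<rho> (?par y)) / partial UNIV j \<rho> (?par y)" if "y \<in> W" for y a
    using partial_eqI[OF dh[OF that], of a] by simp
  have dhd: "h differentiable at y" if "y \<in> W" for y using dh[OF that] unfolding differentiable_def by blast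
  \<comment> \<open>Bootstrapping: the partials of \<open>h\<close> are quotients of first partials
    of \<rho> evaluated on the graph, so \<open>h\<close> gains one order of regularity as long as
    those partials have the regularity already known for \<open>h\<close>.\<close>
  have step: "Ck_on (Suc k) W h" if "Ck_on k W h" "k \<le> 1" for k
  proof (rule Ck_on_SucI[OF oW dhd])
    fix a
    have q: "Ck_on k V' (\<lambda>z. (- partial UNIV (\<iota> a) \<rho> z) / partial UNIV j \<rho> z)"
      using Ck_on_subset[OF V(1) oV' _ Ck_on_mono[OF p1 that(2)]]
      by (intro Ck_on_divide Ck_on_minus oV') (auto simp: V'_def)
    have "?par ` W \<subseteq> V'" using parB r by blast
    then have "Ck_on k W (\<lambda>y. (- partial UNIV (\<iota> a) \<rho> (?par y)) / partial UNIV j \<rho> (?par y))"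
      by (rule Ck_on_compose[OF oW oV' Ck_par[OF that(1)] _ q])
    then show "Ck_on k W (partial UNIV a h)" using Ck_on_cong[OF oW, of "partial UNIV a h"] ph by simp
  qed
  have "h differentiable_on W"
    unfolding differentiable_on_def using differentiable_at_withinI[OF dhd] by blast
  then have "Ck_on 0 W h" by (simp add: differentiable_imp_continuous_on)
  then have h2: "Ck_on 2 W h" using step[OF step] by (simp add: numeral_2_eq_2 del: Ck_on.simps)
  define Q where "Q = {z \<in> ?B. prj \<iota> z \<in> W}"
  have oQ: "open Q"
  proof -
    have "continuous_on UNIV (prj \<iota>)" by (intro continuous_on_prj[OF hyp] continuous_on_id)
    then have "open (?B \<inter> prj \<iota> -` W)" by (intro open_Int open_ball open_vimage[OF oW])
    then show ?thesis by (simp add: Q_def vimage_def Int_def)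
  qed
  have xQ: "x \<in> Q"
  proof -
    have "?F x = ins j \<iota> 0 (prj \<iota> x)" using \<rho>0 by simp
    then have "prj \<iota> x \<in> W" unfolding W_def using r(1) by (metis (mono_tags, lifting) centre_in_ball imageI mem_Collect_eq)
    then show ?thesis using r(1) by (simp add: Q_def)
  qed
  have "z \<in> D \<longleftrightarrow> graph_fun j \<iota> h s z < 0" if "z \<in> Q" for z
  proof -
    have z: "z \<in> ?B" "prj \<iota> z \<in> W" using that by (auto simp: Q_def)
    have z': "?par (prj \<iota> z) \<in> ?B" "prj \<iota> z = prj \<iota> (?par (prj \<iota> z))" using parB[OF z(2)] by simp_all
    have "z \<in> D \<longleftrightarrow> \<rho> z < 0" using DV z(1) BV by blast
    moreover have "s * \<rho> z < 0 \<longleftrightarrow> z $ j < h (prj \<iota> z)" using sgn_mono[OF z(1) z'] par0[OF z(2)] by simp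
    moreover have "s * (- \<rho> z) < 0 \<longleftrightarrow> h (prj \<iota> z) < z $ j" using sgn_mono[OF z'(1) z(1) z'(2)[symmetric]] par0[OF z(2)] by simp
    moreover have "s = 1 \<or> s = - 1" using ss by (simp add: square_eq_1_iff)
    ultimately show ?thesis by (auto simp: graph_fun_def)
  qed
  then have "graph_patch D Q j \<iota> W h s"
    unfolding graph_patch_def using hyp oQ oW h2 ss parB by (auto simp: Q_def)
  moreover have "Q \<subseteq> X" using r by (auto simp: Q_def)
  ultimately show ?thesis using that xQ by blast
qed

lemma has_derivative_graph_par:
  assumes "graph_patch_loc D Q j \<iota> W h s" "y \<in> W"
  shows "((\<lambda>y. ins j \<iota> (h y) y) has_derivative (\<lambda>v. ins j \<iota> (\<Sum>a\<in>UNIV. v $ a *\<^sub>R partial UNIV a h y) v)) (at y)"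
  by (rule has_derivative_insI[OF graph_patch_loc.hyp[OF assms(1)]
      has_derivative_partial_at[OF graph_patch_loc.diff_h[OF assms]] has_derivative_ident refl])

section \<open>Tangent vectors and conormals of a graph\<close>

context graph_patch_loc begin

abbreviation "dpar y v \<equiv> ins j \<iota> (\<Sum>a\<in>UNIV. v $ a *\<^sub>R partial UNIV a h y) v"

lemma par_deriv: "y \<in> W \<Longrightarrow> (par has_derivative dpar y) (at y)"
  by (rule has_derivative_graph_par[OF graph_patch_loc_axioms])

lemma par_prj: "g z = 0 \<Longrightarrow> par (prj \<iota> z) = z"
proof -
  assume "g z = 0"
  then have "h (prj \<iota> z) = z $ j" using ss by (auto simp: graph_fun_def)
  then show ?thesis by (simp only: ins_prj[OF hyp])
qed

lemma nu_inner: "nu y \<bullet> v = s * (v $ j - (\<Sum>a\<in>UNIV. v $ \<iota> a * partial UNIV a h y))"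
  unfolding inner_vec_def hyper_sum[OF hyp]
  by (simp add: right_diff_distrib sum_distrib_left sum_negf mult_ac)

lemma tangent_eq_dpar: "nu y \<bullet> v = 0 \<Longrightarrow> v = dpar y (prj \<iota> v)"
proof -
  assume "nu y \<bullet> v = 0"
  then have "v $ j = (\<Sum>a\<in>UNIV. v $ \<iota> a * partial UNIV a h y)"
    using ss by (auto simp: nu_inner)
  then show ?thesis unfolding vec_eq_iff hyper_all[OF hyp] by (simp add: prj_nth[OF hyp])
qed

lemma nu_nonzero: "nu y \<noteq> 0"
  using nu_j[of y] ss by (metis mult_zero_left zero_index zero_neq_one)

lemma defining: "z \<in> Q \<Longrightarrow> defining_function D Q g z"
  unfolding defining_function_def
proof (intro conjI ballI)
  fix y assume y: "y \<in> Q"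
  have "partial Q j g y = s" unfolding partial_open[OF open_Q y] partial_g[OF y] by simp
  moreover have "s \<noteq> 0" using ss by auto
  ultimately show "\<exists>i. partial Q i g y \<noteq> 0" by metis
qed (use open_Q Ck_g D_iff in auto)

text \<open>A short step from \<open>z\<close> in a direction \<open>v\<close> with
  \<open>nu (prj \<iota> z) \<bullet> v < 0\<close> enters \<open>D\<close>, where \<rho> is
  negative, while \<rho> is not negative at \<open>z\<close>; so the derivative of \<rho> along
  \<open>v\<close> is at most 0. The two conormals thus satisfy the hypothesis of
  \<open>halfspace_normals\<close>.\<close>

lemma defining_normal:
  assumes z: "z \<in> Q" "g z = 0" and d: "defining_function D V \<rho> z"
  shows "\<exists>l>0. (\<chi> i. partial V i \<rho> z) = l *\<^sub>R nu (prj \<iota> z)"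
proof (rule halfspace_normals[OF nu_nonzero])
  have V: "open V" "z \<in> V" and C2: "Ck_on (Suc 1) V \<rho>" and DV: "D \<inter> V = {y \<in> V. \<rho> y < 0}"
    using d by (auto simp: defining_function_def numeral_2_eq_2)
  show "(\<chi> i. partial V i \<rho> z) \<noteq> 0" using d by (auto simp: defining_function_def vec_eq_iff)
  fix v assume v: "nu (prj \<iota> z) \<bullet> v < 0"
  have line: "((\<lambda>t. f (z + t *\<^sub>R v)) has_real_derivative (\<chi> i. partial UNIV i f z) \<bullet> v) (at 0)"
    if "f differentiable at z" for f :: "real^'n \<Rightarrow> real"
  proof -
    have 1: "((\<lambda>t. z + t *\<^sub>R v) has_derivative (\<lambda>t. t *\<^sub>R v)) (at 0)" by (auto intro!: derivative_eq_intros)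
    have 2: "(f has_derivative (\<lambda>h. \<Sum>i\<in>UNIV. h $ i *\<^sub>R partial UNIV i f z)) (at (z + 0 *\<^sub>R v))"
      using has_derivative_partial_at[OF that] by simp
    have e: "(\<Sum>i\<in>UNIV. (t *\<^sub>R v) $ i *\<^sub>R partial UNIV i f z) = ((\<chi> i. partial UNIV i f z) \<bullet> v) * t" for t
      by (simp add: inner_vec_def sum_distrib_left sum_distrib_right mult_ac)
    show ?thesis using has_derivative_compose[OF 1 2] by (simp only: has_field_derivative_def e)
  qed
  have gd: "g differentiable at z" by (rule Ck_on_1_differentiable[OF open_Q g1 z(1)])
  have gv: "(\<chi> i. partial UNIV i g z) = nu (prj \<iota> z)" using partial_g[OF z(1)] by (simp add: vec_eq_iff)
  have \<rho>v: "(\<chi> i. partial UNIV i \<rho> z) = (\<chi> i. partial V i \<rho> z)"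
    unfolding partial_open[OF V] ..
  have \<rho>z: "\<rho> z \<ge> 0" using DV V z D_iff by (metis (mono_tags, lifting) IntI less_irrefl mem_Collect_eq not_le IntD1)
  have lg: "((\<lambda>t. g (z + t *\<^sub>R v) / t) \<longlongrightarrow> nu (prj \<iota> z) \<bullet> v) (at_right 0)"
    using line[OF gd] z(2) unfolding gv DERIV_def by (simp add: filterlim_at_split)
  have l\<rho>: "((\<lambda>t. (\<rho> (z + t *\<^sub>R v) - \<rho> z) / t) \<longlongrightarrow> (\<chi> i. partial V i \<rho> z) \<bullet> v) (at_right 0)"
    using line[OF Ck_on_SucD1[OF V(1) C2 V(2)]] unfolding \<rho>v DERIV_def by (simp add: filterlim_at_split)
  have ze: "((\<lambda>t. z + t *\<^sub>R v) \<longlongrightarrow> z) (at_right 0)"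
    by (auto intro!: tendsto_eq_intros)
  have "\<forall>\<^sub>F t in at_right 0. (\<rho> (z + t *\<^sub>R v) - \<rho> z) / t \<le> 0"
    using order_tendstoD(2)[OF lg v] topological_tendstoD[OF ze open_Q z(1)] topological_tendstoD[OF ze V] eventually_at_right_less[of 0]
  proof eventually_elim
    case (elim t)
    then have "g (z + t *\<^sub>R v) < 0" by (simp add: divide_less_0_iff)
    then have "z + t *\<^sub>R v \<in> D" using D_iff elim by blast
    then have "\<rho> (z + t *\<^sub>R v) < 0" using DV elim by blast
    then show ?case using \<rho>z elim by (simp add: divide_le_0_iff)
  qed
  then show "(\<chi> i. partial V i \<rho> z) \<bullet> v \<le> 0" by (rule tendsto_upperbound[OF l\<rho>]) simp
qed

end

section \<open>Unit normal, mean curvature and flux in a boundary patch\<close>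

locale boundary_patch = coord_metric G S + graph_patch_loc D Q j \<iota> W h s
  for G :: "real^'n::finite \<Rightarrow> real^'n^'n" and S and D Q :: "(real^'n) set" and j and \<iota> :: "'m::finite \<Rightarrow> 'n"
    and W :: "(real^'m) set" and h s +
  assumes QS: "Q \<subseteq> S"
begin

text \<open>The squared metric length of the conormal. Through the projection, \<open>q\<close> and
  the unit normal \<open>N\<close> are defined on all of \<open>Q\<close>, not only on the graph;
  this extension makes covariant derivatives of the normal available.\<close>

definition "q z = nu (prj \<iota> z) \<bullet> (matrix_inv (G z) *v nu (prj \<iota> z))"
definition "N z = (1 / sqrt (q z)) *\<^sub>R (matrix_inv (G z) *v nu (prj \<iota> z))"

lemma cont_G: "continuous_on S G"
  using smooth Ck_on_continuous[of 0] unfolding Cinf_on_def by blast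

lemma inS: "z \<in> Q \<Longrightarrow> z \<in> S" using QS by blast

lemma G_inv_nu: "z \<in> Q \<Longrightarrow> G z *v (matrix_inv (G z) *v nu (prj \<iota> z)) = nu (prj \<iota> z)"
  by (simp add: matrix_vector_mul_assoc matrix_inv_right[OF inv[OF inS]])

lemma q_pos: "z \<in> Q \<Longrightarrow> q z > 0"
  unfolding q_def by (rule gram_det(1)[OF hyp sym[OF inS] pos[OF inS] ss, where w="\<chi> a. partial UNIV a h (prj \<iota> z)"]) auto

text \<open>The surface density is thus \<open>sqrt (q z)\<close> times the volume density, which is
  the factor between the Euclidean flux through the graph and the Riemannian one.\<close>

lemma gram_par:
  assumes "z \<in> Q"
  shows "det (\<chi> a b. dpar (prj \<iota> z) (axis a 1) \<bullet> (G z *v dpar (prj \<iota> z) (axis b 1))) = det (G z) * q z"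
proof -
  have e: "dpar (prj \<iota> z) (axis a 1) = axis (\<iota> a) 1 + (\<chi> a. partial UNIV a h (prj \<iota> z)) $ a *\<^sub>R axis j 1" for a
  proof -
    have "axis (\<iota> a) (1::real) $ j = 0" by (simp add: axis_def hyper_neq[OF hyp, symmetric])
    moreover have "axis (\<iota> a) (1::real) $ \<iota> b = axis a 1 $ b" "axis j (1::real) $ \<iota> b = 0" for b
      by (simp_all add: axis_def)
    ultimately show ?thesis unfolding vec_eq_iff hyper_all[OF hyp] by simp
  qed
  show ?thesis
    unfolding e q_def by (rule gram_det(2)[OF hyp sym[OF inS[OF assms]] pos[OF inS[OF assms]] ss]) auto
qed

lemma GN: "z \<in> Q \<Longrightarrow> G z *v N z = (1 / sqrt (q z)) *\<^sub>R nu (prj \<iota> z)"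
  by (simp add: N_def matrix_vector_mult_scaleR G_inv_nu)

lemma NN: "z \<in> Q \<Longrightarrow> N z \<bullet> (G z *v N z) = 1"
proof -
  assume z: "z \<in> Q"
  have "N z \<bullet> (G z *v N z) = (1 / sqrt (q z)) * (1 / sqrt (q z)) * q z"
    unfolding GN[OF z] by (simp add: N_def q_def inner_commute)
  then show ?thesis using q_pos[OF z] by simp
qed

lemma inner_N: "z \<in> Q \<Longrightarrow> metric_inner G z v (N z) = (nu (prj \<iota> z) \<bullet> v) / sqrt (q z)"
  by (simp add: metric_inner_def GN inner_commute)

lemma Ck_N: "Ck_on 1 Q (\<lambda>z. N z $ k)"
proof -
  have nu1: "Ck_on 1 Q (\<lambda>z. nu (prj \<iota> z) $ i)" for i
  proof -
    have "Ck_on 1 Q (partial UNIV i g)" using Ck_on_SucD2[OF open_Q, of 1 g i] Ck_g by (simp add: numeral_2_eq_2)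
    moreover have "Ck_on 1 Q (partial UNIV i g) \<longleftrightarrow> Ck_on 1 Q (\<lambda>z. nu (prj \<iota> z) $ i)"
      by (rule Ck_on_cong[OF open_Q partial_g])
    ultimately show ?thesis by blast
  qed
  have gi: "Ck_on 1 Q (\<lambda>z. metric_inv G z i k)" for i k
    by (rule Ck_on_subset[OF open_S open_Q QS Ck_metric_inv])
  have q: "Ck_on 1 Q q"
  proof -
    have "q = (\<lambda>z. \<Sum>i\<in>UNIV. nu (prj \<iota> z) $ i * (\<Sum>k\<in>UNIV. metric_inv G z i k * nu (prj \<iota> z) $ k))"
      by (rule ext) (simp add: q_def inner_vec_def matrix_vector_mult_def metric_inv_def)
    then show ?thesis by (simp only:) (intro Ck_on_sum Ck_on_mult open_Q nu1 gi)
  qed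
  have "Ck_on 1 Q (\<lambda>z. (\<Sum>i\<in>UNIV. metric_inv G z k i * nu (prj \<iota> z) $ i) / sqrt (q z))"
    using q_pos by (intro Ck_on_divide Ck_on_sum Ck_on_mult Ck_on_sqrt_1 open_Q nu1 gi q) fastforce+
  moreover have "(\<lambda>z. N z $ k) = (\<lambda>z. (\<Sum>i\<in>UNIV. metric_inv G z k i * nu (prj \<iota> z) $ i) / sqrt (q z))"
    by (rule ext) (simp add: N_def matrix_vector_mult_def metric_inv_def)
  ultimately show ?thesis by simp
qed

lemma diff_N: "z \<in> Q \<Longrightarrow> N differentiable at z"
  by (rule vec_differentiableI) (rule Ck_on_1_differentiable[OF open_Q Ck_N])

lemma cont_N: "continuous_on Q N"
  using continuous_on_vec_lambda[of Q "\<lambda>k z. N z $ k"] Ck_on_continuous[OF Ck_N] by simp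

lemma normal_of_defining:
  assumes z: "z \<in> Q" "g z = 0" and d: "defining_function D V \<rho> z"
  shows "(let X = gradient G V \<rho> z in (1 / sqrt (metric_inner G z X X)) *\<^sub>R X) = N z"
proof -
  obtain l where l: "l > 0" "(\<chi> i. partial V i \<rho> z) = l *\<^sub>R nu (prj \<iota> z)"
    using defining_normal[OF z d] by blast
  have X: "gradient G V \<rho> z = l *\<^sub>R (matrix_inv (G z) *v nu (prj \<iota> z))"
    by (simp add: gradient_def l(2) matrix_vector_mult_scaleR)
  have "metric_inner G z (gradient G V \<rho> z) (gradient G V \<rho> z) = l\<^sup>2 * q z"
    unfolding X metric_inner_def by (simp add: matrix_vector_mult_scaleR G_inv_nu[OF z(1)] q_def inner_commute power2_eq_square)
  then show ?thesis using l(1) by (simp add: Let_def X N_def real_sqrt_mult)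
qed

lemma outward_normal_eq:
  assumes z: "z \<in> Q" "g z = 0"
  shows "outward_normal G D z = N z"
  unfolding outward_normal_def
proof (rule the_equality)
  show "\<exists>V \<rho>. defining_function D V \<rho> z \<and> N z = (let X = gradient G V \<rho> z in (1 / sqrt (metric_inner G z X X)) *\<^sub>R X)"
    using defining[OF z(1)] normal_of_defining[OF z] by metis
qed (use normal_of_defining[OF z] in metis)

definition "proj z = matrix (\<lambda>X. X - metric_inner G z X (N z) *\<^sub>R N z)"

lemma proj_mult: "proj z *v X = X - metric_inner G z X (N z) *\<^sub>R N z"
proof -
  have "linear (\<lambda>X. X - metric_inner G z X (N z) *\<^sub>R N z)"
    by (intro linearI) (simp_all add: metric_inner_def inner_add_left algebra_simps)
  then show ?thesis unfolding proj_def by (simp add: matrix_works)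
qed

lemma proj_tangent: "z \<in> Q \<Longrightarrow> nu (prj \<iota> z) \<bullet> (proj z *v X) = 0"
proof -
  assume z: "z \<in> Q"
  have "nu (prj \<iota> z) \<bullet> (proj z *v X) = nu (prj \<iota> z) \<bullet> X - (nu (prj \<iota> z) \<bullet> X / sqrt (q z)) * (nu (prj \<iota> z) \<bullet> N z)"
    by (simp add: proj_mult inner_diff_right inner_N[OF z])
  also have "nu (prj \<iota> z) \<bullet> N z = sqrt (q z)"
    using q_pos[OF z] by (simp add: N_def q_def[symmetric] real_div_sqrt)
  finally show ?thesis using q_pos[OF z] by simp
qed

lemma trace_proj: "z \<in> Q \<Longrightarrow> trace (T ** proj z) = trace T - metric_inner G z (T *v N z) (N z)"
proof -
  assume z: "z \<in> Q"
  have p: "proj z $ i $ k = mat 1 $ i $ k - (G z *v N z) $ k * N z $ i" for i k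
    by (simp add: proj_def matrix_def metric_inner_def inner_axis') (simp add: mat_def axis_def)
  have "trace (T ** proj z) = trace (T ** mat 1) - (\<Sum>i\<in>UNIV. \<Sum>k\<in>UNIV. T $ i $ k * N z $ k * (G z *v N z) $ i)"
    by (simp add: trace_def matrix_matrix_mult_def p right_diff_distrib sum_subtractf mult_ac)
  also have "(\<Sum>i\<in>UNIV. \<Sum>k\<in>UNIV. T $ i $ k * N z $ k * (G z *v N z) $ i) = metric_inner G z (T *v N z) (N z)"
    by (simp add: metric_inner_def inner_vec_def matrix_vector_mult_def[of T] sum_distrib_right)
  finally show ?thesis by simp
qed

lemma trace_shape_extension:
  assumes z: "z \<in> Q" "g z = 0" and B: "\<And>z. z \<in> Q \<Longrightarrow> z \<in> B \<longleftrightarrow> g z = 0"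
    and M: "M differentiable at z" and O': "open O'" "z \<in> O'" "\<And>z'. z' \<in> O' \<Longrightarrow> z' \<in> Q \<Longrightarrow> g z' = 0 \<Longrightarrow> M z' = N z'"
  shows "trace_shape G B (outward_normal G D) z = trace (nab G M z ** proj z)"
proof -
  let ?y = "prj \<iota> z"
  have yW: "?y \<in> W" by (rule prjW[OF z(1)])
  have par_z: "par ?y = z" by (rule par_prj[OF z(2)])
  have zB: "z \<in> B" using B z by blast
  have N0: "outward_normal G D z' = M z'" if "z' \<in> O' \<inter> Q" "z' \<in> B" for z'
    using outward_normal_eq that B O' by auto
  have N0z: "outward_normal G D z = M z" "outward_normal G D z = N z"
    using N0 outward_normal_eq z zB O' by auto
  have dN: "(M has_derivative frechet_derivative M (at z)) (at z)"
    using M unfolding frechet_derivative_works .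
  have "open (O' \<inter> Q)" "z \<in> O' \<inter> Q" using O' open_Q z by auto
  then obtain e where e: "e > 0" "ball z e \<subseteq> O' \<inter> Q" using open_contains_ball by blast
  have "(outward_normal G D has_derivative frechet_derivative M (at z)) (at z within B)"
    by (rule has_derivative_transform_within[OF has_derivative_at_withinI[OF dN] e(1) zB])
       (use N0 e(2) in \<open>auto simp: dist_commute subset_iff\<close>)
  then have dM: "(outward_normal G D has_derivative frechet_derivative (outward_normal G D) (at z within B)) (at z within B)"
    using frechet_derivative_works unfolding differentiable_def by blast
  let ?F = "frechet_derivative (outward_normal G D) (at z within B)"
  have parB: "par ` W \<subseteq> B" using B par_Q by auto
  have dM': "(outward_normal G D has_derivative ?F) (at (par ?y) within par ` W)"
    using has_derivative_subset[OF dM parB] par_z by simp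
  have "((\<lambda>y. outward_normal G D (par y)) has_derivative (\<lambda>v. ?F (dpar ?y v))) (at ?y within W)"
    by (rule has_derivative_in_compose[OF has_derivative_at_withinI[OF par_deriv[OF yW]] dM'])
  then have 1: "((\<lambda>y. outward_normal G D (par y)) has_derivative (\<lambda>v. ?F (dpar ?y v))) (at ?y)"
    unfolding at_within_open[OF yW open_W] .
  have 2: "((\<lambda>y. M (par y)) has_derivative (\<lambda>v. frechet_derivative M (at z) (dpar ?y v))) (at ?y)"
    using has_derivative_compose[OF par_deriv[OF yW], of M] dN par_z by simp
  have oP: "open (W \<inter> par -` (O' \<inter> Q))" "?y \<in> W \<inter> par -` (O' \<inter> Q)"
    using continuous_openin_preimage_gen[OF cont_par \<open>open (O' \<inter> Q)\<close>] open_W openin_open_trans par_z O' z yW by auto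
  have 3: "((\<lambda>y. M (par y)) has_derivative (\<lambda>v. ?F (dpar ?y v))) (at ?y)"
    by (rule has_derivative_transform_within_open[OF 1 oP]) (use N0 parB in auto)
  have tang: "?F v = frechet_derivative M (at z) v" if "nu ?y \<bullet> v = 0" for v
    using fun_cong[OF has_derivative_unique[OF 3 2], of "prj \<iota> v"] tangent_eq_dpar[OF that] by simp
  have cov: "covariant_along G B (outward_normal G D) z v = nab G M z *v v" if "nu ?y \<bullet> v = 0" for v
    unfolding covariant_along_def tang[OF that] nab_mult[OF M] Gam_def by (simp add: N0z(1))
  have "(\<lambda>X. covariant_along G B (outward_normal G D) z (X - metric_inner G z X (outward_normal G D z) *\<^sub>R outward_normal G D z))
     = (\<lambda>X. (nab G M z ** proj z) *v X)"
  proof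
    fix X
    have "X - metric_inner G z X (outward_normal G D z) *\<^sub>R outward_normal G D z = proj z *v X"
      by (simp add: proj_mult N0z(2))
    then show "covariant_along G B (outward_normal G D) z (X - metric_inner G z X (outward_normal G D z) *\<^sub>R outward_normal G D z)
       = (nab G M z ** proj z) *v X"
      using cov[OF proj_tangent[OF z(1), of X]] by (simp add: matrix_vector_mul_assoc)
  qed
  then show ?thesis by (simp add: trace_shape_def)
qed

lemma continuous_on_trace_shape: "continuous_on Q (\<lambda>z. trace (nab G N z ** proj z))"
proof -
  have n: "continuous_on Q (\<lambda>z. nab G N z $ i $ k)" for i k
    unfolding nab_def vec_lambda_beta
    using Ck_on_1_partial[OF open_Q Ck_N] cont_N continuous_on_subset[OF Ck_on_continuous[OF Ck_christoffel] QS]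
    by (intro continuous_intros) auto
  have p: "continuous_on Q (\<lambda>z. proj z $ i $ k)" for i k
  proof -
    have "proj z $ i $ k = mat 1 $ i $ k - (\<Sum>l\<in>UNIV. G z $ k $ l * N z $ l) * N z $ i" for z
      by (simp add: proj_def matrix_def metric_inner_def inner_axis' matrix_vector_mult_def) (simp add: mat_def axis_def)
    moreover have "continuous_on Q (\<lambda>z. mat 1 $ i $ k - (\<Sum>l\<in>UNIV. G z $ k $ l * N z $ l) * N z $ i)"
      using cont_N continuous_on_subset[OF cont_G QS]
      by (intro continuous_intros) auto
    ultimately show ?thesis by simp
  qed
  show ?thesis unfolding trace_def matrix_matrix_mult_def vec_lambda_beta by (intro continuous_intros n p)
qed

lemma boundary_gradient:
  assumes S0: "S0 \<subseteq> S" "\<And>z. z \<in> Q \<Longrightarrow> z \<in> S0 \<longleftrightarrow> g z \<le> 0" and u: "Ck_on 2 S0 u"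
    and u0: "\<And>y. y \<in> W \<Longrightarrow> u (par y) = 0" and z: "z \<in> Q" "g z = 0"
  defines "X \<equiv> gradient G S0 u"
  shows "X z = metric_inner G z (X z) (N z) *\<^sub>R N z"
proof -
  let ?y = "prj \<iota> z" and ?p = "\<chi> i. partial S0 i u z"
  have yW: "?y \<in> W" by (rule prjW[OF z(1)])
  have par_z: "par ?y = z" by (rule par_prj[OF z(2)])
  have zS0: "z \<in> S0" using S0 z by simp
  have "u differentiable at z within S0" using u zS0 by (simp add: numeral_2_eq_2 differentiable_on_def)
  from has_derivative_partial[OF this]
  have du: "(u has_derivative (\<lambda>v. ?p \<bullet> v)) (at z within S0)"
    by (simp add: inner_vec_def mult.commute)
  have parS: "par ` W \<subseteq> S0" using S0 par_Q by auto
  have du': "(u has_derivative (\<lambda>v. ?p \<bullet> v)) (at (par ?y) within par ` W)"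
    using has_derivative_subset[OF du parS] par_z by simp
  have 1: "((\<lambda>y. u (par y)) has_derivative (\<lambda>v. ?p \<bullet> dpar ?y v)) (at ?y within W)"
    by (rule has_derivative_in_compose[OF has_derivative_at_withinI[OF par_deriv[OF yW]] du'])
  have 2: "((\<lambda>y. u (par y)) has_derivative (\<lambda>v. 0)) (at ?y within W)"
    by (rule has_derivative_transform[OF yW _ has_derivative_const[of 0]]) (use u0 in simp)
  have t: "?p \<bullet> v = 0" if "nu ?y \<bullet> v = 0" for v
    using fun_cong[OF has_derivative_unique[OF 1[unfolded at_within_open[OF yW open_W]] 2[unfolded at_within_open[OF yW open_W]]], of "prj \<iota> v"]
      tangent_eq_dpar[OF that] by simp
  have "v \<bullet> (G z *v X z) = v \<bullet> (G z *v (metric_inner G z (X z) (N z) *\<^sub>R N z))" for v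
  proof -
    have GX: "G z *v X z = ?p"
      by (simp add: X_def gradient_def matrix_vector_mul_assoc matrix_inv_right[OF inv[OF inS[OF z(1)]]])
    have "?p \<bullet> (proj z *v v) = 0" by (rule t[OF proj_tangent[OF z(1)]])
    then have "?p \<bullet> v = metric_inner G z v (N z) * (?p \<bullet> N z)"
      by (simp add: proj_mult inner_diff_right)
    also have "?p \<bullet> N z = metric_inner G z (X z) (N z)"
      unfolding metric_inner_def GX[symmetric] by (simp add: inner_sym[OF inS[OF z(1)]])
    finally show ?thesis
      unfolding GX by (simp add: metric_inner_def matrix_vector_mult_scaleR inner_commute mult.commute)
  qed
  then have "G z *v X z = G z *v (metric_inner G z (X z) (N z) *\<^sub>R N z)"
    by (intro vec_eq_if_inner) (simp add: inner_commute)
  then show ?thesis by (rule matvec_cancel[OF inv[OF inS[OF z(1)]]])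
qed

lemma Gam_scaleR_right: "Gam G z v (c *\<^sub>R w) = c *\<^sub>R Gam G z v w"
  by (simp add: Gam_def vec_eq_iff sum_distrib_left mult_ac)

text \<open>Differentiating \<open>X = w N\<close> along the boundary shows that the tangential part of \<open>\<nabla>X\<close> is
  \<open>w \<nabla>N\<close> up to a multiple of \<open>N\<close>.\<close>

lemma boundary_flux:
  assumes S0: "S0 \<subseteq> S" "\<And>z. z \<in> Q \<Longrightarrow> z \<in> S0 \<longleftrightarrow> g z \<le> 0" and u: "Ck_on 2 S0 u"
    and u0: "\<And>y. y \<in> W \<Longrightarrow> u (par y) = 0" and z: "z \<in> Q" "g z = 0"
  defines "X \<equiv> gradient G S0 u" and "T \<equiv> matrix_inv (G z) ** transpose (hessian G S0 u z)"
  shows "metric_inner G z (T *v X z - trace T *\<^sub>R X z) (N z)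
     = - trace (nab G N z ** proj z) * (metric_inner G z (X z) (N z))\<^sup>2"
proof -
  let ?y = "prj \<iota> z"
  have yW: "?y \<in> W" by (rule prjW[OF z(1)])
  have par_z: "par ?y = z" by (rule par_prj[OF z(2)])
  have zS0: "z \<in> S0" using S0 z by simp
  let ?w = "metric_inner G z (X z) (N z)"
  have Xz: "X z' = metric_inner G z' (X z') (N z') *\<^sub>R N z'" if "z' \<in> Q" "g z' = 0" for z'
    unfolding X_def by (rule boundary_gradient[OF S0 u u0 that])
  have parS: "par ` W \<subseteq> S0" using S0 par_Q by auto
  have dX: "(X has_derivative (\<lambda>v. T *v v - Gam G z v (X z))) (at (par ?y) within par ` W)"
    using has_derivative_subset[OF gradient_has_derivative[OF S0(1) u zS0] parS] par_z by (simp add: X_def T_def)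
  have dXp: "((\<lambda>y. X (par y)) has_derivative (\<lambda>v. T *v dpar ?y v - Gam G z (dpar ?y v) (X z))) (at ?y)"
    using has_derivative_in_compose[OF has_derivative_at_withinI[OF par_deriv[OF yW]] dX]
    unfolding at_within_open[OF yW open_W] .
  have dN: "(N has_derivative frechet_derivative N (at z)) (at (par ?y))"
    using diff_N[OF z(1)] unfolding frechet_derivative_works par_z .
  have dNp: "((\<lambda>y. N (par y)) has_derivative (\<lambda>v. frechet_derivative N (at z) (dpar ?y v))) (at ?y)"
    by (rule has_derivative_compose[OF par_deriv[OF yW] dN])
  have dG: "((\<lambda>y. G (par y)) has_derivative (\<lambda>v. mat_deriv G z (dpar ?y v))) (at ?y)"
    using has_derivative_compose[OF par_deriv[OF yW], of G "mat_deriv G z"] deriv_G[OF inS[OF z(1)]] par_z by simp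
  let ?\<omega> = "\<lambda>y. X (par y) \<bullet> (G (par y) *v N (par y))"
  obtain \<omega>' where \<omega>: "(?\<omega> has_derivative \<omega>') (at ?y)"
    using has_derivative_inner[OF dXp has_derivative_matvec[OF dG dNp]] by blast
  have 1: "((\<lambda>y. ?\<omega> y *\<^sub>R N (par y)) has_derivative (\<lambda>v. ?w *\<^sub>R frechet_derivative N (at z) (dpar ?y v) + \<omega>' v *\<^sub>R N z)) (at ?y)"
    using has_derivative_scaleR[OF \<omega> dNp] unfolding par_z metric_inner_def .
  have 2: "((\<lambda>y. X (par y)) has_derivative (\<lambda>v. ?w *\<^sub>R frechet_derivative N (at z) (dpar ?y v) + \<omega>' v *\<^sub>R N z)) (at ?y)"
    by (rule has_derivative_transform_within_open[OF 1 open_W yW]) (use Xz par_Q in \<open>simp add: metric_inner_def\<close>)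
  \<comment> \<open>For tangent \<open>v\<close> the two derivatives of \<open>X\<close> along the
    parametrization agree; the Christoffel terms combine because \<open>X z\<close> is
    \<open>?w\<close> times \<open>N z\<close>.\<close>
  have Tt: "T *v v = \<omega>' (prj \<iota> v) *\<^sub>R N z + ?w *\<^sub>R (nab G N z *v v)" if "nu ?y \<bullet> v = 0" for v
  proof -
    have "T *v v - Gam G z v (X z) = ?w *\<^sub>R frechet_derivative N (at z) v + \<omega>' (prj \<iota> v) *\<^sub>R N z"
      using fun_cong[OF has_derivative_unique[OF dXp 2], of "prj \<iota> v"] tangent_eq_dpar[OF that] by simp
    moreover have "Gam G z v (X z) = ?w *\<^sub>R Gam G z v (N z)"
      using arg_cong[OF Xz[OF z], of "Gam G z v"] unfolding Gam_scaleR_right .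
    ultimately show ?thesis
      unfolding nab_mult[OF diff_N[OF z(1)]] by (simp add: scaleR_add_right diff_eq_eq)
  qed
  have l\<omega>: "linear \<omega>'" by (rule has_derivative_linear[OF \<omega>])
  have lprj: "linear (prj \<iota>)" by (intro linearI) (simp_all add: prj_def vec_eq_iff)
  let ?\<alpha> = "\<lambda>v. \<omega>' (prj \<iota> (proj z *v v))"
  have l\<alpha>: "linear ?\<alpha>"
    using linear_compose[OF linear_compose[OF matrix_vector_mul_linear[of "proj z"] lprj] l\<omega>] by (simp add: o_def)
  have entries: "(T ** proj z) $ i $ k = ?\<alpha> (axis k 1) * N z $ i + ?w * (nab G N z ** proj z) $ i $ k" for i k
  proof -
    have "(T ** proj z) *v axis k 1 = ?\<alpha> (axis k 1) *\<^sub>R N z + ?w *\<^sub>R ((nab G N z ** proj z) *v axis k 1)"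
      using Tt[OF proj_tangent[OF z(1), of "axis k 1"]] by (simp add: matrix_vector_mul_assoc)
    then have "((T ** proj z) *v axis k 1) $ i = ?\<alpha> (axis k 1) * N z $ i + ?w * ((nab G N z ** proj z) *v axis k 1) $ i" by simp
    then show ?thesis by (simp only: matrix_vector_mult_basis column_def vec_lambda_beta)
  qed
  \<comment> \<open>The columns of \<open>T ** proj z\<close> contain a multiple of
    \<open>N z\<close> given by the linear form \<alpha>. Its contribution to the trace is \<alpha>
    evaluated at \<open>N z\<close>, which is 0 because \<open>proj z\<close> kills
    \<open>N z\<close>.\<close>
  have "proj z *v N z = 0" using NN[OF z(1)] by (simp add: proj_mult metric_inner_def)
  then have "(\<Sum>i\<in>UNIV. ?\<alpha> (axis i 1) * N z $ i) = 0"
    using linear_eq_sum_axis[OF l\<alpha>, of "N z"] linear_0[OF l\<omega>] linear_0[OF lprj] by (simp add: mult.commute)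
  then have "trace (T ** proj z) = ?w * trace (nab G N z ** proj z)"
    unfolding trace_def entries by (simp add: sum.distrib sum_distrib_left)
  then have tr: "trace T - metric_inner G z (T *v N z) (N z) = ?w * trace (nab G N z ** proj z)"
    unfolding trace_proj[OF z(1)] .
  have "metric_inner G z (T *v X z - trace T *\<^sub>R X z) (N z) = metric_inner G z (T *v X z) (N z) - trace T * ?w"
    by (simp add: metric_inner_def inner_diff_left)
  also have "metric_inner G z (T *v X z) (N z) = ?w * metric_inner G z (T *v N z) (N z)"
    by (subst Xz[OF z]) (simp add: metric_inner_def matrix_vector_mult_scaleR)
  also have "metric_inner G z (T *v N z) (N z) = trace T - ?w * trace (nab G N z ** proj z)" using tr by simp
  finally show ?thesis by (simp add: power2_eq_square algebra_simps)
qed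

end

section \<open>The surface measure of the boundary\<close>

text \<open>The argument \<open>TM\<close> only fixes the type whose cardinality is the dimension of the boundary.\<close>

locale riem_dom = riem A g
  for A :: "('a::{t2_space, second_countable_topology}, 'n::finite) chart set" and g +
  fixes \<Omega> :: "'a set" and TM :: "'m::finite itself"
  assumes card: "CARD('n) = CARD('m) + 1" and open_\<Omega>: "open \<Omega>" and compact_cl: "compact (closure \<Omega>)"
    and C2b: "C2_boundary A \<Omega>"
begin

abbreviation "B \<equiv> frontier \<Omega>"

lemma B_def': "B = closure \<Omega> - \<Omega>"
  using open_\<Omega> by (simp add: frontier_def interior_open)

lemma closed_B: "closed B" by simp

lemma compact_B: "compact B"
  using compact_cl by (metis compact_Int_closed closed_B Int_absorb1 frontier_subset_closed closure_subset B_def' Diff_subset)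

definition bpatch :: "('a, 'n) chart \<Rightarrow> (real^'n) set \<Rightarrow> 'n \<Rightarrow> ('m \<Rightarrow> 'n) \<Rightarrow> (real^'m) set \<Rightarrow> (real^'m \<Rightarrow> real) \<Rightarrow> real \<Rightarrow> bool" where
  "bpatch c Q j \<iota> W h s \<longleftrightarrow> c \<in> A \<and> Q \<subseteq> img c \<and> graph_patch (chart_img c \<Omega>) Q j \<iota> W h s"

lemma bpatchD:
  assumes "bpatch c Q j \<iota> W h s"
  shows "c \<in> A" "boundary_patch (g c) (img c) (chart_img c \<Omega>) Q j \<iota> W h s"
  using assms coord_metric_at by (auto simp: bpatch_def boundary_patch_def boundary_patch_axioms_def graph_patch_loc_def)

text \<open>A defining function is only known to be negative exactly on the domain. That it vanishes
  at a frontier point, as the implicit function theorem requires, follows since a point where it is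
  positive has a neighbourhood disjoint from \<Omega>.\<close>

lemma bpatch_exists:
  assumes p: "p \<in> B" "c \<in> A" "p \<in> fst c" and X: "open X" "snd c p \<in> X"
  shows "\<exists>Q j \<iota> W h s. bpatch c Q j \<iota> W h s \<and> snd c p \<in> Q \<and> Q \<subseteq> X"
proof -
  interpret L: chart_loc c by (rule chart_at[OF p(2)])
  let ?x = "snd c p"
  obtain V \<rho> where d: "defining_function (chart_img c \<Omega>) V \<rho> ?x"
    using C2b p unfolding C2_boundary_def by blast
  have V: "open V" "?x \<in> V" "chart_img c \<Omega> \<inter> V = {y \<in> V. \<rho> y < 0}" and "Ck_on 2 V \<rho>"
    using d by (auto simp: defining_function_def)
  then have c\<rho>: "continuous_on V \<rho>" using Ck_on_continuous by blast
  have "p \<notin> \<Omega>" using p B_def' by blast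
  then have "?x \<notin> chart_img c \<Omega>" using L.snd_mem_img[OF p(3)] by blast
  then have 1: "\<not> \<rho> ?x < 0" using V by blast
  have 2: "\<not> \<rho> ?x > 0"
  proof
    assume pos: "\<rho> ?x > 0"
    have "open (V \<inter> \<rho> -` {0<..})"
      using continuous_openin_preimage_gen[OF c\<rho> open_greaterThan] V(1) openin_open_trans by blast
    then have o: "open {q \<in> fst c. snd c q \<in> V \<inter> \<rho> -` {0<..}}" by (rule L.open_chart_preimage)
    have "{q \<in> fst c. snd c q \<in> V \<inter> \<rho> -` {0<..}} \<inter> \<Omega> = {}"
    proof (rule equals0I)
      fix q assume "q \<in> {q \<in> fst c. snd c q \<in> V \<inter> \<rho> -` {0<..}} \<inter> \<Omega>"
      then have q: "q \<in> fst c" "snd c q \<in> V" "\<rho> (snd c q) > 0" "q \<in> \<Omega>" by auto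
      then have "snd c q \<in> chart_img c \<Omega> \<inter> V" using L.snd_mem_img by blast
      then show False using q V(3) by auto
    qed
    then have "{q \<in> fst c. snd c q \<in> V \<inter> \<rho> -` {0<..}} \<inter> closure \<Omega> = {}"
      using open_Int_closure_eq_empty[OF o] by blast
    then show False using p pos V(2) B_def' by blast
  qed
  have \<rho>0: "\<rho> ?x = 0" using 1 2 by simp
  obtain Q j and \<iota> :: "'m \<Rightarrow> 'n" and W h s where gp: "graph_patch (chart_img c \<Omega>) Q j \<iota> W h s" "?x \<in> Q" "Q \<subseteq> X \<inter> img c"
    by (rule graph_patch_exists[OF card d \<rho>0, of "X \<inter> img c"])
       (use X L.open_img L.snd_img[OF p(3)] in auto)
  then have "bpatch c Q j \<iota> W h s \<and> snd c p \<in> Q \<and> Q \<subseteq> X" using p(2) unfolding bpatch_def by blast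
  then show ?thesis by blast
qed

text \<open>Where the graph function is positive there is a neighbourhood missing \<Omega>.
  Conversely, a point with value at most 0 is a limit of points of \<Omega>, reached by moving along
  coordinate \<open>j\<close> in the direction of \<open>- s\<close>.\<close>

lemma bpatch_closure:
  assumes b: "bpatch c Q j \<iota> W h s" and z: "z \<in> Q"
  shows "z \<in> chart_img c (closure \<Omega>) \<longleftrightarrow> graph_fun j \<iota> h s z \<le> 0"
    and "z \<in> chart_img c B \<longleftrightarrow> graph_fun j \<iota> h s z = 0"
proof -
  note c = bpatchD(1)[OF b]
  interpret L: chart_loc c by (rule chart_at[OF c])
  interpret boundary_patch "g c" "img c" "chart_img c \<Omega>" Q j \<iota> W h s by (rule bpatchD(2)[OF b])
  let ?g = "graph_fun j \<iota> h s"
  have zi: "z \<in> img c" using z QS by blast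
  show cl: "z \<in> chart_img c (closure \<Omega>) \<longleftrightarrow> ?g z \<le> 0"
  proof
    assume a: "z \<in> chart_img c (closure \<Omega>)"
    show "?g z \<le> 0"
    proof (rule ccontr)
      assume "\<not> ?g z \<le> 0"
      have "open (Q \<inter> ?g -` {0<..})"
        using continuous_openin_preimage_gen[OF cont_g open_greaterThan] open_Q openin_open_trans by blast
      then have o: "open {q \<in> fst c. snd c q \<in> Q \<inter> ?g -` {0<..}}" by (rule L.open_chart_preimage)
      have "{q \<in> fst c. snd c q \<in> Q \<inter> ?g -` {0<..}} \<inter> \<Omega> = {}"
      proof (rule equals0I)
        fix q assume "q \<in> {q \<in> fst c. snd c q \<in> Q \<inter> ?g -` {0<..}} \<inter> \<Omega>"
        then have q: "q \<in> fst c" "snd c q \<in> Q" "?g (snd c q) > 0" "q \<in> \<Omega>" by auto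
        then have "snd c q \<in> chart_img c \<Omega>" using L.snd_mem_img by blast
        then show False using q D_iff by auto
      qed
      then have "{q \<in> fst c. snd c q \<in> Q \<inter> ?g -` {0<..}} \<inter> closure \<Omega> = {}"
        using open_Int_closure_eq_empty[OF o] by blast
      then show False using mem_imgD[OF c a] z \<open>\<not> ?g z \<le> 0\<close> by auto
    qed
  next
    assume gz: "?g z \<le> 0"
    show "z \<in> chart_img c (closure \<Omega>)"
    proof (rule ccontr)
      assume n: "z \<notin> chart_img c (closure \<Omega>)"
      let ?O = "Q \<inter> chart_img c (- closure \<Omega>)"
      have oO: "open ?O" using open_Q L.open_chart_img[of "- closure \<Omega>"] by auto
      have zO: "z \<in> ?O" using n z zi L.mem_img[of z "closure \<Omega>"] L.mem_img[of z "- closure \<Omega>"] by blast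
      have "continuous_on UNIV (\<lambda>t. ins j \<iota> (z $ j - s * t) (prj \<iota> z))"
        by (intro continuous_on_ins[OF hyp] continuous_intros)
      then have "((\<lambda>t. ins j \<iota> (z $ j - s * t) (prj \<iota> z)) \<longlongrightarrow> ins j \<iota> (z $ j - s * 0) (prj \<iota> z)) (at 0)"
        unfolding continuous_on_def by blast
      then have lim: "((\<lambda>t. ins j \<iota> (z $ j - s * t) (prj \<iota> z)) \<longlongrightarrow> z) (at_right 0)"
        by (simp add: filterlim_at_split)
      have "\<forall>\<^sub>F t in at_right 0. ins j \<iota> (z $ j - s * t) (prj \<iota> z) \<in> ?O \<and> t > 0"
        using topological_tendstoD[OF lim oO zO] eventually_at_right_less[of 0] by eventually_elim simp
      then obtain t where t: "ins j \<iota> (z $ j - s * t) (prj \<iota> z) \<in> ?O" "t > 0"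
        using eventually_happens trivial_limit_at_right_real by blast
      let ?z = "ins j \<iota> (z $ j - s * t) (prj \<iota> z)"
      have "?g ?z = ?g z - (s * s) * t" by (simp add: graph_fun_def algebra_simps)
      then have "?z \<in> chart_img c \<Omega>" using D_iff[of ?z] t gz by (simp add: ss)
      then have "ci c ?z \<in> \<Omega>" using mem_imgD(2)[OF c] by blast
      moreover have "ci c ?z \<in> - closure \<Omega>" using mem_imgD(2)[OF c, of ?z "- closure \<Omega>"] t(1) by blast
      ultimately show False using closure_subset by blast
    qed
  qed
  have "z \<in> chart_img c B \<longleftrightarrow> z \<in> chart_img c (closure \<Omega>) \<and> z \<notin> chart_img c \<Omega>"
    unfolding B_def' using zi L.mem_img[of z "closure \<Omega> - \<Omega>"] L.mem_img[of z "closure \<Omega>"] L.mem_img[of z "\<Omega>"] by blast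
  then show "z \<in> chart_img c B \<longleftrightarrow> ?g z = 0" using cl D_iff[OF z] by auto
qed

definition gram :: "('a, 'n) chart \<Rightarrow> (real^'m) set \<Rightarrow> (real^'m \<Rightarrow> real^'n) \<Rightarrow> real^'m \<Rightarrow> real" where
  "gram c W \<psi> y = sqrt (det (\<chi> a b. metric_inner (g c) (\<psi> y) (partial W a \<psi> y) (partial W b \<psi> y)))"

definition "pm c W \<psi> = param_measure W (ci c \<circ> \<psi>) (gram c W \<psi>)"

lemma sets_pm [simp]: "sets (pm c W \<psi>) = sets borel" by (simp add: pm_def)

text \<open>Add a small multiple of the identity, apply the positive definite case and let the
  multiple tend to 0.\<close>

lemma gram_nonneg_aux:
  fixes M :: "real^'m^'m"
  assumes "\<And>v. v \<bullet> (M *v v) \<ge> 0" shows "det M \<ge> 0"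
proof -
  have "((\<lambda>e. det (M + e *\<^sub>R mat 1)) \<longlongrightarrow> det (M + 0 *\<^sub>R mat 1)) (at_right 0)"
  proof -
    have "continuous_on UNIV (\<lambda>e. det (M + e *\<^sub>R mat 1))" by (intro continuous_intros)
    then have "((\<lambda>e. det (M + e *\<^sub>R mat 1)) \<longlongrightarrow> det (M + 0 *\<^sub>R mat 1)) (at 0)" unfolding continuous_on_def by blast
    then show ?thesis by (simp add: filterlim_at_split)
  qed
  moreover have "\<forall>\<^sub>F e in at_right 0. 0 \<le> det (M + e *\<^sub>R mat 1)"
    using eventually_at_right_less[of 0]
  proof eventually_elim
    case (elim e)
    have "v \<bullet> ((M + e *\<^sub>R mat 1) *v v) > 0" if "v \<noteq> 0" for v
    proof -
      have "v \<bullet> ((M + e *\<^sub>R mat 1) *v v) = v \<bullet> (M *v v) + e * (v \<bullet> v)"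
        by (simp add: matrix_vector_mult_add_rdistrib scaleR_matrix_vector_assoc[symmetric] inner_add_right)
      moreover have "v \<bullet> v > 0" using that by simp
      ultimately show ?thesis using assms[of v] elim by (simp add: add_nonneg_pos)
    qed
    then show ?case using posdef_det_pos less_imp_le by blast
  qed
  ultimately have "0 \<le> det (M + 0 *\<^sub>R mat 1)" by (rule tendsto_lowerbound) simp
  then show ?thesis by simp
qed

lemma local_param_ok:
  assumes c: "c \<in> A" and lp: "local_parametrization c X W \<psi>"
  shows "open W" "continuous_on W \<psi>" "\<psi> ` W \<subseteq> img c" "continuous_on W (ci c \<circ> \<psi>)" "continuous_on W (gram c W \<psi>)"
    "\<And>y. y \<in> W \<Longrightarrow> 0 \<le> gram c W \<psi> y" "\<And>y. y \<in> W \<Longrightarrow> \<psi> differentiable at y"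
    "\<And>y. y \<in> W \<Longrightarrow> ci c (\<psi> y) \<in> X"
proof -
  interpret L: chart_loc c by (rule chart_at[OF c])
  interpret coord_metric "g c" "img c" by (rule coord_metric_at[OF c])
  show W: "open W" and im: "\<psi> ` W \<subseteq> img c" using lp L.img_subset unfolding local_parametrization_def by blast+
  have C2: "Ck_on (Suc 1) W \<psi>" using lp by (simp add: local_parametrization_def numeral_2_eq_2)
  show cp: "continuous_on W \<psi>" by (rule Ck_on_continuous[OF C2])
  show "continuous_on W (ci c \<circ> \<psi>)" by (rule continuous_on_compose[OF cp continuous_on_subset[OF L.cont_ci im]])
  show d: "\<psi> differentiable at y" if "y \<in> W" for y by (rule Ck_on_SucD1[OF W C2 that])
  have pc: "continuous_on W (partial W a \<psi>)" for a
  proof -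
    have "Ck_on 1 W (partial W a \<psi>)" using C2 unfolding Ck_on.simps(2)[of 1] by blast
    then show ?thesis by (rule Ck_on_continuous)
  qed
  have Gc: "continuous_on W (\<lambda>y. g c (\<psi> y) $ i $ k)" for i k
    by (rule continuous_on_compose2[OF Ck_on_continuous[OF Ck_G] cp im])
  have "continuous_on W (\<lambda>y. metric_inner (g c) (\<psi> y) (partial W a \<psi> y) (partial W b \<psi> y))" for a b
    unfolding metric_inner_def inner_vec_def matrix_vector_mult_def vec_lambda_beta inner_real_def
    by (intro continuous_on_sum continuous_on_mult continuous_on_component pc Gc)
  then show "continuous_on W (gram c W \<psi>)"
    unfolding gram_def[abs_def] by (intro continuous_on_real_sqrt continuous_on_det) simp
  show "0 \<le> gram c W \<psi> y" if "y \<in> W" for y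
  proof -
    let ?p = "\<lambda>a. partial W a \<psi> y"
    let ?M = "\<chi> a b. metric_inner (g c) (\<psi> y) (?p a) (?p b)"
    have "v \<bullet> (?M *v v) \<ge> 0" for v
    proof -
      let ?v = "\<Sum>a\<in>UNIV. v $ a *\<^sub>R ?p a"
      have "v \<bullet> (?M *v v) = (\<Sum>a\<in>UNIV. \<Sum>b\<in>UNIV. v $ a * (v $ b * (?p a \<bullet> (g c (\<psi> y) *v ?p b))))"
        by (simp add: inner_vec_def[of v] matrix_vector_mult_def[of ?M] sum_distrib_left)
           (simp add: metric_inner_def mult_ac)
      also have "\<dots> = (\<Sum>b\<in>UNIV. \<Sum>a\<in>UNIV. v $ a * (v $ b * (?p a \<bullet> (g c (\<psi> y) *v ?p b))))"
        by (rule sum.swap)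
      also have "\<dots> = ?v \<bullet> (g c (\<psi> y) *v ?v)"
        by (simp add: inner_sum_left inner_sum_right linear_sum[OF matrix_vector_mul_linear]
            matrix_vector_mult_scaleR sum_distrib_left mult_ac)
      finally have "v \<bullet> (?M *v v) = ?v \<bullet> (g c (\<psi> y) *v ?v)" .
      then show ?thesis using pos[of "\<psi> y" ?v] im that by (cases "?v = 0") (auto intro: less_imp_le)
    qed
    then show ?thesis unfolding gram_def using gram_nonneg_aux by simp
  qed
  show "ci c (\<psi> y) \<in> X" if "y \<in> W" for y
    using lp that mem_imgD(2)[OF c] unfolding local_parametrization_def by blast
qed

lemma emeasure_pm:
  assumes "c \<in> A" "local_parametrization c X W \<psi>" "E \<in> sets borel"
  shows "emeasure (pm c W \<psi>) E = (\<integral>\<^sup>+y\<in>{y\<in>W. ci c (\<psi> y) \<in> E}. ennreal (gram c W \<psi> y) \<partial>lborel)"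
  unfolding pm_def using local_param_ok[OF assms(1,2)] assms(3)
  by (subst emeasure_param_measure) auto

lemma bpatch_param:
  assumes b: "bpatch c Q j \<iota> W h s"
  shows "local_parametrization c B W (\<lambda>y. ins j \<iota> (h y) y)"
    and "y \<in> W \<Longrightarrow> partial W a (\<lambda>y. ins j \<iota> (h y) y) y = ins j \<iota> (\<Sum>b\<in>UNIV. axis a 1 $ b *\<^sub>R partial UNIV b h y) (axis a 1)"
    and "(ci c \<circ> (\<lambda>y. ins j \<iota> (h y) y)) ` W = {p \<in> fst c. snd c p \<in> Q} \<inter> B"
proof -
  note c = bpatchD(1)[OF b]
  interpret L: chart_loc c by (rule chart_at[OF c])
  interpret boundary_patch "g c" "img c" "chart_img c \<Omega>" Q j \<iota> W h s by (rule bpatchD(2)[OF b])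
  let ?par = "\<lambda>y. ins j \<iota> (h y) y"
  have C2: "Ck_on 2 W ?par"
  proof (rule Ck_on_vecI[OF open_W])
    fix i show "Ck_on 2 W (\<lambda>y. ?par y $ i)"
      using open_W h2 by (cases "i = j") (simp_all add: ins_def del: Ck_on.simps)
  qed
  have fd: "frechet_derivative ?par (at y) = dpar y" if "y \<in> W" for y
    using frechet_derivative_at[OF par_deriv[OF that]] by simp
  have inB: "?par y \<in> chart_img c B" if "y \<in> W" for y
    using bpatch_closure(2)[OF b par_Q[OF that]] by simp
  show "local_parametrization c B W ?par"
    unfolding local_parametrization_def
  proof (intro conjI ballI)
    show "inj_on ?par W" by (rule inj_on_inverseI[of _ "prj \<iota>"]) simp
    show "inj (frechet_derivative ?par (at y))" if "y \<in> W" for y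
      unfolding fd[OF that] by (rule inj_on_inverseI[of _ "prj \<iota>"]) simp
  qed (use open_W C2 inB in auto)
  show "partial W a ?par y = dpar y (axis a 1)" if "y \<in> W" for a y
    unfolding partial_open[OF open_W that] by (rule partial_eqI[OF par_deriv[OF that]])
  show "(ci c \<circ> ?par) ` W = {p \<in> fst c. snd c p \<in> Q} \<inter> B"
  proof
    show "(ci c \<circ> ?par) ` W \<subseteq> {p \<in> fst c. snd c p \<in> Q} \<inter> B"
      using mem_imgD[OF c inB] par_Q by auto
    show "{p \<in> fst c. snd c p \<in> Q} \<inter> B \<subseteq> (ci c \<circ> ?par) ` W"
    proof
      fix p assume p: "p \<in> {p \<in> fst c. snd c p \<in> Q} \<inter> B"
      then have "graph_fun j \<iota> h s (snd c p) = 0"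
        using bpatch_closure(2)[OF b, of "snd c p"] L.snd_mem_img[of p B] by blast
      then have "?par (prj \<iota> (snd c p)) = snd c p" by (rule par_prj)
      then have "(ci c \<circ> ?par) (prj \<iota> (snd c p)) = p" using L.ci_snd p by simp
      then show "p \<in> (ci c \<circ> ?par) ` W" using prjW p by (metis (mono_tags, lifting) IntD1 image_eqI mem_Collect_eq)
    qed
  qed
qed

text \<open>Only a graph patch is compared with an arbitrary parametrization. In this case the
  transition map is explicit, namely \<psi> in the chart \<open>c\<close> followed by the
  projection, and so it is differentiable without any local inversion of immersions. Arbitrary
  parametrizations are related to each other only through graph patches.\<close>

lemma pm_compare:
  assumes b: "bpatch c Q j \<iota> W h s" and d: "d \<in> A" and lp: "local_parametrization d B W2 \<psi>"
    and E: "E \<in> sets borel" "E \<subseteq> {p \<in> fst c. snd c p \<in> Q} \<inter> B" "E \<subseteq> (ci d \<circ> \<psi>) ` W2"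
  shows "emeasure (pm c W (\<lambda>y. ins j \<iota> (h y) y)) E = emeasure (pm d W2 \<psi>) E"
proof -
  note c = bpatchD(1)[OF b]
  interpret L: chart_loc c by (rule chart_at[OF c])
  interpret Ld: chart_loc d by (rule chart_at[OF d])
  interpret boundary_patch "g c" "img c" "chart_img c \<Omega>" Q j \<iota> W h s by (rule bpatchD(2)[OF b])
  interpret T: coord_change "g d" "img d" "g c" "img c" "chart_img d (fst c)" "tr d c" "jac d c"
    by (rule coord_change_at[OF d c]) (rule jac_eq)
  let ?par = "\<lambda>y. ins j \<iota> (h y) y"
  note bp = bpatch_param[OF b]
  note ok = local_param_ok[OF d lp]
  note okp = local_param_ok[OF c bp(1)]
  have inj\<psi>: "inj_on \<psi> W2" using lp by (simp add: local_parametrization_def)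
  define Oy where "Oy = {y \<in> W2. ci d (\<psi> y) \<in> {p \<in> fst c. snd c p \<in> Q}}"
  have oO: "open Oy"
  proof -
    have "open {p \<in> fst c. snd c p \<in> Q}" by (rule L.open_chart_preimage[OF open_Q])
    then have "open (W2 \<inter> (ci d \<circ> \<psi>) -` {p \<in> fst c. snd c p \<in> Q})"
      using continuous_openin_preimage_gen[OF ok(4)] ok(1) openin_open_trans by blast
    moreover have "W2 \<inter> (ci d \<circ> \<psi>) -` {p \<in> fst c. snd c p \<in> Q} = Oy" by (auto simp: Oy_def)
    ultimately show ?thesis by simp
  qed
  have \<psi>Z: "\<psi> y \<in> chart_img d (fst c)" if "y \<in> Oy" for y
    using that ok(3) Ld.mem_img[of "\<psi> y" "fst c"] by (auto simp: Oy_def)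
  define \<theta> where "\<theta> y = prj \<iota> (tr d c (\<psi> y))" for y
  have trQ: "tr d c (\<psi> y) \<in> Q" if "y \<in> Oy" for y using that by (simp add: Oy_def)
  have tr_par: "tr d c (\<psi> y) = ?par (\<theta> y)" if "y \<in> Oy" for y
  proof -
    have "ci d (\<psi> y) \<in> B" "ci d (\<psi> y) \<in> fst c" using ok(8) that by (auto simp: Oy_def)
    then have "tr d c (\<psi> y) \<in> chart_img c B" using L.snd_mem_img by simp
    then have "graph_fun j \<iota> h s (tr d c (\<psi> y)) = 0" using bpatch_closure(2)[OF b trQ[OF that]] by blast
    then show ?thesis unfolding \<theta>_def by (rule par_prj[symmetric])
  qed
  have \<theta>W: "\<theta> y \<in> W" if "y \<in> Oy" for y unfolding \<theta>_def by (rule prjW[OF trQ[OF that]])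
  define \<psi>' where "\<psi>' y v = (\<Sum>a\<in>UNIV. v $ a *\<^sub>R partial UNIV a \<psi> y)" for y v
  define K where "K y v = jac d c (\<psi> y) *v \<psi>' y v" for y v
  have dK: "((\<lambda>y. tr d c (\<psi> y)) has_derivative K y) (at y)" if "y \<in> Oy" for y
    using has_derivative_compose[OF has_derivative_partial_at[OF ok(7)] T.\<tau>_deriv[OF \<psi>Z[OF that]]] that
    unfolding K_def[abs_def] \<psi>'_def[abs_def] by (simp add: Oy_def)
  have d\<theta>: "(\<theta> has_derivative (\<lambda>v. prj \<iota> (K y v))) (at y)" if "y \<in> Oy" for y
    unfolding \<theta>_def[abs_def] by (rule has_derivative_prjI[OF dK[OF that]])
  have Kpar: "K y v = dpar (\<theta> y) (prj \<iota> (K y v))" if "y \<in> Oy" for y v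
  proof -
    have 1: "((\<lambda>y. ?par (\<theta> y)) has_derivative (\<lambda>v. dpar (\<theta> y) (prj \<iota> (K y v)))) (at y)"
      by (rule has_derivative_compose[OF d\<theta>[OF that] par_deriv[OF \<theta>W[OF that]]])
    have 2: "((\<lambda>y. ?par (\<theta> y)) has_derivative K y) (at y)"
      by (rule has_derivative_transform_within_open[OF dK[OF that] oO that]) (rule tr_par)
    show ?thesis using fun_cong[OF has_derivative_unique[OF 2 1], of v] .
  qed
  define M where "M y = matrix (\<lambda>v. prj \<iota> (K y v))" for y
  have gr: "\<bar>det (M y)\<bar> * gram c W ?par (\<theta> y) = gram d W2 \<psi> y" if y: "y \<in> Oy" for y
  proof -
    have yW2: "y \<in> W2" using y by (simp add: Oy_def)
    let ?e = "\<lambda>a. dpar (\<theta> y) (axis a 1)"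
    let ?G = "g c (?par (\<theta> y))"
    let ?P = "\<chi> a b. metric_inner (g c) (?par (\<theta> y)) (partial W a ?par (\<theta> y)) (partial W b ?par (\<theta> y))"
    have P: "?P $ a $ b = ?e a \<bullet> (?G *v ?e b)" for a b
      unfolding vec_lambda_beta bp(2)[OF \<theta>W[OF y]] metric_inner_def ..
    have Ka: "K y (axis a 1) = (\<Sum>b\<in>UNIV. M y $ b $ a *\<^sub>R ?e b)" for a
    proof -
      have "linear (dpar (\<theta> y))" by (rule has_derivative_linear[OF par_deriv[OF \<theta>W[OF y]]])
      from linear_eq_sum_axis[OF this, of "prj \<iota> (K y (axis a 1))"]
      show ?thesis using Kpar[OF y, of "axis a 1"] by (simp add: M_def matrix_def)
    qed
    have "metric_inner (g d) (\<psi> y) (partial W2 a \<psi> y) (partial W2 b \<psi> y) = (transpose (M y) ** ?P ** M y) $ a $ b" for a b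
    proof -
      have p: "partial W2 a \<psi> y = \<psi>' y (axis a 1)" for a
        unfolding partial_open[OF ok(1) yW2] \<psi>'_def by simp
      have "metric_inner (g d) (\<psi> y) (partial W2 a \<psi> y) (partial W2 b \<psi> y) = K y (axis a 1) \<bullet> (?G *v K y (axis b 1))"
        unfolding metric_inner_def T.inner_trans[OF \<psi>Z[OF y]] p K_def tr_par[OF y] ..
      also have "\<dots> = (\<Sum>b'\<in>UNIV. \<Sum>a'\<in>UNIV. M y $ a' $ a * (M y $ b' $ b * ?P $ a' $ b'))"
        unfolding P Ka by (simp add: linear_sum[OF matrix_vector_mul_linear] inner_sum_left inner_sum_right
            matrix_vector_mult_scaleR sum_distrib_left mult_ac)
      also have "\<dots> = (transpose (M y) ** ?P ** M y) $ a $ b"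
        by (simp add: matrix_matrix_mult_def transpose_def sum_distrib_left sum_distrib_right mult_ac)
      finally show ?thesis .
    qed
    then have "(\<chi> a b. metric_inner (g d) (\<psi> y) (partial W2 a \<psi> y) (partial W2 b \<psi> y)) = transpose (M y) ** ?P ** M y"
      by (simp add: vec_eq_iff)
    then have "det (\<chi> a b. metric_inner (g d) (\<psi> y) (partial W2 a \<psi> y) (partial W2 b \<psi> y)) = (det (M y))\<^sup>2 * det ?P"
      by (simp add: det_mul power2_eq_square mult_ac)
    then show ?thesis unfolding gram_def by (simp add: real_sqrt_mult)
  qed
  let ?S = "{y \<in> W2. ci d (\<psi> y) \<in> E}"
  have SO: "?S \<subseteq> Oy" using E(2) by (auto simp: Oy_def)
  have im: "\<theta> ` ?S = {y \<in> W. ci c (?par y) \<in> E}"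
  proof
    show "\<theta> ` ?S \<subseteq> {y \<in> W. ci c (?par y) \<in> E}"
    proof
      fix y' assume "y' \<in> \<theta> ` ?S"
      then obtain y where y: "y \<in> W2" "ci d (\<psi> y) \<in> E" "y' = \<theta> y" by auto
      have yO: "y \<in> Oy" using y SO by blast
      have "ci c (?par y') = ci d (\<psi> y)" unfolding y(3) tr_par[OF yO, symmetric] using ci_tr[OF d c \<psi>Z[OF yO]] by simp
      then show "y' \<in> {y \<in> W. ci c (?par y) \<in> E}" using y \<theta>W[OF yO] by simp
    qed
    show "{y \<in> W. ci c (?par y) \<in> E} \<subseteq> \<theta> ` ?S"
    proof
      fix y' assume "y' \<in> {y \<in> W. ci c (?par y) \<in> E}"
      then have y': "y' \<in> W" "ci c (?par y') \<in> E" by auto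
      then obtain y where y: "y \<in> W2" "ci d (\<psi> y) = ci c (?par y')" using E(3) by auto
      then have yS: "y \<in> ?S" using y' by simp
      have "snd c (ci c (?par y')) = ?par y'" using L.snd_ci okp(3) y'(1) by blast
      then have "\<theta> y = y'" using y(2) by (simp add: \<theta>_def)
      then show "y' \<in> \<theta> ` ?S" using yS by blast
    qed
  qed
  have mS: "?S \<in> sets borel" using param_preimage[OF _ ok(4) ok(5) ok(6) E(1)] ok(1) by simp
  have mI: "{y \<in> W. ci c (?par y) \<in> E} \<in> sets borel" using param_preimage[OF _ okp(4) okp(5) okp(6) E(1)] okp(1) by simp
  have e: "indicator ?S y * (\<bar>det (matrix (\<lambda>v. prj \<iota> (K y v)))\<bar> * gram c W ?par (\<theta> y)) = indicator ?S y * gram d W2 \<psi> y" for y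
    using gr[of y] SO by (cases "y \<in> ?S") (auto simp: M_def)
  have m1: "(\<lambda>y. indicator {y \<in> W. ci c (?par y) \<in> E} y * gram c W ?par y) \<in> borel_measurable borel"
    using borel_measurable_continuous_on_indicator[OF mI continuous_on_subset[OF okp(5)]] by auto
  have m2: "(\<lambda>y. indicator ?S y * gram d W2 \<psi> y) \<in> borel_measurable borel"
    using borel_measurable_continuous_on_indicator[OF mS continuous_on_subset[OF ok(5)]] by auto
  have "(\<integral>\<^sup>+y. ennreal (indicator (\<theta> ` ?S) y * gram c W ?par y) \<partial>lborel)
     = (\<integral>\<^sup>+y. ennreal (indicator ?S y * (\<bar>det (matrix (\<lambda>v. prj \<iota> (K y v)))\<bar> * gram c W ?par (\<theta> y))) \<partial>lborel)"
  proof (rule nn_integral_change_of_variables[OF mS])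
    show "\<theta> ` ?S \<in> sets borel" unfolding im by (rule mI)
    show "(\<theta> has_derivative (\<lambda>v. prj \<iota> (K y v))) (at y within ?S)" if "y \<in> ?S" for y
      by (rule has_derivative_at_withinI[OF d\<theta>]) (use that SO in blast)
    show "inj_on \<theta> ?S"
    proof (rule inj_onI)
      fix y y' assume y: "y \<in> ?S" "y' \<in> ?S" "\<theta> y = \<theta> y'"
      then have yy: "y \<in> Oy" "y' \<in> Oy" using SO by blast+
      then have "tr d c (\<psi> y) = tr d c (\<psi> y')" using tr_par y(3) by metis
      then have "\<psi> y = \<psi> y'" using tr_tr[OF d c] \<psi>Z yy by metis
      then show "y = y'" using inj\<psi> y by (auto dest: inj_onD)
    qed
    show "(\<lambda>y. indicator ?S y * (\<bar>det (matrix (\<lambda>v. prj \<iota> (K y v)))\<bar> * gram c W ?par (\<theta> y))) \<in> borel_measurable borel"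
      unfolding e by (rule m2)
    show "(\<lambda>y. indicator (\<theta> ` ?S) y * gram c W ?par y) \<in> borel_measurable borel" unfolding im by (rule m1)
    show "0 \<le> gram c W ?par y" if "y \<in> \<theta> ` ?S" for y using that okp(6) unfolding im by simp
  qed
  then have "(\<integral>\<^sup>+y. ennreal (indicator {y \<in> W. ci c (?par y) \<in> E} y * gram c W ?par y) \<partial>lborel)
     = (\<integral>\<^sup>+y. ennreal (indicator ?S y * gram d W2 \<psi> y) \<partial>lborel)" unfolding im e .
  moreover have conv: "(\<integral>\<^sup>+x\<in>X. ennreal (f x) \<partial>lborel) = (\<integral>\<^sup>+x. ennreal (indicator X x * f x) \<partial>lborel)" for X and f :: "real^'m \<Rightarrow> real"
    by (intro nn_integral_cong) (simp add: indicator_def)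
  ultimately show ?thesis
    unfolding emeasure_pm[OF c bp(1) E(1)] emeasure_pm[OF d lp E(1)] conv by simp
qed

end

context riem_dom begin

text \<open>A piece of the boundary with a measure that is correct for every parametrization meeting
  it. The last clause says that the piece is itself a parametrized set, through which it can be
  compared with other pieces.\<close>

definition surface_piece :: "'m itself \<Rightarrow> 'a set \<Rightarrow> 'a measure \<Rightarrow> bool" where
  "surface_piece T U \<nu> \<longleftrightarrow> U \<in> sets borel \<and> sets \<nu> = sets borel \<and> U \<subseteq> B \<and>
    (\<forall>d\<in>A. \<forall>W \<psi>. local_parametrization d B (W :: (real^'m) set) \<psi> \<longrightarrow> (\<forall>E\<in>sets borel. E \<subseteq> U \<longrightarrow> E \<subseteq> (ci d \<circ> \<psi>) ` W \<longrightarrow>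
       emeasure \<nu> E = emeasure (pm d W \<psi>) E)) \<and>
    (U = {} \<or> (\<exists>c\<in>A. \<exists>(W :: (real^'m) set) \<psi>. local_parametrization c B W \<psi> \<and> U = (ci c \<circ> \<psi>) ` W))"

lemma bpatch_piece:
  assumes b: "bpatch c Q j \<iota> W h s"
  shows "surface_piece TM ({p \<in> fst c. snd c p \<in> Q} \<inter> B) (pm c W (\<lambda>y. ins j \<iota> (h y) y))"
proof -
  note c = bpatchD(1)[OF b]
  have "open Q" using b by (auto simp: bpatch_def graph_patch_def)
  then have "open {p \<in> fst c. snd c p \<in> Q}" by (rule chart_loc.open_chart_preimage[OF chart_at[OF c]])
  then have "{p \<in> fst c. snd c p \<in> Q} \<inter> B \<in> sets borel" by (intro sets.Int borel_open borel_closed) auto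
  then show ?thesis
    unfolding surface_piece_def using pm_compare[OF b] bpatch_param(1,3)[OF b] c
    by (auto simp: image_comp) metis+
qed

lemma surface_pieces_exist:
  "\<exists>U \<nu>. (\<forall>i::nat. surface_piece TM (U i) (\<nu> i)) \<and> (\<Union>i. U i) = B"
proof -
  have "\<exists>V \<nu>. open V \<and> p \<in> V \<and> surface_piece TM (V \<inter> B) \<nu>" if p: "p \<in> B" for p
  proof -
    obtain c where c: "c \<in> A" "p \<in> fst c" using cover by blast
    obtain Q j \<iota> W h s where b: "bpatch c Q j \<iota> W h s" "snd c p \<in> Q"
      using bpatch_exists[OF p c open_UNIV] by blast
    have "open Q" using b by (auto simp: bpatch_def graph_patch_def)
    then have "open {p \<in> fst c. snd c p \<in> Q}" by (rule chart_loc.open_chart_preimage[OF chart_at[OF c(1)]])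
    then show ?thesis using bpatch_piece[OF b(1)] c(2) b(2) by blast
  qed
  then obtain V \<nu> where V: "\<And>p. p \<in> B \<Longrightarrow> open (V p) \<and> p \<in> V p \<and> surface_piece TM (V p \<inter> B) (\<nu> p)" by metis
  obtain F where F: "F \<subseteq> V ` B" "countable F" "\<Union> F = \<Union> (V ` B)"
    using Lindelof[of "V ` B"] V by (metis (mono_tags, lifting) imageE)
  show ?thesis
  proof (cases "F = {}")
    case True
    then have "B = {}" using F(3) V by fastforce
    \<comment> \<open>The case of an empty frontier: countably many empty pieces with the null
      measure.\<close>
    have "surface_piece TM {} (null_measure borel)" by (auto simp: surface_piece_def)
    then show ?thesis using \<open>B = {}\<close> by (intro exI[of _ "\<lambda>_. {}"] exI[of _ "\<lambda>_. null_measure borel"]) auto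
  next
    case False
    define P where "P i = (SOME p. p \<in> B \<and> V p = from_nat_into F i)" for i :: nat
    have P: "P i \<in> B \<and> V (P i) = from_nat_into F i" for i
      unfolding P_def
    proof (rule someI_ex)
      have "from_nat_into F i \<in> V ` B" using from_nat_into[OF False, of i] F(1) by blast
      then show "\<exists>p. p \<in> B \<and> V p = from_nat_into F i" by blast
    qed
    have "(\<Union>i. V (P i) \<inter> B) = \<Union> F \<inter> B" using P range_from_nat_into[OF False F(2)] by auto
    also have "\<dots> = B" using F(3) V by blast
    finally have "(\<Union>i. V (P i) \<inter> B) = B" .
    moreover have "surface_piece TM (V (P i) \<inter> B) (\<nu> (P i))" for i using V P by blast
    ultimately show ?thesis by (intro exI[of _ "\<lambda>i. V (P i) \<inter> B"] exI[of _ "\<lambda>i. \<nu> (P i)"]) blast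
  qed
qed

text \<open>This justifies the definite description in \<open>submanifold_measure\<close>. The
  parametrizations determine the measure inside the boundary only; off the boundary it is pinned
  down by the requirement that the complement be a null set.\<close>

lemma surface_measure_unique:
  "\<exists>!\<mu>. sets \<mu> = sets borel \<and> emeasure \<mu> (- B) = 0 \<and>
     (\<forall>c\<in>A. \<forall>(W :: (real^'m) set) \<psi>. local_parametrization c B W \<psi> \<longrightarrow>
        (\<forall>E\<in>sets borel. E \<subseteq> (chart_inv c \<circ> \<psi>) ` W \<longrightarrow>
           emeasure \<mu> E = (\<integral>\<^sup>+y\<in>{y\<in>W. chart_inv c (\<psi> y) \<in> E}.
             ennreal (sqrt (det (\<chi> a b.
               metric_inner (g c) (\<psi> y) (partial W a \<psi> y) (partial W b \<psi> y)))) \<partial>lborel)))"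
  (is "\<exists>!\<mu>. ?P \<mu>")
proof -
  obtain U \<nu> where U: "\<And>i::nat. surface_piece TM (U i) (\<nu> i)" "(\<Union>i. U i) = B" using surface_pieces_exist by blast
  have Ub: "U i \<in> sets borel" and sn: "sets (\<nu> i) = sets borel" for i using U(1)[of i] by (auto simp: surface_piece_def)
  have Uc: "\<And>d W \<psi> E. d \<in> A \<Longrightarrow> local_parametrization d B W \<psi> \<Longrightarrow> E \<in> sets borel \<Longrightarrow> E \<subseteq> U i \<Longrightarrow> E \<subseteq> (ci d \<circ> \<psi>) ` W \<Longrightarrow>
       emeasure (\<nu> i) E = emeasure (pm d W \<psi>) E" for i using U(1)[of i] unfolding surface_piece_def by blast
  have Up: "U i = {} \<or> (\<exists>c\<in>A. \<exists>(W :: (real^'m) set) \<psi>. local_parametrization c B W \<psi> \<and> U i = (ci c \<circ> \<psi>) ` W)" for i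
    using U(1)[of i] unfolding surface_piece_def by blast
  have compat: "emeasure (\<nu> i) E = emeasure (\<nu> k) E" if "E \<in> sets borel" "E \<subseteq> U i" "E \<subseteq> U k" for i k E
  proof (cases "U k = {}")
    case False
    then obtain c and W :: "(real^'m) set" and \<psi> where p: "c \<in> A" "local_parametrization c B W \<psi>" "U k = (ci c \<circ> \<psi>) ` W" using Up[of k] by blast
    then have "E \<subseteq> (ci c \<circ> \<psi>) ` W" using that(3) by simp
    then show ?thesis using Uc[OF p(1,2) that(1,2)] Uc[OF p(1,2) that(1,3)] by simp
  qed (use that in auto)
  obtain \<mu> where \<mu>: "sets \<mu> = sets borel" "emeasure \<mu> (- B) = 0"
    "\<And>i E. E \<in> sets borel \<Longrightarrow> E \<subseteq> U i \<Longrightarrow> emeasure \<mu> E = emeasure (\<nu> i) E"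
    using glue_measures[of U \<nu>, OF Ub sn compat] unfolding U(2) by metis
  have D: "disjointed U i \<in> sets borel" for i
    using sets.range_disjointed_sets[of U borel] Ub by auto
  have agree: "emeasure \<mu> E = emeasure (pm d W \<psi>) E"
    if "d \<in> A" "local_parametrization d B W \<psi>" "E \<in> sets borel" "E \<subseteq> (ci d \<circ> \<psi>) ` W" for d W \<psi> E
  proof -
    have EB: "E \<subseteq> (\<Union>i. U i)" unfolding U(2) using that(4) local_param_ok(8)[OF that(1,2)] by auto
    have "emeasure \<mu> (E \<inter> disjointed U i) = emeasure (pm d W \<psi>) (E \<inter> disjointed U i)" for i
    proof -
      have 1: "E \<inter> disjointed U i \<in> sets borel" using D that(3) by auto
      have 2: "E \<inter> disjointed U i \<subseteq> U i" using disjointed_subset[of U i] by auto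
      have 3: "E \<inter> disjointed U i \<subseteq> (ci d \<circ> \<psi>) ` W" using that(4) by blast
      show ?thesis using \<mu>(3)[OF 1 2] Uc[OF that(1,2) 1 2 3] by simp
    qed
    then show ?thesis
      using emeasure_disjointed_sum[where U=U, OF \<mu>(1) Ub that(3) EB]
        emeasure_disjointed_sum[where U=U and \<mu>="pm d W \<psi>", OF sets_pm Ub that(3) EB] by simp
  qed
  have P_iff: "?P \<mu>' \<longleftrightarrow> sets \<mu>' = sets borel \<and> emeasure \<mu>' (- B) = 0 \<and>
    (\<forall>d\<in>A. \<forall>W \<psi>. local_parametrization d B W \<psi> \<longrightarrow> (\<forall>E\<in>sets borel. E \<subseteq> (ci d \<circ> \<psi>) ` W \<longrightarrow>
       emeasure \<mu>' E = emeasure (pm d W \<psi>) E))" for \<mu>'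
    using emeasure_pm unfolding gram_def by (auto 0 3)
  show ?thesis
  proof (rule ex1I[of _ \<mu>])
    show "?P \<mu>" unfolding P_iff using \<mu>(1,2) agree by blast
    fix \<mu>' assume "?P \<mu>'"
    then have \<mu>': "sets \<mu>' = sets borel" "emeasure \<mu>' (- B) = 0"
      "\<And>d W \<psi> E. d \<in> A \<Longrightarrow> local_parametrization d B W \<psi> \<Longrightarrow> E \<in> sets borel \<Longrightarrow> E \<subseteq> (ci d \<circ> \<psi>) ` W \<Longrightarrow>
       emeasure \<mu>' E = emeasure (pm d W \<psi>) E" unfolding P_iff by blast+
    show "\<mu>' = \<mu>"
    proof (rule measure_eqI)
      fix E assume "E \<in> sets \<mu>'"
      then have E: "E \<in> sets borel" using \<mu>' by simp
      have Bb: "B \<in> sets borel" by (simp add: borel_closed)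
      have split: "emeasure m E = (\<Sum>i. emeasure m (E \<inter> B \<inter> disjointed U i))"
        if m: "sets m = sets borel" "emeasure m (- B) = 0" for m
      proof -
        have "emeasure m E = emeasure m (E \<inter> B) + emeasure m (E - B)"
          using E Bb m(1) by (subst plus_emeasure) (auto intro!: arg_cong[of _ _ "emeasure m"])
        also have "emeasure m (E - B) = 0"
          using emeasure_mono[of "E - B" "- B" m] m Bb E by (auto simp: Diff_eq)
        also have "emeasure m (E \<inter> B) = (\<Sum>i. emeasure m (E \<inter> B \<inter> disjointed U i))"
          by (rule emeasure_disjointed_sum[OF m(1) Ub]) (use E Bb U(2) in auto)
        finally show ?thesis by simp
      qed
      have "emeasure \<mu>' (E \<inter> B \<inter> disjointed U i) = emeasure \<mu> (E \<inter> B \<inter> disjointed U i)" for i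
      proof -
        have 1: "E \<inter> B \<inter> disjointed U i \<in> sets borel" using D E Bb by auto
        have 2: "E \<inter> B \<inter> disjointed U i \<subseteq> U i" using disjointed_subset[of U i] by auto
        show ?thesis
        proof (cases "U i = {}")
          case False
          then obtain c and W :: "(real^'m) set" and \<psi> where p: "c \<in> A" "local_parametrization c B W \<psi>" "U i = (ci c \<circ> \<psi>) ` W" using Up by blast
          then have "E \<inter> B \<inter> disjointed U i \<subseteq> (ci c \<circ> \<psi>) ` W" using 2 by simp
          then show ?thesis using \<mu>'(3)[OF p(1,2) 1] agree[OF p(1,2) 1] by simp
        qed (use 2 in auto)
      qed
      then show "emeasure \<mu>' E = emeasure \<mu> E" using split[OF \<mu>'(1,2)] split[OF \<mu>(1,2)] by simp
    qed (use \<mu>' \<mu> in simp)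
  qed
qed

abbreviation "\<sigma> \<equiv> submanifold_measure TM A g B"

lemma sets_\<sigma> [simp]: "sets \<sigma> = sets borel"
  and emeasure_\<sigma>: "c \<in> A \<Longrightarrow> local_parametrization c B (W :: (real^'m) set) \<psi> \<Longrightarrow> E \<in> sets borel \<Longrightarrow> E \<subseteq> (ci c \<circ> \<psi>) ` W
      \<Longrightarrow> emeasure \<sigma> E = emeasure (pm c W \<psi>) E"
proof -
  note P = theI'[OF surface_measure_unique, folded submanifold_measure_def]
  show "sets \<sigma> = sets borel" using P unfolding submanifold_measure_def by blast
  show "emeasure \<sigma> E = emeasure (pm c W \<psi>) E"
    if "c \<in> A" "local_parametrization c B (W :: (real^'m) set) \<psi>" "E \<in> sets borel" "E \<subseteq> (ci c \<circ> \<psi>) ` W"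
    unfolding emeasure_pm[OF that(1-3)] gram_def
    using P that unfolding submanifold_measure_def by blast
qed

lemma integral_\<sigma>_patch:
  fixes F :: "'a \<Rightarrow> real"
  assumes b: "bpatch c Q j \<iota> W h s" and F: "F \<in> borel_measurable borel"
    and F0: "\<And>p. p \<notin> {p \<in> fst c. snd c p \<in> Q} \<inter> B \<Longrightarrow> F p = 0"
  shows "integral\<^sup>L \<sigma> F = (LINT y:W|lborel. gram c W (\<lambda>y. ins j \<iota> (h y) y) y * F (ci c (ins j \<iota> (h y) y)))"
proof -
  note c = bpatchD(1)[OF b] and bp = bpatch_param[OF b]
  note ok = local_param_ok[OF c bp(1)]
  have U: "{p \<in> fst c. snd c p \<in> Q} \<inter> B \<in> sets borel"
    using bpatch_piece[OF b] by (simp add: surface_piece_def)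
  have "integral\<^sup>L \<sigma> F = integral\<^sup>L (pm c W (\<lambda>y. ins j \<iota> (h y) y)) F"
    by (rule integral_eq_of_local_eq[OF sets_\<sigma> sets_pm U _ F0])
       (use emeasure_\<sigma>[OF c bp(1)] bp(3) in auto)
  also have "\<dots> = (LINT y:W|lborel. gram c W (\<lambda>y. ins j \<iota> (h y) y) y * F ((ci c \<circ> (\<lambda>y. ins j \<iota> (h y) y)) y))"
    unfolding pm_def by (rule integral_param_measure) (use ok F in auto)
  finally show ?thesis by simp
qed

lemma \<sigma>_finite: "emeasure \<sigma> B < \<infinity>"
proof -
  have Bb: "B \<in> sets borel" by (simp add: borel_closed)
  have "emeasure \<sigma> (B \<inter> B) < \<infinity>"
  proof (rule emeasure_compact_finite_local[OF sets_\<sigma> compact_B Bb])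
    fix p assume p: "p \<in> B"
    obtain c where c: "c \<in> A" "p \<in> fst c" using cover by blast
    obtain Q j \<iota> W h s where b: "bpatch c Q j \<iota> W h s" "snd c p \<in> Q"
      using bpatch_exists[OF p c open_UNIV] by blast
    interpret L: chart_loc c by (rule chart_at[OF c(1)])
    interpret boundary_patch "g c" "img c" "chart_img c \<Omega>" Q j \<iota> W h s by (rule bpatchD(2)[OF b(1)])
    let ?par = "\<lambda>y. ins j \<iota> (h y) y"
    note bp = bpatch_param[OF b(1)]
    note ok = local_param_ok[OF c(1) bp(1)]
    let ?y = "prj \<iota> (snd c p)"
    have yW: "?y \<in> W" by (rule prjW[OF b(2)])
    then obtain r where r: "r > 0" "cball ?y r \<subseteq> W" using open_W open_contains_cball by blast
    let ?Q = "Q \<inter> prj \<iota> -` ball ?y r"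
    have oQ: "open ?Q"
    proof -
      have "continuous_on UNIV (prj \<iota>)" by (intro continuous_on_prj[OF hyp] continuous_on_id)
      then show ?thesis by (intro open_Int open_Q open_vimage) auto
    qed
    let ?U = "{q \<in> fst c. snd c q \<in> ?Q}"
    have oU: "open ?U" by (rule L.open_chart_preimage[OF oQ])
    have "bounded (gram c W ?par ` cball ?y r)"
      by (intro compact_imp_bounded compact_continuous_image continuous_on_subset[OF ok(5) r(2)] compact_cball)
    then obtain M where M0: "\<forall>x\<in>gram c W ?par ` cball ?y r. norm x \<le> M" unfolding bounded_iff by blast
    have M: "gram c W ?par y \<le> M" if "y \<in> cball ?y r" for y
    proof -
      have "norm (gram c W ?par y) \<le> M" using M0 that by blast
      then show ?thesis by simp
    qed
    have UB: "?U \<inter> B \<in> sets borel" using oU Bb by auto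
    have "?U \<inter> B \<subseteq> (ci c \<circ> ?par) ` W" unfolding bp(3) by blast
    then have "emeasure \<sigma> (?U \<inter> B) = (\<integral>\<^sup>+y\<in>{y\<in>W. ci c (?par y) \<in> ?U \<inter> B}. ennreal (gram c W ?par y) \<partial>lborel)"
      using emeasure_\<sigma>[OF c(1) bp(1) UB] emeasure_pm[OF c(1) bp(1) UB] by simp
    also have "\<dots> \<le> (\<integral>\<^sup>+y. ennreal M * indicator (cball ?y r) y \<partial>lborel)"
    proof (rule nn_integral_mono)
      fix y show "ennreal (gram c W ?par y) * indicator {y\<in>W. ci c (?par y) \<in> ?U \<inter> B} y \<le> ennreal M * indicator (cball ?y r) y"
      proof (cases "y \<in> {y\<in>W. ci c (?par y) \<in> ?U \<inter> B}")
        case True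
        have "snd c (ci c (?par y)) = ?par y" using True ok(3) L.snd_ci by blast
        then have "y \<in> cball ?y r" using True by auto
        then show ?thesis using M True by (simp add: ennreal_leI)
      qed simp
    qed
    also have "\<dots> = ennreal M * emeasure lborel (cball ?y r)"
      by (simp add: nn_integral_cmult_indicator)
    also have "\<dots> < \<infinity>"
      using emeasure_bounded_finite[OF bounded_cball, of ?y r] by (simp add: ennreal_mult_less_top)
    finally show "\<exists>U. open U \<and> p \<in> U \<and> emeasure \<sigma> (U \<inter> B) < \<infinity>"
      using oU c(2) b(2) r(1) by (intro exI[of _ ?U]) auto
  qed (use Bb in simp)
  then show ?thesis by simp
qed

end

section \<open>Normal and mean curvature in different charts\<close>

context riem begin

text \<open>The way to evaluate \<open>scalar\<close>: its value in one chart may be used as soon as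
  all other charts at the point are shown to give the same number.\<close>

lemma scalar_eq:
  assumes "\<And>d. d \<in> A \<Longrightarrow> p \<in> fst d \<Longrightarrow> F d (snd d p) = F c (snd c p)" "c \<in> A" "p \<in> fst c"
  shows "scalar A F p = F c (snd c p)"
  unfolding scalar_def using assms by (intro the_equality) blast+

end

context riem_dom begin

abbreviation "nrm c \<equiv> outward_normal (g c) (chart_img c \<Omega>)"

lemma bpatch_normal:
  assumes b: "bpatch c Q j \<iota> W h s" and p: "p \<in> B" "p \<in> fst c" "snd c p \<in> Q"
  shows "graph_fun j \<iota> h s (snd c p) = 0" "nrm c (snd c p) = boundary_patch.N (g c) j \<iota> h s (snd c p)"
proof -
  interpret boundary_patch "g c" "img c" "chart_img c \<Omega>" Q j \<iota> W h s by (rule bpatchD(2)[OF b])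
  have "snd c p \<in> chart_img c B" using chart_loc.snd_mem_img[OF chart_at[OF bpatchD(1)[OF b]] p(2)] p(1) by blast
  then show 0: "graph_fun j \<iota> h s (snd c p) = 0" using bpatch_closure(2)[OF b p(3)] by blast
  show "nrm c (snd c p) = N (snd c p)" by (rule outward_normal_eq[OF p(3) 0])
qed

text \<open>Pulled back by the transition map, the graph function of a patch in \<open>c\<close> is
  a defining function in \<open>d\<close> and may be used to compute the normal there. Its gradient
  transforms as a vector and keeps its length.\<close>

lemma normal_transform:
  assumes c: "c \<in> A" and d: "d \<in> A" and p: "p \<in> B" "p \<in> fst c" "p \<in> fst d"
  shows "nrm d (snd d p) = jac c d (snd c p) *v nrm c (snd c p)"
proof -
  interpret Lc: chart_loc c by (rule chart_at[OF c])
  interpret Ld: chart_loc d by (rule chart_at[OF d])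
  interpret T: coord_change "g c" "img c" "g d" "img d" "chart_img c (fst d)" "tr c d" "jac c d"
    by (rule coord_change_at[OF c d]) (rule jac_eq)
  interpret R: coord_change "g d" "img d" "g c" "img c" "chart_img d (fst c)" "tr d c" "jac d c"
    by (rule coord_change_at[OF d c]) (rule jac_eq)
  let ?x = "snd c p" and ?z = "snd d p"
  obtain Q j \<iota> W h s where b: "bpatch c Q j \<iota> W h s" and xQ: "?x \<in> Q"
    using bpatch_exists[OF p(1) c p(2) open_UNIV] by blast
  obtain Q2 j2 \<iota>2 W2 h2 s2 where b2: "bpatch d Q2 j2 \<iota>2 W2 h2 s2" and zQ: "?z \<in> Q2"
    using bpatch_exists[OF p(1) d p(3) open_UNIV] by blast
  interpret C: boundary_patch "g c" "img c" "chart_img c \<Omega>" Q j \<iota> W h s by (rule bpatchD(2)[OF b])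
  interpret D: boundary_patch "g d" "img d" "chart_img d \<Omega>" Q2 j2 \<iota>2 W2 h2 s2 by (rule bpatchD(2)[OF b2])
  note nc = bpatch_normal[OF b p(1,2) xQ] and nd = bpatch_normal[OF b2 p(1,3) zQ]
  let ?g = "graph_fun j \<iota> h s"
  define V where "V = {z \<in> chart_img d (fst c). tr d c z \<in> Q}"
  define \<rho> where "\<rho> z = ?g (tr d c z)" for z
  have xZ: "?x \<in> chart_img c (fst d)" and zZ: "?z \<in> chart_img d (fst c)"
    using Lc.snd_mem_img[OF p(2)] Ld.snd_mem_img[OF p(3)] p by blast+
  have tz: "tr d c ?z = ?x" "tr c d ?x = ?z" using tr_snd[OF d p(3)] tr_snd[OF c p(2)] by auto
  have oV: "open V"
  proof -
    have "open (chart_img d (fst c) \<inter> tr d c -` Q)"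
      using continuous_openin_preimage_gen[OF Ck_on_continuous[OF R.\<tau>] C.open_Q] R.Z(1) openin_open_trans by blast
    moreover have "chart_img d (fst c) \<inter> tr d c -` Q = V" by (auto simp: V_def)
    ultimately show ?thesis by simp
  qed
  have zV: "?z \<in> V" using zZ tz xQ by (simp add: V_def)
  have VZ: "V \<subseteq> chart_img d (fst c)" by (auto simp: V_def)
  have par: "partial V i \<rho> z = (transpose (jac d c z) *v C.nu (prj \<iota> (tr d c z))) $ i" if z: "z \<in> V" for i z
  proof -
    have q: "tr d c z \<in> Q" and zz: "z \<in> chart_img d (fst c)" using z by (auto simp: V_def)
    have gd: "?g differentiable at (tr d c z)" by (rule Ck_on_1_differentiable[OF C.open_Q C.g1 q])
    have "partial V i \<rho> z = (\<Sum>a\<in>UNIV. partial UNIV i (\<lambda>y. tr d c y $ a) z * partial UNIV a ?g (tr d c z))"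
      unfolding partial_open[OF oV z] \<rho>_def[abs_def] partial_compose[OF R.\<tau>_diff[OF zz] gd] by simp
    also have "\<dots> = (\<Sum>a\<in>UNIV. jac d c z $ a $ i * C.nu (prj \<iota> (tr d c z)) $ a)"
      unfolding R.J_nth[OF zz] C.partial_g[OF q] ..
    finally show ?thesis by (simp add: matrix_vector_mult_def transpose_def)
  qed
  have Jinv: "invertible (transpose (jac d c z))" if "z \<in> V" for z
    using R.J_inv[of z] that VZ by (auto simp: invertible_det_nz)
  have def: "defining_function (chart_img d \<Omega>) V \<rho> ?z"
    unfolding defining_function_def
  proof (intro conjI ballI)
    show "Ck_on 2 V \<rho>" unfolding \<rho>_def[abs_def]
    proof (rule Ck_on_compose[OF oV C.open_Q _ _ C.Ck_g])
      show "Ck_on 2 V (tr d c)" by (rule Ck_on_subset[OF R.Z(1) oV VZ R.\<tau>])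
    qed (auto simp: V_def)
    show "\<exists>i. partial V i \<rho> y \<noteq> 0" if y: "y \<in> V" for y
    proof (rule ccontr)
      assume "\<nexists>i. partial V i \<rho> y \<noteq> 0"
      then have "transpose (jac d c y) *v C.nu (prj \<iota> (tr d c y)) = transpose (jac d c y) *v 0"
        using par[OF y] by (simp add: vec_eq_iff)
      then show False using matvec_cancel[OF Jinv[OF y]] C.nu_nonzero by blast
    qed
    show "chart_img d \<Omega> \<inter> V = {y \<in> V. \<rho> y < 0}"
    proof -
      have "z \<in> chart_img d \<Omega> \<longleftrightarrow> \<rho> z < 0" if z: "z \<in> V" for z
      proof -
        have q: "tr d c z \<in> Q" and zz: "z \<in> chart_img d (fst c)" using z by (auto simp: V_def)
        have "z \<in> chart_img d \<Omega> \<longleftrightarrow> ci d z \<in> \<Omega>" using Ld.mem_img[of z \<Omega>] mem_imgD(1)[OF d zz] by blast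
        also have "\<dots> \<longleftrightarrow> ci c (tr d c z) \<in> \<Omega>" unfolding ci_tr[OF d c zz] ..
        also have "\<dots> \<longleftrightarrow> tr d c z \<in> chart_img c \<Omega>" using Lc.mem_img[of "tr d c z" \<Omega>] q C.QS by blast
        also have "\<dots> \<longleftrightarrow> \<rho> z < 0" unfolding \<rho>_def by (rule C.D_iff[OF q])
        finally show ?thesis .
      qed
      then show ?thesis by blast
    qed
  qed (use oV zV in auto)
  let ?X = "gradient (g d) V \<rho> ?z" and ?\<nu> = "C.nu (prj \<iota> ?x)"
  have "(jac d c ?z ** jac c d ?x) = mat 1" using jac_mult[OF c d xZ] unfolding tz .
  then have "transpose (jac c d ?x) ** transpose (jac d c ?z) = mat 1"
    by (simp add: matrix_transpose_mul[symmetric] transpose_mat)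
  then have JJ: "transpose (jac c d ?x) *v (transpose (jac d c ?z) *v ?\<nu>) = ?\<nu>"
    by (simp only: matrix_vector_mul_assoc matrix_vector_mul_lid)
  have "(\<chi> i. partial V i \<rho> ?z) = transpose (jac d c ?z) *v ?\<nu>"
    using par[OF zV] unfolding tz by (simp add: vec_eq_iff)
  then have "?X = matrix_inv (g d (tr c d ?x)) *v (transpose (jac d c ?z) *v ?\<nu>)"
    unfolding gradient_def tz by simp
  also have "\<dots> = jac c d ?x *v (matrix_inv (g c ?x) *v ?\<nu>)"
    using T.inverse_transform[OF xZ, of "transpose (jac d c ?z) *v ?\<nu>"] unfolding JJ by simp
  finally have X: "?X = jac c d ?x *v (matrix_inv (g c ?x) *v ?\<nu>)" .
  have "metric_inner (g d) ?z ?X ?X = C.q ?x"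
    using T.inner_trans[OF xZ, of "matrix_inv (g c ?x) *v ?\<nu>" "matrix_inv (g c ?x) *v ?\<nu>"]
    unfolding X metric_inner_def tz C.q_def C.G_inv_nu[OF xQ] by (simp add: inner_commute)
  then have "D.N ?z = (1 / sqrt (C.q ?x)) *\<^sub>R (jac c d ?x *v (matrix_inv (g c ?x) *v ?\<nu>))"
    using D.normal_of_defining[OF zQ nd(1) def] unfolding Let_def X by simp
  then show ?thesis unfolding nc(2) nd(2) C.N_def by (simp add: matrix_vector_mult_scaleR)
qed

text \<open>The extended normal of a patch in \<open>c\<close> is carried to \<open>d\<close>. It
  agrees there with the normal of a patch in \<open>d\<close> on the boundary, though perhaps not
  nearby, which suffices by \<open>trace_shape_extension\<close>. Covariant derivative and
  projection are both intertwined by the Jacobian.\<close>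

lemma mean_curvature_transform:
  assumes c: "c \<in> A" and d: "d \<in> A" and p: "p \<in> B" "p \<in> fst c" "p \<in> fst d"
  shows "trace_shape (g d) (chart_img d B) (nrm d) (snd d p) = trace_shape (g c) (chart_img c B) (nrm c) (snd c p)"
proof -
  interpret Lc: chart_loc c by (rule chart_at[OF c])
  interpret Ld: chart_loc d by (rule chart_at[OF d])
  interpret T: coord_change "g c" "img c" "g d" "img d" "chart_img c (fst d)" "tr c d" "jac c d"
    by (rule coord_change_at[OF c d]) (rule jac_eq)
  interpret R: coord_change "g d" "img d" "g c" "img c" "chart_img d (fst c)" "tr d c" "jac d c"
    by (rule coord_change_at[OF d c]) (rule jac_eq)
  let ?x = "snd c p" and ?z = "snd d p"
  obtain Q j \<iota> W h s where b: "bpatch c Q j \<iota> W h s" and xQ: "?x \<in> Q"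
    using bpatch_exists[OF p(1) c p(2) open_UNIV] by blast
  obtain Q2 j2 \<iota>2 W2 h2 s2 where b2: "bpatch d Q2 j2 \<iota>2 W2 h2 s2" and zQ: "?z \<in> Q2"
    using bpatch_exists[OF p(1) d p(3) open_UNIV] by blast
  interpret C: boundary_patch "g c" "img c" "chart_img c \<Omega>" Q j \<iota> W h s by (rule bpatchD(2)[OF b])
  interpret D: boundary_patch "g d" "img d" "chart_img d \<Omega>" Q2 j2 \<iota>2 W2 h2 s2 by (rule bpatchD(2)[OF b2])
  note nc = bpatch_normal[OF b p(1,2) xQ] and nd = bpatch_normal[OF b2 p(1,3) zQ]
  have xZ: "?x \<in> chart_img c (fst d)" and zZ: "?z \<in> chart_img d (fst c)"
    using Lc.snd_mem_img[OF p(2)] Ld.snd_mem_img[OF p(3)] p by blast+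
  have tz: "tr d c ?z = ?x" "tr c d ?x = ?z" using tr_snd[OF d p(3)] tr_snd[OF c p(2)] by auto
  define M where "M z = jac c d (tr d c z) *v C.N (tr d c z)" for z
  define O' where "O' = {z \<in> chart_img d (fst c). tr d c z \<in> Q}"
  have oO: "open O'"
  proof -
    have "open (chart_img d (fst c) \<inter> tr d c -` Q)"
      using continuous_openin_preimage_gen[OF Ck_on_continuous[OF R.\<tau>] C.open_Q] R.Z(1) openin_open_trans by blast
    moreover have "chart_img d (fst c) \<inter> tr d c -` Q = O'" by (auto simp: O'_def)
    ultimately show ?thesis by simp
  qed
  have zO: "?z \<in> O'" using zZ tz xQ by (simp add: O'_def)
  have dM: "M differentiable at ?z"
  proof -
    have 1: "(tr d c has_derivative (*v) (jac d c ?z)) (at ?z)" by (rule R.\<tau>_deriv[OF zZ])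
    have 2: "(jac c d has_derivative mat_deriv (jac c d) ?x) (at (tr d c ?z))" using T.deriv_J[OF xZ] unfolding tz .
    have "(C.N has_derivative frechet_derivative C.N (at ?x)) (at (tr d c ?z))"
      using C.diff_N[OF xQ] unfolding tz frechet_derivative_works .
    from has_derivative_matvec[OF has_derivative_compose[OF 1 2] has_derivative_compose[OF 1 this]]
    show ?thesis unfolding M_def[abs_def] differentiable_def by blast
  qed
  have MN: "M z' = D.N z'" if z': "z' \<in> O'" "z' \<in> Q2" "graph_fun j2 \<iota>2 h2 s2 z' = 0" for z'
  proof -
    have zz: "z' \<in> chart_img d (fst c)" "tr d c z' \<in> Q" using z' by (auto simp: O'_def)
    have "z' \<in> chart_img d B" using bpatch_closure(2)[OF b2 z'(2)] z'(3) by blast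
    note m = mem_imgD[OF d this]
    have pc: "ci d z' \<in> fst c" using mem_imgD(2)[OF d zz(1)] .
    have "nrm d (snd d (ci d z')) = jac c d (snd c (ci d z')) *v nrm c (snd c (ci d z'))"
      by (rule normal_transform[OF c d m(2) pc m(3)])
    then show ?thesis
      using bpatch_normal(2)[OF b m(2) pc] bpatch_normal(2)[OF b2 m(2,3)] zz z' m(4) by (simp add: M_def)
  qed
  have Hd: "trace_shape (g d) (chart_img d B) (nrm d) ?z = trace (nab (g d) M ?z ** D.proj ?z)"
    by (rule D.trace_shape_extension[OF zQ nd(1) bpatch_closure(2)[OF b2] dM oO zO MN])
  have Hc: "trace_shape (g c) (chart_img c B) (nrm c) ?x = trace (nab (g c) C.N ?x ** C.proj ?x)"
    by (rule C.trace_shape_extension[OF xQ nc(1) bpatch_closure(2)[OF b] C.diff_N[OF xQ] C.open_Q xQ refl])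
  have nabM: "nab (g d) M ?z ** jac c d ?x = jac c d ?x ** nab (g c) C.N ?x"
  proof -
    have "nab (g d) M (tr c d ?x) ** jac c d ?x = jac c d ?x ** nab (g c) C.N ?x"
    proof (rule T.nab_transform[of "Q \<inter> chart_img c (fst d)"])
      show "open (Q \<inter> chart_img c (fst d))" using C.open_Q T.Z(1) by auto
      show "M (tr c d y) = jac c d y *v C.N y" if "y \<in> Q \<inter> chart_img c (fst d)" for y
        using tr_tr[OF c d, of y] that by (simp add: M_def)
      show "M differentiable at (tr c d ?x)" using dM unfolding tz .
    qed (use xQ xZ C.diff_N in auto)
    then show ?thesis unfolding tz .
  qed
  have "nrm d ?z = jac c d ?x *v nrm c ?x" by (rule normal_transform[OF c d p])
  then have Nz: "D.N ?z = jac c d ?x *v C.N ?x" unfolding nc(2) nd(2) .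
  have "(D.proj ?z ** jac c d ?x) *v v = (jac c d ?x ** C.proj ?x) *v v" for v
  proof -
    have "metric_inner (g d) ?z (jac c d ?x *v v) (jac c d ?x *v C.N ?x) = metric_inner (g c) ?x v (C.N ?x)"
      using T.inner_trans[OF xZ, of v "C.N ?x"] unfolding metric_inner_def tz by simp
    then have "D.proj ?z *v (jac c d ?x *v v) = jac c d ?x *v (C.proj ?x *v v)"
      by (simp only: D.proj_mult C.proj_mult Nz matrix_vector_mult_diff_distrib matrix_vector_mult_scaleR)
    then show ?thesis by (simp only: matrix_vector_mul_assoc)
  qed
  then have pr: "D.proj ?z ** jac c d ?x = jac c d ?x ** C.proj ?x" by (simp add: matrix_eq)
  show ?thesis unfolding Hc Hd
    by (rule trace_similar[OF intertwine_mult[OF nabM pr] T.J_inv[OF xZ]])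
qed

lemma mean_curvature_eq:
  assumes "c \<in> A" "p \<in> B" "p \<in> fst c"
  shows "mean_curvature A g \<Omega> p = trace_shape (g c) (chart_img c B) (nrm c) (snd c p)"
  unfolding mean_curvature_def by (rule scalar_eq[OF _ assms(1,3)]) (rule mean_curvature_transform[OF assms(1) _ assms(2,3)])

lemma mean_curvature_patch:
  assumes b: "bpatch c Q j \<iota> W h s" and p: "p \<in> B" "p \<in> fst c" "snd c p \<in> Q"
  shows "mean_curvature A g \<Omega> p = trace (nab (g c) (boundary_patch.N (g c) j \<iota> h s) (snd c p) ** boundary_patch.proj (g c) j \<iota> h s (snd c p))"
proof -
  interpret C: boundary_patch "g c" "img c" "chart_img c \<Omega>" Q j \<iota> W h s by (rule bpatchD(2)[OF b])
  show ?thesis unfolding mean_curvature_eq[OF bpatchD(1)[OF b] p(1,2)]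
    by (rule C.trace_shape_extension[OF p(3) bpatch_normal(1)[OF b p] bpatch_closure(2)[OF b] C.diff_N[OF p(3)] C.open_Q p(3) refl])
qed

end

section \<open>The divergence theorem on the domain\<close>

lemma set_integrable_continuous_bounded:
  fixes f :: "'a::topological_space \<Rightarrow> real"
  assumes M: "sets M = sets borel" "emeasure M X < \<infinity>" and X: "X \<in> sets borel"
    and f: "continuous_on X f" "bounded (f ` X)"
  shows "set_integrable M X f"
proof -
  have m: "(\<lambda>x. indicator X x *\<^sub>R f x) \<in> borel_measurable M"
    using borel_measurable_continuous_on_indicator[OF X f(1)] M(1) measurable_cong_sets by blast
  obtain b where b: "\<And>x. x \<in> X \<Longrightarrow> \<bar>f x\<bar> \<le> b" using f(2) unfolding bounded_iff by auto
  have "integrable M (\<lambda>x. indicator X x *\<^sub>R (indicator X x *\<^sub>R f x))"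
    by (rule integrableI_bounded_set_indicator[where B=b])
       (use m M X b in \<open>auto simp: indicator_def\<close>)
  moreover have "(\<lambda>x. indicator X x *\<^sub>R (indicator X x *\<^sub>R f x)) = (\<lambda>x. indicator X x *\<^sub>R f x)"
    by (auto simp: indicator_def fun_eq_iff)
  ultimately show ?thesis unfolding set_integrable_def by (simp only:)
qed

lemma bounded_if_locally_bounded:
  fixes f :: "'a::topological_space \<Rightarrow> real"
  assumes K: "compact K" and loc: "\<And>p. p \<in> K \<Longrightarrow> \<exists>U M. open U \<and> p \<in> U \<and> (\<forall>q\<in>U \<inter> X. \<bar>f q\<bar> \<le> M)" and XK: "X \<subseteq> K"
  shows "bounded (f ` X)"
proof -
  obtain U M where U: "\<And>p. p \<in> K \<Longrightarrow> open (U p) \<and> p \<in> U p \<and> (\<forall>q\<in>U p \<inter> X. \<bar>f q\<bar> \<le> M p)" using loc by metis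
  obtain T where T: "T \<subseteq> K" "finite T" "K \<subseteq> (\<Union>p\<in>T. U p)" using compactE_image[OF K, of K U] U by blast
  have "X \<subseteq> (\<Union>p\<in>T. U p \<inter> X)" using T XK by blast
  then have "f ` X \<subseteq> (\<Union>p\<in>T. f ` (U p \<inter> X))" by blast
  moreover have "bounded (\<Union>p\<in>T. f ` (U p \<inter> X))"
  proof (rule bounded_UN)
    show "\<forall>p\<in>T. bounded (f ` (U p \<inter> X))" using U T(1) unfolding bounded_iff by (metis (no_types, opaque_lifting) imageE real_norm_def subsetD)
  qed (rule T(2))
  ultimately show ?thesis using bounded_subset by blast
qed

context riem begin

lemma continuous_on_if_in_charts:
  assumes "\<And>p. p \<in> X \<Longrightarrow> \<exists>c\<in>A. \<exists>Q F. p \<in> fst c \<and> open Q \<and> snd c p \<in> Q \<and> continuous_on (Q \<inter> chart_img c X) F \<and>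
     (\<forall>q\<in>X \<inter> fst c. snd c q \<in> Q \<longrightarrow> \<delta> q = F (snd c q))"
  shows "continuous_on X \<delta>"
  unfolding continuous_on_def
proof
  fix p assume p: "p \<in> X"
  obtain c Q F where c: "c \<in> A" "p \<in> fst c" and Q: "open Q" "snd c p \<in> Q" and F: "continuous_on (Q \<inter> chart_img c X) F"
    and e: "\<forall>q\<in>X \<inter> fst c. snd c q \<in> Q \<longrightarrow> \<delta> q = F (snd c q)" using assms[OF p] by blast
  interpret L: chart_loc c by (rule chart_at[OF c(1)])
  let ?U = "{q \<in> fst c. snd c q \<in> Q}"
  have oU: "open ?U" by (rule L.open_chart_preimage[OF Q(1)])
  have "continuous_on (?U \<inter> X) (\<lambda>q. F (snd c q))"
    by (rule continuous_on_compose2[OF F continuous_on_subset[OF L.cont_snd]]) (auto simp: chart_img_def)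
  then have "continuous_on (?U \<inter> X) \<delta>" by (rule continuous_on_eq) (use e in auto)
  then have "(\<delta> \<longlongrightarrow> \<delta> p) (at p within ?U \<inter> X)" using p c Q unfolding continuous_on_def by blast
  moreover have "at p within ?U \<inter> X = at p within X" by (rule at_within_nhd[OF _ oU]) (use c Q in auto)
  ultimately show "(\<delta> \<longlongrightarrow> \<delta> p) (at p within X)" by simp
qed

end

context riem_dom begin

lemma integrable_vol:
  fixes f :: "'a \<Rightarrow> real"
  assumes "continuous_on \<Omega> f" "bounded (f ` \<Omega>)"
  shows "set_integrable vol \<Omega> f"
proof (rule set_integrable_continuous_bounded[OF sets_vol _ _ assms])
  have "emeasure vol \<Omega> \<le> emeasure vol (closure \<Omega>)"
    by (rule emeasure_mono[OF closure_subset]) (simp add: borel_closed)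
  also have "\<dots> < \<infinity>" by (rule vol_finite_compact[OF compact_cl])
  finally show "emeasure vol \<Omega> < \<infinity>" .
qed (use open_\<Omega> in simp)

lemma integrable_\<sigma>:
  fixes f :: "'a \<Rightarrow> real"
  assumes "continuous_on B f" shows "set_integrable \<sigma> B f"
  by (rule set_integrable_continuous_bounded[OF sets_\<sigma> \<sigma>_finite _ assms])
     (use compact_imp_bounded[OF compact_continuous_image[OF assms compact_B]] in \<open>auto simp: borel_closed\<close>)

text \<open>The function matters only in the open domain, but its chart expressions are continuous
  up to the boundary. They give local bounds near every point of the compact closure.\<close>

lemma continuous_bounded_from_charts:
  fixes \<delta> :: "'a \<Rightarrow> real"
  assumes F: "\<And>c. c \<in> A \<Longrightarrow> continuous_on (chart_img c (closure \<Omega>)) (F c)"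
    and e: "\<And>c p. c \<in> A \<Longrightarrow> p \<in> fst c \<Longrightarrow> p \<in> \<Omega> \<Longrightarrow> \<delta> p = F c (snd c p)"
  shows "continuous_on \<Omega> \<delta>" "bounded (\<delta> ` \<Omega>)"
proof -
  show "continuous_on \<Omega> \<delta>"
  proof (rule continuous_on_if_in_charts)
    fix p assume "p \<in> \<Omega>"
    obtain c where c: "c \<in> A" "p \<in> fst c" using cover by blast
    have "continuous_on (UNIV \<inter> chart_img c \<Omega>) (F c)"
      by (rule continuous_on_subset[OF F[OF c(1)]]) (use chart_loc.img_mono[OF chart_at[OF c(1)] closure_subset] in auto)
    then show "\<exists>c\<in>A. \<exists>Q F. p \<in> fst c \<and> open Q \<and> snd c p \<in> Q \<and> continuous_on (Q \<inter> chart_img c \<Omega>) F \<and>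
     (\<forall>q\<in>\<Omega> \<inter> fst c. snd c q \<in> Q \<longrightarrow> \<delta> q = F (snd c q))"
      using c e by (intro bexI[of _ c] exI[of _ UNIV] exI[of _ "F c"]) auto
  qed
  show "bounded (\<delta> ` \<Omega>)"
  proof (rule bounded_if_locally_bounded[OF compact_cl _ closure_subset])
    fix p assume p: "p \<in> closure \<Omega>"
    obtain c where c: "c \<in> A" "p \<in> fst c" using cover by blast
    interpret L: chart_loc c by (rule chart_at[OF c(1)])
    have x: "snd c p \<in> chart_img c (closure \<Omega>)" using L.snd_mem_img[OF c(2)] p by blast
    obtain e0 where e0: "e0 > 0" "\<And>y. y \<in> chart_img c (closure \<Omega>) \<Longrightarrow> dist y (snd c p) < e0 \<Longrightarrow> dist (F c y) (F c (snd c p)) < 1"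
      using F[OF c(1)] x unfolding continuous_on_iff by (metis zero_less_one)
    let ?U = "{q \<in> fst c. snd c q \<in> ball (snd c p) e0}"
    have "open ?U" by (rule L.open_chart_preimage) simp
    moreover have "p \<in> ?U" using c e0 by simp
    moreover have "\<bar>\<delta> q\<bar> \<le> \<bar>F c (snd c p)\<bar> + 1" if q: "q \<in> ?U \<inter> \<Omega>" for q
    proof -
      have "q \<in> closure \<Omega>" using q closure_subset by blast
      then have "snd c q \<in> chart_img c (closure \<Omega>)" using L.snd_mem_img[of q "closure \<Omega>"] q by blast
      then have "dist (F c (snd c q)) (F c (snd c p)) < 1" using e0(2)[of "snd c q"] q by (simp only: dist_commute[of "snd c q"]) simp
      then show ?thesis using e[OF c(1), of q] q by (simp add: dist_real_def)
    qed
    ultimately show "\<exists>U M. open U \<and> p \<in> U \<and> (\<forall>q\<in>U \<inter> \<Omega>. \<bar>\<delta> q\<bar> \<le> M)" by blast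
  qed
qed

end

lemma nab_scale:
  assumes a: "a differentiable at x" and X: "\<And>k. (\<lambda>y. X y $ k) differentiable at x"
  shows "trace (nab G (\<lambda>y. a y *\<^sub>R X y) x) = a x * trace (nab G X x) + (\<Sum>k\<in>UNIV. partial UNIV k a x * X x $ k)"
proof -
  have "partial UNIV k (\<lambda>y. (a y *\<^sub>R X y) $ k) x = a x * partial UNIV k (\<lambda>y. X y $ k) x + partial UNIV k a x * X x $ k" for k
    using partial_mult[OF a X[of k], of k] by simp
  then show ?thesis by (simp add: trace_def nab_def sum.distrib sum_distrib_left algebra_simps)
qed

text \<open>A vector field given by its components \<open>Y c\<close>, which is \<open>C\<^sup>1\<close> inside \<open>\<Omega>\<close> but only continuous up to the
  boundary, with divergence \<open>\<delta>\<close> and flux density \<open>fl\<close>.\<close>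

locale divergence_data = riem_dom A g \<Omega> TM
  for A :: "('a::{t2_space, second_countable_topology}, 'n::finite) chart set" and g
    and \<Omega> :: "'a set" and TM :: "'m::finite itself" +
  fixes Y :: "('a, 'n) chart \<Rightarrow> real^'n \<Rightarrow> real^'n" and \<delta> fl :: "'a \<Rightarrow> real"
  assumes Y_cont: "\<And>c. c \<in> A \<Longrightarrow> continuous_on (chart_img c (closure \<Omega>)) (Y c)"
    and Y_C1: "\<And>c k. c \<in> A \<Longrightarrow> Ck_on 1 (chart_img c \<Omega>) (\<lambda>x. Y c x $ k)"
    and Y_transform: "\<And>c d p. c \<in> A \<Longrightarrow> d \<in> A \<Longrightarrow> p \<in> fst c \<Longrightarrow> p \<in> fst d \<Longrightarrow> p \<in> \<Omega> \<Longrightarrow>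
      Y d (snd d p) = jac c d (snd c p) *v Y c (snd c p)"
    and div_Y: "\<And>c p. c \<in> A \<Longrightarrow> p \<in> fst c \<Longrightarrow> p \<in> \<Omega> \<Longrightarrow> trace (nab (g c) (Y c) (snd c p)) = \<delta> p"
    and \<delta>_cont: "continuous_on \<Omega> \<delta>" and \<delta>_bdd: "bounded (\<delta> ` \<Omega>)"
    and flux: "\<And>c p. c \<in> A \<Longrightarrow> p \<in> fst c \<Longrightarrow> p \<in> B \<Longrightarrow>
      metric_inner (g c) (snd c p) (Y c (snd c p)) (nrm c (snd c p)) = fl p"
    and fl_cont: "continuous_on B fl"
begin

text \<open>A neighbourhood of the closure is used because the functions of the partition of unity
  are quotients whose denominator is positive only there, while their derivatives must be continuous
  up to the boundary.\<close>

definition C1_near :: "('a \<Rightarrow> real) \<Rightarrow> bool" where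
  "C1_near \<phi> \<longleftrightarrow> (\<forall>c\<in>A. \<exists>V. open V \<and> chart_img c (closure \<Omega>) \<subseteq> V \<and> V \<subseteq> img c \<and> Ck_on 1 V (\<phi> \<circ> ci c))"

text \<open>The derivative of \<phi> in the direction of the field \<open>Y\<close>, i.e. the second
  term in the divergence of \<phi> times \<open>Y\<close>.\<close>

definition "along \<phi> = scalar A (\<lambda>c x. \<Sum>k\<in>UNIV. partial UNIV k (\<phi> \<circ> ci c) x * Y c x $ k)"

lemma C1_nearD:
  assumes "C1_near \<phi>" "c \<in> A"
  obtains V where "open V" "chart_img c (closure \<Omega>) \<subseteq> V" "V \<subseteq> img c" "Ck_on 1 V (\<phi> \<circ> ci c)" "chart_img c \<Omega> \<subseteq> V"
  using assms chart_loc.img_mono[OF chart_at[OF assms(2)] closure_subset[of \<Omega>]] unfolding C1_near_def by fastforce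

lemma along_eq:
  assumes \<phi>: "C1_near \<phi>" and c: "c \<in> A" and p: "p \<in> fst c" "p \<in> \<Omega>"
  shows "along \<phi> p = (\<Sum>k\<in>UNIV. partial UNIV k (\<phi> \<circ> ci c) (snd c p) * Y c (snd c p) $ k)"
  unfolding along_def
proof (rule scalar_eq[OF _ c p(1)])
  fix d assume d: "d \<in> A" "p \<in> fst d"
  interpret Lc: chart_loc c by (rule chart_at[OF c])
  interpret Ld: chart_loc d by (rule chart_at[OF d(1)])
  interpret T: coord_change "g c" "img c" "g d" "img d" "chart_img c (fst d)" "tr c d" "jac c d"
    by (rule coord_change_at[OF c d(1)]) (rule jac_eq)
  let ?x = "snd c p" and ?z = "snd d p"
  obtain V where V: "open V" "Ck_on 1 V (\<phi> \<circ> ci d)" "chart_img d \<Omega> \<subseteq> V" using C1_nearD[OF \<phi> d(1)] by metis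
  have xZ: "?x \<in> chart_img c (fst d)" using Lc.snd_mem_img[OF p(1)] d by blast
  have tz: "tr c d ?x = ?z" by (rule tr_snd[OF c p(1)])
  have "?z \<in> V" using V(3) Ld.snd_mem_img[OF d(2), of \<Omega>] p(2) by blast
  then have fd: "(\<phi> \<circ> ci d) differentiable at (tr c d ?x)" unfolding tz by (rule Ck_on_1_differentiable[OF V(1,2)])
  have pk: "partial UNIV k (\<phi> \<circ> ci c) ?x = (\<Sum>a\<in>UNIV. jac c d ?x $ a $ k * partial UNIV a (\<phi> \<circ> ci d) ?z)" for k
  proof -
    have "partial UNIV k (\<phi> \<circ> ci c) ?x = partial UNIV k (\<lambda>x. (\<phi> \<circ> ci d) (tr c d x)) ?x"
      by (rule partial_cong_open[OF T.Z(1) xZ]) (use ci_tr[OF c d(1)] in simp)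
    also have "\<dots> = (\<Sum>a\<in>UNIV. partial UNIV k (\<lambda>x. tr c d x $ a) ?x *\<^sub>R partial UNIV a (\<phi> \<circ> ci d) (tr c d ?x))"
      by (rule partial_compose[OF T.\<tau>_diff[OF xZ] fd])
    finally show ?thesis unfolding T.J_nth[OF xZ] tz by simp
  qed
  have "(\<Sum>k\<in>UNIV. partial UNIV k (\<phi> \<circ> ci c) ?x * Y c ?x $ k)
      = (\<Sum>k\<in>UNIV. \<Sum>a\<in>UNIV. partial UNIV a (\<phi> \<circ> ci d) ?z * (jac c d ?x $ a $ k * Y c ?x $ k))"
    unfolding pk by (simp add: sum_distrib_right sum_distrib_left mult_ac)
  also have "\<dots> = (\<Sum>a\<in>UNIV. \<Sum>k\<in>UNIV. partial UNIV a (\<phi> \<circ> ci d) ?z * (jac c d ?x $ a $ k * Y c ?x $ k))"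
    by (rule sum.swap)
  also have "\<dots> = (\<Sum>a\<in>UNIV. partial UNIV a (\<phi> \<circ> ci d) ?z * Y d ?z $ a)"
    unfolding Y_transform[OF c d(1) p(1) d(2) p(2)] by (simp add: matrix_vector_mult_def sum_distrib_left)
  finally show "(\<Sum>k\<in>UNIV. partial UNIV k (\<phi> \<circ> ci d) ?z * Y d ?z $ k)
      = (\<Sum>k\<in>UNIV. partial UNIV k (\<phi> \<circ> ci c) ?x * Y c ?x $ k)" by simp
qed

lemma C1_near_cont:
  assumes \<phi>: "C1_near \<phi>"
  shows "continuous_on \<Omega> \<phi>" "bounded (\<phi> ` \<Omega>)" "continuous_on B \<phi>"
    "continuous_on \<Omega> (along \<phi>)" "bounded (along \<phi> ` \<Omega>)"
proof -
  have c1: "continuous_on (chart_img c (closure \<Omega>)) (\<phi> \<circ> ci c)" if "c \<in> A" for c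
    using C1_nearD[OF \<phi> that] Ck_on_continuous continuous_on_subset by metis
  have e1: "\<phi> p = (\<phi> \<circ> ci c) (snd c p)" if "c \<in> A" "p \<in> fst c" for c p
    using chart_loc.ci_snd[OF chart_at[OF that(1)] that(2)] by simp
  show "continuous_on \<Omega> \<phi>" "bounded (\<phi> ` \<Omega>)"
    using continuous_bounded_from_charts[of "\<lambda>c. \<phi> \<circ> ci c" \<phi>] c1 e1 by blast+
  show "continuous_on B \<phi>"
  proof (rule continuous_on_if_in_charts)
    fix p assume "p \<in> B"
    obtain c where c: "c \<in> A" "p \<in> fst c" using cover by blast
    have "continuous_on (UNIV \<inter> chart_img c B) (\<phi> \<circ> ci c)"
      by (rule continuous_on_subset[OF c1[OF c(1)]])
         (use chart_loc.img_mono[OF chart_at[OF c(1)], of B "closure \<Omega>"] B_def' in auto)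
    then show "\<exists>c\<in>A. \<exists>Q F. p \<in> fst c \<and> open Q \<and> snd c p \<in> Q \<and> continuous_on (Q \<inter> chart_img c B) F \<and>
     (\<forall>q\<in>B \<inter> fst c. snd c q \<in> Q \<longrightarrow> \<phi> q = F (snd c q))"
      using c e1 by (intro bexI[of _ c] exI[of _ UNIV] exI[of _ "\<phi> \<circ> ci c"]) auto
  qed
  have c2: "continuous_on (chart_img c (closure \<Omega>)) (\<lambda>x. \<Sum>k\<in>UNIV. partial UNIV k (\<phi> \<circ> ci c) x * Y c x $ k)" if c: "c \<in> A" for c
  proof -
    obtain V where V: "open V" "chart_img c (closure \<Omega>) \<subseteq> V" "Ck_on 1 V (\<phi> \<circ> ci c)" using C1_nearD[OF \<phi> c] by metis
    have "continuous_on (chart_img c (closure \<Omega>)) (partial UNIV k (\<phi> \<circ> ci c))" for k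
      by (rule continuous_on_subset[OF Ck_on_1_partial[OF V(1,3)] V(2)])
    then show ?thesis by (intro continuous_intros Y_cont[OF c])
  qed
  show "continuous_on \<Omega> (along \<phi>)" "bounded (along \<phi> ` \<Omega>)"
    by (rule continuous_bounded_from_charts[OF c2 along_eq[OF \<phi>]]; assumption)+
qed

lemma C1_near_div:
  assumes \<phi>: "C1_near \<phi>"
  shows "continuous_on \<Omega> (\<lambda>q. \<phi> q * \<delta> q + along \<phi> q)" "bounded ((\<lambda>q. \<phi> q * \<delta> q + along \<phi> q) ` \<Omega>)"
proof -
  show "continuous_on \<Omega> (\<lambda>q. \<phi> q * \<delta> q + along \<phi> q)"
    by (intro continuous_intros C1_near_cont[OF \<phi>] \<delta>_cont)
  have bd: "\<exists>a. \<forall>q\<in>\<Omega>. \<bar>\<psi> q\<bar> \<le> a" if "bounded (\<psi> ` \<Omega>)" for \<psi> :: "'a \<Rightarrow> real"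
    using that unfolding bounded_iff by auto
  obtain a b c where abc: "\<And>q. q \<in> \<Omega> \<Longrightarrow> \<bar>\<phi> q\<bar> \<le> a" "\<And>q. q \<in> \<Omega> \<Longrightarrow> \<bar>\<delta> q\<bar> \<le> b" "\<And>q. q \<in> \<Omega> \<Longrightarrow> \<bar>along \<phi> q\<bar> \<le> c"
    using bd[OF C1_near_cont(2)[OF \<phi>]] bd[OF C1_near_cont(5)[OF \<phi>]] bd[OF \<delta>_bdd] by blast
  have "\<bar>\<phi> q * \<delta> q + along \<phi> q\<bar> \<le> a * b + c" if "q \<in> \<Omega>" for q
  proof -
    have "\<bar>\<phi> q * \<delta> q\<bar> \<le> a * b" unfolding abs_mult using abc(1,2)[OF that] by (intro mult_mono) auto
    then show ?thesis using abc(3)[OF that] by linarith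
  qed
  then show "bounded ((\<lambda>q. \<phi> q * \<delta> q + along \<phi> q) ` \<Omega>)" unfolding bounded_iff by auto
qed

text \<open>The part common to interior and boundary patches. The factor \<open>dens c\<close> makes
  the divergence Euclidean, and the support condition confines the integral to the single chart
  \<open>c\<close>.\<close>

lemma local_divergence:
  assumes \<phi>: "C1_near \<phi>" and c: "c \<in> A" and K: "compact K" "K \<subseteq> img c"
    and supp_all: "\<forall>q. q \<notin> fst c \<or> snd c q \<notin> K \<longrightarrow> \<phi> q = 0"
  defines "Z \<equiv> \<lambda>x. (dens c x * \<phi> (ci c x)) *\<^sub>R Y c x"
  shows "\<And>x. x \<in> chart_img c \<Omega> \<Longrightarrow> (\<Sum>i\<in>UNIV. partial UNIV i (\<lambda>z. Z z $ i) x)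
          = dens c x * (\<phi> (ci c x) * \<delta> (ci c x) + along \<phi> (ci c x))"
    and "\<And>i. Ck_on 1 (chart_img c \<Omega>) (\<lambda>z. Z z $ i)"
    and "\<exists>M. \<forall>x\<in>chart_img c \<Omega>. \<bar>\<Sum>i\<in>UNIV. partial UNIV i (\<lambda>z. Z z $ i) x\<bar> \<le> M"
    and "\<And>Q. K \<subseteq> Q \<Longrightarrow> (LINT q:\<Omega>|vol. \<phi> q * \<delta> q + along \<phi> q)
          = (LINT x:chart_img c \<Omega> \<inter> Q|lborel. \<Sum>i\<in>UNIV. partial UNIV i (\<lambda>z. Z z $ i) x)"
    and "continuous_on (chart_img c (closure \<Omega>)) Z"
proof -
  interpret L: chart_loc c by (rule chart_at[OF c])
  interpret M: coord_metric "g c" "img c" by (rule coord_metric_at[OF c])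
  note supp = supp_all[rule_format]
  let ?D = "chart_img c \<Omega>"
  have oD: "open ?D" by (rule L.open_chart_img[OF open_\<Omega>])
  have Dimg: "?D \<subseteq> img c" by (rule L.img_subset)
  obtain V where V: "open V" "chart_img c (closure \<Omega>) \<subseteq> V" "V \<subseteq> img c" "Ck_on 1 V (\<phi> \<circ> ci c)" "?D \<subseteq> V"
    using C1_nearD[OF \<phi> c] by metis
  have \<phi>D: "Ck_on 1 ?D (\<phi> \<circ> ci c)" by (rule Ck_on_subset[OF V(1) oD V(5,4)])
  have dD: "Ck_on 1 ?D (dens c)" by (rule Ck_on_subset[OF L.open_img oD Dimg M.Ck_sqrt_det])
  show CZ: "Ck_on 1 ?D (\<lambda>z. Z z $ i)" for i
  proof -
    have "Ck_on 1 ?D (\<lambda>z. dens c z * (\<phi> \<circ> ci c) z * Y c z $ i)"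
      by (intro Ck_on_mult oD dD \<phi>D Y_C1[OF c])
    then show ?thesis by (simp add: Z_def)
  qed
  show "continuous_on (chart_img c (closure \<Omega>)) Z"
  proof -
    have "continuous_on (chart_img c (closure \<Omega>)) (dens c)" using dens_cont[OF c] V continuous_on_subset by blast
    moreover have "continuous_on (chart_img c (closure \<Omega>)) (\<phi> \<circ> ci c)"
      using Ck_on_continuous[OF V(4)] V(2) continuous_on_subset by blast
    ultimately have "continuous_on (chart_img c (closure \<Omega>)) (\<lambda>x. (dens c x * (\<phi> \<circ> ci c) x) *\<^sub>R Y c x)"
      using Y_cont[OF c] by (intro continuous_on_scaleR continuous_on_mult)
    then show ?thesis by (simp add: Z_def)
  qed
  show DZ: "(\<Sum>i\<in>UNIV. partial UNIV i (\<lambda>z. Z z $ i) x) = dens c x * (\<phi> (ci c x) * \<delta> (ci c x) + along \<phi> (ci c x))"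
    if x: "x \<in> ?D" for x
  proof -
    note m = mem_imgD[OF c x]
    let ?Y = "\<lambda>y. (\<phi> \<circ> ci c) y *\<^sub>R Y c y"
    have \<phi>d: "(\<phi> \<circ> ci c) differentiable at x" by (rule Ck_on_1_differentiable[OF oD \<phi>D x])
    have Yd: "(\<lambda>y. Y c y $ k) differentiable at x" for k by (rule Ck_on_1_differentiable[OF oD Y_C1[OF c] x])
    have dY: "(\<lambda>y. ?Y y $ k) differentiable at x" for k
      using differentiable_mult[OF \<phi>d Yd[of k]] by simp
    have "(\<Sum>i\<in>UNIV. partial UNIV i (\<lambda>z. Z z $ i) x) = dens c x * trace (nab (g c) ?Y x)"
      using M.weighted_divergence[OF m(1) dY] by (simp add: Z_def mult_ac)
    also have "trace (nab (g c) ?Y x) = \<phi> (ci c x) * trace (nab (g c) (Y c) x) + (\<Sum>k\<in>UNIV. partial UNIV k (\<phi> \<circ> ci c) x * Y c x $ k)"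
      using nab_scale[OF \<phi>d Yd, of "g c"] by simp
    also have "trace (nab (g c) (Y c) x) = \<delta> (ci c x)" using div_Y[OF c m(3,2)] m(4) by simp
    also have "(\<Sum>k\<in>UNIV. partial UNIV k (\<phi> \<circ> ci c) x * Y c x $ k) = along \<phi> (ci c x)"
      using along_eq[OF \<phi> c m(3,2)] m(4) by simp
    finally show ?thesis .
  qed
  let ?F = "\<lambda>q. \<phi> q * \<delta> q + along \<phi> q"
  have cK: "continuous_on K (ci c)" by (rule continuous_on_subset[OF L.cont_ci K(2)])
  have clK: "closed (ci c ` K)" by (rule compact_imp_closed[OF compact_continuous_image[OF cK K(1)]])
  \<comment> \<open>Since \<open>q\<close> may lie outside the domain of \<open>c\<close>,
    \<open>along \<phi>\<close> is evaluated in another chart \<open>d\<close>: near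
    \<open>q\<close> the function \<phi> is 0 because the image of \<open>K\<close> is closed in the
    manifold.\<close>
  have van: "?F q = 0" if q: "q \<in> \<Omega>" "q \<notin> fst c \<or> snd c q \<notin> K" for q
  proof -
    obtain d where d: "d \<in> A" "q \<in> fst d" using cover by blast
    interpret Ld: chart_loc d by (rule chart_at[OF d(1)])
    have qK: "q \<in> - ci c ` K"
    proof
      assume "q \<in> ci c ` K"
      then obtain y where "y \<in> K" "q = ci c y" by blast
      then show False using q(2) K(2) L.snd_ci[of y] L.ci_dom[of y] by auto
    qed
    have o: "open (chart_img d (- ci c ` K))" using Ld.open_chart_img[of "- ci c ` K"] clK by auto
    have z: "snd d q \<in> chart_img d (- ci c ` K)" using Ld.snd_mem_img[OF d(2)] qK by blast
    have "partial UNIV k (\<phi> \<circ> ci d) (snd d q) = 0" for k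
    proof (rule partial_zero_open[OF o z])
      fix y assume y: "y \<in> chart_img d (- ci c ` K)"
      have "ci d y \<notin> ci c ` K" using mem_imgD(2)[OF d(1) y] by simp
      then have "ci d y \<notin> fst c \<or> snd c (ci d y) \<notin> K" using L.ci_snd by (metis image_eqI)
      then show "(\<phi> \<circ> ci d) y = 0" using supp by simp
    qed
    then have "along \<phi> q = 0" using along_eq[OF \<phi> d q(1)] by simp
    then show ?thesis using supp[OF q(2)] by simp
  qed
  show "\<exists>M. \<forall>x\<in>?D. \<bar>\<Sum>i\<in>UNIV. partial UNIV i (\<lambda>z. Z z $ i) x\<bar> \<le> M"
  proof -
    obtain M1 where M1: "\<And>x. x \<in> K \<Longrightarrow> \<bar>dens c x\<bar> \<le> M1"
      using compact_imp_bounded[OF compact_continuous_image[OF continuous_on_subset[OF dens_cont[OF c] K(2)] K(1)]]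
      unfolding bounded_iff by auto
    obtain M2 where M2: "\<And>q. q \<in> \<Omega> \<Longrightarrow> \<bar>?F q\<bar> \<le> M2" using C1_near_div(2)[OF \<phi>] unfolding bounded_iff by auto
    have "\<bar>\<Sum>i\<in>UNIV. partial UNIV i (\<lambda>z. Z z $ i) x\<bar> \<le> \<bar>M1\<bar> * \<bar>M2\<bar>" if x: "x \<in> ?D" for x
    proof (cases "x \<in> K")
      case True
      have "\<bar>dens c x\<bar> \<le> \<bar>M1\<bar>" "\<bar>?F (ci c x)\<bar> \<le> \<bar>M2\<bar>" using M1[OF True] M2[OF mem_imgD(2)[OF c x]] by linarith+
      then show ?thesis unfolding DZ[OF x] abs_mult by (intro mult_mono) auto
    next
      case False
      then have "?F (ci c x) = 0" using van[OF mem_imgD(2)[OF c x]] mem_imgD(4)[OF c x] by simp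
      then show ?thesis unfolding DZ[OF x] by simp
    qed
    then show ?thesis by blast
  qed
  show "(LINT q:\<Omega>|vol. ?F q) = (LINT x:?D \<inter> Q|lborel. \<Sum>i\<in>UNIV. partial UNIV i (\<lambda>z. Z z $ i) x)" if Q: "K \<subseteq> Q" for Q
  proof -
    let ?G = "\<lambda>q. indicator \<Omega> q *\<^sub>R ?F q"
    have m: "?G \<in> borel_measurable borel"
      by (rule borel_measurable_continuous_on_indicator[OF _ C1_near_div(1)[OF \<phi>]]) (use open_\<Omega> in simp)
    have 0: "?G q = 0" if "q \<notin> fst c" for q using van[of q] that by (cases "q \<in> \<Omega>") auto
    have "(LINT q:\<Omega>|vol. ?F q) = (LINT x:img c|lborel. dens c x * ?G (ci c x))"
      unfolding set_lebesgue_integral_def[of vol] by (rule integral_vol_chart[OF c m 0])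
    also have "\<dots> = (LINT x:?D \<inter> Q|lborel. \<Sum>i\<in>UNIV. partial UNIV i (\<lambda>z. Z z $ i) x)"
      unfolding set_lebesgue_integral_def
    proof (rule Bochner_Integration.integral_cong[OF refl])
      fix x
      show "indicator (img c) x *\<^sub>R (dens c x * ?G (ci c x)) = indicator (?D \<inter> Q) x *\<^sub>R (\<Sum>i\<in>UNIV. partial UNIV i (\<lambda>z. Z z $ i) x)"
      proof (cases "x \<in> ?D")
        case True
        note m = mem_imgD[OF c True]
        have "?F (ci c x) = 0" if "x \<notin> Q" using van[OF m(2)] m(4) that Q by auto
        then show ?thesis unfolding DZ[OF True] using m True by (cases "x \<in> Q") auto
      next
        case False
        then have "x \<notin> img c \<or> ci c x \<notin> \<Omega>" using L.mem_img[of x \<Omega>] by blast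
        then show ?thesis using False by auto
      qed
    qed
    finally show ?thesis .
  qed
qed

end

context divergence_data begin

text \<open>With compact support inside \<Omega> both sides are 0: the weighted field extends by
  zero to a \<open>C\<^sup>1\<close> field, and the cutoff vanishes on the boundary.\<close>

lemma local_divergence_interior:
  assumes \<phi>: "C1_near \<phi>" and c: "c \<in> A" and K: "compact K" "K \<subseteq> chart_img c \<Omega>"
    and supp: "\<And>q. q \<notin> fst c \<or> snd c q \<notin> K \<Longrightarrow> \<phi> q = 0"
  shows "(LINT q:\<Omega>|vol. \<phi> q * \<delta> q + along \<phi> q) = (LINT q:B|\<sigma>. \<phi> q * fl q)"
proof -
  interpret L: chart_loc c by (rule chart_at[OF c])
  let ?D = "chart_img c \<Omega>"
  have oD: "open ?D" by (rule L.open_chart_img[OF open_\<Omega>])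
  have oK: "open (- K)" using K(1) by (simp add: compact_imp_closed open_Compl)
  have Ki: "K \<subseteq> img c" using K(2) L.img_subset by blast
  define Z where "Z x = (dens c x * \<phi> (ci c x)) *\<^sub>R Y c x" for x
  have supp_all: "\<forall>q. q \<notin> fst c \<or> snd c q \<notin> K \<longrightarrow> \<phi> q = 0" using supp by blast
  note ld = local_divergence[OF \<phi> c K(1) Ki supp_all, folded Z_def]
  define Z' where "Z' i z = (if z \<in> ?D then Z z $ i else 0)" for i z
  have Z0: "Z' i x = 0" if "x \<notin> K" for i x
  proof (cases "x \<in> ?D")
    case True
    then show ?thesis using supp[of "ci c x"] mem_imgD(4)[OF c True] that by (simp add: Z_def Z'_def)
  qed (simp add: Z'_def)
  have C1: "Ck_on 1 UNIV (Z' i)" for i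
  proof (rule Ck_on_UNIV_compact_support[OF oD K _ Z0])
    show "Ck_on 1 ?D (Z' i)" using ld(2)[of i] Ck_on_cong[OF oD, of "Z' i" "\<lambda>z. Z z $ i" 1] by (simp add: Z'_def)
  qed
  note ip = integral_partial_compact_support[OF C1 K(1) Z0]
  have e: "indicator (?D \<inter> UNIV) x *\<^sub>R (\<Sum>i\<in>UNIV. partial UNIV i (\<lambda>z. Z z $ i) x) = (\<Sum>i\<in>UNIV. partial UNIV i (Z' i) x)" for x
  proof (cases "x \<in> ?D")
    case True
    have "partial UNIV i (Z' i) x = partial UNIV i (\<lambda>z. Z z $ i) x" for i
      by (rule partial_cong_open[OF oD True]) (simp add: Z'_def)
    then show ?thesis using True by simp
  next
    case False
    then have "x \<in> - K" using K by blast
    then have "partial UNIV i (Z' i) x = 0" for i by (rule partial_zero_open[OF oK]) (simp add: Z0)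
    then show ?thesis using False by simp
  qed
  have "(LINT q:\<Omega>|vol. \<phi> q * \<delta> q + along \<phi> q) = (LINT x:?D \<inter> UNIV|lborel. \<Sum>i\<in>UNIV. partial UNIV i (\<lambda>z. Z z $ i) x)"
    by (rule ld(4)) simp
  also have "\<dots> = (LINT x|lborel. (\<Sum>i\<in>UNIV. partial UNIV i (Z' i) x))"
    unfolding set_lebesgue_integral_def e ..
  also have "\<dots> = 0" by (simp add: Bochner_Integration.integral_sum ip)
  finally have 1: "(LINT q:\<Omega>|vol. \<phi> q * \<delta> q + along \<phi> q) = 0" .
  have "\<phi> q = 0" if "q \<in> B" for q
  proof (rule supp)
    show "q \<notin> fst c \<or> snd c q \<notin> K" using K(2) L.snd_mem_img[of q \<Omega>] that B_def' by blast
  qed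
  then have "(LINT q:B|\<sigma>. \<phi> q * fl q) = (LINT q:B|\<sigma>. 0)"
    by (intro set_lebesgue_integral_cong) (auto simp: borel_closed)
  then show ?thesis using 1 by simp
qed

lemma local_divergence_boundary:
  assumes \<phi>: "C1_near \<phi>" and b: "bpatch c Q j \<iota> W h s" and K: "compact K" "K \<subseteq> Q"
    and supp: "\<And>q. q \<notin> fst c \<or> snd c q \<notin> K \<Longrightarrow> \<phi> q = 0"
  shows "(LINT q:\<Omega>|vol. \<phi> q * \<delta> q + along \<phi> q) = (LINT q:B|\<sigma>. \<phi> q * fl q)"
proof -
  note c = bpatchD(1)[OF b]
  interpret L: chart_loc c by (rule chart_at[OF c])
  interpret P: boundary_patch "g c" "img c" "chart_img c \<Omega>" Q j \<iota> W h s by (rule bpatchD(2)[OF b])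
  let ?D = "chart_img c \<Omega>"
  let ?par = "\<lambda>y. ins j \<iota> (h y) y"
  have oD: "open ?D" by (rule L.open_chart_img[OF open_\<Omega>])
  have Ki: "K \<subseteq> img c" using K(2) P.QS by blast
  define Z where "Z x = (dens c x * \<phi> (ci c x)) *\<^sub>R Y c x" for x
  have supp_all: "\<forall>q. q \<notin> fst c \<or> snd c q \<notin> K \<longrightarrow> \<phi> q = 0" using supp by blast
  note ld = local_divergence[OF \<phi> c K(1) Ki supp_all, folded Z_def]
  obtain M where M: "\<forall>x\<in>?D. \<bar>\<Sum>i\<in>UNIV. partial UNIV i (\<lambda>z. Z z $ i) x\<bar> \<le> M" using ld(3) by blast
  have "(LINT q:\<Omega>|vol. \<phi> q * \<delta> q + along \<phi> q) = (LINT x:?D \<inter> Q|lborel. \<Sum>i\<in>UNIV. partial UNIV i (\<lambda>z. Z z $ i) x)"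
    by (rule ld(4)[OF K(2)])
  also have "\<dots> = (LINT y:W|lborel. Z (?par y) \<bullet> P.nu y)"
  proof (rule P.divergence_patch[OF oD K])
    show "continuous_on {z \<in> Q. graph_fun j \<iota> h s z \<le> 0} Z"
      by (rule continuous_on_subset[OF ld(5)]) (use bpatch_closure(1)[OF b] in auto)
    show "Ck_on 1 (?D \<inter> Q) (\<lambda>z. Z z $ i)" for i
      by (rule Ck_on_subset[OF oD _ _ ld(2)]) (use oD P.open_Q in auto)
    show "Z z = 0" if "z \<in> Q" "graph_fun j \<iota> h s z \<le> 0" "z \<notin> K" for z
    proof -
      have "z \<in> img c" using that P.QS by blast
      then have "snd c (ci c z) \<notin> K" using that L.snd_ci by simp
      then show ?thesis using supp[of "ci c z"] by (simp add: Z_def)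
    qed
  qed (use M in auto)
  also have "\<dots> = (LINT y:W|lborel. gram c W ?par y * (indicator B (ci c (?par y)) *\<^sub>R (\<phi> (ci c (?par y)) * fl (ci c (?par y)))))"
    unfolding set_lebesgue_integral_def
  proof (rule Bochner_Integration.integral_cong[OF refl], rule arg_cong)
    fix y
    show "indicator W y *\<^sub>R (Z (?par y) \<bullet> P.nu y) = indicator W y *\<^sub>R
      (gram c W ?par y * (indicator B (ci c (?par y)) *\<^sub>R (\<phi> (ci c (?par y)) * fl (ci c (?par y)))))"
    proof (cases "y \<in> W")
      case True
      let ?z = "?par y"
      have zQ: "?z \<in> Q" by (rule P.par_Q[OF True])
      have zi: "?z \<in> img c" using zQ P.QS by blast
      have zB: "?z \<in> chart_img c B" using bpatch_closure(2)[OF b zQ] by simp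
      note m = mem_imgD[OF c zB]
      have y: "prj \<iota> ?z = y" by simp
      have N: "nrm c ?z = P.N ?z" using bpatch_normal(2)[OF b m(2,3)] m(4) zQ by simp
      \<comment> \<open>The \<open>sqrt (P.q ?z)\<close> in this denominator normalizes the
        conormal; it cancels against the one in the surface density \<open>gr\<close>.\<close>
      have f: "fl (ci c ?z) = (P.nu y \<bullet> Y c ?z) / sqrt (P.q ?z)"
        using flux[OF c m(3,2)] P.inner_N[OF zQ, of "Y c ?z"] unfolding m(4) N y by simp
      have "det (\<chi> a b. metric_inner (g c) ?z (partial W a ?par y) (partial W b ?par y)) = det (g c ?z) * P.q ?z"
        using P.gram_par[OF zQ] unfolding bpatch_param(2)[OF b True] metric_inner_def y .
      then have gr: "gram c W ?par y = dens c ?z * sqrt (P.q ?z)" by (simp add: gram_def real_sqrt_mult)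
      have "Z ?z \<bullet> P.nu y = gram c W ?par y * (\<phi> (ci c ?z) * fl (ci c ?z))"
        unfolding gr f Z_def using P.q_pos[OF zQ] by (simp add: inner_commute field_simps)
      then show ?thesis using m(2) True by simp
    qed simp
  qed
  also have "\<dots> = integral\<^sup>L \<sigma> (\<lambda>q. indicator B q *\<^sub>R (\<phi> q * fl q))"
  proof (rule integral_\<sigma>_patch[OF b, symmetric])
    show "(\<lambda>q. indicator B q *\<^sub>R (\<phi> q * fl q)) \<in> borel_measurable borel"
      by (rule borel_measurable_continuous_on_indicator)
         (auto intro!: continuous_intros C1_near_cont(3)[OF \<phi>] fl_cont simp: borel_closed)
    show "indicator B p *\<^sub>R (\<phi> p * fl p) = 0" if "p \<notin> {p \<in> fst c. snd c p \<in> Q} \<inter> B" for p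
      using that supp[of p] K(2) by (cases "p \<in> B") auto
  qed
  finally show ?thesis unfolding set_lebesgue_integral_def .
qed

end

section \<open>Bump functions and the partition of unity\<close>

context riem begin

text \<open>Being the square of a positive part it is \<open>C\<^sup>1\<close> across the edge of
  the coordinate ball, which is all that the product rule for the divergence requires.\<close>

definition bump :: "('a, 'n) chart \<Rightarrow> real^'n \<Rightarrow> real \<Rightarrow> 'a \<Rightarrow> real" where
  "bump c x0 r q = (if q \<in> fst c then (max 0 (r\<^sup>2 - (snd c q - x0) \<bullet> (snd c q - x0)))\<^sup>2 else 0)"

lemma bump_nonneg: "bump c x0 r q \<ge> 0" by (simp add: bump_def)

lemma bump_pos: "q \<in> fst c \<Longrightarrow> snd c q \<in> ball x0 r \<Longrightarrow> bump c x0 r q > 0"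
proof -
  assume q: "q \<in> fst c" "snd c q \<in> ball x0 r"
  then have "norm (snd c q - x0) < r" by (simp add: dist_norm norm_minus_commute)
  then have "(norm (snd c q - x0))\<^sup>2 < r\<^sup>2" by (intro power_strict_mono) auto
  then show ?thesis using q(1) by (simp add: bump_def power2_norm_eq_inner)
qed

lemma bump_zero:
  assumes "r > 0" "q \<notin> fst c \<or> snd c q \<notin> cball x0 r" shows "bump c x0 r q = 0"
proof (cases "q \<in> fst c")
  case True
  then have "norm (snd c q - x0) > r" using assms(2) by (simp add: dist_norm norm_minus_commute)
  then have "(norm (snd c q - x0))\<^sup>2 > r\<^sup>2" using assms(1) by (intro power_strict_mono) auto
  then show ?thesis by (simp add: bump_def power2_norm_eq_inner)
qed (simp add: bump_def)

text \<open>In another chart, points inside the domain of \<open>c\<close> see the formula composed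
  with the transition map. All other points have a neighbourhood on which the function is 0, because
  the closed coordinate ball is compact and hence closed in the Hausdorff space.\<close>

lemma Ck_bump:
  assumes c: "c \<in> A" and d: "d \<in> A" and r: "r > 0" "cball x0 r \<subseteq> img c"
  shows "Ck_on 1 (img d) (bump c x0 r \<circ> ci d)"
proof -
  interpret Lc: chart_loc c by (rule chart_at[OF c])
  interpret Ld: chart_loc d by (rule chart_at[OF d])
  let ?b = "bump c x0 r \<circ> ci d"
  have clK: "closed (ci c ` cball x0 r)"
    by (intro compact_imp_closed compact_continuous_image continuous_on_subset[OF Lc.cont_ci r(2)] compact_cball)
  show ?thesis
  proof (rule Ck_on_local[OF Ld.open_img])
    fix x assume x: "x \<in> img d"
    show "\<exists>T. open T \<and> x \<in> T \<and> Ck_on 1 (img d \<inter> T) ?b"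
    proof (cases "ci d x \<in> fst c")
      case True
      let ?T = "chart_img d (fst c)"
      have oT: "open ?T" by (rule open_overlap[OF d c])
      have xT: "x \<in> ?T" using Ld.mem_img[of x "fst c"] x True by blast
      have eqT: "img d \<inter> ?T = ?T" using Ld.img_subset[of "fst c"] by blast
      define G where "G y = r\<^sup>2 - (\<Sum>a\<in>UNIV. (tr d c y $ a - x0 $ a) * (tr d c y $ a - x0 $ a))" for y
      have G1: "Ck_on 1 ?T G"
        unfolding G_def[abs_def]
        by (intro Ck_on_diff Ck_on_sum Ck_on_mult Ck_on_component tr_smooth[OF d c] Ck_on_const oT)
      have "Ck_on 1 ?T (\<lambda>y. (max 0 (G y))\<^sup>2)"
        by (rule Ck_on_1_real_compose[OF oT G1, where \<beta>'="\<lambda>t. 2 * max 0 t"])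
           (rule DERIV_max_square, intro continuous_intros)
      moreover have "?b y = (max 0 (G y))\<^sup>2" if "y \<in> ?T" for y
        using mem_imgD(2)[OF d that] by (simp add: bump_def G_def inner_vec_def)
      ultimately have "Ck_on 1 ?T ?b" using Ck_on_cong[OF oT, of ?b "\<lambda>y. (max 0 (G y))\<^sup>2" 1] by blast
      then show ?thesis using oT xT eqT by (intro exI[of _ ?T]) (simp only: simp_thms)
    next
      case False
      let ?T = "chart_img d (- ci c ` cball x0 r)"
      have oT: "open ?T" using Ld.open_chart_img[of "- ci c ` cball x0 r"] clK by auto
      have "ci d x \<notin> ci c ` cball x0 r" using False Lc.ci_dom r(2) by (metis imageE subsetD)
      then have xT: "x \<in> ?T" using Ld.mem_img[of x "- ci c ` cball x0 r"] x by blast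
      have eqT: "img d \<inter> ?T = ?T" using Ld.img_subset[of "- ci c ` cball x0 r"] by blast
      have "?b y = 0" if "y \<in> ?T" for y
      proof -
        have "ci d y \<notin> ci c ` cball x0 r" using mem_imgD(2)[OF d that] by simp
        then have "ci d y \<notin> fst c \<or> snd c (ci d y) \<notin> cball x0 r" using Lc.ci_snd by (metis image_eqI)
        then show ?thesis using bump_zero[OF r(1)] by simp
      qed
      then have "Ck_on 1 ?T ?b" using Ck_on_cong[OF oT, of ?b "\<lambda>_. 0" 1] Ck_on_const[OF oT] by blast
      then show ?thesis using oT xT eqT by (intro exI[of _ ?T]) (simp only: simp_thms)
    qed
  qed
qed

end

context divergence_data begin

text \<open>Quantified over all cutoffs supported in the ball, since the partition of unity can be
  chosen only after finitely many balls cover the closure.\<close>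

definition "divergence_ball p c r \<longleftrightarrow> c \<in> A \<and> p \<in> fst c \<and> r > 0 \<and> cball (snd c p) r \<subseteq> img c \<and>
    (\<forall>\<phi>. C1_near \<phi> \<longrightarrow> (\<forall>q. q \<notin> fst c \<or> snd c q \<notin> cball (snd c p) r \<longrightarrow> \<phi> q = 0) \<longrightarrow>
      (LINT q:\<Omega>|vol. \<phi> q * \<delta> q + along \<phi> q) = (LINT q:B|\<sigma>. \<phi> q * fl q))"

lemma divergence_ball_exists:
  assumes p: "p \<in> closure \<Omega>"
  shows "\<exists>c r. divergence_ball p c r"
proof -
  obtain c where c: "c \<in> A" "p \<in> fst c" using cover by blast
  interpret L: chart_loc c by (rule chart_at[OF c(1)])
  show ?thesis
  proof (cases "p \<in> \<Omega>")
    case True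
    have "snd c p \<in> chart_img c \<Omega>" using L.snd_mem_img[OF c(2)] True by blast
    then obtain r where r: "r > 0" "cball (snd c p) r \<subseteq> chart_img c \<Omega>"
      using L.open_chart_img[OF open_\<Omega>] open_contains_cball by blast
    have "cball (snd c p) r \<subseteq> img c" using r L.img_subset by blast
    moreover have "(LINT q:\<Omega>|vol. \<phi> q * \<delta> q + along \<phi> q) = (LINT q:B|\<sigma>. \<phi> q * fl q)"
      if "C1_near \<phi>" "\<forall>q. q \<notin> fst c \<or> snd c q \<notin> cball (snd c p) r \<longrightarrow> \<phi> q = 0" for \<phi>
      by (rule local_divergence_interior[OF that(1) c(1) compact_cball r(2)]) (use that in blast)
    ultimately show ?thesis unfolding divergence_ball_def using c r by blast
  next
    case False
    then have "p \<in> B" using p B_def' by blast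
    then obtain Q j \<iota> W h s where b: "bpatch c Q j \<iota> W h s" and Q: "snd c p \<in> Q"
      using bpatch_exists[OF _ c open_UNIV] by blast
    have oQ: "open Q" and QI: "Q \<subseteq> img c" using b by (auto simp: bpatch_def graph_patch_def)
    obtain r where r: "r > 0" "cball (snd c p) r \<subseteq> Q" using oQ Q open_contains_cball by blast
    have "cball (snd c p) r \<subseteq> img c" using r QI by blast
    moreover have "(LINT q:\<Omega>|vol. \<phi> q * \<delta> q + along \<phi> q) = (LINT q:B|\<sigma>. \<phi> q * fl q)"
      if "C1_near \<phi>" "\<forall>q. q \<notin> fst c \<or> snd c q \<notin> cball (snd c p) r \<longrightarrow> \<phi> q = 0" for \<phi>
      by (rule local_divergence_boundary[OF that(1) b compact_cball r(2)]) (use that in blast)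
    ultimately show ?thesis unfolding divergence_ball_def using c r by blast
  qed
qed

theorem divergence_theorem: "(LINT q:\<Omega>|vol. \<delta> q) = (LINT q:B|\<sigma>. fl q)"
proof -
  obtain C r where "\<And>p. p \<in> closure \<Omega> \<Longrightarrow> divergence_ball p (C p) (r p)"
    using divergence_ball_exists by metis
  note Cr = this[unfolded divergence_ball_def]
  let ?U = "\<lambda>p. {q \<in> fst (C p). snd (C p) q \<in> ball (snd (C p) p) (r p)}"
  have oU: "open (?U p)" and pU: "p \<in> ?U p" if "p \<in> closure \<Omega>" for p
    using chart_loc.open_chart_preimage[OF chart_at, of "C p" "ball (snd (C p) p) (r p)"] Cr[OF that] by auto
  obtain T where T: "T \<subseteq> closure \<Omega>" "finite T" "closure \<Omega> \<subseteq> (\<Union>p\<in>T. ?U p)"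
    using compactE_image[OF compact_cl, of "closure \<Omega>" ?U] oU pU by blast
  define b where "b p = bump (C p) (snd (C p) p) (r p)" for p
  define S where "S q = (\<Sum>p\<in>T. b p q)" for q
  define \<phi> where "\<phi> p q = b p q / S q" for p q
  have S_pos: "S q > 0" if q: "q \<in> closure \<Omega>" for q
  proof -
    obtain p where p: "p \<in> T" "q \<in> ?U p" using T(3) q by blast
    then have "b p q > 0" unfolding b_def using bump_pos by blast
    then show ?thesis unfolding S_def by (intro sum_pos2[OF T(2) p(1)]) (auto simp: b_def bump_nonneg)
  qed
  have bC: "Ck_on 1 (img d) (b p \<circ> ci d)" if "d \<in> A" "p \<in> T" for d p
    unfolding b_def by (rule Ck_bump) (use that Cr T(1) in auto)
  have SC: "Ck_on 1 (img d) (S \<circ> ci d)" if d: "d \<in> A" for d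
  proof -
    have "Ck_on 1 (img d) (\<lambda>x. \<Sum>p\<in>T. (b p \<circ> ci d) x)"
      by (rule Ck_on_sum[OF chart_loc.open_img[OF chart_at[OF d]]]) (rule bC[OF d])
    then show ?thesis by (simp add: S_def o_def)
  qed
  \<comment> \<open>The open neighbourhood of the closure on which division by \<open>S\<close> is
    regular.\<close>
  define V where "V d = {x \<in> img d. (S \<circ> ci d) x > 0}" for d :: "('a, 'n) chart"
  have oV: "open (V d)" if d: "d \<in> A" for d
  proof -
    have "open (img d \<inter> (S \<circ> ci d) -` {0<..})"
      using continuous_openin_preimage_gen[OF Ck_on_continuous[OF SC[OF d]] open_greaterThan]
        chart_loc.open_img[OF chart_at[OF d]] openin_open_trans by blast
    moreover have "img d \<inter> (S \<circ> ci d) -` {0<..} = V d" by (auto simp: V_def)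
    ultimately show ?thesis by simp
  qed
  have clV: "chart_img d (closure \<Omega>) \<subseteq> V d" if d: "d \<in> A" for d
  proof
    fix x assume x: "x \<in> chart_img d (closure \<Omega>)"
    show "x \<in> V d" using mem_imgD(1)[OF d x] S_pos[OF mem_imgD(2)[OF d x]] by (simp add: V_def)
  qed
  have \<phi>V: "Ck_on 1 (V d) (\<phi> p \<circ> ci d)" if d: "d \<in> A" "p \<in> T" for d p
  proof -
    have sub: "V d \<subseteq> img d" by (auto simp: V_def)
    note o = chart_loc.open_img[OF chart_at[OF d(1)]]
    have "Ck_on 1 (V d) (\<lambda>x. (b p \<circ> ci d) x / (S \<circ> ci d) x)"
      by (rule Ck_on_divide[OF oV[OF d(1)] Ck_on_subset[OF o oV[OF d(1)] sub bC[OF d]] Ck_on_subset[OF o oV[OF d(1)] sub SC[OF d(1)]]])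
         (auto simp: V_def)
    then show ?thesis by (simp add: \<phi>_def o_def)
  qed
  have \<phi>C: "C1_near (\<phi> p)" if p: "p \<in> T" for p
    unfolding C1_near_def
  proof
    fix d assume d: "d \<in> A"
    have "V d \<subseteq> img d" by (auto simp: V_def)
    then show "\<exists>V. open V \<and> chart_img d (closure \<Omega>) \<subseteq> V \<and> V \<subseteq> img d \<and> Ck_on 1 V (\<phi> p \<circ> ci d)"
      using oV[OF d] clV[OF d] \<phi>V[OF d p] by blast
  qed
  have \<phi>0: "\<phi> p q = 0" if "p \<in> T" "q \<notin> fst (C p) \<or> snd (C p) q \<notin> cball (snd (C p) p) (r p)" for p q
    using bump_zero[of "r p" q "C p" "snd (C p) p"] Cr[of p] T(1) that by (auto simp: \<phi>_def b_def)
  have loc: "(LINT q:\<Omega>|vol. \<phi> p q * \<delta> q + along (\<phi> p) q) = (LINT q:B|\<sigma>. \<phi> p q * fl q)" if p: "p \<in> T" for p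
    using Cr[of p] \<phi>C[OF p] \<phi>0[OF p] T(1) p by blast
  have sum1: "(\<Sum>p\<in>T. \<phi> p q) = 1" if "S q > 0" for q
    using that by (simp add: \<phi>_def sum_divide_distrib[symmetric] S_def[symmetric])
  \<comment> \<open>The functions of the partition add up to 1 near \<open>q\<close>, so their
    derivatives add up to 0 and only the undisturbed divergence survives the summation.\<close>
  have along0: "(\<Sum>p\<in>T. along (\<phi> p) q) = 0" if q: "q \<in> \<Omega>" for q
  proof -
    obtain c where c: "c \<in> A" "q \<in> fst c" using cover by blast
    let ?x = "snd c q"
    have "q \<in> closure \<Omega>" using q closure_subset by blast
    then have xV: "?x \<in> V c" using clV[OF c(1)] chart_loc.snd_mem_img[OF chart_at[OF c(1)] c(2), of "closure \<Omega>"] by blast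
    have d: "(\<phi> p \<circ> ci c) differentiable at ?x" if "p \<in> T" for p
      by (rule Ck_on_1_differentiable[OF oV[OF c(1)] \<phi>V[OF c(1) that] xV])
    have "(\<Sum>p\<in>T. partial UNIV k (\<phi> p \<circ> ci c) ?x) = 0" for k
    proof -
      have "(\<Sum>p\<in>T. partial UNIV k (\<phi> p \<circ> ci c) ?x) = partial UNIV k (\<lambda>x. \<Sum>p\<in>T. (\<phi> p \<circ> ci c) x) ?x"
        by (rule partial_sum[symmetric, OF T(2) d])
      also have "\<dots> = partial UNIV k (\<lambda>x. 1) ?x"
        by (rule partial_cong_open[OF oV[OF c(1)] xV]) (use sum1 in \<open>simp add: V_def\<close>)
      finally show ?thesis by simp
    qed
    then have "0 = (\<Sum>k\<in>UNIV. (\<Sum>p\<in>T. partial UNIV k (\<phi> p \<circ> ci c) ?x) * Y c ?x $ k)" by simp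
    also have "\<dots> = (\<Sum>p\<in>T. \<Sum>k\<in>UNIV. partial UNIV k (\<phi> p \<circ> ci c) ?x * Y c ?x $ k)"
      unfolding sum_distrib_right by (rule sum.swap)
    also have "\<dots> = (\<Sum>p\<in>T. along (\<phi> p) q)"
      by (rule sum.cong[OF refl]) (rule along_eq[OF \<phi>C c q, symmetric])
    finally show ?thesis by simp
  qed
  have "(LINT q:\<Omega>|vol. \<delta> q) = (LINT q:\<Omega>|vol. \<Sum>p\<in>T. \<phi> p q * \<delta> q + along (\<phi> p) q)"
  proof (rule set_lebesgue_integral_cong)
    show "\<forall>q. q \<in> \<Omega> \<longrightarrow> \<delta> q = (\<Sum>p\<in>T. \<phi> p q * \<delta> q + along (\<phi> p) q)"
    proof (intro allI impI)
      fix q assume q: "q \<in> \<Omega>"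
      then have "S q > 0" using S_pos closure_subset by blast
      then show "\<delta> q = (\<Sum>p\<in>T. \<phi> p q * \<delta> q + along (\<phi> p) q)"
        by (simp add: sum.distrib along0[OF q] sum_distrib_right[symmetric] sum1)
    qed
  qed (use open_\<Omega> in simp)
  also have "\<dots> = (\<Sum>p\<in>T. LINT q:\<Omega>|vol. \<phi> p q * \<delta> q + along (\<phi> p) q)"
    using integrable_vol[OF C1_near_div[OF \<phi>C]] unfolding set_lebesgue_integral_def set_integrable_def
    by (simp add: sum_distrib_left Bochner_Integration.integral_sum)
  also have "\<dots> = (\<Sum>p\<in>T. LINT q:B|\<sigma>. \<phi> p q * fl q)" by (rule sum.cong[OF refl loc])
  also have "\<dots> = (LINT q:B|\<sigma>. \<Sum>p\<in>T. \<phi> p q * fl q)"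
  proof -
    have "set_integrable \<sigma> B (\<lambda>q. \<phi> p q * fl q)" if "p \<in> T" for p
      by (rule integrable_\<sigma>) (intro continuous_intros C1_near_cont(3)[OF \<phi>C[OF that]] fl_cont)
    then show ?thesis unfolding set_lebesgue_integral_def set_integrable_def
      by (simp add: sum_distrib_left Bochner_Integration.integral_sum)
  qed
  also have "\<dots> = (LINT q:B|\<sigma>. fl q)"
  proof (rule set_lebesgue_integral_cong)
    show "\<forall>q. q \<in> B \<longrightarrow> (\<Sum>p\<in>T. \<phi> p q * fl q) = fl q"
      using sum1[OF S_pos] B_def' by (auto simp: sum_distrib_right[symmetric])
  qed (simp add: borel_closed)
  finally show ?thesis .
qed

end

section \<open>The gradient field\<close>

text \<open>Take a \<open>G\<close>-orthonormal set of largest size, which exists since such sets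
  are independent. If some vector were not recovered from its coefficients, the normalized remainder
  could be added to the set.\<close>

lemma orthonormal_expansion:
  fixes G :: "real^'n^'n"
  assumes sym: "transpose G = G" and pos: "\<And>v. v \<noteq> 0 \<Longrightarrow> v \<bullet> (G *v v) > 0"
  shows "\<exists>S. finite S \<and> (\<forall>v. (\<Sum>s\<in>S. (s \<bullet> (G *v v)) *\<^sub>R s) = v)"
proof -
  define on where "on S \<longleftrightarrow> finite S \<and> (\<forall>s\<in>S. \<forall>t\<in>S. s \<bullet> (G *v t) = (if s = t then 1 else 0))" for S
  have Gs: "v \<bullet> (G *v w) = w \<bullet> (G *v v)" for v w
    using inner_transpose_left[of G v w] unfolding sym by (simp add: inner_commute)
  have coef: "t \<bullet> (G *v (\<Sum>s\<in>S. a s *\<^sub>R s)) = a t" if S: "on S" and t: "t \<in> S" for S t a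
  proof -
    have "t \<bullet> (G *v (\<Sum>s\<in>S. a s *\<^sub>R s)) = (\<Sum>s\<in>S. a s * (t \<bullet> (G *v s)))"
      by (simp add: linear_sum[OF matrix_vector_mul_linear] matrix_vector_mult_scaleR inner_sum_right)
    also have "\<dots> = (\<Sum>s\<in>S. if t = s then a s else 0)"
      by (rule sum.cong[OF refl]) (use S t in \<open>auto simp: on_def\<close>)
    also have "\<dots> = a t" using S t by (auto simp: on_def)
    finally show ?thesis .
  qed
  have card: "card S \<le> CARD('n)" if S: "on S" for S
  proof -
    have "independent S"
    proof (rule independent_if_scalars_zero)
      fix a t assume "(\<Sum>s\<in>S. a s *\<^sub>R s) = 0" "t \<in> S"
      then show "a t = 0" using coef[OF S, of t a] by simp
    qed (use S in \<open>auto simp: on_def\<close>)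
    then show ?thesis using independent_bound[of S] by simp
  qed
  have "on {}" by (simp add: on_def)
  then obtain S where S: "on S" "\<And>S'. on S' \<Longrightarrow> card S' \<le> card S"
    using ex_has_greatest_nat[of on "{}" card "CARD('n) + 1"] card by (metis less_Suc_eq_le Suc_eq_plus1)
  have "(\<Sum>s\<in>S. (s \<bullet> (G *v v)) *\<^sub>R s) = v" for v
  proof (rule ccontr)
    define w where "w = v - (\<Sum>s\<in>S. (s \<bullet> (G *v v)) *\<^sub>R s)"
    assume "(\<Sum>s\<in>S. (s \<bullet> (G *v v)) *\<^sub>R s) \<noteq> v"
    then have "w \<noteq> 0" by (auto simp: w_def)
    then have wp: "w \<bullet> (G *v w) > 0" by (rule pos)
    have sw: "s \<bullet> (G *v w) = 0" if "s \<in> S" for s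
      unfolding w_def matrix_vector_mult_diff_distrib inner_diff_right coef[OF S(1) that] by (rule diff_self)
    define e where "e = (1 / sqrt (w \<bullet> (G *v w))) *\<^sub>R w"
    have se: "s \<bullet> (G *v e) = 0" if "s \<in> S" for s using sw[OF that] by (simp add: e_def matrix_vector_mult_scaleR)
    have "e \<bullet> (G *v e) = (1 / sqrt (w \<bullet> (G *v w)) * (1 / sqrt (w \<bullet> (G *v w)))) * (w \<bullet> (G *v w))"
      by (simp add: e_def matrix_vector_mult_scaleR)
    then have ee: "e \<bullet> (G *v e) = 1" using wp by simp
    have "e \<notin> S" using se ee by force
    moreover have "on (insert e S)"
    proof -
      have es: "e \<bullet> (G *v s) = 0" if "s \<in> S" for s using se[OF that] Gs[of e s] by (rule trans[rotated])
      show ?thesis unfolding on_def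
      proof (intro conjI ballI)
        fix s t assume "s \<in> insert e S" "t \<in> insert e S"
        then consider "s = e" "t = e" | "s = e" "t \<in> S" | "s \<in> S" "t = e" | "s \<in> S" "t \<in> S" by blast
        then show "s \<bullet> (G *v t) = (if s = t then 1 else 0)"
        proof cases
          case 1 then show ?thesis using ee by simp
        next
          case 2 then show ?thesis using es[OF 2(2)] \<open>e \<notin> S\<close> by auto
        next
          case 3 then show ?thesis using se[OF 3(1)] \<open>e \<notin> S\<close> by auto
        next
          case 4 then show ?thesis using S(1) unfolding on_def by blast
        qed
      qed (use S(1) in \<open>simp add: on_def\<close>)
    qed
    moreover have "finite S" using S(1) by (simp add: on_def)
    ultimately show False using S(2)[of "insert e S"] by simp
  qed
  then show ?thesis using S(1) on_def by blast
qed

context coord_metric begin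

text \<open>In an orthonormal frame \<open>F\<close> the inverse metric is the sum of the products
  \<open>s $ i * s $ j\<close>, which turns the fourfold contraction into a sum of squares of the
  values of \<open>K\<close> on pairs of frame vectors.\<close>

lemma metric_norm2_nonneg:
  assumes x: "x \<in> S" shows "metric_norm2 G x K \<ge> 0"
proof -
  obtain F where F: "finite F" "\<And>v. (\<Sum>s\<in>F. (s \<bullet> (G x *v v)) *\<^sub>R s) = v"
    using orthonormal_expansion[OF sym[OF x] pos[OF x]] by metis
  define P where "P = (\<chi> i j. \<Sum>s\<in>F. s $ i * s $ j)"
  have "(P ** G x) *v v = v" for v
  proof -
    have "(P *v w) $ i = (\<Sum>s\<in>F. (s \<bullet> w) *\<^sub>R s) $ i" for w i
      unfolding P_def matrix_vector_mult_def inner_vec_def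
      by (simp add: sum_distrib_right sum_distrib_left mult_ac) (rule sum.swap)
    then show ?thesis unfolding matrix_vector_mul_assoc[symmetric] using F(2)[of v] by (simp add: vec_eq_iff)
  qed
  then have "P ** G x = mat 1" by (simp add: matrix_eq)
  then have "matrix_inv (G x) = P" by (rule matrix_inv_unique_left)
  then have P: "metric_inv G x i j = (\<Sum>s\<in>F. s $ i * s $ j)" for i j by (simp add: metric_inv_def P_def)
  have prod4: "(\<Sum>s\<in>F. s $ i * s $ k) * (\<Sum>t\<in>F. t $ j * t $ l) * a * b
      = (\<Sum>s\<in>F. \<Sum>t\<in>F. (s $ i * t $ j * a) * (s $ k * t $ l * b))" for i j k l and a b :: real
    unfolding sum_product unfolding sum_distrib_right by (intro sum.cong refl) (simp only: mult_ac)
  have sq: "(\<Sum>i\<in>UNIV. \<Sum>j\<in>UNIV. \<Sum>k\<in>UNIV. \<Sum>l\<in>UNIV. a i j * a k l) = (\<Sum>i\<in>UNIV. \<Sum>j\<in>UNIV. a i j)\<^sup>2"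
    for a :: "'n \<Rightarrow> 'n \<Rightarrow> real"
  proof -
    have 1: "(\<Sum>i\<in>UNIV. \<Sum>j\<in>UNIV. a i j) * Z = (\<Sum>i\<in>UNIV. \<Sum>j\<in>UNIV. a i j * Z)" for Z
      by (simp only: sum_distrib_right)
    have 2: "Z * (\<Sum>k\<in>UNIV. \<Sum>l\<in>UNIV. a k l) = (\<Sum>k\<in>UNIV. \<Sum>l\<in>UNIV. Z * a k l)" for Z
      by (simp only: sum_distrib_left)
    show ?thesis unfolding power2_eq_square 1 unfolding 2 ..
  qed
  have "metric_norm2 G x K = (\<Sum>i\<in>UNIV. \<Sum>j\<in>UNIV. \<Sum>k\<in>UNIV. \<Sum>l\<in>UNIV. \<Sum>s\<in>F. \<Sum>t\<in>F.
      (s $ i * t $ j * K $ i $ j) * (s $ k * t $ l * K $ k $ l))"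
    unfolding metric_norm2_def P prod4 ..
  also have "\<dots> = (\<Sum>s\<in>F. \<Sum>t\<in>F. \<Sum>i\<in>UNIV. \<Sum>j\<in>UNIV. \<Sum>k\<in>UNIV. \<Sum>l\<in>UNIV.
      (s $ i * t $ j * K $ i $ j) * (s $ k * t $ l * K $ k $ l))"
    by (simp only: sum.swap[of _ "UNIV :: 'n set" F])
  also have "\<dots> = (\<Sum>s\<in>F. \<Sum>t\<in>F. (\<Sum>i\<in>UNIV. \<Sum>j\<in>UNIV. s $ i * t $ j * K $ i $ j)\<^sup>2)"
    unfolding sq ..
  finally show ?thesis by (simp add: sum_nonneg)
qed

end

text \<open>Interior quantities are formed with derivatives within \<Omega>, the normal derivative
  with derivatives within the closure; inside \<Omega> the two have to be identified.\<close>

lemma partial_interior: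
  assumes "open D" "D \<subseteq> S" "x \<in> D" shows "partial S i f x = partial D i f x"
proof -
  have "at x within S = at x within D" by (rule at_within_nhd[OF assms(3,1)]) (use assms(2) in blast)
  then show ?thesis by (simp add: partial_def)
qed

lemma gradient_interior:
  assumes "open D" "D \<subseteq> S" "x \<in> D" shows "gradient G S u x = gradient G D u x"
  unfolding gradient_def partial_interior[OF assms] ..

lemma hessian_interior:
  assumes "open D" "D \<subseteq> S" "x \<in> D" shows "hessian G S u x = hessian G D u x"
proof -
  have "partial S i (partial S j u) x = partial D i (partial D j u) x" for i j
    unfolding partial_interior[OF assms] partial_open[OF assms(1,3)]
    by (rule partial_cong_open[OF assms(1,3)])
       (simp add: partial_interior[OF assms(1,2)] partial_open[OF assms(1)])
  then show ?thesis unfolding hessian_def partial_interior[OF assms] by simp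
qed

lemma nab_cong:
  assumes "open D" "x \<in> D" "\<And>y. y \<in> D \<Longrightarrow> X y = X' y" shows "nab G X x = nab G X' x"
proof -
  have "partial UNIV j (\<lambda>y. X y $ k) x = partial UNIV j (\<lambda>y. X' y $ k) x" for j k
    by (rule partial_cong_open[OF assms(1,2)]) (simp add: assms(3))
  then show ?thesis unfolding nab_def using assms(2,3) by simp
qed

context coord_metric begin

lemma continuous_on_ricci: "continuous_on S (\<lambda>x. ricci G x $ j $ k)"
proof -
  have 0: "continuous_on S (christoffel G l i m)" for l i m by (rule Ck_on_continuous[OF Ck_christoffel])
  have 1: "continuous_on S (partial UNIV a (christoffel G l i m))" for a l i m by (rule Ck_on_1_partial[OF open_S Ck_christoffel])
  show ?thesis unfolding ricci_def vec_lambda_beta curvature_def by (intro continuous_intros 0 1)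
qed

end

locale riem_fun = riem_dom A g \<Omega> TM
  for A :: "('a::{t2_space, second_countable_topology}, 'n::finite) chart set" and g
    and \<Omega> :: "'a set" and TM :: "'m::finite itself" +
  fixes u :: "'a \<Rightarrow> real"
  assumes u3: "Ck_manifold_on A 3 \<Omega> u" and u2: "Ck_manifold_on A 2 (closure \<Omega>) u"
begin

abbreviation "Dm c \<equiv> chart_img c \<Omega>"
abbreviation "Dc c \<equiv> chart_img c (closure \<Omega>)"
abbreviation "uc c \<equiv> u \<circ> ci c"

text \<open>Both are formed over the closure in order to have continuous boundary values. In the
  interior \<open>T c\<close> is the endomorphism sending \<open>v\<close> to the covariant
  derivative of the gradient along \<open>v\<close>.\<close>

definition "X c = gradient (g c) (Dc c) (uc c)"
definition "T c x = matrix_inv (g c x) ** transpose (hessian (g c) (Dc c) (uc c) x)"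

lemma open_Dm: "c \<in> A \<Longrightarrow> open (Dm c)" by (rule chart_loc.open_chart_img[OF chart_at open_\<Omega>])
lemma Dm_Dc: "c \<in> A \<Longrightarrow> Dm c \<subseteq> Dc c" by (rule chart_loc.img_mono[OF chart_at closure_subset])
lemma Dc_img: "c \<in> A \<Longrightarrow> Dc c \<subseteq> img c" by (rule chart_loc.img_subset[OF chart_at])
lemma Dm_img: "c \<in> A \<Longrightarrow> Dm c \<subseteq> img c" by (rule chart_loc.img_subset[OF chart_at])
lemma snd_Dm: "c \<in> A \<Longrightarrow> p \<in> fst c \<Longrightarrow> p \<in> \<Omega> \<Longrightarrow> snd c p \<in> Dm c" using chart_loc.snd_mem_img[OF chart_at] by blast

lemma uc2: "c \<in> A \<Longrightarrow> Ck_on 2 (Dc c) (uc c)" using u2 unfolding Ck_manifold_on_def by blast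
lemma uc3: "c \<in> A \<Longrightarrow> Ck_on 3 (Dm c) (uc c)" using u3 unfolding Ck_manifold_on_def by blast
lemma uc2_Dm: "c \<in> A \<Longrightarrow> Ck_on 2 (Dm c) (uc c)" by (rule Ck_on_mono[OF uc3]) auto
lemma uc_diff: "c \<in> A \<Longrightarrow> x \<in> Dm c \<Longrightarrow> uc c differentiable at x"
  using Ck_on_1_differentiable[OF open_Dm Ck_on_mono[OF uc3, of c 1]] by simp

lemma X_interior: "c \<in> A \<Longrightarrow> x \<in> Dm c \<Longrightarrow> X c x = gradient (g c) (Dm c) (uc c) x"
  unfolding X_def by (rule gradient_interior[OF open_Dm Dm_Dc])

lemma T_interior: "c \<in> A \<Longrightarrow> x \<in> Dm c \<Longrightarrow> T c x = matrix_inv (g c x) ** transpose (hessian (g c) (Dm c) (uc c) x)"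
  unfolding T_def by (subst hessian_interior[OF open_Dm Dm_Dc]) auto

lemma nab_X: "c \<in> A \<Longrightarrow> x \<in> Dm c \<Longrightarrow> nab (g c) (X c) x = T c x"
proof -
  assume c: "c \<in> A" and x: "x \<in> Dm c"
  have "nab (g c) (X c) x = nab (g c) (gradient (g c) (Dm c) (uc c)) x"
    by (rule nab_cong[OF open_Dm[OF c] x X_interior[OF c]])
  then show ?thesis
    using coord_metric.nab_gradient[OF coord_metric_at[OF c] open_Dm[OF c] Dm_img[OF c] uc2_Dm[OF c] x] T_interior[OF c x] by simp
qed

lemma X_lower: "c \<in> A \<Longrightarrow> x \<in> img c \<Longrightarrow> g c x *v X c x = (\<chi> i. partial (Dc c) i (uc c) x)"
  by (simp add: X_def gradient_def matrix_vector_mul_assoc matrix_inv_right[OF coord_metric.inv[OF coord_metric_at]])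

lemma C2_X: "c \<in> A \<Longrightarrow> Ck_on 2 (Dm c) (\<lambda>x. X c x $ k)"
proof -
  assume c: "c \<in> A"
  have u: "Ck_on 2 (Dm c) (partial UNIV i (uc c))" for i
    by (rule Ck_on_SucD2[OF open_Dm[OF c]]) (use uc3[OF c] in \<open>simp add: numeral_3_eq_3 numeral_2_eq_2\<close>)
  have gi: "Ck_on 2 (Dm c) (\<lambda>x. metric_inv (g c) x k i)" for i
    by (rule Ck_on_subset[OF chart_loc.open_img[OF chart_at[OF c]] open_Dm[OF c] Dm_img[OF c] coord_metric.Ck_metric_inv[OF coord_metric_at[OF c]]])
  have "Ck_on 2 (Dm c) (\<lambda>x. \<Sum>i\<in>UNIV. metric_inv (g c) x k i * partial UNIV i (uc c) x)"
    by (intro Ck_on_sum Ck_on_mult open_Dm c u gi)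
  moreover have "X c x $ k = (\<Sum>i\<in>UNIV. metric_inv (g c) x k i * partial UNIV i (uc c) x)" if "x \<in> Dm c" for x
    unfolding X_interior[OF c that] gradient_def partial_open[OF open_Dm[OF c] that] by (simp add: matrix_vector_mult_def metric_inv_def)
  ultimately show ?thesis using Ck_on_cong[OF open_Dm[OF c], of "\<lambda>x. X c x $ k" "\<lambda>x. \<Sum>i\<in>UNIV. metric_inv (g c) x k i * partial UNIV i (uc c) x" 2] by blast
qed

lemma diff_X: "c \<in> A \<Longrightarrow> x \<in> Dm c \<Longrightarrow> (\<lambda>x. X c x $ k) differentiable at x"
  using Ck_on_1_differentiable[OF open_Dm Ck_on_mono[OF C2_X, of c 1]] by simp

lemma diff_X_vec: "c \<in> A \<Longrightarrow> x \<in> Dm c \<Longrightarrow> X c differentiable at x"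
  by (rule vec_differentiableI) (rule diff_X)

lemma cont_metric_inv: "c \<in> A \<Longrightarrow> continuous_on (Dc c) (\<lambda>x. matrix_inv (g c x) $ i $ k)"
  using continuous_on_subset[OF Ck_on_continuous[OF coord_metric.Ck_metric_inv[OF coord_metric_at]] Dc_img] unfolding metric_inv_def .

lemma cont_partial_u:
  assumes "c \<in> A"
  shows "continuous_on (Dc c) (partial (Dc c) i (uc c))" "continuous_on (Dc c) (partial (Dc c) i (partial (Dc c) k (uc c)))"
proof -
  have 1: "Ck_on 1 (Dc c) (partial (Dc c) i (uc c))" for i
    using uc2[OF assms] unfolding numeral_2_eq_2 Ck_on.simps(2)[of "Suc 0"] One_nat_def by blast
  show "continuous_on (Dc c) (partial (Dc c) i (uc c))" by (rule Ck_on_continuous[OF 1])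
  show "continuous_on (Dc c) (partial (Dc c) i (partial (Dc c) k (uc c)))" using 1[of k] by simp
qed

lemma cont_X: "c \<in> A \<Longrightarrow> continuous_on (Dc c) (X c)"
proof -
  assume c: "c \<in> A"
  have "continuous_on (Dc c) (\<lambda>x. \<chi> k. \<Sum>i\<in>UNIV. matrix_inv (g c x) $ k $ i * partial (Dc c) i (uc c) x)"
    by (intro continuous_on_vec_lambda continuous_intros cont_metric_inv[OF c] cont_partial_u[OF c])
  then show ?thesis unfolding X_def gradient_def[abs_def] matrix_vector_mult_def by simp
qed

lemma cont_T: "c \<in> A \<Longrightarrow> continuous_on (Dc c) (\<lambda>x. T c x $ i $ k)"
proof -
  assume c: "c \<in> A"
  have "continuous_on (Dc c) (christoffel (g c) a i k)" for a i k
    by (rule continuous_on_subset[OF Ck_on_continuous[OF coord_metric.Ck_christoffel[OF coord_metric_at[OF c]]] Dc_img[OF c]])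
  then show ?thesis
    unfolding T_def matrix_matrix_mult_def transpose_def hessian_def vec_lambda_beta
    by (intro continuous_intros cont_metric_inv[OF c] cont_partial_u[OF c])
qed

lemma X_transform:
  assumes c: "c \<in> A" and d: "d \<in> A" and p: "p \<in> fst c" "p \<in> fst d" "p \<in> \<Omega>"
  shows "X d (snd d p) = jac c d (snd c p) *v X c (snd c p)"
proof -
  interpret T: coord_change "g c" "img c" "g d" "img d" "chart_img c (fst d)" "tr c d" "jac c d"
    by (rule coord_change_at[OF c d]) (rule jac_eq)
  let ?x = "snd c p" and ?z = "snd d p"
  note xD = snd_Dm[OF c p(1,3)] and zD = snd_Dm[OF d p(2,3)]
  have xZ: "?x \<in> chart_img c (fst d)" using chart_loc.snd_mem_img[OF chart_at[OF c] p(1), of "fst d"] p by blast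
  have tz: "tr c d ?x = ?z" by (rule tr_snd[OF c p(1)])
  have fd: "uc d differentiable at (tr c d ?x)" unfolding tz by (rule uc_diff[OF d zD])
  have "(\<chi> k. partial (Dm c) k (uc c) ?x) = transpose (jac c d ?x) *v (\<chi> a. partial (Dm d) a (uc d) ?z)"
  proof -
    have "partial UNIV k (uc c) ?x = (\<Sum>a\<in>UNIV. jac c d ?x $ a $ k * partial UNIV a (uc d) ?z)" for k
    proof -
      have "partial UNIV k (uc c) ?x = partial UNIV k (\<lambda>x. uc d (tr c d x)) ?x"
        by (rule partial_cong_open[OF T.Z(1) xZ]) (use ci_tr[OF c d] in simp)
      also have "\<dots> = (\<Sum>a\<in>UNIV. partial UNIV k (\<lambda>x. tr c d x $ a) ?x *\<^sub>R partial UNIV a (uc d) (tr c d ?x))"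
        by (rule partial_compose[OF T.\<tau>_diff[OF xZ] fd])
      finally show ?thesis unfolding T.J_nth[OF xZ] tz by simp
    qed
    then show ?thesis
      unfolding partial_open[OF open_Dm[OF c] xD] partial_open[OF open_Dm[OF d] zD]
      by (simp add: vec_eq_iff matrix_vector_mult_def transpose_def)
  qed
  then show ?thesis
    unfolding X_interior[OF c xD] X_interior[OF d zD] gradient_def
    using T.inverse_transform[OF xZ, of "\<chi> a. partial (Dm d) a (uc d) ?z"] unfolding tz by simp
qed

lemma nab_transform_\<Omega>:
  assumes c: "c \<in> A" and d: "d \<in> A" and p: "p \<in> fst c" "p \<in> fst d" "p \<in> \<Omega>"
    and Y: "\<And>q. q \<in> fst c \<Longrightarrow> q \<in> fst d \<Longrightarrow> q \<in> \<Omega> \<Longrightarrow> Y d (snd d q) = jac c d (snd c q) *v Y c (snd c q)"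
    and dY: "\<And>c x. c \<in> A \<Longrightarrow> x \<in> Dm c \<Longrightarrow> Y c differentiable at x"
  shows "nab (g d) (Y d) (snd d p) ** jac c d (snd c p) = jac c d (snd c p) ** nab (g c) (Y c) (snd c p)"
proof -
  interpret T: coord_change "g c" "img c" "g d" "img d" "chart_img c (fst d)" "tr c d" "jac c d"
    by (rule coord_change_at[OF c d]) (rule jac_eq)
  let ?U = "chart_img c (fst d \<inter> \<Omega>)"
  have oU: "open ?U" using chart_loc.open_chart_img[OF chart_at[OF c]] chart_loc.open_dom[OF chart_at[OF d]] open_\<Omega> by blast
  have xU: "snd c p \<in> ?U" using chart_loc.snd_mem_img[OF chart_at[OF c] p(1)] p by blast
  have tz: "tr c d (snd c p) = snd d p" by (rule tr_snd[OF c p(1)])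
  have "nab (g d) (Y d) (tr c d (snd c p)) ** jac c d (snd c p) = jac c d (snd c p) ** nab (g c) (Y c) (snd c p)"
  proof (rule T.nab_transform[OF oU xU])
    show "?U \<subseteq> chart_img c (fst d)" by (rule chart_loc.img_mono[OF chart_at[OF c]]) simp
    show "Y d (tr c d y) = jac c d y *v Y c y" if "y \<in> ?U" for y
      using Y[of "ci c y"] mem_imgD[OF c that] by simp
    show "Y c differentiable at (snd c p)" by (rule dY[OF c snd_Dm[OF c p(1,3)]])
    show "Y d differentiable at (tr c d (snd c p))" unfolding tz by (rule dY[OF d snd_Dm[OF d p(2,3)]])
  qed
  then show ?thesis unfolding tz .
qed

lemma jac_invertible: "c \<in> A \<Longrightarrow> d \<in> A \<Longrightarrow> p \<in> fst c \<Longrightarrow> p \<in> fst d \<Longrightarrow> invertible (jac c d (snd c p))"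
proof -
  assume c: "c \<in> A" and d: "d \<in> A" and p: "p \<in> fst c" "p \<in> fst d"
  interpret T: coord_change "g c" "img c" "g d" "img d" "chart_img c (fst d)" "tr c d" "jac c d"
    by (rule coord_change_at[OF c d]) (rule jac_eq)
  show ?thesis using T.J_inv chart_loc.snd_mem_img[OF chart_at[OF c] p(1), of "fst d"] p by blast
qed

lemma metric_inner_transform:
  assumes c: "c \<in> A" and d: "d \<in> A" and p: "p \<in> fst c" "p \<in> fst d"
  shows "metric_inner (g d) (snd d p) (jac c d (snd c p) *v v) (jac c d (snd c p) *v w) = metric_inner (g c) (snd c p) v w"
proof -
  interpret T: coord_change "g c" "img c" "g d" "img d" "chart_img c (fst d)" "tr c d" "jac c d"
    by (rule coord_change_at[OF c d]) (rule jac_eq)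
  have "snd c p \<in> chart_img c (fst d)" using chart_loc.snd_mem_img[OF chart_at[OF c] p(1), of "fst d"] p by blast
  from T.inner_trans[OF this] show ?thesis unfolding metric_inner_def tr_snd[OF c p(1)] by simp
qed

text \<open>The first of the three fields, written with \<open>T\<close> because \<open>T\<close>,
  unlike \<open>nab\<close> of the gradient, makes sense at boundary points too.\<close>

definition "Y1 c x = T c x *v X c x - trace (T c x) *\<^sub>R X c x"
definition "Ric c x = X c x \<bullet> (ricci (g c) x *v X c x)"
definition "TT c x = trace (T c x ** T c x)"

lemma T_transform:
  assumes c: "c \<in> A" and d: "d \<in> A" and p: "p \<in> fst c" "p \<in> fst d" "p \<in> \<Omega>"
  shows "T d (snd d p) ** jac c d (snd c p) = jac c d (snd c p) ** T c (snd c p)"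
proof -
  have "nab (g d) (X d) (snd d p) ** jac c d (snd c p) = jac c d (snd c p) ** nab (g c) (X c) (snd c p)"
    by (rule nab_transform_\<Omega>[OF c d p X_transform[OF c d] diff_X_vec])
  then show ?thesis unfolding nab_X[OF c snd_Dm[OF c p(1,3)]] nab_X[OF d snd_Dm[OF d p(2,3)]] .
qed

lemma trace_T_transform:
  assumes "c \<in> A" "d \<in> A" "p \<in> fst c" "p \<in> fst d" "p \<in> \<Omega>"
  shows "trace (T d (snd d p)) = trace (T c (snd c p))" "TT d (snd d p) = TT c (snd c p)"
  unfolding TT_def
  by (rule trace_similar[OF T_transform[OF assms] jac_invertible[OF assms(1-4)]],
      rule trace_similar[OF intertwine_mult[OF T_transform[OF assms] T_transform[OF assms]] jac_invertible[OF assms(1-4)]])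

lemma Y1_bochner:
  assumes c: "c \<in> A"
  shows "\<And>x. x \<in> Dm c \<Longrightarrow> trace (nab (g c) (Y1 c) x) = TT c x - (trace (T c x))\<^sup>2 + Ric c x"
    and "\<And>k. Ck_on 1 (Dm c) (\<lambda>y. Y1 c y $ k)"
proof -
  interpret M: coord_metric "g c" "img c" by (rule coord_metric_at[OF c])
  let ?Y = "\<lambda>y. nab (g c) (X c) y *v X c y - trace (nab (g c) (X c) y) *\<^sub>R X c y"
  have Y: "Y1 c y = ?Y y" if "y \<in> Dm c" for y unfolding Y1_def nab_X[OF c that] ..
  note bo = M.bochner[OF open_Dm[OF c] Dm_img[OF c] _ C2_X[OF c]]
  show "trace (nab (g c) (Y1 c) x) = TT c x - (trace (T c x))\<^sup>2 + Ric c x" if x: "x \<in> Dm c" for x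
    using bo(1)[OF x] nab_cong[OF open_Dm[OF c] x Y, where G = "g c"] unfolding nab_X[OF c x] TT_def Ric_def by simp
  \<comment> \<open>The regularity part of \<open>bochner\<close> presupposes a point of the domain,
    so an empty chart image is treated apart.\<close>
  show "Ck_on 1 (Dm c) (\<lambda>y. Y1 c y $ k)" for k
  proof (cases "Dm c = {}")
    case True
    then show ?thesis by (simp add: differentiable_on_def)
  next
    case False
    then obtain x where "x \<in> Dm c" by blast
    from bo(2)[OF this, of k] show ?thesis
      using Ck_on_cong[OF open_Dm[OF c], of "\<lambda>y. Y1 c y $ k" "\<lambda>y. ?Y y $ k" 1] Y by simp
  qed
qed

lemma Y1_transform:
  assumes c: "c \<in> A" and d: "d \<in> A" and p: "p \<in> fst c" "p \<in> fst d" "p \<in> \<Omega>"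
  shows "Y1 d (snd d p) = jac c d (snd c p) *v Y1 c (snd c p)"
proof -
  have "T d (snd d p) *v (jac c d (snd c p) *v X c (snd c p)) = jac c d (snd c p) *v (T c (snd c p) *v X c (snd c p))"
    by (simp only: matrix_vector_mul_assoc T_transform[OF assms])
  then show ?thesis
    unfolding Y1_def X_transform[OF assms] trace_T_transform(1)[OF assms]
    by (simp only: matrix_vector_mult_diff_distrib matrix_vector_mult_scaleR)
qed

lemma diff_Y1: "c \<in> A \<Longrightarrow> x \<in> Dm c \<Longrightarrow> Y1 c differentiable at x"
  by (rule vec_differentiableI) (rule Ck_on_1_differentiable[OF open_Dm Y1_bochner(2)])

text \<open>By the Bochner formula \<open>Ric(\<nabla>u,\<nabla>u)\<close> is a combination of traces of covariant derivatives,
  hence independent of the chart.\<close>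

lemma Ric_transform:
  assumes c: "c \<in> A" and d: "d \<in> A" and p: "p \<in> fst c" "p \<in> fst d" "p \<in> \<Omega>"
  shows "Ric d (snd d p) = Ric c (snd c p)"
proof -
  have "trace (nab (g d) (Y1 d) (snd d p)) = trace (nab (g c) (Y1 c) (snd c p))"
    by (rule trace_similar[OF nab_transform_\<Omega>[OF c d p Y1_transform[OF c d] diff_Y1] jac_invertible[OF c d p(1,2)]])
  then show ?thesis
    unfolding Y1_bochner(1)[OF c snd_Dm[OF c p(1,3)]] Y1_bochner(1)[OF d snd_Dm[OF d p(2,3)]] trace_T_transform[OF assms] by simp
qed

lemma Lap_eq:
  assumes c: "c \<in> A" and p: "p \<in> fst c" "p \<in> \<Omega>"
  shows "Lap A g \<Omega> u p = trace (T c (snd c p))"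
proof -
  have e: "laplacian (g d) (Dm d) (uc d) (snd d p) = trace (T d (snd d p))" if "d \<in> A" "p \<in> fst d" for d
    unfolding coord_metric.laplacian_eq_trace[OF coord_metric_at[OF that(1)]] T_interior[OF that(1) snd_Dm[OF that p(2)]] ..
  show ?thesis unfolding Lap_def e[OF c p(1), symmetric]
    by (rule scalar_eq[OF _ c p(1)]) (simp only: e[OF c p(1)] e trace_T_transform(1)[OF c _ p(1) _ p(2)])
qed

lemma grad_norm2_eq:
  assumes c: "c \<in> A" and p: "p \<in> fst c" "p \<in> \<Omega>"
  shows "grad_norm2 A g \<Omega> u p = metric_inner (g c) (snd c p) (X c (snd c p)) (X c (snd c p))"
proof -
  let ?F = "\<lambda>c x. let X = gradient (g c) (Dm c) (uc c) x in metric_inner (g c) x X X"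
  have e: "?F d (snd d p) = metric_inner (g d) (snd d p) (X d (snd d p)) (X d (snd d p))" if "d \<in> A" "p \<in> fst d" for d
    unfolding X_interior[OF that(1) snd_Dm[OF that p(2)]] Let_def ..
  have "scalar A ?F p = ?F c (snd c p)"
  proof (rule scalar_eq[OF _ c p(1)])
    fix d assume d: "d \<in> A" "p \<in> fst d"
    show "?F d (snd d p) = ?F c (snd c p)"
      unfolding e[OF c p(1)] e[OF d] X_transform[OF c d(1) p(1) d(2) p(2)] by (rule metric_inner_transform[OF c d(1) p(1) d(2)])
  qed
  then show ?thesis unfolding grad_norm2_def e[OF c p(1)] .
qed

lemma tracefree_eq:
  assumes c: "c \<in> A" and p: "p \<in> fst c" "p \<in> \<Omega>"
  shows "tracefree_hessian_norm2 A g \<Omega> u p = TT c (snd c p) - (trace (T c (snd c p)))\<^sup>2 / real CARD('n)"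
    and "tracefree_hessian_norm2 A g \<Omega> u p \<ge> 0"
proof -
  let ?F = "\<lambda>c x. metric_norm2 (g c) x (tracefree_hessian (g c) (Dm c) (uc c) x)"
  have e: "?F d (snd d p) = TT d (snd d p) - (trace (T d (snd d p)))\<^sup>2 / real CARD('n)" if "d \<in> A" "p \<in> fst d" for d
    using coord_metric.tracefree_norm2[OF coord_metric_at[OF that(1)] open_Dm Dm_img uc2_Dm snd_Dm[OF that p(2)]] that(1)
    unfolding TT_def T_interior[OF that(1) snd_Dm[OF that p(2)]] by blast
  have s: "scalar A ?F p = ?F c (snd c p)"
    by (rule scalar_eq[OF _ c p(1)]) (simp only: e[OF c p(1)] e trace_T_transform[OF c _ p(1) _ p(2)])
  show "tracefree_hessian_norm2 A g \<Omega> u p = TT c (snd c p) - (trace (T c (snd c p)))\<^sup>2 / real CARD('n)"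
    unfolding tracefree_hessian_norm2_def s e[OF c p(1)] ..
  show "tracefree_hessian_norm2 A g \<Omega> u p \<ge> 0"
    unfolding tracefree_hessian_norm2_def s
    by (rule coord_metric.metric_norm2_nonneg[OF coord_metric_at[OF c]]) (use Dm_img[OF c] snd_Dm[OF c p] in blast)
qed

lemma ricci_minus_grad_eq:
  assumes c: "c \<in> A" and p: "p \<in> fst c" "p \<in> \<Omega>"
  shows "ricci_minus_grad A g \<kappa> \<Omega> u p = Ric c (snd c p) - \<kappa> * grad_norm2 A g \<Omega> u p"
proof -
  let ?F = "\<lambda>c x. let X = gradient (g c) (Dm c) (uc c) x in X \<bullet> ((ricci (g c) x - \<kappa> *\<^sub>R g c x) *v X)"
  have e: "?F d (snd d p) = Ric d (snd d p) - \<kappa> * grad_norm2 A g \<Omega> u p" if "d \<in> A" "p \<in> fst d" for d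
    unfolding grad_norm2_eq[OF that p(2)] X_interior[OF that(1) snd_Dm[OF that p(2)]] Let_def Ric_def metric_inner_def
    by (simp add: matrix_vector_mult_diff_rdistrib inner_diff_right scaleR_matrix_vector_assoc[symmetric] X_interior[OF that(1) snd_Dm[OF that p(2)]])
  have s: "scalar A ?F p = ?F c (snd c p)"
    by (rule scalar_eq[OF _ c p(1)]) (simp only: e[OF c p(1)] e Ric_transform[OF c _ p(1) _ p(2)])
  show ?thesis unfolding ricci_minus_grad_def s e[OF c p(1)] ..
qed

end

context riem_fun begin

text \<open>By density: both sides are continuous up to the boundary, so a failure at
  \<open>p\<close> would persist on a relative neighbourhood, and that meets \<Omega>, where the law
  is known.\<close>

lemma X_transform_closure:
  assumes c: "c \<in> A" and d: "d \<in> A" and p: "p \<in> fst c" "p \<in> fst d" "p \<in> closure \<Omega>"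
  shows "X d (snd d p) = jac c d (snd c p) *v X c (snd c p)"
proof (rule ccontr)
  assume ne: "X d (snd d p) \<noteq> jac c d (snd c p) *v X c (snd c p)"
  interpret L: chart_loc c by (rule chart_at[OF c])
  interpret T: coord_change "g c" "img c" "g d" "img d" "chart_img c (fst d)" "tr c d" "jac c d"
    by (rule coord_change_at[OF c d]) (rule jac_eq)
  let ?S = "Dc c \<inter> chart_img c (fst d)"
  define e where "e x = X d (tr c d x) - jac c d x *v X c x" for x
  have "continuous_on ?S e"
  proof -
    have tr: "continuous_on ?S (tr c d)" by (rule continuous_on_subset[OF Ck_on_continuous[OF T.\<tau>]]) simp
    have sub: "tr c d ` ?S \<subseteq> Dc d"
    proof
      fix z assume "z \<in> tr c d ` ?S"
      then obtain x where x: "x \<in> Dc c" "x \<in> chart_img c (fst d)" "z = tr c d x" by blast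
      show "z \<in> Dc d" using chart_loc.snd_mem_img[OF chart_at[OF d] mem_imgD(2)[OF c x(2)], of "closure \<Omega>"] mem_imgD(2)[OF c x(1)] x(3) by simp
    qed
    have 1: "continuous_on ?S (\<lambda>x. X d (tr c d x))" by (rule continuous_on_compose2[OF cont_X[OF d] tr sub])
    have J: "continuous_on ?S (\<lambda>x. jac c d x $ i $ k)" for i k
      by (rule continuous_on_subset[OF Ck_on_continuous[OF T.Ck_J]]) simp
    have X: "continuous_on ?S (X c)" by (rule continuous_on_subset[OF cont_X[OF c]]) simp
    have "continuous_on ?S (\<lambda>x. \<chi> i. \<Sum>k\<in>UNIV. jac c d x $ i $ k * X c x $ k)"
      by (intro continuous_on_vec_lambda continuous_intros J X)
    then have 2: "continuous_on ?S (\<lambda>x. jac c d x *v X c x)" unfolding matrix_vector_mult_def .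
    show ?thesis unfolding e_def[abs_def] by (rule continuous_on_diff[OF 1 2])
  qed
  then have "openin (top_of_set ?S) (?S \<inter> e -` (- {0}))"
    by (rule continuous_openin_preimage_gen) (simp add: open_Compl)
  then obtain V where V: "open V" "?S \<inter> e -` (- {0}) = ?S \<inter> V" unfolding openin_open by blast
  have xS: "snd c p \<in> ?S" using L.snd_mem_img[OF p(1), of "fst d"] L.snd_mem_img[OF p(1), of "closure \<Omega>"] p by blast
  have "e (snd c p) \<noteq> 0" using ne tr_snd[OF c p(1), of d] by (simp add: e_def)
  then have xV: "snd c p \<in> V" using xS V(2) by blast
  let ?U = "{q \<in> fst c. snd c q \<in> V} \<inter> fst d"
  have "open ?U" using L.open_chart_preimage[OF V(1)] chart_loc.open_dom[OF chart_at[OF d]] by blast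
  moreover have "p \<in> ?U" using p xV by blast
  ultimately have "?U \<inter> \<Omega> \<noteq> {}" using p(3) open_Int_closure_eq_empty by blast
  then obtain q where q: "q \<in> fst c" "snd c q \<in> V" "q \<in> fst d" "q \<in> \<Omega>" by blast
  have "snd c q \<in> ?S"
    using L.snd_mem_img[OF q(1), of "fst d"] L.snd_mem_img[OF q(1), of "closure \<Omega>"] q closure_subset by blast
  then have "e (snd c q) \<noteq> 0" using V(2) q(2) by blast
  then show False using X_transform[OF c d q(1,3,4)] tr_snd[OF c q(1), of d] by (simp add: e_def)
qed

abbreviation "H \<equiv> mean_curvature A g \<Omega>"
abbreviation "u\<eta> \<equiv> normal_derivative A g \<Omega> u"
abbreviation "lap \<equiv> Lap A g \<Omega> u"
abbreviation "gn \<equiv> grad_norm2 A g \<Omega> u"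
abbreviation "tf \<equiv> tracefree_hessian_norm2 A g \<Omega> u"
abbreviation "rmg \<kappa> \<equiv> ricci_minus_grad A g \<kappa> \<Omega> u"

lemma normal_derivative_eq:
  assumes c: "c \<in> A" and p: "p \<in> fst c" "p \<in> B"
  shows "u\<eta> p = metric_inner (g c) (snd c p) (X c (snd c p)) (nrm c (snd c p))"
  unfolding normal_derivative_def X_def[symmetric]
proof (rule scalar_eq[OF _ c p(1)])
  fix d assume d: "d \<in> A" "p \<in> fst d"
  have pc: "p \<in> closure \<Omega>" using p(2) B_def' by blast
  show "metric_inner (g d) (snd d p) (X d (snd d p)) (nrm d (snd d p))
    = metric_inner (g c) (snd c p) (X c (snd c p)) (nrm c (snd c p))"
    unfolding X_transform_closure[OF c d(1) p(1) d(2) pc] normal_transform[OF c d(1) p(2,1) d(2)]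
    by (rule metric_inner_transform[OF c d(1) p(1) d(2)])
qed

lemma cont_metric_inner:
  assumes c: "c \<in> A" and S: "S \<subseteq> img c" and v: "continuous_on S v" and w: "continuous_on S w"
  shows "continuous_on S (\<lambda>x. metric_inner (g c) x (v x) (w x))"
proof -
  have G: "continuous_on S (\<lambda>x. g c x $ i $ k)" for i k
    by (rule continuous_on_subset[OF Ck_on_continuous[OF coord_metric.Ck_G[OF coord_metric_at[OF c]]] S])
  have "continuous_on S (\<lambda>x. v x $ i)" "continuous_on S (\<lambda>x. w x $ i)" for i
    by (intro continuous_on_component v w)+
  then show ?thesis
    unfolding metric_inner_def inner_vec_def matrix_vector_mult_def vec_lambda_beta inner_real_def
    by (intro continuous_on_sum continuous_on_mult G)
qed

lemma continuous_on_H: "continuous_on B H" and continuous_on_u\<eta>: "continuous_on B u\<eta>"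
proof -
  have "\<exists>c\<in>A. \<exists>Q F F'. p \<in> fst c \<and> open Q \<and> snd c p \<in> Q \<and>
     continuous_on (Q \<inter> chart_img c B) F \<and> (\<forall>q\<in>B \<inter> fst c. snd c q \<in> Q \<longrightarrow> H q = F (snd c q)) \<and>
     continuous_on (Q \<inter> chart_img c B) F' \<and> (\<forall>q\<in>B \<inter> fst c. snd c q \<in> Q \<longrightarrow> u\<eta> q = F' (snd c q))" if p: "p \<in> B" for p
  proof -
    obtain c where c: "c \<in> A" "p \<in> fst c" using cover by blast
    obtain Q j \<iota> W h s where b: "bpatch c Q j \<iota> W h s" and Q: "snd c p \<in> Q"
      using bpatch_exists[OF p c open_UNIV] by blast
    interpret P: boundary_patch "g c" "img c" "chart_img c \<Omega>" Q j \<iota> W h s by (rule bpatchD(2)[OF b])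
    have 1: "continuous_on (Q \<inter> chart_img c B) (\<lambda>z. trace (nab (g c) P.N z ** P.proj z))"
      by (rule continuous_on_subset[OF P.continuous_on_trace_shape]) simp
    have "chart_img c B \<subseteq> Dc c" by (rule chart_loc.img_mono[OF chart_at[OF c(1)]]) (use B_def' in blast)
    then have 2: "continuous_on (Q \<inter> chart_img c B) (\<lambda>z. metric_inner (g c) z (X c z) (P.N z))"
      by (intro cont_metric_inner[OF c(1)] continuous_on_subset[OF cont_X[OF c(1)]] continuous_on_subset[OF P.cont_N]) (use P.QS in auto)
    have 3: "\<forall>q\<in>B \<inter> fst c. snd c q \<in> Q \<longrightarrow> H q = (\<lambda>z. trace (nab (g c) P.N z ** P.proj z)) (snd c q)"
      using mean_curvature_patch[OF b] by blast
    have 4: "\<forall>q\<in>B \<inter> fst c. snd c q \<in> Q \<longrightarrow> u\<eta> q = (\<lambda>z. metric_inner (g c) z (X c z) (P.N z)) (snd c q)"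
      using normal_derivative_eq[OF c(1)] bpatch_normal(2)[OF b] by auto
    show ?thesis using c(2) P.open_Q Q 1 2 3 4 by (intro bexI[OF _ c(1)] exI conjI)
  qed
  then show "continuous_on B H" "continuous_on B u\<eta>"
    by (intro continuous_on_if_in_charts; meson)+
qed

text \<open>Enough for integrability, because \<Omega> has finite volume, and stable under
  arithmetic. The scalar quantities are built from derivatives within \<Omega>, hence boundedness is
  asked for instead of continuity on the closure.\<close>

definition "bdd_cont \<phi> \<longleftrightarrow> continuous_on \<Omega> \<phi> \<and> bounded (\<phi> ` \<Omega>)" for \<phi> :: "'a \<Rightarrow> real"

lemma bdd_cont_integrable: "bdd_cont \<phi> \<Longrightarrow> set_integrable vol \<Omega> \<phi>"
  unfolding bdd_cont_def using integrable_vol by blast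

lemma bdd_cont_compose: "bdd_cont \<phi> \<Longrightarrow> continuous_on UNIV h \<Longrightarrow> bdd_cont (\<lambda>p. h (\<phi> p))" for h :: "real \<Rightarrow> real"
proof -
  assume a: "bdd_cont \<phi>" and h: "continuous_on UNIV h"
  have "bounded (h ` closure (\<phi> ` \<Omega>))"
    by (intro compact_imp_bounded compact_continuous_image continuous_on_subset[OF h]) (use a in \<open>auto simp: bdd_cont_def compact_closure\<close>)
  then have "bounded ((\<lambda>p. h (\<phi> p)) ` \<Omega>)"
    by (rule bounded_subset) (use closure_subset[of "\<phi> ` \<Omega>"] in blast)
  moreover have "continuous_on \<Omega> (\<lambda>p. h (\<phi> p))"
    using a continuous_on_compose2[OF h] unfolding bdd_cont_def by blast
  ultimately show ?thesis by (simp add: bdd_cont_def)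
qed

lemma bdd_cont_arith:
  assumes "bdd_cont \<phi>" "bdd_cont \<psi>"
  shows "bdd_cont (\<lambda>p. \<phi> p + \<psi> p)" "bdd_cont (\<lambda>p. \<phi> p - \<psi> p)" "bdd_cont (\<lambda>p. \<phi> p * \<psi> p)"
proof -
  obtain a b where ab: "\<And>p. p \<in> \<Omega> \<Longrightarrow> \<bar>\<phi> p\<bar> \<le> a" "\<And>p. p \<in> \<Omega> \<Longrightarrow> \<bar>\<psi> p\<bar> \<le> b"
    using assms unfolding bdd_cont_def bounded_iff by (auto; blast)
  have cont: "continuous_on \<Omega> \<phi>" "continuous_on \<Omega> \<psi>" using assms by (auto simp: bdd_cont_def)
  have "\<bar>\<phi> p + \<psi> p\<bar> \<le> a + b" "\<bar>\<phi> p - \<psi> p\<bar> \<le> a + b" "\<bar>\<phi> p * \<psi> p\<bar> \<le> a * b" if "p \<in> \<Omega>" for p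
    using ab[OF that] unfolding abs_mult by (auto intro: mult_mono)
  then have "bounded ((\<lambda>p. \<phi> p + \<psi> p) ` \<Omega>)" "bounded ((\<lambda>p. \<phi> p - \<psi> p) ` \<Omega>)" "bounded ((\<lambda>p. \<phi> p * \<psi> p) ` \<Omega>)"
    unfolding bounded_iff by (auto; blast)+
  then show "bdd_cont (\<lambda>p. \<phi> p + \<psi> p)" "bdd_cont (\<lambda>p. \<phi> p - \<psi> p)" "bdd_cont (\<lambda>p. \<phi> p * \<psi> p)"
    unfolding bdd_cont_def using cont by (auto intro: continuous_intros)
qed

lemma bdd_cont_const: "bdd_cont (\<lambda>p. a)" by (simp add: bdd_cont_def bounded_iff) blast

lemma bdd_cont_chartsI:
  assumes "\<And>c. c \<in> A \<Longrightarrow> continuous_on (Dc c) (F c)" "\<And>c p. c \<in> A \<Longrightarrow> p \<in> fst c \<Longrightarrow> p \<in> \<Omega> \<Longrightarrow> \<phi> p = F c (snd c p)"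
  shows "bdd_cont \<phi>"
  using continuous_bounded_from_charts[OF assms] by (simp add: bdd_cont_def)

lemma cont_trace_T: "c \<in> A \<Longrightarrow> continuous_on (Dc c) (\<lambda>x. trace (T c x))"
  unfolding trace_def by (intro continuous_intros cont_T)

lemma bdd_cont_scalars: "bdd_cont u" "bdd_cont lap" "bdd_cont gn" "bdd_cont tf" "bdd_cont (rmg \<kappa>)"
proof -
  show "bdd_cont u"
    by (rule bdd_cont_chartsI[of uc, OF Ck_on_continuous[OF uc2]]) (use chart_loc.ci_snd[OF chart_at] in auto)
  show "bdd_cont lap" by (rule bdd_cont_chartsI[OF cont_trace_T Lap_eq])
  show gn: "bdd_cont gn" by (rule bdd_cont_chartsI[OF cont_metric_inner[OF _ Dc_img cont_X cont_X] grad_norm2_eq])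
  have "continuous_on (Dc c) (TT c)" if "c \<in> A" for c
    unfolding TT_def[abs_def] trace_def matrix_matrix_mult_def vec_lambda_beta by (intro continuous_intros cont_T that)
  then show "bdd_cont tf"
    by (intro bdd_cont_chartsI[of "\<lambda>c x. TT c x - (trace (T c x))\<^sup>2 / real CARD('n)"] continuous_intros cont_trace_T tracefree_eq(1)) auto
  have "continuous_on (Dc c) (Ric c)" if c: "c \<in> A" for c
  proof -
    have r: "continuous_on (Dc c) (\<lambda>x. ricci (g c) x $ i $ k)" for i k
      by (rule continuous_on_subset[OF coord_metric.continuous_on_ricci[OF coord_metric_at[OF c]] Dc_img[OF c]])
    have "continuous_on (Dc c) (\<lambda>x. X c x $ i)" for i by (intro continuous_on_component cont_X[OF c])
    then show ?thesis
      unfolding Ric_def[abs_def] inner_vec_def matrix_vector_mult_def vec_lambda_beta inner_real_def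
      by (intro continuous_on_sum continuous_on_mult r)
  qed
  \<comment> \<open>It suffices to treat \<kappa> = 0, where the value is \<open>Ric\<close>; the
    general case subtracts a multiple of the squared gradient.\<close>
  moreover have "rmg 0 p = Ric c (snd c p)" if "c \<in> A" "p \<in> fst c" "p \<in> \<Omega>" for c p
    using ricci_minus_grad_eq[OF that, of 0] by simp
  ultimately have "bdd_cont (rmg 0)" by (rule bdd_cont_chartsI)
  then have a: "bdd_cont (\<lambda>p. rmg 0 p - \<kappa> * gn p)" by (intro bdd_cont_arith bdd_cont_const gn)
  show "bdd_cont (rmg \<kappa>)"
  proof -
    have "rmg \<kappa> p = rmg 0 p - \<kappa> * gn p" if "p \<in> \<Omega>" for p
    proof -
      obtain c where "c \<in> A" "p \<in> fst c" using cover by blast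
      then show ?thesis using ricci_minus_grad_eq[OF _ _ that] by simp
    qed
    then show ?thesis using a unfolding bdd_cont_def by (simp cong: continuous_on_cong image_cong)
  qed
qed

lemma bdd_cont_square: "bdd_cont \<phi> \<Longrightarrow> bdd_cont (\<lambda>p. (\<phi> p)\<^sup>2)"
  using bdd_cont_arith(3)[of \<phi> \<phi>] by (simp add: power2_eq_square)

text \<open>The trace of \<open>T ** T\<close> is rewritten by the trace-free Hessian, which changes
  the coefficient of the squared Laplacian to \<open>1 - 1/n\<close>. The term with \<kappa> is
  split off and added back, so the curvature enters in the form of the statement.\<close>

lemma integral_bochner:
  assumes u0: "\<And>p. p \<in> B \<Longrightarrow> u p = 0"
  shows "(LINT p:\<Omega>|vol. tf p - (1 - 1 / real CARD('n)) * (lap p)\<^sup>2 + (rmg \<kappa> p + \<kappa> * gn p)) = (LINT p:B|\<sigma>. - (H p * (u\<eta> p)\<^sup>2))"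
    (is "(LINT p:\<Omega>|vol. ?\<delta> p) = (LINT p:B|\<sigma>. ?fl p)")
proof (rule divergence_data.divergence_theorem[where Y = Y1], intro divergence_data.intro divergence_data_axioms.intro)
  show "riem_dom TYPE('m) A g \<Omega>" by (rule riem_dom_axioms)
  show "continuous_on (Dc c) (Y1 c)" if c: "c \<in> A" for c
  proof -
    have "continuous_on (Dc c) (\<lambda>x. \<chi> i. \<Sum>k\<in>UNIV. T c x $ i $ k * X c x $ k)"
      by (intro continuous_on_vec_lambda continuous_intros cont_T[OF c] cont_X[OF c])
    then have "continuous_on (Dc c) (\<lambda>x. T c x *v X c x)" unfolding matrix_vector_mult_def .
    then show ?thesis unfolding Y1_def[abs_def] by (intro continuous_intros cont_trace_T[OF c] cont_X[OF c])
  qed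
  show "trace (nab (g c) (Y1 c) (snd c p)) = ?\<delta> p" if cp: "c \<in> A" "p \<in> fst c" "p \<in> \<Omega>" for c p
    unfolding Y1_bochner(1)[OF cp(1) snd_Dm[OF cp]] tracefree_eq(1)[OF cp] Lap_eq[OF cp] ricci_minus_grad_eq[OF cp]
    by (simp add: algebra_simps)
  have bdd_cont: "bdd_cont ?\<delta>" by (intro bdd_cont_arith bdd_cont_const bdd_cont_square bdd_cont_scalars)
  then show "continuous_on \<Omega> ?\<delta>" "bounded (?\<delta> ` \<Omega>)" by (auto simp: bdd_cont_def)
  show "continuous_on B ?fl" by (intro continuous_intros continuous_on_H continuous_on_u\<eta>)
  show "metric_inner (g c) (snd c p) (Y1 c (snd c p)) (nrm c (snd c p)) = ?fl p"
    if cp: "c \<in> A" "p \<in> fst c" "p \<in> B" for c p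
  proof -
    obtain Q j \<iota> W h s where b: "bpatch c Q j \<iota> W h s" and Q: "snd c p \<in> Q"
      using bpatch_exists[OF cp(3,1,2) open_UNIV] by blast
    interpret P: boundary_patch "g c" "img c" "chart_img c \<Omega>" Q j \<iota> W h s by (rule bpatchD(2)[OF b])
    note n = bpatch_normal[OF b cp(3,2) Q]
    have par0: "uc c (ins j \<iota> (h y) y) = 0" if y: "y \<in> W" for y
    proof -
      have "ins j \<iota> (h y) y \<in> chart_img c B" using bpatch_closure(2)[OF b P.par_Q[OF y]] by simp
      then show ?thesis using mem_imgD(2)[OF cp(1)] u0 by simp
    qed
    show ?thesis
      using P.boundary_flux[OF Dc_img[OF cp(1)] bpatch_closure(1)[OF b] uc2[OF cp(1)] par0 Q n(1)]
      unfolding normal_derivative_eq[OF cp] mean_curvature_patch[OF b cp(3,2) Q] n(2) Y1_def T_def X_def by (simp only: minus_mult_left)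
  qed
  show "Ck_on 1 (Dm c) (\<lambda>x. Y1 c x $ k)" if "c \<in> A" for c k by (rule Y1_bochner(2)[OF that])
  show "Y1 d (snd d p) = jac c d (snd c p) *v Y1 c (snd c p)"
    if "c \<in> A" "d \<in> A" "p \<in> fst c" "p \<in> fst d" "p \<in> \<Omega>" for c d p by (rule Y1_transform[OF that])
qed

text \<open>Serves both remaining fields: the constant function 1 gives the flux of the gradient,
  and the nonlinearity itself gives the energy identity. On the boundary \<open>f (u p)\<close> is
  the constant \<open>f 0\<close>.\<close>

lemma integral_compose_gradient:
  assumes u0: "\<And>p. p \<in> B \<Longrightarrow> u p = 0"
    and f: "\<And>t. (f has_real_derivative f' t) (at t)" "continuous_on UNIV f'"
  shows "(LINT p:\<Omega>|vol. f' (u p) * gn p + f (u p) * lap p) = (LINT p:B|\<sigma>. f 0 * u\<eta> p)"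
    (is "(LINT p:\<Omega>|vol. ?\<delta> p) = (LINT p:B|\<sigma>. ?fl p)")
proof (rule divergence_data.divergence_theorem[where Y = "\<lambda>c x. f (uc c x) *\<^sub>R X c x"], intro divergence_data.intro divergence_data_axioms.intro)
  have cf: "continuous_on UNIV f" using f(1) by (meson DERIV_continuous_on has_field_derivative_at_within)
  show "riem_dom TYPE('m) A g \<Omega>" by (rule riem_dom_axioms)
  show "continuous_on (Dc c) (\<lambda>x. f (uc c x) *\<^sub>R X c x)" if c: "c \<in> A" for c
    by (intro continuous_intros cont_X[OF c] continuous_on_compose2[OF cf Ck_on_continuous[OF uc2[OF c]]]) auto
  have f1: "Ck_on 1 (Dm c) (\<lambda>x. f (uc c x))" if c: "c \<in> A" for c
    by (rule Ck_on_1_real_compose[OF open_Dm[OF c] Ck_on_mono[OF uc3[OF c]] f(1) continuous_on_subset[OF f(2)]]) auto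
  show "Ck_on 1 (Dm c) (\<lambda>x. (f (uc c x) *\<^sub>R X c x) $ k)" if c: "c \<in> A" for c k
    using Ck_on_mult[OF open_Dm[OF c] f1[OF c] Ck_on_mono[OF C2_X[OF c]], of k] by simp
  show "f (uc d (snd d p)) *\<^sub>R X d (snd d p) = jac c d (snd c p) *v (f (uc c (snd c p)) *\<^sub>R X c (snd c p))"
    if "c \<in> A" "d \<in> A" "p \<in> fst c" "p \<in> fst d" "p \<in> \<Omega>" for c d p
    unfolding X_transform[OF that] matrix_vector_mult_scaleR
    using chart_loc.ci_snd[OF chart_at[OF that(1)] that(3)] chart_loc.ci_snd[OF chart_at[OF that(2)] that(4)] by simp
  show "trace (nab (g c) (\<lambda>x. f (uc c x) *\<^sub>R X c x) (snd c p)) = ?\<delta> p" if cp: "c \<in> A" "p \<in> fst c" "p \<in> \<Omega>" for c p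
  proof -
    let ?x = "snd c p"
    note x = snd_Dm[OF cp]
    have up: "uc c ?x = u p" using chart_loc.ci_snd[OF chart_at[OF cp(1)] cp(2)] by simp
    have "trace (nab (g c) (\<lambda>x. f (uc c x) *\<^sub>R X c x) ?x)
        = f (uc c ?x) * trace (T c ?x) + (\<Sum>k\<in>UNIV. partial UNIV k (\<lambda>x. f (uc c x)) ?x * X c ?x $ k)"
      unfolding nab_X[OF cp(1) x, symmetric]
      by (rule nab_scale[OF Ck_on_1_differentiable[OF open_Dm[OF cp(1)] f1[OF cp(1)] x] diff_X[OF cp(1) x]])
    also have "(\<Sum>k\<in>UNIV. partial UNIV k (\<lambda>x. f (uc c x)) ?x * X c ?x $ k) = f' (uc c ?x) * (X c ?x \<bullet> (\<chi> k. partial UNIV k (uc c) ?x))"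
      unfolding partial_real_compose[OF uc_diff[OF cp(1) x] f(1)] by (simp add: inner_vec_def sum_distrib_left mult_ac)
    also have "(\<chi> k. partial UNIV k (uc c) ?x) = g c ?x *v X c ?x"
    proof -
      have "?x \<in> img c" using x Dm_img[OF cp(1)] by blast
      then show ?thesis
        by (simp add: X_lower[OF cp(1)] partial_interior[OF open_Dm[OF cp(1)] Dm_Dc[OF cp(1)] x] partial_open[OF open_Dm[OF cp(1)] x])
    qed
    finally show ?thesis unfolding up Lap_eq[OF cp] grad_norm2_eq[OF cp] metric_inner_def by simp
  qed
  have bdd_cont: "bdd_cont ?\<delta>" by (intro bdd_cont_arith bdd_cont_scalars bdd_cont_compose[OF bdd_cont_scalars(1)] cf f(2))
  then show "continuous_on \<Omega> ?\<delta>" "bounded (?\<delta> ` \<Omega>)" by (auto simp: bdd_cont_def)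
  show "continuous_on B ?fl" by (intro continuous_intros continuous_on_u\<eta>)
  show "metric_inner (g c) (snd c p) (f (uc c (snd c p)) *\<^sub>R X c (snd c p)) (nrm c (snd c p)) = ?fl p"
    if cp: "c \<in> A" "p \<in> fst c" "p \<in> B" for c p
    using u0[OF cp(3)] chart_loc.ci_snd[OF chart_at[OF cp(1)] cp(2)]
    unfolding normal_derivative_eq[OF cp] by (simp add: metric_inner_def)
qed

lemma scalar_nonneg:
  assumes "p \<in> \<Omega>" shows "tf p \<ge> 0" "ricci_ge A g \<kappa> \<Omega> \<Longrightarrow> rmg \<kappa> p \<ge> 0"
proof -
  obtain c where c: "c \<in> A" "p \<in> fst c" using cover by blast
  show "tf p \<ge> 0" by (rule tracefree_eq(2)[OF c assms])
  assume "ricci_ge A g \<kappa> \<Omega>"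
  then have "Ric c (snd c p) \<ge> \<kappa> * metric_inner (g c) (snd c p) (X c (snd c p)) (X c (snd c p))"
    using c snd_Dm[OF c assms] unfolding ricci_ge_def Ric_def by blast
  then show "rmg \<kappa> p \<ge> 0" unfolding ricci_minus_grad_eq[OF c assms] grad_norm2_eq[OF c assms] by simp
qed

end

section \<open>The integral identity\<close>

theorem lemma5p2:
  fixes A :: "('a::{t2_space, second_countable_topology}, 'n::finite) chart set"
    and g :: "('a, 'n) chart \<Rightarrow> real^'n \<Rightarrow> real^'n^'n"
    and \<Omega> :: "'a set"
    and f :: "real \<Rightarrow> real"
    and u :: "'a \<Rightarrow> real"
    and k n c E :: real
    and H u\<eta> :: "'a \<Rightarrow> real"
    and d\<Omega> d\<sigma> :: "'a measure"
  assumes dim: "CARD('n) \<ge> 2" "n = real CARD('n)"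
    and dim_boundary: "CARD('n) = CARD('m::finite) + 1"
    and manifold: "smooth_atlas A" "connected (UNIV :: 'a set)" "riemannian_metric A g"
    and domain: "open \<Omega>" "connected \<Omega>" "\<Omega> \<noteq> {}" "compact (closure \<Omega>)" "C2_boundary A \<Omega>"
    and f_C1: "f C1_differentiable_on UNIV"
    and u_reg: "Ck_manifold_on A 3 \<Omega> u" "Ck_manifold_on A 2 (closure \<Omega>) u"
    and u_pos: "\<And>p. p \<in> \<Omega> \<Longrightarrow> u p > 0"
    and u_eq: "\<And>p. p \<in> \<Omega> \<Longrightarrow> Lap A g \<Omega> u p = - f (u p)"
    and u_bdry: "\<And>p. p \<in> frontier \<Omega> \<Longrightarrow> u p = 0"
    and d\<Omega>: "d\<Omega> = volume_measure A g"
    and d\<sigma>: "d\<sigma> = submanifold_measure TYPE('m) A g (frontier \<Omega>)"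
    and H: "H = mean_curvature A g \<Omega>"
    and u\<eta>: "u\<eta> = normal_derivative A g \<Omega> u"
    and H_pos: "\<And>p. p \<in> frontier \<Omega> \<Longrightarrow> H p > 0"
    and E: "E = (LINT p:\<Omega>|d\<Omega>. (deriv f (u p) - n * k) * grad_norm2 A g \<Omega> u p)"
    and c: "c = (n - 1) / n"
  shows "(c * (c * (f 0)\<^sup>2 * (LINT p:frontier \<Omega>|d\<sigma>. 1 / H p)
              - f 0 * (LINT p:\<Omega>|d\<Omega>. f (u p)) + E)
         = (LINT p:\<Omega>|d\<Omega>. tracefree_hessian_norm2 A g \<Omega> u p)
           + (LINT p:\<Omega>|d\<Omega>. ricci_minus_grad A g ((n - 1) * k) \<Omega> u p)
           + (LINT p:frontier \<Omega>|d\<sigma>. (H p * u\<eta> p + c * f 0)\<^sup>2 / H p))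
       \<and> (ricci_ge A g ((n - 1) * k) \<Omega> \<longrightarrow>
         (n - 1) / n * (f 0)\<^sup>2 * (LINT p:frontier \<Omega>|d\<sigma>. 1 / H p)
           \<ge> f 0 * (LINT p:\<Omega>|d\<Omega>. f (u p)) - E)"
proof -
  interpret R: riem_fun A g \<Omega> "TYPE('m)" u
    by unfold_locales (use manifold dim_boundary domain u_reg in auto)
  let ?vol = "volume_measure A g" and ?\<sigma> = "submanifold_measure TYPE('m) A g (frontier \<Omega>)"
  have m\<Omega>: "\<Omega> \<in> sets ?vol" and mB: "frontier \<Omega> \<in> sets ?\<sigma>"
    using domain(1) by (simp_all add: borel_closed)
  obtain f' where "\<And>t. (f has_vector_derivative f' t) (at t)" and f'c: "continuous_on UNIV f'"
    using f_C1 unfolding C1_differentiable_on_def by blast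
  then have fd: "(f has_real_derivative f' t) (at t)" for t
    by (simp add: has_real_derivative_iff_has_vector_derivative)
  have df: "deriv f t = f' t" for t by (rule DERIV_imp_deriv[OF fd])
  have fc: "continuous_on UNIV f" using fd by (meson DERIV_continuous_on has_field_derivative_at_within)
  note cbs = R.bdd_cont_scalars and int\<Omega> = R.bdd_cont_integrable and int\<sigma> = R.integrable_\<sigma>
  have n: "n \<ge> 2" using dim by simp
  define \<kappa> where "\<kappa> = (n - 1) * k"
  have lap: "R.lap p = - f (u p)" if "p \<in> \<Omega>" for p by (rule u_eq[OF that])
  have H0: "H p \<noteq> 0" if "p \<in> frontier \<Omega>" for p using H_pos[OF that] by simp
  have cH: "continuous_on (frontier \<Omega>) H" and cu: "continuous_on (frontier \<Omega>) u\<eta>"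
    unfolding H u\<eta> by (rule R.continuous_on_H R.continuous_on_u\<eta>)+
  define I where "I \<phi> = (LINT p:\<Omega>|?vol. \<phi> p)" for \<phi> :: "'a \<Rightarrow> real"
  define J where "J \<phi> = (LINT p:frontier \<Omega>|?\<sigma>. \<phi> p)" for \<phi> :: "'a \<Rightarrow> real"
  have I_cong: "I \<phi> = I \<psi>" if "\<And>p. p \<in> \<Omega> \<Longrightarrow> \<phi> p = \<psi> p" for \<phi> \<psi>
    unfolding I_def by (rule set_lebesgue_integral_cong[OF m\<Omega>]) (use that in blast)
  have J_cong: "J \<phi> = J \<psi>" if "\<And>p. p \<in> frontier \<Omega> \<Longrightarrow> \<phi> p = \<psi> p" for \<phi> \<psi>
    unfolding J_def by (rule set_lebesgue_integral_cong[OF mB]) (use that in blast)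
  have I_add: "I (\<lambda>p. \<phi> p + \<psi> p) = I \<phi> + I \<psi>" and I_diff: "I (\<lambda>p. \<phi> p - \<psi> p) = I \<phi> - I \<psi>"
    if "R.bdd_cont \<phi>" "R.bdd_cont \<psi>" for \<phi> \<psi>
    unfolding I_def using int\<Omega>[OF that(1)] int\<Omega>[OF that(2)] by (simp_all add: set_integral_add set_integral_diff)
  have I_mult: "I (\<lambda>p. a * \<phi> p) = a * I \<phi>" for a \<phi> unfolding I_def by simp
  have J_add: "J (\<lambda>p. \<phi> p + \<psi> p) = J \<phi> + J \<psi>"
    if "continuous_on (frontier \<Omega>) \<phi>" "continuous_on (frontier \<Omega>) \<psi>" for \<phi> \<psi>
    unfolding J_def using int\<sigma>[OF that(1)] int\<sigma>[OF that(2)] by (simp add: set_integral_add)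
  have J_mult: "J (\<lambda>p. a * \<phi> p) = a * J \<phi>" for a \<phi> unfolding J_def by simp
  have cbf: "R.bdd_cont (\<lambda>p. f (u p))" "R.bdd_cont (\<lambda>p. f' (u p))" "R.bdd_cont (\<lambda>p. (f (u p))\<^sup>2)"
    by (intro R.bdd_cont_square R.bdd_cont_compose[OF cbs(1)] fc f'c)+
  have cbg: "R.bdd_cont (\<lambda>p. f' (u p) * R.gn p)" by (intro R.bdd_cont_arith cbf cbs)
  let ?F = "I (\<lambda>p. f (u p))" and ?F2 = "I (\<lambda>p. (f (u p))\<^sup>2)" and ?G = "I R.gn" and ?D = "I (\<lambda>p. f' (u p) * R.gn p)"
  let ?HU = "J (\<lambda>p. H p * (u\<eta> p)\<^sup>2)" and ?U = "J u\<eta>" and ?V = "J (\<lambda>p. 1 / H p)"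
  have c': "c = 1 - 1 / real CARD('n)" using n by (simp add: c dim field_simps)
  have cpos: "c > 0" using n by (simp add: c)
  have bochner: "I R.tf - c * ?F2 + (I (R.rmg \<kappa>) + \<kappa> * ?G) = - ?HU"
  proof -
    have "I (\<lambda>p. R.tf p - c * (R.lap p)\<^sup>2 + (R.rmg \<kappa> p + \<kappa> * R.gn p)) = J (\<lambda>p. - (H p * (u\<eta> p)\<^sup>2))"
      unfolding I_def J_def c' H u\<eta> by (rule R.integral_bochner[OF u_bdry])
    also have "I (\<lambda>p. R.tf p - c * (R.lap p)\<^sup>2 + (R.rmg \<kappa> p + \<kappa> * R.gn p))
        = I (\<lambda>p. R.tf p - c * (f (u p))\<^sup>2 + (R.rmg \<kappa> p + \<kappa> * R.gn p))"
      by (rule I_cong) (simp add: lap)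
    also have "\<dots> = I R.tf - c * ?F2 + (I (R.rmg \<kappa>) + \<kappa> * ?G)"
      by (simp add: I_add I_diff I_mult R.bdd_cont_arith R.bdd_cont_const cbs cbf)
    also have "J (\<lambda>p. - (H p * (u\<eta> p)\<^sup>2)) = - ?HU"
      using J_mult[of "- 1" "\<lambda>p. H p * (u\<eta> p)\<^sup>2"] by simp
    finally show ?thesis .
  qed
  have flux: "- ?F = ?U"
  proof -
    have "I (\<lambda>p. 0 * R.gn p + 1 * R.lap p) = J (\<lambda>p. 1 * u\<eta> p)"
      unfolding I_def J_def u\<eta> by (rule R.integral_compose_gradient[OF u_bdry DERIV_const continuous_on_const])
    moreover have "I (\<lambda>p. 0 * R.gn p + 1 * R.lap p) = I (\<lambda>p. (- 1) * f (u p))" by (rule I_cong) (simp add: lap)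
    ultimately show ?thesis unfolding I_mult J_mult by simp
  qed
  have energy: "?D - ?F2 = f 0 * ?U"
  proof -
    have "I (\<lambda>p. f' (u p) * R.gn p + f (u p) * R.lap p) = J (\<lambda>p. f 0 * u\<eta> p)"
      unfolding I_def J_def u\<eta> by (rule R.integral_compose_gradient[OF u_bdry fd f'c])
    moreover have "I (\<lambda>p. f' (u p) * R.gn p + f (u p) * R.lap p) = I (\<lambda>p. f' (u p) * R.gn p - (f (u p))\<^sup>2)"
      by (rule I_cong) (simp add: lap power2_eq_square)
    ultimately show ?thesis unfolding I_diff[OF cbg cbf(3)] J_mult by simp
  qed
  have E': "E = ?D - n * k * ?G"
  proof -
    have "E = I (\<lambda>p. f' (u p) * R.gn p - n * k * R.gn p)"
      unfolding E d\<Omega> I_def df by (simp add: left_diff_distrib)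
    then show ?thesis by (simp add: I_diff[OF cbg] R.bdd_cont_arith R.bdd_cont_const cbs I_mult)
  qed
  \<comment> \<open>Dividing by \<open>H\<close> removes it from the cross term, so the integral of
    \<open>u\<eta>\<close> appears there without a weight and can be eliminated by
    \<open>flux\<close>.\<close>
  have square: "J (\<lambda>p. (H p * u\<eta> p + c * f 0)\<^sup>2 / H p) = ?HU + 2 * c * f 0 * ?U + (c * f 0)\<^sup>2 * ?V"
  proof -
    have "J (\<lambda>p. (H p * u\<eta> p + c * f 0)\<^sup>2 / H p)
        = J (\<lambda>p. H p * (u\<eta> p)\<^sup>2 + (2 * c * f 0 * u\<eta> p + (c * f 0)\<^sup>2 * (1 / H p)))"
      by (rule J_cong) (simp add: H0 power2_eq_square field_simps)
    then show ?thesis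
      by (simp only:) (subst J_add, (intro continuous_intros cH cu ballI H0; assumption)+,
        subst J_add, (intro continuous_intros cH cu ballI H0; assumption)+, simp only: J_mult add.assoc)
  qed
  \<comment> \<open>This is why \<open>E\<close> carries the shift \<open>n * k\<close>: the term of
    the Bochner identity with \<kappa> is absorbed into \<open>c * E\<close>.\<close>
  have nk: "\<kappa> = c * (n * k)" using n by (simp add: \<kappa>_def c)
  \<comment> \<open>By \<open>flux\<close> the cross term of the square contributes
    \<open>- 2 * c * f 0 * ?F\<close>, and by \<open>energy\<close> the term \<open>c * ?F2\<close>
    contributes \<open>c * f 0 * ?F\<close>; together they give the single
    \<open>- c * f 0 * ?F\<close> on the left.\<close>
  have id: "c * (c * (f 0)\<^sup>2 * ?V - f 0 * ?F + E)
      = I R.tf + I (R.rmg \<kappa>) + J (\<lambda>p. (H p * u\<eta> p + c * f 0)\<^sup>2 / H p)"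
  proof -
    have "I R.tf + I (R.rmg \<kappa>) + ?HU = c * ?F2 - c * (n * k * ?G)" using bochner by (simp add: nk)
    moreover have F2: "?F2 = ?D + f 0 * ?F" using energy unfolding flux[symmetric] by (simp add: algebra_simps)
    moreover have "?U = - ?F" using flux by simp
    ultimately show ?thesis unfolding square E' by (simp add: algebra_simps power2_eq_square)
  qed
  have I_nonneg: "I \<phi> \<ge> 0" if "\<And>p. p \<in> \<Omega> \<Longrightarrow> \<phi> p \<ge> 0" for \<phi>
    unfolding I_def set_lebesgue_integral_def by (rule Bochner_Integration.integral_nonneg) (use that in \<open>auto simp: indicator_def\<close>)
  have J_nonneg: "J (\<lambda>p. (H p * u\<eta> p + c * f 0)\<^sup>2 / H p) \<ge> 0"
    unfolding J_def set_lebesgue_integral_def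
    by (rule Bochner_Integration.integral_nonneg) (use H_pos in \<open>auto simp: indicator_def less_imp_le\<close>)
  have ineq: "c * (f 0)\<^sup>2 * ?V \<ge> f 0 * ?F - E" if "ricci_ge A g \<kappa> \<Omega>"
  proof -
    have "0 \<le> c * (c * (f 0)\<^sup>2 * ?V - f 0 * ?F + E)"
      unfolding id using I_nonneg[OF R.scalar_nonneg(1)] I_nonneg[OF R.scalar_nonneg(2)[OF _ that]] J_nonneg by simp
    then show ?thesis using cpos by (simp add: zero_le_mult_iff)
  qed
  show ?thesis using id ineq unfolding I_def J_def \<kappa>_def d\<Omega> d\<sigma> c by blast
qed

end
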